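(* Let $\mathcal{C}$ be a triangulated category and let $\mathcal{P}=((\mathcal{S},\mathcal{T}),(\mathcal{U},\mathcal{V}))$ be a concentric twin cotorsion pair on $\mathcal{C}$ satisfying conditions (I) and (II) (stated in the context). Put $\mathcal{Z}=\mathcal{T}\cap\mathcal{U}$ and $\mathcal{I}=\mathcal{S}\cap\mathcal{T}=\mathcal{U}\cap\mathcal{V}$. Then $\mathcal{Z}/\mathcal{I}$, with the endofunctor $\Sigma$ and the class of distinguished right triangles, is a triangulated category. In particular, for all $X,Y\in\mathcal{Z}/\mathcal{I}$, $\mathrm{Ext}^1_{\mathcal{Z}/\mathcal{I}}(X,Y)=(\mathcal{Z}/\mathcal{I})(X,\Sigma Y)\cong(\mathcal{Z}/\mathcal{I})(\Omega X,Y)$.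
   Context: $\mathcal{C}$ is a triangulated category with shift $[1]$; $\mathrm{Ext}^1(X,Y)=\mathcal{C}(X,Y[1])$. For full subcategories $\mathcal{X},\mathcal{Y}\subseteq\mathcal{C}$, $\mathcal{X}\ast\mathcal{Y}$ is the full subcategory of objects $C$ admitting a distinguished triangle $X\to C\to Y\to X[1]$ with $X\in\mathcal{X},Y\in\mathcal{Y}$. A cotorsion pair on $\mathcal{C}$ is a pair $(\mathcal{U},\mathcal{V})$ of full additive subcategories closed under isomorphisms and direct summands with $\mathcal{C}=\mathcal{U}\ast\mathcal{V}[1]$ and $\mathrm{Ext}^1(\mathcal{U},\mathcal{V})=0$. A twin cotorsion pair (TCP) is a pair $((\mathcal{S},\mathcal{T}),(\mathcal{U},\mathcal{V}))$ of cotorsion pairs with $\mathrm{Ext}^1(\mathcal{S},\mathcal{V})=0$ (equivalently $\mathcal{S}\subseteq\mathcal{U}$, equivalently $\mathcal{V}\subseteq\mathcal{T}$). It is concentric if $\mathcal{S}\cap\mathcal{T}=\mathcal{U}\cap\mathcal{V}=:\mathcal{I}$. Put $\mathcal{Z}=\mathcal{T}\cap\mathcal{U}$, $\mathcal{N}^i=\mathcal{S}\ast\mathcal{V}[1]$, $\mathcal{N}^f=\mathcal{S}[-1]\ast\mathcal{V}$. For $\mathcal{I}\subseteq\mathcal{X}\subseteq\mathcal{C}$, $\mathcal{X}/\mathcal{I}$ is the ideal quotient (same objects; morphisms modulo those factoring through an object of $\mathcal{I}$); $\underline{f}$ is the class of $f$. Adjoints. $\mathcal{U}/\mathcal{I}\hookrightarrow\mathcal{C}/\mathcal{I}$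 has a right adjoint $\omega_{\mathcal{U}}$ with counit $\varepsilon_{\mathcal{U}}$: for a triangle $U\overset{u}{\to}C\to V[1]\to U[1]$ with $U\in\mathcal{U},V\in\mathcal{V}$, $\omega_{\mathcal{U}}(C)=U$ and $(\varepsilon_{\mathcal{U}})_C=\underline{u}$. $\mathcal{T}/\mathcal{I}\hookrightarrow\mathcal{C}/\mathcal{I}$ has a left adjoint $\sigma_{\mathcal{T}}$ with unit $\eta_{\mathcal{T}}$: for a triangle $S[-1]\to C\overset{t}{\to}T\to S$ with $S\in\mathcal{S},T\in\mathcal{T}$, $\sigma_{\mathcal{T}}(C)=T$ and $(\eta_{\mathcal{T}})_C=\underline{t}$. These restrict to a right adjoint $\omega\colon\mathcal{T}/\mathcal{I}\to\mathcal{Z}/\mathcal{I}$ (counit $\varepsilon$) and a left adjoint $\sigma\colon\mathcal{U}/\mathcal{I}\to\mathcal{Z}/\mathcal{I}$ (unit $\eta$) of the inclusions. There is a unique natural transformation $\mu\colon\sigma\circ\omega_{\mathcal{U}}\Rightarrow\omega\circ\sigma_{\mathcal{T}}$ of functors $\mathcal{C}/\mathcal{I}\to\mathcal{Z}/\mathcal{I}$ with $\varepsilon_{\sigma_{\mathcal{T}}(X)}\circ\mu_X\circ\eta_{\omega_{\mathcal{U}}(X)}=(\eta_{\mathcal{T}})_X\circ(\varepsilon_{\mathcal{U}})_X$ in $\mathcal{C}/\mathcal{I}$ for all $X\in\mathcal{C}$. Condition (I): for every $X\in\mathcal{T}\ast\mathcal{U}$, $\mu_X\colon\sigma(\omega_{\mathcal{U}}(X))\to\omega(\sigma_{\mathcal{T}}(X))$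 is an isomorphism in $\mathcal{Z}/\mathcal{I}$. Condition (II): $\mathcal{U}\cap\mathcal{N}^f=\mathcal{S}$ and $\mathcal{T}\cap\mathcal{N}^i=\mathcal{V}$. Shifts. For $Z\in\mathcal{Z}$ choose a triangle $Z\to I\to U\to Z[1]$ with $I\in\mathcal{I}$, $U\in\mathcal{U}$, and put $Z\langle1\rangle=U$; a morphism $\underline{z}$ is sent to $\underline{u}$, where $(z,i,u)$ is a morphism between the chosen triangles. This is a functor $\langle1\rangle\colon\mathcal{Z}/\mathcal{I}\to\mathcal{U}/\mathcal{I}$. Dually, triangles $T\to I\to Z\to T[1]$ with $T\in\mathcal{T}$, $I\in\mathcal{I}$ define $\langle-1\rangle\colon\mathcal{Z}/\mathcal{I}\to\mathcal{T}/\mathcal{I}$, $Z\langle-1\rangle=T$. Put $\Sigma=\sigma\circ\langle1\rangle$, $\Omega=\omega\circ\langle-1\rangle$. Define $\mathrm{Ext}^1_{\mathcal{Z}/\mathcal{I}}(X,Y)=(\mathcal{Z}/\mathcal{I})(X,\Sigma Y)$. Distinguished right triangles. Let $X\overset{f}{\to}Y\overset{a}{\to}U\overset{b}{\to}X[1]$ be a distinguished triangle in $\mathcal{C}$ with $X,Y\in\mathcal{Z}$, $U\in\mathcal{U}$. Take a triangle $X\to I_X\to U_X\to X[1]$ with $I_X\in\mathcal{I}$, $U_X\in\mathcal{U}$ (so $\Sigma X=\sigma(U_X)$) and a morphism of triangles $(\mathrm{id}_X,y,c)$ from the former to the latter. The associated standard right triangle is $X\overset{\underline{f}}{\to}Y\overset{\eta_U\circ\underline{a}}{\to}\sigma(U)\overset{\sigma(\underline{c})}{\to}\Sigma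 X$. A distinguished right triangle is a right triangle in $\mathcal{Z}/\mathcal{I}$ isomorphic to a standard one. *)

theory Defs
  imports "HOL-Algebra.Group"
begin

section \<open>Additive categories\<close>

text \<open>
  A category is given by a set of objects and a set of arrows, each arrow carrying its own domain
  and codomain. Composition is written in the usual order and is only meaningful on composable
  pairs; \<open>Add\<close> is only meaningful on parallel pairs.
\<close>

record ('o, 'a) addcat =
  Obj :: "'o set"
  Arr :: "'a set"
  Dom :: "'a \<Rightarrow> 'o"
  Cod :: "'a \<Rightarrow> 'o"
  Ident :: "'o \<Rightarrow> 'a"
  Comp :: "'a \<Rightarrow> 'a \<Rightarrow> 'a"  (infixl "\<cdot>\<index>" 70)
  Add :: "'a \<Rightarrow> 'a \<Rightarrow> 'a"
  Zero :: "'o \<Rightarrow> 'o \<Rightarrow> 'a"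

definition Hom :: "('o, 'a) addcat \<Rightarrow> 'o \<Rightarrow> 'o \<Rightarrow> 'a set" where
  "Hom C X Y = {f \<in> Arr C. Dom C f = X \<and> Cod C f = Y}"

definition Hom_group :: "('o, 'a) addcat \<Rightarrow> 'o \<Rightarrow> 'o \<Rightarrow> 'a monoid" where
  "Hom_group C X Y = \<lparr>carrier = Hom C X Y, mult = Add C, one = Zero C X Y\<rparr>"

definition Neg :: "('o, 'a) addcat \<Rightarrow> 'a \<Rightarrow> 'a" where
  "Neg C f = inv\<^bsub>Hom_group C (Dom C f) (Cod C f)\<^esub> f"

locale category =
  fixes C :: "('o, 'a) addcat"
  assumes dom_obj: "f \<in> Arr C \<Longrightarrow> Dom C f \<in> Obj C"
    and cod_obj: "f \<in> Arr C \<Longrightarrow> Cod C f \<in> Obj C"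
    and ident_hom: "X \<in> Obj C \<Longrightarrow> Ident C X \<in> Hom C X X"
    and comp_hom: "f \<in> Hom C X Y \<Longrightarrow> g \<in> Hom C Y Z \<Longrightarrow> g \<cdot>\<^bsub>C\<^esub> f \<in> Hom C X Z"
    and ident_left: "f \<in> Hom C X Y \<Longrightarrow> Ident C Y \<cdot>\<^bsub>C\<^esub> f = f"
    and ident_right: "f \<in> Hom C X Y \<Longrightarrow> f \<cdot>\<^bsub>C\<^esub> Ident C X = f"
    and comp_assoc: "f \<in> Hom C W X \<Longrightarrow> g \<in> Hom C X Y \<Longrightarrow> h \<in> Hom C Y Z \<Longrightarrow>
      h \<cdot>\<^bsub>C\<^esub> (g \<cdot>\<^bsub>C\<^esub> f) = (h \<cdot>\<^bsub>C\<^esub> g) \<cdot>\<^bsub>C\<^esub> f"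

definition is_isom :: "('o, 'a) addcat \<Rightarrow> 'a \<Rightarrow> bool" where
  "is_isom C f \<longleftrightarrow> f \<in> Arr C \<and> (\<exists>g \<in> Hom C (Cod C f) (Dom C f).
     g \<cdot>\<^bsub>C\<^esub> f = Ident C (Dom C f) \<and> f \<cdot>\<^bsub>C\<^esub> g = Ident C (Cod C f))"

definition is_zero_object :: "('o, 'a) addcat \<Rightarrow> 'o \<Rightarrow> bool" where
  "is_zero_object C Z \<longleftrightarrow> Z \<in> Obj C \<and>
     (\<forall>X \<in> Obj C. (\<exists>!f. f \<in> Hom C Z X) \<and> (\<exists>!f. f \<in> Hom C X Z))"

definition is_biproduct :: "('o, 'a) addcat \<Rightarrow> 'o \<Rightarrow> 'o \<Rightarrow> 'o \<Rightarrow> bool" where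
  "is_biproduct C A B P \<longleftrightarrow> A \<in> Obj C \<and> B \<in> Obj C \<and> P \<in> Obj C \<and>
     (\<exists>i \<in> Hom C A P. \<exists>j \<in> Hom C B P. \<exists>p \<in> Hom C P A. \<exists>q \<in> Hom C P B.
        p \<cdot>\<^bsub>C\<^esub> i = Ident C A \<and> q \<cdot>\<^bsub>C\<^esub> j = Ident C B \<and>
        p \<cdot>\<^bsub>C\<^esub> j = Zero C B A \<and> q \<cdot>\<^bsub>C\<^esub> i = Zero C A B \<and>
        Add C (i \<cdot>\<^bsub>C\<^esub> p) (j \<cdot>\<^bsub>C\<^esub> q) = Ident C P)"

locale additive_category = category +
  assumes hom_group: "X \<in> Obj C \<Longrightarrow> Y \<in> Obj C \<Longrightarrow> comm_group (Hom_group C X Y)"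
    and comp_add_right: "f \<in> Hom C X Y \<Longrightarrow> f' \<in> Hom C X Y \<Longrightarrow> g \<in> Hom C Y Z \<Longrightarrow>
      g \<cdot>\<^bsub>C\<^esub> Add C f f' = Add C (g \<cdot>\<^bsub>C\<^esub> f) (g \<cdot>\<^bsub>C\<^esub> f')"
    and comp_add_left: "f \<in> Hom C X Y \<Longrightarrow> g \<in> Hom C Y Z \<Longrightarrow> g' \<in> Hom C Y Z \<Longrightarrow>
      Add C g g' \<cdot>\<^bsub>C\<^esub> f = Add C (g \<cdot>\<^bsub>C\<^esub> f) (g' \<cdot>\<^bsub>C\<^esub> f)"
    and zero_object: "\<exists>Z. is_zero_object C Z"
    and biproducts: "A \<in> Obj C \<Longrightarrow> B \<in> Obj C \<Longrightarrow> \<exists>P. is_biproduct C A B P"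


section \<open>Functors and natural transformations\<close>

record ('o, 'a, 'p, 'b) ftor =
  omap :: "'o \<Rightarrow> 'p"
  amap :: "'a \<Rightarrow> 'b"

definition is_functor ::
    "('o, 'a) addcat \<Rightarrow> ('p, 'b) addcat \<Rightarrow> ('o, 'a, 'p, 'b) ftor \<Rightarrow> bool" where
  "is_functor A B F \<longleftrightarrow>
     (\<forall>X \<in> Obj A. omap F X \<in> Obj B) \<and>
     (\<forall>X Y. \<forall>f \<in> Hom A X Y. amap F f \<in> Hom B (omap F X) (omap F Y)) \<and>
     (\<forall>X \<in> Obj A. amap F (Ident A X) = Ident B (omap F X)) \<and>
     (\<forall>X Y Z. \<forall>f \<in> Hom A X Y. \<forall>g \<in> Hom A Y Z.
        amap F (g \<cdot>\<^bsub>A\<^esub> f) = amap F g \<cdot>\<^bsub>B\<^esub> amap F f)"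

definition is_additive_functor ::
    "('o, 'a) addcat \<Rightarrow> ('p, 'b) addcat \<Rightarrow> ('o, 'a, 'p, 'b) ftor \<Rightarrow> bool" where
  "is_additive_functor A B F \<longleftrightarrow> is_functor A B F \<and>
     (\<forall>X Y. \<forall>f \<in> Hom A X Y. \<forall>g \<in> Hom A X Y. amap F (Add A f g) = Add B (amap F f) (amap F g))"

definition id_ftor :: "('o, 'a, 'o, 'a) ftor" where
  "id_ftor = \<lparr>omap = id, amap = id\<rparr>"

definition comp_ftor ::
    "('p, 'b, 'q, 'c) ftor \<Rightarrow> ('o, 'a, 'p, 'b) ftor \<Rightarrow> ('o, 'a, 'q, 'c) ftor" where
  "comp_ftor G F = \<lparr>omap = omap G \<circ> omap F, amap = amap G \<circ> amap F\<rparr>"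

definition is_nat_trans ::
    "('o, 'a) addcat \<Rightarrow> ('p, 'b) addcat \<Rightarrow> ('o, 'a, 'p, 'b) ftor \<Rightarrow> ('o, 'a, 'p, 'b) ftor
      \<Rightarrow> ('o \<Rightarrow> 'b) \<Rightarrow> bool" where
  "is_nat_trans A B F G m \<longleftrightarrow>
     (\<forall>X \<in> Obj A. m X \<in> Hom B (omap F X) (omap G X)) \<and>
     (\<forall>X Y. \<forall>f \<in> Hom A X Y. m Y \<cdot>\<^bsub>B\<^esub> amap F f = amap G f \<cdot>\<^bsub>B\<^esub> m X)"

definition naturally_isomorphic ::
    "('o, 'a) addcat \<Rightarrow> ('p, 'b) addcat \<Rightarrow> ('o, 'a, 'p, 'b) ftor \<Rightarrow> ('o, 'a, 'p, 'b) ftor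
      \<Rightarrow> bool" where
  "naturally_isomorphic A B F G \<longleftrightarrow>
     (\<exists>m. is_nat_trans A B F G m \<and> (\<forall>X \<in> Obj A. is_isom B (m X)))"

definition is_equivalence ::
    "('o, 'a) addcat \<Rightarrow> ('p, 'b) addcat \<Rightarrow> ('o, 'a, 'p, 'b) ftor \<Rightarrow> bool" where
  "is_equivalence A B F \<longleftrightarrow> is_functor A B F \<and>
     (\<exists>G. is_functor B A G \<and>
          naturally_isomorphic A A (comp_ftor G F) id_ftor \<and>
          naturally_isomorphic B B (comp_ftor F G) id_ftor)"


section \<open>Triangulated categories\<close>

text \<open>
  The triple \<open>(f, g, h)\<close> stands for the triangle \<open>X \<rightarrow> Y \<rightarrow> Z \<rightarrow> X[1]\<close> with these arrows; the
  objects are recovered as domains and codomains. \<open>F\<close> is the shift functor \<open>[1]\<close>.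
\<close>

type_synonym 'a triangle = "'a \<times> 'a \<times> 'a"

definition is_triangle ::
    "('o, 'a) addcat \<Rightarrow> ('o, 'a, 'o, 'a) ftor \<Rightarrow> 'a triangle \<Rightarrow> bool" where
  "is_triangle C F = (\<lambda>(f, g, h). \<exists>X Y Z.
     f \<in> Hom C X Y \<and> g \<in> Hom C Y Z \<and> h \<in> Hom C Z (omap F X))"

definition is_tri_morph ::
    "('o, 'a) addcat \<Rightarrow> ('o, 'a, 'o, 'a) ftor \<Rightarrow> 'a triangle \<Rightarrow> 'a triangle
      \<Rightarrow> 'a \<Rightarrow> 'a \<Rightarrow> 'a \<Rightarrow> bool" where
  "is_tri_morph C F = (\<lambda>(f, g, h) (f', g', h') x y z.
     x \<in> Hom C (Dom C f) (Dom C f') \<and>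
     y \<in> Hom C (Dom C g) (Dom C g') \<and>
     z \<in> Hom C (Dom C h) (Dom C h') \<and>
     y \<cdot>\<^bsub>C\<^esub> f = f' \<cdot>\<^bsub>C\<^esub> x \<and>
     z \<cdot>\<^bsub>C\<^esub> g = g' \<cdot>\<^bsub>C\<^esub> y \<and>
     amap F x \<cdot>\<^bsub>C\<^esub> h = h' \<cdot>\<^bsub>C\<^esub> z)"

definition tri_isomorphic ::
    "('o, 'a) addcat \<Rightarrow> ('o, 'a, 'o, 'a) ftor \<Rightarrow> 'a triangle \<Rightarrow> 'a triangle \<Rightarrow> bool" where
  "tri_isomorphic C F t t' \<longleftrightarrow>
     (\<exists>x y z. is_tri_morph C F t t' x y z \<and> is_isom C x \<and> is_isom C y \<and> is_isom C z)"

text \<open>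
  The shift is required to be an autoequivalence, not necessarily an automorphism. All axioms are
  therefore phrased without an inverse shift.
\<close>

locale triangulated_category = additive_category C
  for C :: "('o, 'a) addcat" +
  fixes F :: "('o, 'a, 'o, 'a) ftor"
    and D :: "'a triangle set"
  assumes shift_additive: "is_additive_functor C C F"
    and shift_equivalence: "is_equivalence C C F"
    and dist_triangle: "t \<in> D \<Longrightarrow> is_triangle C F t"
    and TR1_iso: "t \<in> D \<Longrightarrow> is_triangle C F t' \<Longrightarrow> tri_isomorphic C F t t' \<Longrightarrow> t' \<in> D"
    and TR1_ident: "X \<in> Obj C \<Longrightarrow> is_zero_object C Z \<Longrightarrow>
      (Ident C X, Zero C X Z, Zero C Z (omap F X)) \<in> D"
    and TR1_cone: "f \<in> Arr C \<Longrightarrow> \<exists>g h. (f, g, h) \<in> D"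
    and TR2: "is_triangle C F (f, g, h) \<Longrightarrow>
      (f, g, h) \<in> D \<longleftrightarrow> (g, h, Neg C (amap F f)) \<in> D"
    and TR3: "(f, g, h) \<in> D \<Longrightarrow> (f', g', h') \<in> D \<Longrightarrow>
      x \<in> Hom C (Dom C f) (Dom C f') \<Longrightarrow> y \<in> Hom C (Cod C f) (Cod C f') \<Longrightarrow>
      y \<cdot>\<^bsub>C\<^esub> f = f' \<cdot>\<^bsub>C\<^esub> x \<Longrightarrow> \<exists>z. is_tri_morph C F (f, g, h) (f', g', h') x y z"
    and TR4: "f \<in> Hom C X Y \<Longrightarrow> g \<in> Hom C Y Z \<Longrightarrow>
      (f, f', f'') \<in> D \<Longrightarrow> (g, g', g'') \<in> D \<Longrightarrow> (g \<cdot>\<^bsub>C\<^esub> f, k', k'') \<in> D \<Longrightarrow>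
      \<exists>u \<in> Hom C (Cod C f') (Cod C k'). \<exists>v \<in> Hom C (Cod C k') (Cod C g').
        (u, v, amap F f' \<cdot>\<^bsub>C\<^esub> g'') \<in> D \<and>
        u \<cdot>\<^bsub>C\<^esub> f' = k' \<cdot>\<^bsub>C\<^esub> g \<and> k'' \<cdot>\<^bsub>C\<^esub> u = f'' \<and>
        v \<cdot>\<^bsub>C\<^esub> k' = g' \<and> g'' \<cdot>\<^bsub>C\<^esub> v = amap F f \<cdot>\<^bsub>C\<^esub> k''"

definition Ext1 ::
    "('o, 'a) addcat \<Rightarrow> ('o, 'a, 'o, 'a) ftor \<Rightarrow> 'o \<Rightarrow> 'o \<Rightarrow> 'a monoid" where
  "Ext1 C F X Y = Hom_group C X (omap F Y)"


section \<open>Full subcategories and ideal quotients\<close>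

text \<open>A full subcategory is represented by its set of objects.\<close>

definition full_subcategory :: "('o, 'a) addcat \<Rightarrow> 'o set \<Rightarrow> ('o, 'a) addcat" where
  "full_subcategory C X =
     C \<lparr>Obj := X, Arr := {f \<in> Arr C. Dom C f \<in> X \<and> Cod C f \<in> X}\<rparr>"

definition is_full_additive_sub :: "('o, 'a) addcat \<Rightarrow> 'o set \<Rightarrow> bool" where
  "is_full_additive_sub C X \<longleftrightarrow> X \<subseteq> Obj C \<and> (\<exists>Z \<in> X. is_zero_object C Z) \<and>
     (\<forall>A \<in> X. \<forall>B \<in> X. \<exists>P \<in> X. is_biproduct C A B P)"

definition closed_under_isom :: "('o, 'a) addcat \<Rightarrow> 'o set \<Rightarrow> bool" where
  "closed_under_isom C X \<longleftrightarrow> (\<forall>f. is_isom C f \<longrightarrow> Dom C f \<in> X \<longrightarrow> Cod C f \<in> X)"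

definition closed_under_summands :: "('o, 'a) addcat \<Rightarrow> 'o set \<Rightarrow> bool" where
  "closed_under_summands C X \<longleftrightarrow>
     (\<forall>A B P. is_biproduct C A B P \<longrightarrow> P \<in> X \<longrightarrow> A \<in> X \<and> B \<in> X)"

definition factoring_arrows :: "('o, 'a) addcat \<Rightarrow> 'o set \<Rightarrow> 'o \<Rightarrow> 'o \<Rightarrow> 'a set" where
  "factoring_arrows C J X Y = {g \<cdot>\<^bsub>C\<^esub> f | f g I. I \<in> J \<and> f \<in> Hom C X I \<and> g \<in> Hom C I Y}"

definition quot_class :: "('o, 'a) addcat \<Rightarrow> 'o set \<Rightarrow> 'a \<Rightarrow> 'a set" where
  "quot_class C J f = {Add C f h | h. h \<in> factoring_arrows C J (Dom C f) (Cod C f)}"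

definition quot_rep :: "'a set \<Rightarrow> 'a" where
  "quot_rep c = (SOME f. f \<in> c)"

definition ideal_quotient :: "('o, 'a) addcat \<Rightarrow> 'o set \<Rightarrow> ('o, 'a set) addcat" where
  "ideal_quotient C J = \<lparr>
     Obj = Obj C,
     Arr = quot_class C J ` Arr C,
     Dom = (\<lambda>c. Dom C (quot_rep c)),
     Cod = (\<lambda>c. Cod C (quot_rep c)),
     Ident = (\<lambda>X. quot_class C J (Ident C X)),
     Comp = (\<lambda>c d. quot_class C J (quot_rep c \<cdot>\<^bsub>C\<^esub> quot_rep d)),
     Add = (\<lambda>c d. quot_class C J (Add C (quot_rep c) (quot_rep d))),
     Zero = (\<lambda>X Y. quot_class C J (Zero C X Y))\<rparr>"


section \<open>Twin cotorsion pairs\<close>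

definition star :: "('o, 'a) addcat \<Rightarrow> 'a triangle set \<Rightarrow> 'o set \<Rightarrow> 'o set \<Rightarrow> 'o set" where
  "star C D X Y = {A \<in> Obj C. \<exists>f g h.
     (f, g, h) \<in> D \<and> Dom C f \<in> X \<and> Cod C f = A \<and> Cod C g \<in> Y}"

text \<open>
  \<open>X[1]\<close> is the literal image. As the shift need not be invertible on objects, \<open>X[-1]\<close> is the
  preimage; for \<open>X\<close> closed under isomorphisms, this is the isomorphism closure of the image of
  \<open>X\<close> under any quasi-inverse of the shift.
\<close>

definition shift_set :: "('o, 'a, 'o, 'a) ftor \<Rightarrow> 'o set \<Rightarrow> 'o set" where
  "shift_set F X = omap F ` X"

definition unshift_set ::
    "('o, 'a) addcat \<Rightarrow> ('o, 'a, 'o, 'a) ftor \<Rightarrow> 'o set \<Rightarrow> 'o set" where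
  "unshift_set C F X = {A \<in> Obj C. omap F A \<in> X}"

definition Ext1_vanishes ::
    "('o, 'a) addcat \<Rightarrow> ('o, 'a, 'o, 'a) ftor \<Rightarrow> 'o set \<Rightarrow> 'o set \<Rightarrow> bool" where
  "Ext1_vanishes C F X Y \<longleftrightarrow>
     (\<forall>A \<in> X. \<forall>B \<in> Y. carrier (Ext1 C F A B) = {one (Ext1 C F A B)})"

definition is_cotorsion_pair ::
    "('o, 'a) addcat \<Rightarrow> ('o, 'a, 'o, 'a) ftor \<Rightarrow> 'a triangle set
      \<Rightarrow> 'o set \<Rightarrow> 'o set \<Rightarrow> bool" where
  "is_cotorsion_pair C F D U V \<longleftrightarrow>
     is_full_additive_sub C U \<and> closed_under_isom C U \<and> closed_under_summands C U \<and>
     is_full_additive_sub C V \<and> closed_under_isom C V \<and> closed_under_summands C V \<and>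
     Obj C = star C D U (shift_set F V) \<and>
     Ext1_vanishes C F U V"

text \<open>A category with shift and triangles, together with candidates \<open>((S, T), (U, V))\<close>.\<close>

record ('o, 'a) tcp =
  amb :: "('o, 'a) addcat"
  shift :: "('o, 'a, 'o, 'a) ftor"
  dist :: "'a triangle set"
  subS :: "'o set"
  subT :: "'o set"
  subU :: "'o set"
  subV :: "'o set"

definition is_twin_cotorsion_pair :: "('o, 'a) tcp \<Rightarrow> bool" where
  "is_twin_cotorsion_pair P \<longleftrightarrow>
     is_cotorsion_pair (amb P) (shift P) (dist P) (subS P) (subT P) \<and>
     is_cotorsion_pair (amb P) (shift P) (dist P) (subU P) (subV P) \<and>
     Ext1_vanishes (amb P) (shift P) (subS P) (subV P)"

definition is_concentric :: "('o, 'a) tcp \<Rightarrow> bool" where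
  "is_concentric P \<longleftrightarrow> subS P \<inter> subT P = subU P \<inter> subV P"

definition subI :: "('o, 'a) tcp \<Rightarrow> 'o set" where
  "subI P = subS P \<inter> subT P"

definition subZ :: "('o, 'a) tcp \<Rightarrow> 'o set" where
  "subZ P = subT P \<inter> subU P"

definition subNi :: "('o, 'a) tcp \<Rightarrow> 'o set" where
  "subNi P = star (amb P) (dist P) (subS P) (shift_set (shift P) (subV P))"

definition subNf :: "('o, 'a) tcp \<Rightarrow> 'o set" where
  "subNf P = star (amb P) (dist P) (unshift_set (amb P) (shift P) (subS P)) (subV P)"

abbreviation cls :: "('o, 'a) tcp \<Rightarrow> 'a \<Rightarrow> 'a set" where
  "cls P f \<equiv> quot_class (amb P) (subI P) f"

definition C_mod_I :: "('o, 'a) tcp \<Rightarrow> ('o, 'a set) addcat" where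
  "C_mod_I P = ideal_quotient (amb P) (subI P)"

definition Z_mod_I :: "('o, 'a) tcp \<Rightarrow> ('o, 'a set) addcat" where
  "Z_mod_I P = full_subcategory (C_mod_I P) (subZ P)"


section \<open>The functors attached to a concentric twin cotorsion pair\<close>

text \<open>
  The adjoints and shifts depend on chosen triangles, which are kept as explicit data:
  \<^item> \<open>triU X\<close> is a triangle \<open>U \<rightarrow> X \<rightarrow> V[1] \<rightarrow> U[1]\<close>, for every object \<open>X\<close>;
  \<^item> \<open>triT X\<close> is a triangle \<open>S[-1] \<rightarrow> X \<rightarrow> T \<rightarrow> S\<close>, for every object \<open>X\<close>;
  \<^item> \<open>tri_plus Z\<close> is a triangle \<open>Z \<rightarrow> I \<rightarrow> U \<rightarrow> Z[1]\<close>, for every \<open>Z\<close> in \<open>T \<inter> U\<close>;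
  \<^item> \<open>tri_minus Z\<close> is a triangle \<open>T \<rightarrow> I \<rightarrow> Z \<rightarrow> T[1]\<close>, for every \<open>Z\<close> in \<open>T \<inter> U\<close>.
\<close>

record ('o, 'a) tcp_choices =
  triU :: "'o \<Rightarrow> 'a triangle"
  triT :: "'o \<Rightarrow> 'a triangle"
  tri_plus :: "'o \<Rightarrow> 'a triangle"
  tri_minus :: "'o \<Rightarrow> 'a triangle"

definition valid_choices :: "('o, 'a) tcp \<Rightarrow> ('o, 'a) tcp_choices \<Rightarrow> bool" where
  "valid_choices P K \<longleftrightarrow>
     (\<forall>X \<in> Obj (amb P). \<exists>u v w. triU K X = (u, v, w) \<and> (u, v, w) \<in> dist P \<and>
        Dom (amb P) u \<in> subU P \<and> Cod (amb P) u = X \<and>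
        Cod (amb P) v \<in> shift_set (shift P) (subV P)) \<and>
     (\<forall>X \<in> Obj (amb P). \<exists>s t w. triT K X = (s, t, w) \<and> (s, t, w) \<in> dist P \<and>
        Dom (amb P) s \<in> unshift_set (amb P) (shift P) (subS P) \<and> Cod (amb P) s = X \<and>
        Cod (amb P) t \<in> subT P) \<and>
     (\<forall>Z \<in> subZ P. \<exists>i p q. tri_plus K Z = (i, p, q) \<and> (i, p, q) \<in> dist P \<and>
        Dom (amb P) i = Z \<and> Cod (amb P) i \<in> subI P \<and> Cod (amb P) p \<in> subU P) \<and>
     (\<forall>Z \<in> subZ P. \<exists>j k l. tri_minus K Z = (j, k, l) \<and> (j, k, l) \<in> dist P \<and>
        Dom (amb P) j \<in> subT P \<and> Cod (amb P) j \<in> subI P \<and> Cod (amb P) k = Z)"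

definition counitU :: "('o, 'a) tcp \<Rightarrow> ('o, 'a) tcp_choices \<Rightarrow> 'o \<Rightarrow> 'a set" where
  "counitU P K X = cls P (fst (triU K X))"

definition unitT :: "('o, 'a) tcp \<Rightarrow> ('o, 'a) tcp_choices \<Rightarrow> 'o \<Rightarrow> 'a set" where
  "unitT P K X = cls P (fst (snd (triT K X)))"

text \<open>
  The right adjoint \<open>C/I \<rightarrow> U/I\<close> (resp. left adjoint \<open>C/I \<rightarrow> T/I\<close>) of the inclusion; on arrows it
  is determined by naturality of the counit (resp. unit). Its restriction \<open>T/I \<rightarrow> Z/I\<close>
  (resp. \<open>U/I \<rightarrow> Z/I\<close>) and the counit (resp. unit) of that are given by the same maps, so that
  \<open>omegaU\<close> and \<open>counitU\<close> (resp. \<open>sigmaT\<close> and \<open>unitT\<close>) serve for both.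
\<close>

definition omegaU ::
    "('o, 'a) tcp \<Rightarrow> ('o, 'a) tcp_choices \<Rightarrow> ('o, 'a set, 'o, 'a set) ftor" where
  "omegaU P K = (let Q = C_mod_I P; W = (\<lambda>X. Dom (amb P) (fst (triU K X))) in \<lparr>
     omap = W,
     amap = (\<lambda>f. THE g. g \<in> Hom Q (W (Dom Q f)) (W (Cod Q f)) \<and>
       counitU P K (Cod Q f) \<cdot>\<^bsub>Q\<^esub> g = f \<cdot>\<^bsub>Q\<^esub> counitU P K (Dom Q f))\<rparr>)"

definition sigmaT ::
    "('o, 'a) tcp \<Rightarrow> ('o, 'a) tcp_choices \<Rightarrow> ('o, 'a set, 'o, 'a set) ftor" where
  "sigmaT P K = (let Q = C_mod_I P; W = (\<lambda>X. Cod (amb P) (fst (snd (triT K X)))) in \<lparr>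
     omap = W,
     amap = (\<lambda>f. THE g. g \<in> Hom Q (W (Dom Q f)) (W (Cod Q f)) \<and>
       g \<cdot>\<^bsub>Q\<^esub> unitT P K (Dom Q f) = unitT P K (Cod Q f) \<cdot>\<^bsub>Q\<^esub> f)\<rparr>)"

definition mu :: "('o, 'a) tcp \<Rightarrow> ('o, 'a) tcp_choices \<Rightarrow> 'o \<Rightarrow> 'a set" where
  "mu P K = (let Q = C_mod_I P in THE m. m \<in> extensional (Obj Q) \<and>
     is_nat_trans Q (Z_mod_I P)
       (comp_ftor (sigmaT P K) (omegaU P K)) (comp_ftor (omegaU P K) (sigmaT P K)) m \<and>
     (\<forall>X \<in> Obj Q.
        counitU P K (omap (sigmaT P K) X) \<cdot>\<^bsub>Q\<^esub> m X \<cdot>\<^bsub>Q\<^esub> unitT P K (omap (omegaU P K) X) =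
        unitT P K X \<cdot>\<^bsub>Q\<^esub> counitU P K X))"

definition condition_I :: "('o, 'a) tcp \<Rightarrow> ('o, 'a) tcp_choices \<Rightarrow> bool" where
  "condition_I P K \<longleftrightarrow>
     (\<forall>X \<in> star (amb P) (dist P) (subT P) (subU P). is_isom (Z_mod_I P) (mu P K X))"

definition condition_II :: "('o, 'a) tcp \<Rightarrow> bool" where
  "condition_II P \<longleftrightarrow> subU P \<inter> subNf P = subS P \<and> subT P \<inter> subNi P = subV P"

text \<open>The shifts \<open>Z/I \<rightarrow> U/I\<close> and \<open>Z/I \<rightarrow> T/I\<close>.\<close>

definition shift_plus ::
    "('o, 'a) tcp \<Rightarrow> ('o, 'a) tcp_choices \<Rightarrow> ('o, 'a set, 'o, 'a set) ftor" where
  "shift_plus P K = (let Q = C_mod_I P in \<lparr>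
     omap = (\<lambda>Z. Cod (amb P) (fst (snd (tri_plus K Z)))),
     amap = (\<lambda>f. THE g. \<exists>z i u. z \<in> f \<and> g = cls P u \<and>
       is_tri_morph (amb P) (shift P) (tri_plus K (Dom Q f)) (tri_plus K (Cod Q f)) z i u)\<rparr>)"

definition shift_minus ::
    "('o, 'a) tcp \<Rightarrow> ('o, 'a) tcp_choices \<Rightarrow> ('o, 'a set, 'o, 'a set) ftor" where
  "shift_minus P K = (let Q = C_mod_I P in \<lparr>
     omap = (\<lambda>Z. Dom (amb P) (fst (tri_minus K Z))),
     amap = (\<lambda>f. THE g. \<exists>t i z. z \<in> f \<and> g = cls P t \<and>
       is_tri_morph (amb P) (shift P) (tri_minus K (Dom Q f)) (tri_minus K (Cod Q f)) t i z)\<rparr>)"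

definition Sigma_ftor ::
    "('o, 'a) tcp \<Rightarrow> ('o, 'a) tcp_choices \<Rightarrow> ('o, 'a set, 'o, 'a set) ftor" where
  "Sigma_ftor P K = comp_ftor (sigmaT P K) (shift_plus P K)"

definition Omega_ftor ::
    "('o, 'a) tcp \<Rightarrow> ('o, 'a) tcp_choices \<Rightarrow> ('o, 'a set, 'o, 'a set) ftor" where
  "Omega_ftor P K = comp_ftor (omegaU P K) (shift_minus P K)"

definition standard_right_triangles ::
    "('o, 'a) tcp \<Rightarrow> ('o, 'a) tcp_choices \<Rightarrow> 'a set triangle set" where
  "standard_right_triangles P K =
     {(cls P f, unitT P K (Cod (amb P) a) \<cdot>\<^bsub>C_mod_I P\<^esub> cls P a, amap (sigmaT P K) (cls P c))
      | f a b y c.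
        (f, a, b) \<in> dist P \<and>
        Dom (amb P) f \<in> subZ P \<and> Cod (amb P) f \<in> subZ P \<and> Cod (amb P) a \<in> subU P \<and>
        is_tri_morph (amb P) (shift P) (f, a, b) (tri_plus K (Dom (amb P) f))
          (Ident (amb P) (Dom (amb P) f)) y c}"

definition dist_right_triangles ::
    "('o, 'a) tcp \<Rightarrow> ('o, 'a) tcp_choices \<Rightarrow> 'a set triangle set" where
  "dist_right_triangles P K =
     {t. is_triangle (Z_mod_I P) (Sigma_ftor P K) t \<and>
         (\<exists>s \<in> standard_right_triangles P K. tri_isomorphic (Z_mod_I P) (Sigma_ftor P K) t s)}"

end

theory Submission
  imports Defs
begin

text \<open>
  Write \<open>Q = C/I\<close>, and let \<open>[c]\<close> be the class in \<open>Q\<close> of a morphism \<open>c\<close> of \<open>C\<close>. A triangle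
  \<open>A \<rightarrow> J \<rightarrow> B \<rightarrow> A[1]\<close> with \<open>A \<in> T\<close>, \<open>J \<in> I\<close>, \<open>B \<in> U\<close> identifies \<open>Q(W, B)\<close> with
  \<open>C(W, A[1])\<close> for \<open>W \<in> U\<close>, and \<open>Q(A, W)\<close> with \<open>C(B, W[1])\<close> for \<open>W \<in> T\<close>. Hence a morphism
  \<open>b: M \<rightarrow> X[1]\<close> with \<open>M \<in> U\<close>, \<open>X \<in> Z\<close> determines a class \<open>\<delta>(b) \<in> Q(M, \<Sigma>X)\<close>, natural in both
  arguments, and the standard right triangle of \<open>X \<rightarrow> Y \<rightarrow> M \<rightarrow> X[1]\<close> has the third morphism \<open>h\<close> with
  \<open>h \<circ> \<eta> = \<delta>(b)\<close>. Every morphism of \<open>Z\<close> can be replaced modulo \<open>I\<close> by one whose cone is in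
  \<open>U\<close>; with this the axioms of a right triangulated category follow from those of \<open>C\<close>.

  The same identifications give an adjunction between \<open>\<Sigma>\<close> and \<open>\<Omega>\<close>. Its unit and counit are
  invertible by conditions (I) and (II). A right triangulated category whose shift is an
  equivalence is triangulated, by the five lemma.
\<close>

section \<open>Additive categories\<close>

text \<open>The obstacle is a mismatch of levels: squares in Z/I commute only modulo I, a map of Z
  need not have its cone in U, and rotations and octahedra produce objects of U that need not be in
  Z. Three devices deal with this. A square is made strictly commutative by subtracting a map
  through I; the subtracted map extends over the first arrow of the triangle because Ext^1(U, V) =
  0. A map X -> Y is traded for a map from X to the sum of Y and J, where X -> J has its cone in U
  and J is in I. This is harmless modulo I, and the new cone is an extension of two objects of U. A
  map whose cone lies in S induces bijections on arrows of Q into objects of T. So any such map may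
  stand in for a chosen unit, and arrows into an object of T can be compared after composing with
  it. The shift of C is only an equivalence, so there is no functor X[-1] to work with: triangles
  are shifted back through fullness, faithfulness and essential surjectivity of the shift.\<close>

lemma Hom_iff: "f \<in> Hom C X Y \<longleftrightarrow> f \<in> Arr C \<and> Dom C f = X \<and> Cod C f = Y"
  by (auto simp: Hom_def)

locale cat = category C for C :: "('o, 'a) addcat" (structure)
begin

lemma hom_objs: "f \<in> Hom C X Y \<Longrightarrow> X \<in> Obj C" "f \<in> Hom C X Y \<Longrightarrow> Y \<in> Obj C"
  using dom_obj cod_obj by (auto simp: Hom_iff)

lemma arr_objs [simp]: "f \<in> Arr C \<Longrightarrow> Dom C f \<in> Obj C" "f \<in> Arr C \<Longrightarrow> Cod C f \<in> Obj C"
  using dom_obj cod_obj by auto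

lemma arr_ident [simp]:
  "X \<in> Obj C \<Longrightarrow> Ident C X \<in> Arr C" "X \<in> Obj C \<Longrightarrow> Dom C (Ident C X) = X"
  "X \<in> Obj C \<Longrightarrow> Cod C (Ident C X) = X"
  using ident_hom by (auto simp: Hom_iff)

lemma arr_comp [simp]:
  assumes "f \<in> Arr C" "g \<in> Arr C" "Dom C g = Cod C f"
  shows "g \<cdot> f \<in> Arr C" "Dom C (g \<cdot> f) = Dom C f" "Cod C (g \<cdot> f) = Cod C g"
  using comp_hom[of f "Dom C f" "Cod C f" g "Cod C g"] assms by (auto simp: Hom_iff)

lemma ident_comp [simp]:
  "f \<in> Arr C \<Longrightarrow> Cod C f = X \<Longrightarrow> Ident C X \<cdot> f = f"
  "f \<in> Arr C \<Longrightarrow> Dom C f = X \<Longrightarrow> f \<cdot> Ident C X = f"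
  using ident_left ident_right by (auto simp: Hom_iff)

lemma assoc [simp]:
  assumes "f \<in> Arr C" "g \<in> Arr C" "h \<in> Arr C" "Dom C g = Cod C f" "Dom C h = Cod C g"
  shows "(h \<cdot> g) \<cdot> f = h \<cdot> (g \<cdot> f)"
  using comp_assoc[of f "Dom C f" "Cod C f" g "Cod C g" h "Cod C h"] assms by (auto simp: Hom_iff)

lemma is_isomI:
  assumes "f \<in> Hom C X Y" "g \<in> Hom C Y X" "g \<cdot> f = Ident C X" "f \<cdot> g = Ident C Y"
  shows "is_isom C f"
  using assms unfolding is_isom_def by (auto simp: Hom_iff)

lemma is_isomE:
  assumes "is_isom C f" "f \<in> Hom C X Y"
  obtains g where "g \<in> Hom C Y X" "g \<cdot> f = Ident C X" "f \<cdot> g = Ident C Y" "is_isom C g"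
  using assms unfolding is_isom_def by (fastforce simp: Hom_iff)

lemma isom_ident [simp]: "X \<in> Obj C \<Longrightarrow> is_isom C (Ident C X)"
  by (rule is_isomI[of _ X X "Ident C X"]) (auto simp: Hom_iff)

text \<open>\<open>assoc\<close> nests composites to the right, so an equation for a composite of
  two arrows no longer matches once a further arrow stands on its right. This lemma,
  \<open>comp_rewrite\<close> and \<open>comp_rewrite1\<close> restate such equations with an
  arbitrary tail \<open>k\<close>.\<close>

lemma comp_cancel_left:
  assumes "g \<cdot> f = Ident C X" "f \<in> Hom C X Y" "g \<in> Hom C Y X" "k \<in> Arr C" "Cod C k = X"
  shows "g \<cdot> (f \<cdot> k) = k"
proof -
  have "g \<cdot> (f \<cdot> k) = (g \<cdot> f) \<cdot> k"
    using assms(2-) by (simp add: Hom_iff del: assms(1))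
  then show ?thesis using assms by (simp add: Hom_iff)
qed

lemma comp_rewrite:
  assumes "g \<cdot> f = g' \<cdot> f'" "f \<in> Hom C X Y" "g \<in> Hom C Y Z" "f' \<in> Hom C X Y'" "g' \<in> Hom C Y' Z"
    and "k \<in> Arr C" "Cod C k = X"
  shows "g \<cdot> (f \<cdot> k) = g' \<cdot> (f' \<cdot> k)"
proof -
  have "g \<cdot> (f \<cdot> k) = (g \<cdot> f) \<cdot> k" "g' \<cdot> (f' \<cdot> k) = (g' \<cdot> f') \<cdot> k"
    using assms(2-) by (simp_all add: Hom_iff)
  then show ?thesis using assms(1) by simp
qed

lemma comp_rewrite1:
  assumes "g \<cdot> f = e" "f \<in> Hom C X Y" "g \<in> Hom C Y Z"
    and "k \<in> Arr C" "Cod C k = X"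
  shows "g \<cdot> (f \<cdot> k) = e \<cdot> k"
proof -
  have "g \<cdot> (f \<cdot> k) = (g \<cdot> f) \<cdot> k"
    using assms(2-) by (simp_all add: Hom_iff)
  then show ?thesis using assms(1) by simp
qed

lemma isom_comp:
  assumes "is_isom C f" "is_isom C g" "f \<in> Hom C X Y" "g \<in> Hom C Y Z"
  shows "is_isom C (g \<cdot> f)"
proof -
  obtain f' where f': "f' \<in> Hom C Y X" "f' \<cdot> f = Ident C X" "f \<cdot> f' = Ident C Y"
    using is_isomE[OF assms(1,3)] by metis
  obtain g' where g': "g' \<in> Hom C Z Y" "g' \<cdot> g = Ident C Y" "g \<cdot> g' = Ident C Z"
    using is_isomE[OF assms(2,4)] by metis
  show ?thesis
    using assms f' g' comp_cancel_left[OF g'(2), of Z f] comp_cancel_left[OF f'(3), of X g']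
    by (intro is_isomI[of _ X Z "f' \<cdot> g'"]) (auto simp: Hom_iff)
qed

lemma isom_epi:
  assumes "is_isom C f" "f \<in> Hom C X Y" "g \<in> Hom C Y Z" "h \<in> Hom C Y Z" "g \<cdot> f = h \<cdot> f"
  shows "g = h"
proof -
  obtain f' where f': "f' \<in> Hom C Y X" "f \<cdot> f' = Ident C Y"
    using is_isomE[OF assms(1,2)] by metis
  have "g = (g \<cdot> f) \<cdot> f'" using assms(1-4) f' by (simp add: Hom_iff)
  also have "\<dots> = (h \<cdot> f) \<cdot> f'" using assms(5) by simp
  also have "\<dots> = h" using assms(1-4) f' by (simp add: Hom_iff)
  finally show ?thesis .
qed

lemma isom_mono:
  assumes "is_isom C f" "f \<in> Hom C X Y" "g \<in> Hom C W X" "h \<in> Hom C W X" "f \<cdot> g = f \<cdot> h"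
  shows "g = h"
proof -
  obtain f' where f': "f' \<in> Hom C Y X" "f' \<cdot> f = Ident C X"
    using is_isomE[OF assms(1,2)] by metis
  have "g = f' \<cdot> (f \<cdot> g)"
    using assms f' comp_cancel_left[OF f'(2), of Y g] by (simp add: Hom_iff)
  also have "\<dots> = f' \<cdot> (f \<cdot> h)" using assms(5) by simp
  also have "\<dots> = h" using assms(1-4) f' comp_cancel_left[OF f'(2), of Y h] by (simp add: Hom_iff)
  finally show ?thesis .
qed

lemma isom_cancel_left:
  assumes "is_isom C (g \<cdot> f)" "is_isom C g" "f \<in> Hom C X Y" "g \<in> Hom C Y Z"
  shows "is_isom C f"
proof -
  obtain g' where g': "g' \<in> Hom C Z Y" "g' \<cdot> g = Ident C Y" "g \<cdot> g' = Ident C Z" "is_isom C g'"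
    using is_isomE[OF assms(2,4)] by metis
  have "g' \<cdot> (g \<cdot> f) = f"
    using assms g' comp_cancel_left[OF g'(2), of Z f] by (simp add: Hom_iff)
  moreover have "is_isom C (g' \<cdot> (g \<cdot> f))"
    by (rule isom_comp[of _ _ X Z Y]) (use assms g' in \<open>auto simp: Hom_iff\<close>)
  ultimately show ?thesis by simp
qed

lemma isom_cancel_right:
  assumes "is_isom C (g \<cdot> f)" "is_isom C f" "f \<in> Hom C X Y" "g \<in> Hom C Y Z"
  shows "is_isom C g"
proof -
  obtain f' where f': "f' \<in> Hom C Y X" "f' \<cdot> f = Ident C X" "f \<cdot> f' = Ident C Y" "is_isom C f'"
    using is_isomE[OF assms(2,3)] by metis
  have "(g \<cdot> f) \<cdot> f' = g" using assms f' by (simp add: Hom_iff)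
  moreover have "is_isom C ((g \<cdot> f) \<cdot> f')"
    by (rule isom_comp[of _ _ Y X Z]) (use assms f' in \<open>auto simp: Hom_iff\<close>)
  ultimately show ?thesis by simp
qed

end

locale addc = cat C + additive_category C for C :: "('o, 'a) addcat" (structure)
begin

abbreviation add (infixl "\<oplus>" 65) where "f \<oplus> g \<equiv> Add C f g"

lemma carrier_Hom_group [simp]: "carrier (Hom_group C X Y) = Hom C X Y"
  "mult (Hom_group C X Y) = Add C" "one (Hom_group C X Y) = Zero C X Y"
  by (simp_all add: Hom_group_def)

context
  fixes X Y assumes XY: "X \<in> Obj C" "Y \<in> Obj C"
begin

interpretation comm_group "Hom_group C X Y" by (rule hom_group[OF XY])

lemma hom_add0: "f \<in> Hom C X Y \<Longrightarrow> g \<in> Hom C X Y \<Longrightarrow> f \<oplus> g \<in> Hom C X Y"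
  using m_closed by simp

lemma hom_zero: "Zero C X Y \<in> Hom C X Y"
  using one_closed by simp

lemma add_assoc0: "f \<in> Hom C X Y \<Longrightarrow> g \<in> Hom C X Y \<Longrightarrow> h \<in> Hom C X Y \<Longrightarrow>
    (f \<oplus> g) \<oplus> h = f \<oplus> (g \<oplus> h)"
  using m_assoc by simp

lemma add_commute0: "f \<in> Hom C X Y \<Longrightarrow> g \<in> Hom C X Y \<Longrightarrow> f \<oplus> g = g \<oplus> f"
  using m_comm by simp

lemma add_zero0: "f \<in> Hom C X Y \<Longrightarrow> f \<oplus> Zero C X Y = f" "f \<in> Hom C X Y \<Longrightarrow> Zero C X Y \<oplus> f = f"
  using r_one l_one by simp_all

lemma neg0: "f \<in> Hom C X Y \<Longrightarrow> Neg C f \<in> Hom C X Y"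
  "f \<in> Hom C X Y \<Longrightarrow> f \<oplus> Neg C f = Zero C X Y" "f \<in> Hom C X Y \<Longrightarrow> Neg C f \<oplus> f = Zero C X Y"
  using inv_closed r_inv l_inv unfolding Neg_def by (auto simp: Hom_iff)

lemma neg_unique0: "f \<in> Hom C X Y \<Longrightarrow> g \<in> Hom C X Y \<Longrightarrow> f \<oplus> g = Zero C X Y \<Longrightarrow> Neg C f = g"
  using inv_equality[of g f] m_comm[of f g] unfolding Neg_def by (auto simp: Hom_iff)

end

lemma arr_add [simp]:
  assumes "f \<in> Arr C" "g \<in> Arr C" "Dom C f = Dom C g" "Cod C f = Cod C g"
  shows "f \<oplus> g \<in> Arr C" "Dom C (f \<oplus> g) = Dom C g" "Cod C (f \<oplus> g) = Cod C g"
  using hom_add0[of "Dom C g" "Cod C g" f g] assms by (auto simp: Hom_iff)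

lemma arr_zero [simp]:
  assumes "X \<in> Obj C" "Y \<in> Obj C"
  shows "Zero C X Y \<in> Arr C" "Dom C (Zero C X Y) = X" "Cod C (Zero C X Y) = Y"
  using hom_zero[OF assms] by (auto simp: Hom_iff)

lemma arr_neg [simp]:
  assumes "f \<in> Arr C"
  shows "Neg C f \<in> Arr C" "Dom C (Neg C f) = Dom C f" "Cod C (Neg C f) = Cod C f"
  using neg0(1)[of "Dom C f" "Cod C f" f] assms by (auto simp: Hom_iff)

lemma add_assoc:
  assumes "f \<in> Arr C" "g \<in> Arr C" "h \<in> Arr C" "Dom C f = Dom C g" "Cod C f = Cod C g"
    "Dom C h = Dom C g" "Cod C h = Cod C g"
  shows "(f \<oplus> g) \<oplus> h = f \<oplus> (g \<oplus> h)"
  using add_assoc0[of "Dom C g" "Cod C g" f g h] assms by (auto simp: Hom_iff)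

lemma add_commute:
  assumes "f \<in> Arr C" "g \<in> Arr C" "Dom C f = Dom C g" "Cod C f = Cod C g"
  shows "f \<oplus> g = g \<oplus> f"
  using add_commute0[of "Dom C g" "Cod C g" f g] assms by (auto simp: Hom_iff)

lemma add_left_commute:
  assumes "f \<in> Arr C" "g \<in> Arr C" "h \<in> Arr C" "Dom C f = Dom C g" "Cod C f = Cod C g"
    "Dom C h = Dom C g" "Cod C h = Cod C g"
  shows "f \<oplus> (g \<oplus> h) = g \<oplus> (f \<oplus> h)"
proof -
  have "f \<oplus> (g \<oplus> h) = (f \<oplus> g) \<oplus> h" using assms by (simp add: add_assoc)
  also have "\<dots> = (g \<oplus> f) \<oplus> h" using assms add_commute[of f g] by simp
  also have "\<dots> = g \<oplus> (f \<oplus> h)" using assms by (simp add: add_assoc)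
  finally show ?thesis .
qed

lemmas add_ac = add_assoc add_commute add_left_commute

lemma add_zero [simp]:
  "f \<in> Arr C \<Longrightarrow> Dom C f = X \<Longrightarrow> Cod C f = Y \<Longrightarrow> f \<oplus> Zero C X Y = f"
  "f \<in> Arr C \<Longrightarrow> Dom C f = X \<Longrightarrow> Cod C f = Y \<Longrightarrow> Zero C X Y \<oplus> f = f"
  using add_zero0[of "Dom C f" "Cod C f" f] by (auto simp: Hom_iff)

lemma add_neg [simp]:
  "f \<in> Arr C \<Longrightarrow> f \<oplus> Neg C f = Zero C (Dom C f) (Cod C f)"
  "f \<in> Arr C \<Longrightarrow> Neg C f \<oplus> f = Zero C (Dom C f) (Cod C f)"
  using neg0(2,3)[of "Dom C f" "Cod C f" f] by (auto simp: Hom_iff)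

lemma add_neg_cancel [simp]:
  assumes "f \<in> Arr C" "g \<in> Arr C" "Dom C f = Dom C g" "Cod C f = Cod C g"
  shows "f \<oplus> (Neg C f \<oplus> g) = g" "Neg C f \<oplus> (f \<oplus> g) = g"
  using assms by (simp_all add: add_assoc[symmetric])

lemma neg_unique: "f \<in> Hom C X Y \<Longrightarrow> g \<in> Hom C X Y \<Longrightarrow> f \<oplus> g = Zero C X Y \<Longrightarrow> Neg C f = g"
  using neg_unique0 hom_objs by blast

lemma neg_neg [simp]: "f \<in> Arr C \<Longrightarrow> Neg C (Neg C f) = f"
  by (rule neg_unique[of _ "Dom C f" "Cod C f"]) (auto simp: Hom_iff)

lemma neg_zero [simp]: "X \<in> Obj C \<Longrightarrow> Y \<in> Obj C \<Longrightarrow> Neg C (Zero C X Y) = Zero C X Y"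
  by (rule neg_unique[of _ X Y]) (auto simp: Hom_iff)

lemma sub_zero:
  assumes "f \<in> Hom C X Y" "g \<in> Hom C X Y" "f \<oplus> Neg C g = Zero C X Y"
  shows "f = g"
proof -
  have "(f \<oplus> Neg C g) \<oplus> g = f" using assms(1,2) hom_objs[OF assms(1)]
    by (simp add: Hom_iff add_assoc)
  then show ?thesis using assms hom_objs[OF assms(1)] by (simp add: Hom_iff)
qed

lemma idem_zero:
  assumes "f \<in> Hom C X Y" "f \<oplus> f = f"
  shows "f = Zero C X Y"
proof -
  have "Neg C f \<oplus> (f \<oplus> f) = f" using assms(1) by (simp add: Hom_iff)
  then show ?thesis using assms by (simp add: Hom_iff)
qed

lemma comp_add [simp]:
  assumes "f \<in> Arr C" "f' \<in> Arr C" "Dom C f = Dom C f'" "Cod C f = Cod C f'" "g \<in> Arr C" "Dom C g = Cod C f'"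
  shows "g \<cdot> (f \<oplus> f') = g \<cdot> f \<oplus> g \<cdot> f'"
  using comp_add_right[of f "Dom C f" "Cod C f" f' g "Cod C g"] assms by (auto simp: Hom_iff)

lemma add_comp [simp]:
  assumes "g \<in> Arr C" "g' \<in> Arr C" "Dom C g = Dom C g'" "Cod C g = Cod C g'" "f \<in> Arr C" "Dom C g' = Cod C f"
  shows "(g \<oplus> g') \<cdot> f = g \<cdot> f \<oplus> g' \<cdot> f"
  using comp_add_left[of f "Dom C f" "Cod C f" g "Cod C g" g'] assms by (auto simp: Hom_iff)

lemma comp_zero [simp]:
  assumes "f \<in> Arr C" "Dom C f = Y" "X \<in> Obj C"
  shows "f \<cdot> Zero C X Y = Zero C X (Cod C f)"
proof (rule idem_zero)
  have Y: "Y \<in> Obj C" using assms by auto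
  show "f \<cdot> Zero C X Y \<in> Hom C X (Cod C f)" using assms Y by (simp add: Hom_iff)
  have "f \<cdot> Zero C X Y = f \<cdot> (Zero C X Y \<oplus> Zero C X Y)" using assms Y by simp
  then show "f \<cdot> Zero C X Y \<oplus> f \<cdot> Zero C X Y = f \<cdot> Zero C X Y" using assms Y by (simp del: add_zero)
qed

lemma zero_comp [simp]:
  assumes "f \<in> Arr C" "Cod C f = Y" "Z \<in> Obj C"
  shows "Zero C Y Z \<cdot> f = Zero C (Dom C f) Z"
proof (rule idem_zero)
  have Y: "Y \<in> Obj C" using assms by auto
  show "Zero C Y Z \<cdot> f \<in> Hom C (Dom C f) Z" using assms Y by (simp add: Hom_iff)
  have "Zero C Y Z \<cdot> f = (Zero C Y Z \<oplus> Zero C Y Z) \<cdot> f" using assms Y by simp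
  then show "Zero C Y Z \<cdot> f \<oplus> Zero C Y Z \<cdot> f = Zero C Y Z \<cdot> f" using assms Y by (simp del: add_zero)
qed

lemma comp_neg [simp]:
  assumes "f \<in> Arr C" "g \<in> Arr C" "Dom C g = Cod C f"
  shows "g \<cdot> Neg C f = Neg C (g \<cdot> f)" "Neg C g \<cdot> f = Neg C (g \<cdot> f)"
proof -
  have "g \<cdot> f \<oplus> g \<cdot> Neg C f = Zero C (Dom C f) (Cod C g)"
    using assms comp_add[of f "Neg C f" g] by (simp del: comp_add)
  then show "g \<cdot> Neg C f = Neg C (g \<cdot> f)"
    using assms neg_unique[of "g \<cdot> f" "Dom C f" "Cod C g" "g \<cdot> Neg C f"] by (simp add: Hom_iff)
  have "g \<cdot> f \<oplus> Neg C g \<cdot> f = Zero C (Dom C f) (Cod C g)"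
    using assms add_comp[of g "Neg C g" f] by (simp del: add_comp)
  then show "Neg C g \<cdot> f = Neg C (g \<cdot> f)"
    using assms neg_unique[of "g \<cdot> f" "Dom C f" "Cod C g" "Neg C g \<cdot> f"] by (simp add: Hom_iff)
qed

lemma neg_add [simp]:
  assumes "f \<in> Arr C" "g \<in> Arr C" "Dom C f = Dom C g" "Cod C f = Cod C g"
  shows "Neg C (f \<oplus> g) = Neg C f \<oplus> Neg C g"
proof (rule neg_unique[of _ "Dom C g" "Cod C g"])
  have "f \<oplus> g \<oplus> (Neg C f \<oplus> Neg C g) = f \<oplus> (Neg C f \<oplus> (g \<oplus> Neg C g))"
    using assms by (simp only: add_assoc add_left_commute arr_add arr_neg)
  then show "f \<oplus> g \<oplus> (Neg C f \<oplus> Neg C g) = Zero C (Dom C g) (Cod C g)"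
    using assms by simp
qed (use assms in \<open>auto simp: Hom_iff\<close>)

lemma isom_neg_ident: "X \<in> Obj C \<Longrightarrow> is_isom C (Neg C (Ident C X))"
  by (rule is_isomI[of _ X X "Neg C (Ident C X)"]) (auto simp: Hom_iff)

lemma zero_obj_hom_eq:
  assumes "is_zero_object C Z"
  shows "f \<in> Hom C Z X \<Longrightarrow> f = Zero C Z X" "f \<in> Hom C X Z \<Longrightarrow> f = Zero C X Z"
  using assms hom_zero hom_objs unfolding is_zero_object_def by metis+

text \<open>The equational form is preserved by anything that preserves identities and zero arrows.
  This is how zero objects are carried along the shift, into the ideal quotient and into full
  subcategories.\<close>

lemma zero_object_iff:
  assumes "Z \<in> Obj C"
  shows "is_zero_object C Z \<longleftrightarrow> Ident C Z = Zero C Z Z"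
proof
  assume "is_zero_object C Z" then show "Ident C Z = Zero C Z Z"
    using zero_obj_hom_eq(1)[of Z "Ident C Z" Z] assms by (simp add: Hom_iff)
next
  assume 0: "Ident C Z = Zero C Z Z"
  have 1: "f = Zero C Z X" if "f \<in> Hom C Z X" for f X
  proof -
    have "f = f \<cdot> Ident C Z" using that by (simp add: Hom_iff)
    then show ?thesis using that assms unfolding 0 by (simp add: Hom_iff)
  qed
  have 2: "f = Zero C X Z" if "f \<in> Hom C X Z" for f X
  proof -
    have "f = Ident C Z \<cdot> f" using that by (simp add: Hom_iff)
    then show ?thesis using that assms unfolding 0 by (simp add: Hom_iff)
  qed
  show "is_zero_object C Z"
    unfolding is_zero_object_def using assms hom_zero 1 2 by blast
qed

lemma retraction_zero:
  assumes "r \<cdot> m = Ident C A" "m \<in> Hom C A B" "r \<in> Hom C B A"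
    and "k \<in> Hom C W A" "m \<cdot> k = Zero C W B"
  shows "k = Zero C W A"
proof -
  have "k = r \<cdot> (m \<cdot> k)" using assms comp_cancel_left[OF assms(1-3), of k] by (simp add: Hom_iff)
  then show ?thesis using assms hom_objs[OF assms(4)] by (simp add: Hom_iff)
qed

end

lemma addcI: "additive_category C \<Longrightarrow> addc C"
  by (simp add: addc_def cat_def additive_category.axioms)

section \<open>Functors and morphisms of triangles\<close>

text \<open>Equivalences are defined through a quasi-inverse, but the arguments about triangles use
  the shift only through faithfulness, fullness and essential surjectivity.\<close>

lemma (in cat) equivalence_full_faithful:
  assumes "is_equivalence C C F"
  shows "f \<in> Hom C X Y \<Longrightarrow> f' \<in> Hom C X Y \<Longrightarrow> amap F f = amap F f' \<Longrightarrow> f = f'"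
    and "X \<in> Obj C \<Longrightarrow> Y \<in> Obj C \<Longrightarrow> k \<in> Hom C (omap F X) (omap F Y) \<Longrightarrow>
      \<exists>f \<in> Hom C X Y. amap F f = k"
    and "Y \<in> Obj C \<Longrightarrow> \<exists>X \<in> Obj C. \<exists>e \<in> Hom C (omap F X) Y. is_isom C e"
proof -
  obtain G a b where F: "is_functor C C F" and G: "is_functor C C G"
    and a: "is_nat_trans C C (comp_ftor G F) id_ftor a" "\<forall>X\<in>Obj C. is_isom C (a X)"
    and b: "is_nat_trans C C (comp_ftor F G) id_ftor b" "\<forall>X\<in>Obj C. is_isom C (b X)"
    using assms unfolding is_equivalence_def naturally_isomorphic_def by blast
  have aH: "a X \<in> Hom C (omap G (omap F X)) X" if "X \<in> Obj C" for X
    using a(1) that by (simp add: is_nat_trans_def comp_ftor_def id_ftor_def)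
  have bH: "b X \<in> Hom C (omap F (omap G X)) X" if "X \<in> Obj C" for X
    using b(1) that by (simp add: is_nat_trans_def comp_ftor_def id_ftor_def)
  have aN: "a Y \<cdot> amap G (amap F f) = f \<cdot> a X" if "f \<in> Hom C X Y" for f X Y
    using a(1) that unfolding is_nat_trans_def by (simp add: comp_ftor_def id_ftor_def)
  have bN: "b Y \<cdot> amap F (amap G f) = f \<cdot> b X" if "f \<in> Hom C X Y" for f X Y
    using b(1) that unfolding is_nat_trans_def by (simp add: comp_ftor_def id_ftor_def)
  have FH: "amap F f \<in> Hom C (omap F X) (omap F Y)" if "f \<in> Hom C X Y" for f X Y
    using F that unfolding is_functor_def by blast
  have GH: "amap G f \<in> Hom C (omap G X) (omap G Y)" if "f \<in> Hom C X Y" for f X Y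
    using G that unfolding is_functor_def by blast
  show faith: "f = f'" if "f \<in> Hom C X Y" "f' \<in> Hom C X Y" "amap F f = amap F f'" for f f' X Y
  proof -
    have "X \<in> Obj C" using that hom_objs by blast
    then show ?thesis
      using aN[OF that(1)] aN[OF that(2)] that isom_epi[OF _ aH, of X f Y f'] a(2) by metis
  qed
  have faithG: "f = f'" if "f \<in> Hom C X Y" "f' \<in> Hom C X Y" "amap G f = amap G f'" for f f' X Y
  proof -
    have "X \<in> Obj C" using that hom_objs by blast
    then show ?thesis
      using bN[OF that(1)] bN[OF that(2)] that isom_epi[OF _ bH, of X f Y f'] b(2) by metis
  qed
  show "\<exists>f \<in> Hom C X Y. amap F f = k"
    if XY: "X \<in> Obj C" "Y \<in> Obj C" and k: "k \<in> Hom C (omap F X) (omap F Y)"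
  proof -
    obtain i where i: "i \<in> Hom C X (omap G (omap F X))" "i \<cdot> a X = Ident C (omap G (omap F X))"
      using is_isomE[OF _ aH, of X] a(2) XY by metis
    \<comment> \<open>Naturality of \<open>a\<close> forces this formula. That
      \<open>amap F f\<close> is \<open>k\<close> is tested after \<open>amap G\<close>, which is
      faithful by the argument for \<open>F\<close> with \<open>b\<close> in place of
      \<open>a\<close>.\<close>
    define f where "f = a Y \<cdot> (amap G k \<cdot> i)"
    have f: "f \<in> Hom C X Y"
      using aH[OF XY(1)] aH[OF XY(2)] GH[OF k] i(1) unfolding f_def by (simp add: Hom_iff)
    have "a Y \<cdot> amap G (amap F f) = f \<cdot> a X" using aN f by blast
    also have "\<dots> = a Y \<cdot> amap G k"
      using aH[OF XY(1)] aH[OF XY(2)] GH[OF k] i unfolding f_def by (simp add: Hom_iff)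
    finally have "amap G (amap F f) = amap G k"
      using isom_mono[OF _ aH[OF XY(2)]] a(2) XY GH[OF k] GH[OF FH[OF f]] by metis
    then have "amap F f = k" using faithG[OF FH[OF f] k] by blast
    then show ?thesis using f by blast
  qed
  show "\<exists>X \<in> Obj C. \<exists>e \<in> Hom C (omap F X) Y. is_isom C e" if "Y \<in> Obj C"
    using bH[OF that] b(2) that G unfolding is_functor_def by blast
qed

text \<open>Serves for Sigma. On objects the quasi-inverse consists of chosen preimages with
  isomorphisms \<open>e\<close>; naturality of \<open>e\<close> determines it on arrows. Its functor
  laws and the second natural isomorphism follow by cancelling \<open>e\<close> and using
  faithfulness.\<close>

lemma (in cat) full_faithful_equivalence:
  assumes F: "is_functor C C F"
    and faith: "\<And>f f' X Y. f \<in> Hom C X Y \<Longrightarrow> f' \<in> Hom C X Y \<Longrightarrow> amap F f = amap F f' \<Longrightarrow> f = f'"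
    and full: "\<And>X Y k. X \<in> Obj C \<Longrightarrow> Y \<in> Obj C \<Longrightarrow> k \<in> Hom C (omap F X) (omap F Y) \<Longrightarrow>
      \<exists>f \<in> Hom C X Y. amap F f = k"
    and surj: "\<And>Y. Y \<in> Obj C \<Longrightarrow> \<exists>X \<in> Obj C. \<exists>e \<in> Hom C (omap F X) Y. is_isom C e"
  shows "is_equivalence C C F"
proof -
  obtain Go where Go: "\<And>Y. Y \<in> Obj C \<Longrightarrow> Go Y \<in> Obj C \<and> (\<exists>e \<in> Hom C (omap F (Go Y)) Y. is_isom C e)"
    using surj by metis
  then obtain e where e: "\<And>Y. Y \<in> Obj C \<Longrightarrow> e Y \<in> Hom C (omap F (Go Y)) Y"
    "\<And>Y. Y \<in> Obj C \<Longrightarrow> is_isom C (e Y)" by metis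
  have FO: "omap F X \<in> Obj C" if "X \<in> Obj C" for X using F that unfolding is_functor_def by blast
  have FH: "amap F f \<in> Hom C (omap F X) (omap F Y)" if "f \<in> Hom C X Y" for f X Y
    using F that unfolding is_functor_def by blast
  have Fid: "amap F (Ident C X) = Ident C (omap F X)" if "X \<in> Obj C" for X
    using F that unfolding is_functor_def by blast
  have Fc: "amap F (g \<cdot> f) = amap F g \<cdot> amap F f" if "f \<in> Hom C X Y" "g \<in> Hom C Y Z" for f g X Y Z
    using F that unfolding is_functor_def by blast
  have ex: "\<exists>g \<in> Hom C (Go X) (Go Y). e Y \<cdot> amap F g = f \<cdot> e X" if f: "f \<in> Hom C X Y" for f X Y
  proof -
    have o: "X \<in> Obj C" "Y \<in> Obj C" using f hom_objs by blast+
    obtain i where i: "i \<in> Hom C Y (omap F (Go Y))" "e Y \<cdot> i = Ident C Y"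
      using is_isomE[OF e(2) e(1)] o by metis
    have "i \<cdot> (f \<cdot> e X) \<in> Hom C (omap F (Go X)) (omap F (Go Y))"
      using i(1) f e(1)[OF o(1)] by (simp add: Hom_iff)
    then obtain g where g: "g \<in> Hom C (Go X) (Go Y)" "amap F g = i \<cdot> (f \<cdot> e X)"
      using full Go o by blast
    have "e Y \<cdot> amap F g = f \<cdot> e X"
      unfolding g(2) using comp_cancel_left[OF i(2) i(1) e(1)] o f e(1)[OF o(1)] by (simp add: Hom_iff)
    then show ?thesis using g by blast
  qed
  define Ga where "Ga f = (SOME g. g \<in> Hom C (Go (Dom C f)) (Go (Cod C f)) \<and>
      e (Cod C f) \<cdot> amap F g = f \<cdot> e (Dom C f))" for f
  have Ga: "Ga f \<in> Hom C (Go X) (Go Y)" "e Y \<cdot> amap F (Ga f) = f \<cdot> e X" if f: "f \<in> Hom C X Y" for f X Y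
  proof -
    have fd: "Dom C f = X" "Cod C f = Y" using f by (auto simp: Hom_iff)
    show "Ga f \<in> Hom C (Go X) (Go Y)" "e Y \<cdot> amap F (Ga f) = f \<cdot> e X"
      using someI_ex[OF ex[OF f, unfolded Bex_def]] unfolding Ga_def fd by blast+
  qed
  have uniq: "g = g'" if "g \<in> Hom C (Go X) (Go Y)" "g' \<in> Hom C (Go X) (Go Y)" "X \<in> Obj C" "Y \<in> Obj C"
    "e Y \<cdot> amap F g = e Y \<cdot> amap F g'" for g g' X Y
    using isom_mono[OF e(2) e(1) FH FH] faith that by metis
  define G where "G = \<lparr>omap = Go, amap = Ga\<rparr>"
  have Gs [simp]: "omap G = Go" "amap G = Ga" by (simp_all add: G_def)
  have G: "is_functor C C G"
    unfolding is_functor_def Gs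
  proof (intro conjI allI ballI)
    fix X assume X: "X \<in> Obj C"
    show "Go X \<in> Obj C" using Go X by blast
    have I: "Ident C X \<in> Hom C X X" "Ident C (Go X) \<in> Hom C (Go X) (Go X)"
      using X Go ident_hom by auto
    show "Ga (Ident C X) = Ident C (Go X)"
      using uniq[OF Ga(1)[OF I(1)] I(2) X X] Ga(2)[OF I(1)] Go[OF X] e(1)[OF X]
      by (simp add: Fid Hom_iff)
  next
    fix X Y f assume "f \<in> Hom C X Y"
    then show "Ga f \<in> Hom C (Go X) (Go Y)" using Ga by blast
  next
    fix X Y Z f g assume f: "f \<in> Hom C X Y" and g: "g \<in> Hom C Y Z"
    have o: "X \<in> Obj C" "Y \<in> Obj C" "Z \<in> Obj C" using f g hom_objs by blast+
    have gf: "g \<cdot> f \<in> Hom C X Z" using f g comp_hom by blast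
    have h: "Ga g \<cdot> Ga f \<in> Hom C (Go X) (Go Z)" using Ga(1) f g comp_hom by blast
    have "e Z \<cdot> amap F (Ga g \<cdot> Ga f) = (e Z \<cdot> amap F (Ga g)) \<cdot> amap F (Ga f)"
      using Fc[OF Ga(1)[OF f] Ga(1)[OF g]] e(1)[OF o(3)] FH[OF Ga(1)[OF f]] FH[OF Ga(1)[OF g]]
      by (simp add: Hom_iff)
    also have "\<dots> = g \<cdot> (e Y \<cdot> amap F (Ga f))"
      unfolding Ga(2)[OF g] using e(1)[OF o(2)] g FH[OF Ga(1)[OF f]] by (simp add: Hom_iff)
    also have "\<dots> = (g \<cdot> f) \<cdot> e X"
      unfolding Ga(2)[OF f] using e(1)[OF o(1)] g f by (simp add: Hom_iff)
    finally show "Ga (g \<cdot> f) = Ga g \<cdot> Ga f"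
      using uniq[OF Ga(1)[OF gf] h o(1,3)] Ga(2)[OF gf] by simp
  qed
  have FG: "naturally_isomorphic C C (comp_ftor F G) id_ftor"
    unfolding naturally_isomorphic_def is_nat_trans_def
    using e Ga by (intro exI[of _ e]) (auto simp: comp_ftor_def id_ftor_def)
  define a where "a X = (SOME f. f \<in> Hom C (Go (omap F X)) X \<and> amap F f = e (omap F X))" for X
  have a: "a X \<in> Hom C (Go (omap F X)) X" "amap F (a X) = e (omap F X)" if "X \<in> Obj C" for X
    using someI_ex[of "\<lambda>f. f \<in> Hom C (Go (omap F X)) X \<and> amap F f = e (omap F X)"]
      full[OF _ that e(1)[OF FO[OF that]]] Go[OF FO[OF that]] unfolding a_def by blast+
  have reflect: "is_isom C f" if f: "f \<in> Hom C X Y" "is_isom C (amap F f)" for f X Y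
  proof -
    have o: "X \<in> Obj C" "Y \<in> Obj C" using f hom_objs by blast+
    obtain i where i: "i \<in> Hom C (omap F Y) (omap F X)" "i \<cdot> amap F f = Ident C (omap F X)"
      "amap F f \<cdot> i = Ident C (omap F Y)" using is_isomE[OF f(2) FH[OF f(1)]] by metis
    obtain g where g: "g \<in> Hom C Y X" "amap F g = i" using full[OF o(2,1) i(1)] by blast
    have "g \<cdot> f = Ident C X"
      using faith[of "g \<cdot> f" X X "Ident C X"] Fc[OF f(1) g(1)] Fid i g f o comp_hom ident_hom by simp
    moreover have "f \<cdot> g = Ident C Y"
      using faith[of "f \<cdot> g" Y Y "Ident C Y"] Fc[OF g(1) f(1)] Fid i g f o comp_hom ident_hom by simp
    ultimately show ?thesis using is_isomI[OF f(1) g(1)] by blast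
  qed
  have GF: "naturally_isomorphic C C (comp_ftor G F) id_ftor"
    unfolding naturally_isomorphic_def is_nat_trans_def
  proof (intro exI[of _ a] conjI allI ballI)
    fix X assume X: "X \<in> Obj C"
    show "a X \<in> Hom C (omap (comp_ftor G F) X) (omap id_ftor X)"
      using a X by (simp add: comp_ftor_def id_ftor_def)
    show "is_isom C (a X)" using reflect[OF a(1)] a(2) e(2) FO X by simp
  next
    fix X Y f assume f: "f \<in> Hom C X Y"
    have o: "X \<in> Obj C" "Y \<in> Obj C" using f hom_objs by blast+
    have H: "a Y \<cdot> Ga (amap F f) \<in> Hom C (Go (omap F X)) Y" "f \<cdot> a X \<in> Hom C (Go (omap F X)) Y"
      using a o f Ga(1)[OF FH[OF f]] comp_hom by blast+
    have "amap F (a Y \<cdot> Ga (amap F f)) = amap F (f \<cdot> a X)"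
      using Fc[OF Ga(1)[OF FH[OF f]] a(1)] Fc[OF a(1) f] o a(2) Ga(2)[OF FH[OF f]] by simp
    then show "a Y \<cdot> amap (comp_ftor G F) f = amap id_ftor f \<cdot> a X"
      using faith[OF H] by (simp add: comp_ftor_def id_ftor_def)
  qed
  show ?thesis unfolding is_equivalence_def using F G FG GF by blast
qed

locale addftor = addc C for C :: "('o, 'a) addcat" (structure) +
  fixes F :: "('o, 'a, 'o, 'a) ftor"
  assumes sh_add: "is_additive_functor C C F"
begin

lemma F_obj [simp]: "X \<in> Obj C \<Longrightarrow> omap F X \<in> Obj C"
  using sh_add by (simp add: is_additive_functor_def is_functor_def)

lemma F_hom: "f \<in> Hom C X Y \<Longrightarrow> amap F f \<in> Hom C (omap F X) (omap F Y)"
  using sh_add unfolding is_additive_functor_def is_functor_def by blast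

lemma F_arr [simp]:
  assumes "f \<in> Arr C"
  shows "amap F f \<in> Arr C" "Dom C (amap F f) = omap F (Dom C f)" "Cod C (amap F f) = omap F (Cod C f)"
  using F_hom[of f "Dom C f" "Cod C f"] assms by (auto simp: Hom_iff)

lemma F_ident [simp]: "X \<in> Obj C \<Longrightarrow> amap F (Ident C X) = Ident C (omap F X)"
  using sh_add by (simp add: is_additive_functor_def is_functor_def)

lemma F_comp [simp]:
  assumes "f \<in> Arr C" "g \<in> Arr C" "Dom C g = Cod C f"
  shows "amap F (g \<cdot> f) = amap F g \<cdot> amap F f"
proof -
  have "f \<in> Hom C (Dom C f) (Cod C f)" "g \<in> Hom C (Cod C f) (Cod C g)" using assms by (auto simp: Hom_iff)
  then show ?thesis using sh_add unfolding is_additive_functor_def is_functor_def by blast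
qed

lemma F_add [simp]:
  assumes "f \<in> Arr C" "g \<in> Arr C" "Dom C f = Dom C g" "Cod C f = Cod C g"
  shows "amap F (f \<oplus> g) = amap F f \<oplus> amap F g"
proof -
  have "f \<in> Hom C (Dom C g) (Cod C g)" "g \<in> Hom C (Dom C g) (Cod C g)" using assms by (auto simp: Hom_iff)
  then show ?thesis using sh_add unfolding is_additive_functor_def by blast
qed

lemma F_zero [simp]: "X \<in> Obj C \<Longrightarrow> Y \<in> Obj C \<Longrightarrow> amap F (Zero C X Y) = Zero C (omap F X) (omap F Y)"
  using F_add[of "Zero C X Y" "Zero C X Y"] idem_zero[of "amap F (Zero C X Y)" "omap F X" "omap F Y"]
  by (auto simp: Hom_iff)

lemma F_neg [simp]: "f \<in> Arr C \<Longrightarrow> amap F (Neg C f) = Neg C (amap F f)"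
  using F_add[of f "Neg C f"] neg_unique[of "amap F f" "omap F (Dom C f)" "omap F (Cod C f)" "amap F (Neg C f)"]
  by (auto simp: Hom_iff simp del: F_add)

lemma F_isom: assumes "is_isom C f" "f \<in> Hom C X Y" shows "is_isom C (amap F f)"
proof -
  obtain g where g: "g \<in> Hom C Y X" "g \<cdot> f = Ident C X" "f \<cdot> g = Ident C Y"
    using is_isomE[OF assms] by metis
  have o: "X \<in> Obj C" "Y \<in> Obj C" using assms hom_objs by blast+
  show ?thesis
    using F_hom[OF assms(2)] F_hom[OF g(1)] F_comp[of f g] F_comp[of g f] g assms o
    by (intro is_isomI[of _ "omap F X" "omap F Y" "amap F g"]) (auto simp: Hom_iff simp del: F_comp)
qed

lemma tri_morph_iff:
  assumes "f \<in> Hom C X Y" "g \<in> Hom C Y Z" "h \<in> Hom C Z W"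
    "f' \<in> Hom C X' Y'" "g' \<in> Hom C Y' Z'" "h' \<in> Hom C Z' W'"
  shows "is_tri_morph C F (f, g, h) (f', g', h') x y z \<longleftrightarrow>
    x \<in> Hom C X X' \<and> y \<in> Hom C Y Y' \<and> z \<in> Hom C Z Z' \<and>
    y \<cdot> f = f' \<cdot> x \<and> z \<cdot> g = g' \<cdot> y \<and> amap F x \<cdot> h = h' \<cdot> z"
  using assms by (simp add: is_tri_morph_def Hom_iff)

text \<open>The two composites with \<open>x\<close> and \<open>y\<close> are recorded because
  \<open>DT_fill\<close> conjugates a morphism by isomorphisms of triangles and has to recognise the
  given first two components afterwards.\<close>

lemma tri_morph_inverse:
  assumes "is_triangle C F t" "is_triangle C F t'" "is_tri_morph C F t t' x y z"
    "is_isom C x" "is_isom C y" "is_isom C z"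
  obtains x' y' z' where "is_tri_morph C F t' t x' y' z'" "is_isom C x'" "is_isom C y'" "is_isom C z'"
    "x' \<cdot> x = Ident C (Dom C x)" "y' \<cdot> y = Ident C (Dom C y)"
proof -
  obtain f g h X Y Z where t: "t = (f, g, h)" "f \<in> Hom C X Y" "g \<in> Hom C Y Z" "h \<in> Hom C Z (omap F X)"
    using assms(1) unfolding is_triangle_def by (cases t) auto
  obtain f' g' h' X' Y' Z' where t': "t' = (f', g', h')" "f' \<in> Hom C X' Y'" "g' \<in> Hom C Y' Z'" "h' \<in> Hom C Z' (omap F X')"
    using assms(2) unfolding is_triangle_def by (cases t') auto
  note m = assms(3-6)
  have xyz: "x \<in> Hom C X X'" "y \<in> Hom C Y Y'" "z \<in> Hom C Z Z'" "y \<cdot> f = f' \<cdot> x"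
    "z \<cdot> g = g' \<cdot> y" "amap F x \<cdot> h = h' \<cdot> z"
    using m(1) unfolding t(1) t'(1) tri_morph_iff[OF t(2-4) t'(2-4)] by auto
  obtain x' where x': "x' \<in> Hom C X' X" "x' \<cdot> x = Ident C X" "x \<cdot> x' = Ident C X'" "is_isom C x'"
    using is_isomE[OF m(2) xyz(1)] by metis
  obtain y' where y': "y' \<in> Hom C Y' Y" "y' \<cdot> y = Ident C Y" "y \<cdot> y' = Ident C Y'" "is_isom C y'"
    using is_isomE[OF m(3) xyz(2)] by metis
  obtain z' where z': "z' \<in> Hom C Z' Z" "z' \<cdot> z = Ident C Z" "z \<cdot> z' = Ident C Z'" "is_isom C z'"
    using is_isomE[OF m(4) xyz(3)] by metis
  have sq: "q' \<cdot> k' = k \<cdot> p'"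
    if "p \<in> Hom C A A'" "p' \<in> Hom C A' A" "p \<cdot> p' = Ident C A'" "q \<in> Hom C B B'" "q' \<in> Hom C B' B"
      "q' \<cdot> q = Ident C B" "k \<in> Hom C A B" "k' \<in> Hom C A' B'" "q \<cdot> k = k' \<cdot> p"
    for p p' q q' k k' A A' B B'
  proof -
    have "q' \<cdot> k' = q' \<cdot> (k' \<cdot> (p \<cdot> p'))" using that(1-8) by (simp add: Hom_iff)
    also have "\<dots> = q' \<cdot> ((k' \<cdot> p) \<cdot> p')" using that(1-8) by (simp add: Hom_iff)
    also have "\<dots> = q' \<cdot> ((q \<cdot> k) \<cdot> p')" unfolding that(9) ..
    also have "\<dots> = k \<cdot> p'"
      using that(1-8) comp_cancel_left[OF that(6) that(4) that(5), of "k \<cdot> p'"] by (simp add: Hom_iff)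
    finally show ?thesis .
  qed
  have Fx: "amap F x \<cdot> amap F x' = Ident C (omap F X')" "amap F x' \<cdot> amap F x = Ident C (omap F X)"
    using F_comp[of x' x] F_comp[of x x'] x' xyz(1) hom_objs[OF x'(1)] by (auto simp: Hom_iff simp del: F_comp)
  have "is_tri_morph C F t' t x' y' z'"
    unfolding t(1) t'(1) tri_morph_iff[OF t'(2-4) t(2-4)]
    using x' y' z' sq[OF xyz(1) x'(1,3) xyz(2) y'(1,2) t(2) t'(2) xyz(4)]
      sq[OF xyz(2) y'(1,3) xyz(3) z'(1,2) t(3) t'(3) xyz(5)]
      sq[OF xyz(3) z'(1,3) F_hom[OF xyz(1)] F_hom[OF x'(1)] Fx(2) t(4) t'(4) xyz(6)] by simp
  moreover have "x' \<cdot> x = Ident C (Dom C x)" "y' \<cdot> y = Ident C (Dom C y)"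
    using x' y' xyz by (auto simp: Hom_iff)
  ultimately show thesis using that x' y' z' by blast
qed

lemma tri_iso_sym:
  "is_triangle C F t \<Longrightarrow> is_triangle C F t' \<Longrightarrow> tri_isomorphic C F t t' \<Longrightarrow> tri_isomorphic C F t' t"
  unfolding tri_isomorphic_def by (metis tri_morph_inverse)

lemma tri_morph_comp:
  assumes "is_triangle C F t" "is_triangle C F t'" "is_triangle C F t''"
    "is_tri_morph C F t t' x y z" "is_tri_morph C F t' t'' x' y' z'"
  shows "is_tri_morph C F t t'' (x' \<cdot> x) (y' \<cdot> y) (z' \<cdot> z)"
proof -
  obtain f g h X Y Z where t: "t = (f, g, h)" "f \<in> Hom C X Y" "g \<in> Hom C Y Z" "h \<in> Hom C Z (omap F X)"
    using assms(1) unfolding is_triangle_def by (cases t) auto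
  obtain f' g' h' X' Y' Z' where t': "t' = (f', g', h')" "f' \<in> Hom C X' Y'" "g' \<in> Hom C Y' Z'" "h' \<in> Hom C Z' (omap F X')"
    using assms(2) unfolding is_triangle_def by (cases t') auto
  obtain f'' g'' h'' X'' Y'' Z'' where t'': "t'' = (f'', g'', h'')" "f'' \<in> Hom C X'' Y''" "g'' \<in> Hom C Y'' Z''" "h'' \<in> Hom C Z'' (omap F X'')"
    using assms(3) unfolding is_triangle_def by (cases t'') auto
  note m = assms(4,5)
  have xyz: "x \<in> Hom C X X'" "y \<in> Hom C Y Y'" "z \<in> Hom C Z Z'" "y \<cdot> f = f' \<cdot> x"
    "z \<cdot> g = g' \<cdot> y" "amap F x \<cdot> h = h' \<cdot> z"
    using m(1) unfolding t(1) t'(1) tri_morph_iff[OF t(2-4) t'(2-4)] by auto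
  have xyz': "x' \<in> Hom C X' X''" "y' \<in> Hom C Y' Y''" "z' \<in> Hom C Z' Z''" "y' \<cdot> f' = f'' \<cdot> x'"
    "z' \<cdot> g' = g'' \<cdot> y'" "amap F x' \<cdot> h' = h'' \<cdot> z'"
    using m(2) unfolding t'(1) t''(1) tri_morph_iff[OF t'(2-4) t''(2-4)] by auto
  have sq: "(q' \<cdot> q) \<cdot> k = k'' \<cdot> (p' \<cdot> p)"
    if "p \<in> Hom C A A'" "p' \<in> Hom C A' A''" "q \<in> Hom C B B'" "q' \<in> Hom C B' B''"
      "k \<in> Hom C A B" "k' \<in> Hom C A' B'" "k'' \<in> Hom C A'' B''" "q \<cdot> k = k' \<cdot> p" "q' \<cdot> k' = k'' \<cdot> p'"
    for p p' q q' k k' k'' A A' A'' B B' B''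
  proof -
    have "(q' \<cdot> q) \<cdot> k = q' \<cdot> (q \<cdot> k)" using that(1-7) by (simp add: Hom_iff)
    also have "\<dots> = (q' \<cdot> k') \<cdot> p" unfolding that(8) using that(1-7) by (simp add: Hom_iff)
    also have "\<dots> = k'' \<cdot> (p' \<cdot> p)" unfolding that(9) using that(1-7) by (simp add: Hom_iff)
    finally show ?thesis .
  qed
  show ?thesis
    unfolding t(1) t''(1) tri_morph_iff[OF t(2-4) t''(2-4)]
    using xyz(1-3) xyz'(1-3) sq[OF xyz(1) xyz'(1) xyz(2) xyz'(2) t(2) t'(2) t''(2) xyz(4) xyz'(4)]
      sq[OF xyz(2) xyz'(2) xyz(3) xyz'(3) t(3) t'(3) t''(3) xyz(5) xyz'(5)]
      sq[OF xyz(3) xyz'(3) F_hom[OF xyz(1)] F_hom[OF xyz'(1)] t(4) t'(4) t''(4) xyz(6) xyz'(6)]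
    by (auto simp: Hom_iff)
qed

lemma tri_iso_trans:
  assumes "is_triangle C F t" "is_triangle C F t'" "is_triangle C F t''"
    "tri_isomorphic C F t t'" "tri_isomorphic C F t' t''"
  shows "tri_isomorphic C F t t''"
proof -
  obtain x y z where m: "is_tri_morph C F t t' x y z" "is_isom C x" "is_isom C y" "is_isom C z"
    using assms(4) unfolding tri_isomorphic_def by blast
  obtain x' y' z' where m': "is_tri_morph C F t' t'' x' y' z'" "is_isom C x'" "is_isom C y'" "is_isom C z'"
    using assms(5) unfolding tri_isomorphic_def by blast
  have "x \<in> Hom C (Dom C x) (Cod C x)" "x' \<in> Hom C (Cod C x) (Cod C x')"
    "y \<in> Hom C (Dom C y) (Cod C y)" "y' \<in> Hom C (Cod C y) (Cod C y')"
    "z \<in> Hom C (Dom C z) (Cod C z)" "z' \<in> Hom C (Cod C z) (Cod C z')"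
    using m(1) m'(1) unfolding is_tri_morph_def by (auto simp: Hom_iff split: prod.splits)
  then have "is_isom C (x' \<cdot> x)" "is_isom C (y' \<cdot> y)" "is_isom C (z' \<cdot> z)"
    using isom_comp m(2-4) m'(2-4) by blast+
  then show ?thesis unfolding tri_isomorphic_def using tri_morph_comp[OF assms(1-3) m(1) m'(1)] by blast
qed

lemma tri_iso_rotate:
  assumes "is_triangle C F (f, g, h)" "is_triangle C F (f', g', h')" "tri_isomorphic C F (f, g, h) (f', g', h')"
  shows "tri_isomorphic C F (g, h, Neg C (amap F f)) (g', h', Neg C (amap F f'))"
proof -
  obtain X Y Z where t: "f \<in> Hom C X Y" "g \<in> Hom C Y Z" "h \<in> Hom C Z (omap F X)"
    using assms(1) unfolding is_triangle_def by auto
  obtain X' Y' Z' where t': "f' \<in> Hom C X' Y'" "g' \<in> Hom C Y' Z'" "h' \<in> Hom C Z' (omap F X')"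
    using assms(2) unfolding is_triangle_def by auto
  obtain x y z where m: "is_tri_morph C F (f, g, h) (f', g', h') x y z" "is_isom C x" "is_isom C y" "is_isom C z"
    using assms(3) unfolding tri_isomorphic_def by blast
  have xyz: "x \<in> Hom C X X'" "y \<in> Hom C Y Y'" "z \<in> Hom C Z Z'" "y \<cdot> f = f' \<cdot> x"
    "z \<cdot> g = g' \<cdot> y" "amap F x \<cdot> h = h' \<cdot> z"
    using m(1) unfolding tri_morph_iff[OF t t'] by auto
  have n: "Neg C (amap F f) \<in> Hom C (omap F X) (omap F Y)" "Neg C (amap F f') \<in> Hom C (omap F X') (omap F Y')"
    using F_hom[OF t(1)] F_hom[OF t'(1)] by (auto simp: Hom_iff)
  have "amap F (y \<cdot> f) = amap F (f' \<cdot> x)" using xyz(4) by simp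
  then have "amap F y \<cdot> Neg C (amap F f) = Neg C (amap F f') \<cdot> amap F x"
    using xyz(1,2) t(1) t'(1) by (simp add: Hom_iff)
  then have "is_tri_morph C F (g, h, Neg C (amap F f)) (g', h', Neg C (amap F f')) y z (amap F x)"
    unfolding tri_morph_iff[OF t(2,3) n(1) t'(2,3) n(2)] using xyz F_hom by simp
  then show ?thesis unfolding tri_isomorphic_def using m F_isom[OF m(2) xyz(1)] by blast
qed

end

section \<open>Right triangulated categories with invertible shift\<close>

lemma (in addc) neg_eq_iff [simp]: "f \<in> Arr C \<Longrightarrow> g \<in> Arr C \<Longrightarrow> Neg C f = Neg C g \<longleftrightarrow> f = g"
  using neg_neg by metis

text \<open>
  Octahedra are only required for some choice of cones: any other choice is isomorphic to it, by
  the five lemma \<open>fill_isom\<close>, whose proof does not use \<open>octa0\<close>.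
\<close>

locale rtri = addftor C F for C :: "('o, 'a) addcat" (structure) and F +
  fixes D :: "'a triangle set"
  assumes sh_eq: "is_equivalence C C F"
    and dist_tri: "t \<in> D \<Longrightarrow> is_triangle C F t"
    and dist_iso: "t \<in> D \<Longrightarrow> is_triangle C F t' \<Longrightarrow> tri_isomorphic C F t t' \<Longrightarrow> t' \<in> D"
    and dist_ident0: "X \<in> Obj C \<Longrightarrow>
      \<exists>Z. is_zero_object C Z \<and> (Ident C X, Zero C X Z, Zero C Z (omap F X)) \<in> D"
    and dist_cone: "f \<in> Arr C \<Longrightarrow> \<exists>g h. (f, g, h) \<in> D"
    and rotate: "(f, g, h) \<in> D \<Longrightarrow> (g, h, Neg C (amap F f)) \<in> D"
    and fill: "(f, g, h) \<in> D \<Longrightarrow> (f', g', h') \<in> D \<Longrightarrow>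
      x \<in> Hom C (Dom C f) (Dom C f') \<Longrightarrow> y \<in> Hom C (Cod C f) (Cod C f') \<Longrightarrow>
      y \<cdot> f = f' \<cdot> x \<Longrightarrow> \<exists>z. is_tri_morph C F (f, g, h) (f', g', h') x y z"
    and octa0: "f \<in> Hom C X Y \<Longrightarrow> g \<in> Hom C Y Z \<Longrightarrow>
      \<exists>f' f'' g' g'' k' k''. (f, f', f'') \<in> D \<and> (g, g', g'') \<in> D \<and> (g \<cdot> f, k', k'') \<in> D \<and>
      (\<exists>u \<in> Hom C (Cod C f') (Cod C k'). \<exists>v \<in> Hom C (Cod C k') (Cod C g').
        (u, v, amap F f' \<cdot> g'') \<in> D \<and>
        u \<cdot> f' = k' \<cdot> g \<and> k'' \<cdot> u = f'' \<and>
        v \<cdot> k' = g' \<and> g'' \<cdot> v = amap F f \<cdot> k'')"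
begin

lemma F_faithful: "f \<in> Hom C X Y \<Longrightarrow> f' \<in> Hom C X Y \<Longrightarrow> amap F f = amap F f' \<Longrightarrow> f = f'"
  using equivalence_full_faithful(1)[OF sh_eq] by blast

lemma F_full:
  assumes "k \<in> Hom C (omap F X) (omap F Y)" "X \<in> Obj C" "Y \<in> Obj C"
  obtains f where "f \<in> Hom C X Y" "amap F f = k"
  using equivalence_full_faithful(2)[OF sh_eq] assms by blast

lemma F_surj:
  assumes "Y \<in> Obj C"
  obtains X e where "X \<in> Obj C" "e \<in> Hom C (omap F X) Y" "is_isom C e"
  using equivalence_full_faithful(3)[OF sh_eq] assms by blast

lemma F_reflects_isom:
  assumes "f \<in> Hom C X Y" "is_isom C (amap F f)"
  shows "is_isom C f"
proof -
  have o: "X \<in> Obj C" "Y \<in> Obj C" using assms hom_objs by blast+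
  obtain k where k: "k \<in> Hom C (omap F Y) (omap F X)" "k \<cdot> amap F f = Ident C (omap F X)"
    "amap F f \<cdot> k = Ident C (omap F Y)"
    using is_isomE[OF assms(2) F_hom[OF assms(1)]] by metis
  obtain g where g: "g \<in> Hom C Y X" "amap F g = k" using F_full[OF k(1) o(2,1)] by blast
  have "amap F (g \<cdot> f) = amap F (Ident C X)" "amap F (f \<cdot> g) = amap F (Ident C Y)"
    using g k assms(1) o by (simp_all add: Hom_iff)
  then have "g \<cdot> f = Ident C X" "f \<cdot> g = Ident C Y"
    using F_faithful[of "g \<cdot> f" X X] F_faithful[of "f \<cdot> g" Y Y] g assms(1) o comp_hom ident_hom by blast+
  then show ?thesis using is_isomI[OF assms(1) g(1)] by blast
qed

lemma distE:
  assumes "(f, g, h) \<in> D"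
  obtains X Y Z where "f \<in> Hom C X Y" "g \<in> Hom C Y Z" "h \<in> Hom C Z (omap F X)"
    "X \<in> Obj C" "Y \<in> Obj C" "Z \<in> Obj C"
  using dist_tri[OF assms] hom_objs unfolding is_triangle_def by auto

lemma dist_homs:
  assumes "(f, g, h) \<in> D" "f \<in> Hom C X Y" "g \<in> Hom C Y' Z"
  shows "g \<in> Hom C Y Z" "h \<in> Hom C Z (omap F X)" "X \<in> Obj C" "Y \<in> Obj C" "Z \<in> Obj C"
  using distE[OF assms(1)] assms(2,3) by (metis Hom_iff)+

lemma dist_arr:
  assumes "(f, g, h) \<in> D"
  shows "f \<in> Hom C (Dom C f) (Cod C f)" "g \<in> Hom C (Cod C f) (Cod C g)"
    "h \<in> Hom C (Cod C g) (omap F (Dom C f))"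
  using distE[OF assms] by (metis Hom_iff)+

lemma dist_isoI:
  assumes "(f, g, h) \<in> D" "f \<in> Hom C X Y" "g \<in> Hom C Y Z" "h \<in> Hom C Z (omap F X)"
    "f' \<in> Hom C X' Y'" "g' \<in> Hom C Y' Z'" "h' \<in> Hom C Z' (omap F X')"
    "x \<in> Hom C X X'" "y \<in> Hom C Y Y'" "z \<in> Hom C Z Z'"
    "is_isom C x" "is_isom C y" "is_isom C z"
    "y \<cdot> f = f' \<cdot> x" "z \<cdot> g = g' \<cdot> y" "amap F x \<cdot> h = h' \<cdot> z"
  shows "(f', g', h') \<in> D"
proof (rule dist_iso[OF assms(1)])
  show "is_triangle C F (f', g', h')" using assms(5-7) unfolding is_triangle_def by blast
  show "tri_isomorphic C F (f, g, h) (f', g', h')"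
    unfolding tri_isomorphic_def using tri_morph_iff[OF assms(2-7)] assms by blast
qed

text \<open>Each pair of sign changes is an isomorphism of triangles: minus the identity on the
  object shared by the two changed arrows, up to the shift for X.\<close>

lemma dist_signs:
  assumes "(f, g, h) \<in> D"
  shows "(Neg C f, Neg C g, h) \<in> D" "(Neg C f, g, Neg C h) \<in> D" "(f, Neg C g, Neg C h) \<in> D"
proof -
  obtain X Y Z where H: "f \<in> Hom C X Y" "g \<in> Hom C Y Z" "h \<in> Hom C Z (omap F X)"
    "X \<in> Obj C" "Y \<in> Obj C" "Z \<in> Obj C" by (rule distE[OF assms])
  have i: "is_isom C (Ident C X)" "is_isom C (Neg C (Ident C X))" if "X \<in> Obj C" for X
    using that isom_neg_ident by auto
  show "(Neg C f, Neg C g, h) \<in> D"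
    by (rule dist_isoI[OF assms H(1-3), where x = "Ident C X" and y = "Neg C (Ident C Y)" and z = "Ident C Z"])
      (use H i in \<open>auto simp: Hom_iff\<close>)
  show "(Neg C f, g, Neg C h) \<in> D"
    by (rule dist_isoI[OF assms H(1-3), where x = "Neg C (Ident C X)" and y = "Ident C Y" and z = "Ident C Z"])
      (use H i in \<open>auto simp: Hom_iff\<close>)
  show "(f, Neg C g, Neg C h) \<in> D"
    by (rule dist_isoI[OF assms H(1-3), where x = "Ident C X" and y = "Ident C Y" and z = "Neg C (Ident C Z)"])
      (use H i in \<open>auto simp: Hom_iff\<close>)
qed

lemma fillE:
  assumes "(f, g, h) \<in> D" "(f', g', h') \<in> D"
    "f \<in> Hom C X Y" "g \<in> Hom C Y Z" "f' \<in> Hom C X' Y'" "g' \<in> Hom C Y' Z'"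
    "x \<in> Hom C X X'" "y \<in> Hom C Y Y'" "y \<cdot> f = f' \<cdot> x"
  obtains z where "z \<in> Hom C Z Z'" "z \<cdot> g = g' \<cdot> y" "amap F x \<cdot> h = h' \<cdot> z"
proof -
  note H = dist_homs[OF assms(1,3,4)] dist_homs[OF assms(2,5,6)]
  have "x \<in> Hom C (Dom C f) (Dom C f')" "y \<in> Hom C (Cod C f) (Cod C f')"
    using assms by (auto simp: Hom_iff)
  from fill[OF assms(1,2) this assms(9)] show thesis
    using tri_morph_iff[OF assms(3,4) H(2) assms(5,6) H(7)] that by blast
qed

text \<open>Filling the rotated triangles produces an arrow between shifts, which descends because
  the shift is full; the remaining square descends because it is faithful. Only forward rotation is
  involved, so this is available before \<open>rotate_back\<close>.\<close>

lemma fill_backE: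
  assumes "(f, g, h) \<in> D" "(f', g', h') \<in> D"
    "f \<in> Hom C X Y" "g \<in> Hom C Y Z" "f' \<in> Hom C X' Y'" "g' \<in> Hom C Y' Z'"
    "y \<in> Hom C Y Y'" "z \<in> Hom C Z Z'" "z \<cdot> g = g' \<cdot> y"
  obtains x where "x \<in> Hom C X X'" "y \<cdot> f = f' \<cdot> x" "amap F x \<cdot> h = h' \<cdot> z"
proof -
  note H = dist_homs[OF assms(1,3,4)] dist_homs[OF assms(2,5,6)]
  obtain k where k: "k \<in> Hom C (omap F X) (omap F X')" "k \<cdot> h = h' \<cdot> z"
    "amap F y \<cdot> Neg C (amap F f) = Neg C (amap F f') \<cdot> k"
    using fillE[OF rotate[OF assms(1)] rotate[OF assms(2)] H(1,2) H(6,7) assms(7-9)] by blast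
  obtain x where x: "x \<in> Hom C X X'" "amap F x = k" using F_full[OF k(1)] H by blast
  have "amap F (y \<cdot> Neg C f) = amap F (Neg C f' \<cdot> x)"
    using k x assms H by (simp add: Hom_iff)
  then have "amap F (y \<cdot> f) = amap F (f' \<cdot> x)"
    using k(1) x assms H by (simp add: Hom_iff)
  then have "y \<cdot> f = f' \<cdot> x"
    using F_faithful[of "y \<cdot> f" X Y'] assms x comp_hom by blast
  then show thesis using that x k by blast
qed

section \<open>Exactness of arrows out of a triangle, the five lemma, backward rotation\<close>

lemma dist_zero:
  assumes "(f, g, h) \<in> D" "f \<in> Hom C X Y" "g \<in> Hom C Y Z"
  shows "g \<cdot> f = Zero C X Z"
proof -
  note H = dist_homs[OF assms]
  obtain O1 where O: "is_zero_object C O1" "(Ident C X, Zero C X O1, Zero C O1 (omap F X)) \<in> D"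
    using dist_ident0 H by blast
  have oO: "O1 \<in> Obj C" using O(1) unfolding is_zero_object_def by blast
  obtain z where z: "z \<in> Hom C O1 Z" "z \<cdot> Zero C X O1 = g \<cdot> f"
    using fillE[OF O(2) assms(1) ident_hom hom_zero assms(2,3) ident_hom assms(2)] H oO assms(2)
    by (auto simp: Hom_iff)
  then show ?thesis using H oO by (simp add: Hom_iff)
qed

lemma dist_zero2:
  assumes "(f, g, h) \<in> D" "f \<in> Hom C X Y" "g \<in> Hom C Y Z"
  shows "h \<cdot> g = Zero C Y (omap F X)" "amap F f \<cdot> h = Zero C Z (omap F Y)"
proof -
  note H = dist_homs[OF assms]
  show "h \<cdot> g = Zero C Y (omap F X)" using dist_zero[OF rotate[OF assms(1)] H(1,2)] .
  have "Neg C (amap F f) \<in> Hom C (omap F X) (omap F Y)" using assms H by (simp add: Hom_iff)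
  from dist_zero[OF rotate[OF rotate[OF assms(1)]] H(2) this]
  have "Neg C (Neg C (amap F f) \<cdot> h) = Neg C (Zero C Z (omap F Y))" by simp
  then show "amap F f \<cdot> h = Zero C Z (omap F Y)" using H assms by (simp add: Hom_iff)
qed

text \<open>One maps the triangle to a triangle whose first term is zero and whose second and third
  terms are W. Forward rotation yields such triangles only on shifts, as the twice rotated trivial
  triangle on V; hence W is first replaced by an isomorphic \<open>omap F V\<close>.\<close>

lemma extend:
  assumes "(f, g, h) \<in> D" "f \<in> Hom C X Y" "g \<in> Hom C Y Z" "k \<in> Hom C Y W" "k \<cdot> f = Zero C X W"
  obtains k' where "k' \<in> Hom C Z W" "k' \<cdot> g = k"
proof -
  note H = dist_homs[OF assms(1-3)]
  have oW: "W \<in> Obj C" using assms hom_objs by blast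
  obtain V e where V: "V \<in> Obj C" "e \<in> Hom C (omap F V) W" "is_isom C e" by (rule F_surj[OF oW])
  obtain e' where e': "e' \<in> Hom C W (omap F V)" "e \<cdot> e' = Ident C W" using is_isomE[OF V(3,2)] by metis
  obtain O1 where O: "is_zero_object C O1" "(Ident C V, Zero C V O1, Zero C O1 (omap F V)) \<in> D"
    using dist_ident0 V by blast
  have oO: "O1 \<in> Obj C" using O(1) unfolding is_zero_object_def by blast
  have R: "(Zero C O1 (omap F V), Neg C (amap F (Ident C V)), Neg C (amap F (Zero C V O1))) \<in> D"
    by (rule rotate[OF rotate[OF O(2)]])
  have "Zero C X O1 \<in> Hom C X O1" "e' \<cdot> k \<in> Hom C Y (omap F V)"
    "Zero C O1 (omap F V) \<in> Hom C O1 (omap F V)"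
    "Neg C (amap F (Ident C V)) \<in> Hom C (omap F V) (omap F V)"
    "(e' \<cdot> k) \<cdot> f = Zero C O1 (omap F V) \<cdot> Zero C X O1"
    using H oO oW V e' assms by (auto simp: Hom_iff)
  from fillE[OF assms(1) R assms(2,3) this(3,4,1,2,5)]
  obtain z where z: "z \<in> Hom C Z (omap F V)" "z \<cdot> g = Neg C (amap F (Ident C V)) \<cdot> (e' \<cdot> k)"
    by blast
  have "(e \<cdot> Neg C z) \<cdot> g = e \<cdot> Neg C (z \<cdot> g)" using z(1) V(1,2) H assms by (simp add: Hom_iff)
  also have "\<dots> = e \<cdot> (e' \<cdot> k)" unfolding z(2) using V(1,2) e'(1) assms by (simp add: Hom_iff)
  also have "\<dots> = k" using comp_cancel_left[OF e'(2,1) V(2)] assms(4) by (simp add: Hom_iff)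
  finally show thesis using that[of "e \<cdot> Neg C z"] z(1) V(2) by (auto simp: Hom_iff)
qed

lemma extend2:
  assumes "(f, g, h) \<in> D" "f \<in> Hom C X Y" "g \<in> Hom C Y Z" "k \<in> Hom C Z W" "k \<cdot> g = Zero C Y W"
  obtains k' where "k' \<in> Hom C (omap F X) W" "k' \<cdot> h = k"
proof -
  note H = dist_homs[OF assms(1-3)]
  show thesis using extend[OF rotate[OF assms(1)] H(1,2) assms(4,5)] that by blast
qed

lemma extend3:
  assumes "(f, g, h) \<in> D" "f \<in> Hom C X Y" "g \<in> Hom C Y Z"
    "k \<in> Hom C (omap F X) W" "k \<cdot> h = Zero C Z W"
  obtains k' where "k' \<in> Hom C (omap F Y) W" "k' \<cdot> amap F f = k"
proof -
  note H = dist_homs[OF assms(1-3)]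
  obtain k' where k': "k' \<in> Hom C (omap F Y) W" "k' \<cdot> Neg C (amap F f) = k"
    using extend2[OF rotate[OF assms(1)] H(1,2) assms(4,5)] by blast
  then have "Neg C k' \<cdot> amap F f = k" using assms by (simp add: Hom_iff)
  then show thesis using that[of "Neg C k'"] k' by (simp add: Hom_iff)
qed

text \<open>The five lemma, done with exactness of arrows out of a triangle alone: first a left
  inverse \<open>r\<close> of \<open>z\<close> is built, then \<open>z\<close> is shown to be
  cancellable on the right, which makes \<open>r\<close> a right inverse too.\<close>

lemma fill_isom:
  assumes d: "(f, g, h) \<in> D" "(f', g', h') \<in> D"
    and f: "f \<in> Hom C X Y" "g \<in> Hom C Y Z" "f' \<in> Hom C X' Y'" "g' \<in> Hom C Y' Z'"
    and x: "x \<in> Hom C X X'" "y \<in> Hom C Y Y'" "z \<in> Hom C Z Z'"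
    and e: "y \<cdot> f = f' \<cdot> x" "z \<cdot> g = g' \<cdot> y" "amap F x \<cdot> h = h' \<cdot> z"
    and i: "is_isom C x" "is_isom C y"
  shows "is_isom C z"
proof -
  note H = dist_homs[OF d(1) f(1,2)] dist_homs[OF d(2) f(3,4)]
  obtain x' where x': "x' \<in> Hom C X' X" "x' \<cdot> x = Ident C X" "x \<cdot> x' = Ident C X'"
    using is_isomE[OF i(1) x(1)] by metis
  obtain y' where y': "y' \<in> Hom C Y' Y" "y' \<cdot> y = Ident C Y" "y \<cdot> y' = Ident C Y'"
    using is_isomE[OF i(2) x(2)] by metis
  have Fx: "amap F x' \<cdot> amap F x = Ident C (omap F X)"
    using F_comp[of x x'] x'(1,2) x(1) H by (simp add: Hom_iff del: F_comp)
  have Fy: "amap F y' \<cdot> amap F y = Ident C (omap F Y)"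
    using F_comp[of y y'] y'(1,2) x(2) H by (simp add: Hom_iff del: F_comp)
  have fy: "y' \<cdot> f' = f \<cdot> x'"
  proof -
    have "y' \<cdot> f' = y' \<cdot> (f' \<cdot> (x \<cdot> x'))" using x' y' f by (simp add: Hom_iff)
    also have "\<dots> = y' \<cdot> ((y \<cdot> f) \<cdot> x')" unfolding e(1) using x(1) x'(1) y'(1) f by (simp add: Hom_iff)
    also have "\<dots> = f \<cdot> x'" using comp_cancel_left[OF y'(2) x(2) y'(1), of "f \<cdot> x'"] x(2) x'(1) y'(1) f
      by (simp add: Hom_iff)
    finally show ?thesis .
  qed
  have hx: "h = amap F x' \<cdot> (h' \<cdot> z)"
    using comp_cancel_left[OF Fx F_hom[OF x(1)] F_hom[OF x'(1)], of h] H e(3) by (simp add: Hom_iff)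
  obtain r where r: "r \<in> Hom C Z' Z" "r \<cdot> z = Ident C Z"
  proof -
    have k0: "g \<cdot> y' \<in> Hom C Y' Z" using y' f comp_hom by blast
    have "(g \<cdot> y') \<cdot> f' = g \<cdot> (f \<cdot> x')"
      using fy y'(1) f by (simp add: Hom_iff)
    also have "\<dots> = (g \<cdot> f) \<cdot> x'" using x'(1) f by (simp add: Hom_iff)
    also have "\<dots> = Zero C X' Z" unfolding dist_zero[OF d(1) f(1,2)] using x'(1) H by (simp add: Hom_iff)
    finally obtain k1 where k1: "k1 \<in> Hom C Z' Z" "k1 \<cdot> g' = g \<cdot> y'"
      using extend[OF d(2) f(3,4) k0] by blast
    have "k1 \<cdot> (z \<cdot> g) = (k1 \<cdot> g') \<cdot> y" unfolding e(2) using k1(1) f x by (simp add: Hom_iff)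
    also have "\<dots> = g" unfolding k1(2) using y' f x by (simp add: Hom_iff)
    finally have "(Ident C Z \<oplus> Neg C (k1 \<cdot> z)) \<cdot> g = Zero C Y Z"
      using H k1(1) x(3) f(2) by (simp add: Hom_iff)
    moreover have "Ident C Z \<oplus> Neg C (k1 \<cdot> z) \<in> Hom C Z Z" using H k1(1) x(3) by (simp add: Hom_iff)
    ultimately obtain l where l: "l \<in> Hom C (omap F X) Z" "l \<cdot> h = Ident C Z \<oplus> Neg C (k1 \<cdot> z)"
      using extend2[OF d(1) f(1,2)] by blast
    \<comment> \<open>\<open>k1\<close> inverts \<open>z\<close> up to the error
      \<open>l \<cdot> h\<close>. By \<open>hx\<close> the arrow \<open>h\<close> factors through
      \<open>z\<close>, so the error can be absorbed in a second summand.\<close>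
    define r where "r = k1 \<oplus> l \<cdot> (amap F x' \<cdot> h')"
    have rH: "r \<in> Hom C Z' Z" unfolding r_def using k1(1) l(1) F_hom[OF x'(1)] H by (simp add: Hom_iff)
    have "r \<cdot> z = k1 \<cdot> z \<oplus> l \<cdot> (amap F x' \<cdot> (h' \<cdot> z))"
      unfolding r_def using k1(1) l(1) F_hom[OF x'(1)] H x(3) by (simp add: Hom_iff)
    also have "\<dots> = k1 \<cdot> z \<oplus> (Ident C Z \<oplus> Neg C (k1 \<cdot> z))" using hx l(2) by simp
    also have "\<dots> = Ident C Z \<oplus> (k1 \<cdot> z \<oplus> Neg C (k1 \<cdot> z))"
      by (rule add_left_commute) (use k1(1) x(3) H in \<open>auto simp: Hom_iff\<close>)
    also have "\<dots> = Ident C Z" using k1(1) x(3) H by (simp add: Hom_iff)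
    finally show thesis using that rH by blast
  qed
  \<comment> \<open>An arrow \<open>k\<close> killed by \<open>z\<close> is killed by
    \<open>g'\<close>, hence comes from some \<open>l\<close> on the shift of X'. The vanishing of
    \<open>k \<cdot> z\<close> pushes \<open>l\<close> one step further, through
    \<open>amap F f'\<close>, which is zero after \<open>h'\<close>.\<close>
  have mono: "k = Zero C Z' W" if k: "k \<in> Hom C Z' W" "k \<cdot> z = Zero C Z W" for k W
  proof -
    have oW: "W \<in> Obj C" using k hom_objs by blast
    have "(k \<cdot> g') \<cdot> y = k \<cdot> (z \<cdot> g)" unfolding e(2) using k(1) f x by (simp add: Hom_iff)
    also have "\<dots> = (k \<cdot> z) \<cdot> g" using k(1) f x by (simp add: Hom_iff)
    also have "\<dots> = Zero C Y' W \<cdot> y" unfolding k(2) using f x oW H by (simp add: Hom_iff)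
    finally have "k \<cdot> g' = Zero C Y' W"
      using isom_epi[OF i(2) x(2)] k(1) f comp_hom hom_zero H oW by metis
    then obtain l where l: "l \<in> Hom C (omap F X') W" "l \<cdot> h' = k"
      using extend2[OF d(2) f(3,4) k(1)] by blast
    have "(l \<cdot> amap F x) \<cdot> h = l \<cdot> (h' \<cdot> z)" unfolding e(3)[symmetric] using l(1) F_hom[OF x(1)] H by (simp add: Hom_iff)
    also have "\<dots> = k \<cdot> z" unfolding l(2)[symmetric] using l(1) H x by (simp add: Hom_iff)
    finally have "(l \<cdot> amap F x) \<cdot> h = Zero C Z W" using k by simp
    then obtain m where m: "m \<in> Hom C (omap F Y) W" "m \<cdot> amap F f = l \<cdot> amap F x"
      using extend3[OF d(1) f(1,2)] comp_hom[OF F_hom[OF x(1)] l(1)] by blast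
    have Ffy: "amap F f \<cdot> amap F x' = amap F y' \<cdot> amap F f'"
      using arg_cong[OF fy, of "amap F"] f x' y' by (simp add: Hom_iff)
    have "amap F x \<cdot> amap F x' = Ident C (omap F X')"
      using F_comp[of x' x] x'(1,3) x(1) H by (simp add: Hom_iff del: F_comp)
    then have "l = (l \<cdot> amap F x) \<cdot> amap F x'"
      using l(1) x'(1) x(1) by (simp add: Hom_iff)
    also have "\<dots> = m \<cdot> (amap F y' \<cdot> amap F f')"
      unfolding m(2)[symmetric] Ffy[symmetric] using m(1) f x'(1) by (simp add: Hom_iff)
    finally have "k = m \<cdot> (amap F y' \<cdot> (amap F f' \<cdot> h'))"
      using l(2) m(1) f y'(1) H by (simp add: Hom_iff)
    also have "\<dots> = Zero C Z' W"
      unfolding dist_zero2(2)[OF d(2) f(3,4)] using m(1) y'(1) H oW by (simp add: Hom_iff)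
    finally show ?thesis .
  qed
  have "(Ident C Z' \<oplus> Neg C (z \<cdot> r)) \<cdot> z = Zero C Z Z'" using r x H by (simp add: Hom_iff)
  moreover have "Ident C Z' \<oplus> Neg C (z \<cdot> r) \<in> Hom C Z' Z'" using r x H by (simp add: Hom_iff)
  ultimately have "Ident C Z' \<oplus> Neg C (z \<cdot> r) = Zero C Z' Z'" using mono by blast
  then have "Ident C Z' = z \<cdot> r"
    using sub_zero[of "Ident C Z'" Z' Z' "z \<cdot> r"] r(1) x(3) H by (simp add: Hom_iff)
  then show ?thesis using is_isomI[OF x(3) r(1)] r(2) by simp
qed

lemma rotate3:
  assumes "(f, g, h) \<in> D"
  shows "(Neg C (amap F f), Neg C (amap F g), Neg C (amap F h)) \<in> D"
  using rotate[OF rotate[OF rotate[OF assms]]] .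

text \<open>Complete \<open>f\<close> to a triangle in some way. Its threefold rotation and the
  twofold rotation of the given triangle both begin with \<open>Neg C (amap F f)\<close>, so the
  five lemma compares them, and the comparison descends along the shift.\<close>

lemma rotate_back:
  assumes "f \<in> Hom C X Y" "g \<in> Hom C Y Z" "h \<in> Hom C Z (omap F X)"
    and d: "(g, h, Neg C (amap F f)) \<in> D"
  shows "(f, g, h) \<in> D"
proof -
  have "f \<in> Arr C" using assms(1) by (simp add: Hom_iff)
  then obtain g' h' where d': "(f, g', h') \<in> D" using dist_cone by blast
  obtain Z' where g': "g' \<in> Hom C Y Z'" using dist_arr(2)[OF d'] assms(1) by (auto simp: Hom_iff)
  note H = dist_homs[OF d' assms(1) g'] assms(1-3)
  have o: "Z \<in> Obj C" using assms hom_objs by blast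
  have R: "(Neg C (amap F f), Neg C (amap F g'), Neg C (amap F h')) \<in> D"
    "(Neg C (amap F f), Neg C (amap F g), Neg C (amap F h)) \<in> D"
    using rotate3[OF d'] rotate[OF rotate[OF d]] .
  have Hs: "Neg C (amap F f) \<in> Hom C (omap F X) (omap F Y)"
    "Neg C (amap F g) \<in> Hom C (omap F Y) (omap F Z)" "Neg C (amap F g') \<in> Hom C (omap F Y) (omap F Z')"
    "Ident C (omap F X) \<in> Hom C (omap F X) (omap F X)" "Ident C (omap F Y) \<in> Hom C (omap F Y) (omap F Y)"
    "Ident C (omap F Y) \<cdot> Neg C (amap F f) = Neg C (amap F f) \<cdot> Ident C (omap F X)"
    using H by (auto simp: Hom_iff)
  obtain k where k: "k \<in> Hom C (omap F Z') (omap F Z)"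
    "k \<cdot> Neg C (amap F g') = Neg C (amap F g) \<cdot> Ident C (omap F Y)"
    "amap F (Ident C (omap F X)) \<cdot> Neg C (amap F h') = Neg C (amap F h) \<cdot> k"
    using fillE[OF R Hs(1,3,1,2,4,5,6)] by blast
  have "is_isom C k"
    by (rule fill_isom[OF R Hs(1,3,1,2,4,5) k(1) Hs(6) k(2,3)]) (use H in auto)
  obtain z where z: "z \<in> Hom C Z' Z" "amap F z = k" using F_full[OF k(1)] H o by blast
  have iz: "is_isom C z" using F_reflects_isom z \<open>is_isom C k\<close> by simp
  have "Neg C (amap F (z \<cdot> g')) = Neg C (amap F g)" "Neg C (amap F h') = Neg C (amap F (h \<cdot> z))"
    using k z H o by (auto simp: Hom_iff)
  then have "amap F (z \<cdot> g') = amap F g" "amap F h' = amap F (h \<cdot> z)"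
    using z(1) H by (auto simp: Hom_iff)
  then have e: "z \<cdot> g' = g" "h' = h \<cdot> z"
    using F_faithful[of "z \<cdot> g'" Y Z g] F_faithful[of h' Z' "omap F X" "h \<cdot> z"] z(1) H comp_hom by blast+
  show ?thesis
    by (rule dist_isoI[OF d' H(6) H(1,2) H(6-8), where x = "Ident C X" and y = "Ident C Y" and z = z])
      (use H iz z(1) e in \<open>auto simp: Hom_iff\<close>)
qed

lemma cone_unique:
  assumes "(f, g, h) \<in> D" "(f, g', h') \<in> D"
  obtains z where "z \<in> Hom C (Cod C g) (Cod C g')" "is_isom C z" "z \<cdot> g = g'" "h' \<cdot> z = h"
proof -
  obtain X Y Z where H: "f \<in> Hom C X Y" "g \<in> Hom C Y Z" "h \<in> Hom C Z (omap F X)"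
    "X \<in> Obj C" "Y \<in> Obj C" "Z \<in> Obj C" by (rule distE[OF assms(1)])
  obtain Z' where g': "g' \<in> Hom C Y Z'" using dist_arr(2)[OF assms(2)] H(1) by (auto simp: Hom_iff)
  note H' = dist_homs[OF assms(2) H(1) g']
  have i: "Ident C X \<in> Hom C X X" "Ident C Y \<in> Hom C Y Y" "Ident C Y \<cdot> f = f \<cdot> Ident C X"
    using H by (auto simp: Hom_iff)
  obtain z where z: "z \<in> Hom C Z Z'" "z \<cdot> g = g' \<cdot> Ident C Y" "amap F (Ident C X) \<cdot> h = h' \<cdot> z"
    using fillE[OF assms H(1,2) H(1) g' i] by blast
  have "is_isom C z" by (rule fill_isom[OF assms H(1,2,1) g' i(1,2) z(1) i(3) z(2,3)]) (use H in auto)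
  moreover have "z \<cdot> g = g'" "h' \<cdot> z = h" using z H H' g' by (auto simp: Hom_iff)
  ultimately show thesis using that z(1) H g' by (simp add: Hom_iff)
qed

lemma octa:
  assumes fg: "f \<in> Hom C X Y" "g \<in> Hom C Y Z"
    and d: "(f, f', f'') \<in> D" "(g, g', g'') \<in> D" "(g \<cdot> f, k', k'') \<in> D"
  shows "\<exists>u \<in> Hom C (Cod C f') (Cod C k'). \<exists>v \<in> Hom C (Cod C k') (Cod C g').
        (u, v, amap F f' \<cdot> g'') \<in> D \<and>
        u \<cdot> f' = k' \<cdot> g \<and> k'' \<cdot> u = f'' \<and>
        v \<cdot> k' = g' \<and> g'' \<cdot> v = amap F f \<cdot> k''"
proof -
  have gf: "g \<cdot> f \<in> Hom C X Z" using fg comp_hom by blast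
  obtain f1 f2 g1 g2 k1 k2 u v where e: "(f, f1, f2) \<in> D" "(g, g1, g2) \<in> D" "(g \<cdot> f, k1, k2) \<in> D"
    "u \<in> Hom C (Cod C f1) (Cod C k1)" "v \<in> Hom C (Cod C k1) (Cod C g1)" "(u, v, amap F f1 \<cdot> g2) \<in> D"
    "u \<cdot> f1 = k1 \<cdot> g" "k2 \<cdot> u = f2" "v \<cdot> k1 = g1" "g2 \<cdot> v = amap F f \<cdot> k2"
    using octa0[OF fg] by blast
  obtain a where a: "a \<in> Hom C (Cod C f1) (Cod C f')" "is_isom C a" "a \<cdot> f1 = f'" "f'' \<cdot> a = f2"
    by (rule cone_unique[OF e(1) d(1)])
  obtain b where b: "b \<in> Hom C (Cod C g1) (Cod C g')" "is_isom C b" "b \<cdot> g1 = g'" "g'' \<cdot> b = g2"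
    by (rule cone_unique[OF e(2) d(2)])
  obtain c where c: "c \<in> Hom C (Cod C k1) (Cod C k')" "is_isom C c" "c \<cdot> k1 = k'" "k'' \<cdot> c = k2"
    by (rule cone_unique[OF e(3) d(3)])
  obtain a' where a': "a' \<in> Hom C (Cod C f') (Cod C f1)" "a' \<cdot> a = Ident C (Cod C f1)"
    "a \<cdot> a' = Ident C (Cod C f')" using is_isomE[OF a(2,1)] by metis
  obtain c' where c': "c' \<in> Hom C (Cod C k') (Cod C k1)" "c' \<cdot> c = Ident C (Cod C k1)"
    "c \<cdot> c' = Ident C (Cod C k')" using is_isomE[OF c(2,1)] by metis
  have H: "f1 \<in> Hom C Y (Cod C f1)" "f2 \<in> Hom C (Cod C f1) (omap F X)"
    "g1 \<in> Hom C Z (Cod C g1)" "g2 \<in> Hom C (Cod C g1) (omap F Y)"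
    "k1 \<in> Hom C Z (Cod C k1)" "k2 \<in> Hom C (Cod C k1) (omap F X)"
    "f' \<in> Hom C Y (Cod C f')" "f'' \<in> Hom C (Cod C f') (omap F X)"
    "g' \<in> Hom C Z (Cod C g')" "g'' \<in> Hom C (Cod C g') (omap F Y)"
    "k' \<in> Hom C Z (Cod C k')" "k'' \<in> Hom C (Cod C k') (omap F X)"
    using dist_arr[OF e(1)] dist_arr[OF e(2)] dist_arr[OF e(3)]
      dist_arr[OF d(1)] dist_arr[OF d(2)] dist_arr[OF d(3)] fg gf
    by (auto simp: Hom_iff)
  define u' where "u' = c \<cdot> (u \<cdot> a')"
  define v' where "v' = b \<cdot> (v \<cdot> c')"
  have uH: "u' \<in> Hom C (Cod C f') (Cod C k')" "v' \<in> Hom C (Cod C k') (Cod C g')"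
    unfolding u'_def v'_def using a'(1) c'(1) b(1) c(1) e(4,5) comp_hom by blast+
  have ua: "u' \<cdot> a = c \<cdot> u"
    unfolding u'_def using a(1) a'(1,2) c(1) e(4) by (simp add: Hom_iff)
  have vc: "v' \<cdot> c = b \<cdot> v"
    unfolding v'_def using c(1) c'(1,2) b(1) e(5) by (simp add: Hom_iff)
  have Fa: "amap F a \<cdot> amap F f1 = amap F f'"
    using F_comp[of f1 a] a(1,3) H(1) by (simp add: Hom_iff del: F_comp)
  have 1: "(u', v', amap F f' \<cdot> g'') \<in> D"
  proof (rule dist_isoI[OF e(6,4,5) _ uH(1,2) _ a(1) c(1) b(1) a(2) c(2) b(2)])
    show "amap F f1 \<cdot> g2 \<in> Hom C (Cod C g1) (omap F (Cod C f1))"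
      using H F_hom[OF H(1)] comp_hom by blast
    show "amap F f' \<cdot> g'' \<in> Hom C (Cod C g') (omap F (Cod C f'))"
      using H F_hom[OF H(7)] comp_hom by blast
    show "c \<cdot> u = u' \<cdot> a" "b \<cdot> v = v' \<cdot> c" using ua vc by simp_all
    have "amap F a \<cdot> (amap F f1 \<cdot> g2) = (amap F a \<cdot> amap F f1) \<cdot> g2"
      using F_hom[OF a(1)] F_hom[OF H(1)] H(4) by (simp add: Hom_iff)
    also have "\<dots> = (amap F f' \<cdot> g'') \<cdot> b"
      unfolding Fa b(4)[symmetric] using F_hom[OF H(7)] H(10) b(1) by (simp add: Hom_iff)
    finally show "amap F a \<cdot> (amap F f1 \<cdot> g2) = (amap F f' \<cdot> g'') \<cdot> b" .
  qed
  have 2: "u' \<cdot> f' = k' \<cdot> g"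
  proof -
    have "u' \<cdot> f' = (u' \<cdot> a) \<cdot> f1" unfolding a(3)[symmetric] using uH a(1) H(1) by (simp add: Hom_iff)
    also have "\<dots> = c \<cdot> (u \<cdot> f1)" unfolding ua using c(1) e(4) H(1) by (simp add: Hom_iff)
    also have "\<dots> = k' \<cdot> g" unfolding e(7) c(3)[symmetric] using c(1) H(5) fg by (simp add: Hom_iff)
    finally show ?thesis .
  qed
  have 3: "k'' \<cdot> u' = f''"
  proof (rule isom_epi[OF a(2,1)])
    have "(k'' \<cdot> u') \<cdot> a = (k'' \<cdot> c) \<cdot> u" using ua H(12) uH a(1) c(1) e(4) by (simp add: Hom_iff)
    also have "\<dots> = f'' \<cdot> a" unfolding c(4) e(8) a(4) ..
    finally show "(k'' \<cdot> u') \<cdot> a = f'' \<cdot> a" .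
  qed (use comp_hom[OF uH(1) H(12)] H(8) in auto)
  have 4: "v' \<cdot> k' = g'"
  proof -
    have "v' \<cdot> k' = (v' \<cdot> c) \<cdot> k1" unfolding c(3)[symmetric] using uH c(1) H(5) by (simp add: Hom_iff)
    also have "\<dots> = b \<cdot> (v \<cdot> k1)" unfolding vc using b(1) e(5) H(5) by (simp add: Hom_iff)
    also have "\<dots> = g'" unfolding e(9) b(3) ..
    finally show ?thesis .
  qed
  have 5: "g'' \<cdot> v' = amap F f \<cdot> k''"
  proof (rule isom_epi[OF c(2,1)])
    have "(g'' \<cdot> v') \<cdot> c = (g'' \<cdot> b) \<cdot> v" using vc H(10) uH b(1) c(1) e(5) by (simp add: Hom_iff)
    also have "\<dots> = (amap F f \<cdot> k'') \<cdot> c"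
      unfolding b(4) e(10) c(4)[symmetric] using F_hom[OF fg(1)] H(12) c(1) by (simp add: Hom_iff)
    finally show "(g'' \<cdot> v') \<cdot> c = (amap F f \<cdot> k'') \<cdot> c" .
  qed (use comp_hom[OF uH(2) H(10)] comp_hom[OF H(12) F_hom[OF fg(1)]] in auto)
  show ?thesis using uH 1 2 3 4 5 by blast
qed

lemma dist_ident:
  assumes "X \<in> Obj C" "is_zero_object C Z"
  shows "(Ident C X, Zero C X Z, Zero C Z (omap F X)) \<in> D"
proof -
  obtain O1 where O: "is_zero_object C O1" "(Ident C X, Zero C X O1, Zero C O1 (omap F X)) \<in> D"
    using dist_ident0 assms by blast
  have o: "O1 \<in> Obj C" "Z \<in> Obj C" using O(1) assms(2) unfolding is_zero_object_def by blast+
  have i: "is_isom C (Zero C O1 Z)"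
    using o O(1) assms(2) by (intro is_isomI[of _ O1 Z "Zero C Z O1"]) (auto simp: hom_zero zero_object_iff)
  show ?thesis
    by (rule dist_isoI[OF O(2), where X = X and Y = X and Z = O1 and x = "Ident C X" and y = "Ident C X" and z = "Zero C O1 Z"
        and X' = X and Y' = X and Z' = Z])
      (use o i assms(1) in \<open>auto simp: Hom_iff\<close>)
qed

theorem triangulated: "triangulated_category C F D"
proof
  show "is_additive_functor C C F" by (rule sh_add)
  show "is_equivalence C C F" by (rule sh_eq)
  show "\<And>f g h. is_triangle C F (f, g, h) \<Longrightarrow> (f, g, h) \<in> D \<longleftrightarrow> (g, h, Neg C (amap F f)) \<in> D"
    using rotate rotate_back unfolding is_triangle_def by auto
qed (fact dist_tri dist_iso dist_ident dist_cone fill octa | assumption)+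

end

text \<open>C is made an instance of the locale that is also used for Z/I, so that the consequences
  of the axioms are proved once and used on both levels.\<close>

lemma triangulated_rtri:
  assumes "triangulated_category C F D"
  shows "rtri C F D"
proof -
  interpret T: triangulated_category C F D by (rule assms)
  interpret addc C by (rule addcI) (rule T.additive_category_axioms)
  show ?thesis
  proof
    show "is_additive_functor C C F" by (rule T.shift_additive)
    show "is_equivalence C C F" by (rule T.shift_equivalence)
    show "\<And>f g h. (f, g, h) \<in> D \<Longrightarrow> (g, h, Neg C (amap F f)) \<in> D"
      using T.TR2 T.dist_triangle by blast
    show "\<And>X. X \<in> Obj C \<Longrightarrow> \<exists>Z. is_zero_object C Z \<and> (Ident C X, Zero C X Z, Zero C Z (omap F X)) \<in> D"
      using T.TR1_ident T.zero_object by blast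
  next
    fix f g X Y Z assume a: "f \<in> Hom C X Y" "g \<in> Hom C Y Z"
    then have "f \<in> Arr C" "g \<in> Arr C" "g \<cdot>\<^bsub>C\<^esub> f \<in> Arr C" by (auto simp: Hom_iff)
    then obtain f' f'' g' g'' k' k'' where d: "(f, f', f'') \<in> D" "(g, g', g'') \<in> D" "(g \<cdot>\<^bsub>C\<^esub> f, k', k'') \<in> D"
      using T.TR1_cone by meson
    show "\<exists>f' f'' g' g'' k' k''. (f, f', f'') \<in> D \<and> (g, g', g'') \<in> D \<and> (g \<cdot>\<^bsub>C\<^esub> f, k', k'') \<in> D \<and>
      (\<exists>u \<in> Hom C (Cod C f') (Cod C k'). \<exists>v \<in> Hom C (Cod C k') (Cod C g').
        (u, v, amap F f' \<cdot>\<^bsub>C\<^esub> g'') \<in> D \<and>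
        u \<cdot>\<^bsub>C\<^esub> f' = k' \<cdot>\<^bsub>C\<^esub> g \<and> k'' \<cdot>\<^bsub>C\<^esub> u = f'' \<and>
        v \<cdot>\<^bsub>C\<^esub> k' = g' \<and> g'' \<cdot>\<^bsub>C\<^esub> v = amap F f \<cdot>\<^bsub>C\<^esub> k'')"
      using T.TR4[OF a d] d by blast
  qed (fact T.dist_triangle T.TR1_iso T.TR1_cone T.TR3 | assumption)+
qed

section \<open>Exactness, homotopy pushouts and cotorsion pairs\<close>

context rtri
begin

text \<open>Dual to \<open>extend\<close>, but without a detour over shifts: the trivial triangle
  starts at W itself, and \<open>fill_backE\<close> supplies the arrow between first terms.\<close>

lemma lift:
  assumes "(f, g, h) \<in> D" "f \<in> Hom C X Y" "g \<in> Hom C Y Z" "k \<in> Hom C W Y" "g \<cdot> k = Zero C W Z"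
  obtains k' where "k' \<in> Hom C W X" "f \<cdot> k' = k"
proof -
  note H = dist_homs[OF assms(1-3)]
  have oW: "W \<in> Obj C" using assms hom_objs by blast
  obtain O1 where O: "is_zero_object C O1" "(Ident C W, Zero C W O1, Zero C O1 (omap F W)) \<in> D"
    using dist_ident0 oW by blast
  have oO: "O1 \<in> Obj C" using O(1) unfolding is_zero_object_def by blast
  have e: "Zero C O1 Z \<cdot> Zero C W O1 = g \<cdot> k" using assms(5) oO oW H by simp
  obtain x where "x \<in> Hom C W X" "k \<cdot> Ident C W = f \<cdot> x"
    using fill_backE[OF O(2) assms(1) ident_hom[OF oW] hom_zero[OF oW oO] assms(2,3,4)
        hom_zero[OF oO H(5)] e] by blast
  then show thesis using that assms by (simp add: Hom_iff)
qed

lemma lift2: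
  assumes "(f, g, h) \<in> D" "f \<in> Hom C X Y" "g \<in> Hom C Y Z" "k \<in> Hom C W Z" "h \<cdot> k = Zero C W (omap F X)"
  obtains k' where "k' \<in> Hom C W Y" "g \<cdot> k' = k"
  using lift[OF rotate[OF assms(1)] dist_homs(1,2)[OF assms(1-3)] assms(4,5)] by blast

lemma lift3:
  assumes "(f, g, h) \<in> D" "f \<in> Hom C X Y" "g \<in> Hom C Y Z" "k \<in> Hom C W (omap F X)"
    "amap F f \<cdot> k = Zero C W (omap F Y)"
  obtains k' where "k' \<in> Hom C W Z" "h \<cdot> k' = k"
proof -
  note H = dist_homs[OF assms(1-3)]
  have oW: "W \<in> Obj C" using assms hom_objs by blast
  have "Neg C (amap F f) \<in> Hom C (omap F X) (omap F Y)" "Neg C (amap F f) \<cdot> k = Zero C W (omap F Y)"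
    using assms H oW by (auto simp: Hom_iff)
  from lift[OF rotate[OF rotate[OF assms(1)]] H(2) this(1) assms(4) this(2)] show thesis using that by blast
qed

text \<open>The exact sequence continued one step to the left: the obstruction to extending
  \<open>k\<close> over \<open>f\<close> is \<open>amap F k \<cdot> h\<close>. In the applications
  it usually lies in a vanishing Ext group.\<close>

lemma extend0:
  assumes "(f, g, h) \<in> D" "f \<in> Hom C X Y" "g \<in> Hom C Y Z"
    "k \<in> Hom C X W" "amap F k \<cdot> h = Zero C Z (omap F W)"
  obtains k' where "k' \<in> Hom C Y W" "k' \<cdot> f = k"
proof -
  note H = dist_homs[OF assms(1-3)]
  have oW: "W \<in> Obj C" using assms hom_objs by blast
  obtain l where l: "l \<in> Hom C (omap F Y) (omap F W)" "l \<cdot> amap F f = amap F k"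
    using extend3[OF assms(1-3) F_hom[OF assms(4)] assms(5)] by blast
  obtain k' where k': "k' \<in> Hom C Y W" "amap F k' = l" using F_full[OF l(1) H(4) oW] by blast
  have "k' \<cdot> f = k"
    using F_faithful[of "k' \<cdot> f" X W k] comp_hom[OF assms(2) k'(1)] assms(4) l k'
      F_comp[of f k'] assms(2) by (simp add: Hom_iff del: F_comp)
  then show thesis using that k' by blast
qed

section \<open>Shifting triangles, homotopy pushouts and pullbacks\<close>

lemma suspend:
  assumes "(f, g, h) \<in> D"
  shows "(amap F f, amap F g, Neg C (amap F h)) \<in> D"
  using dist_signs(1)[OF rotate3[OF assms]] dist_arr[OF assms] by (simp add: Hom_iff)

lemma desuspend:
  assumes "f \<in> Hom C X Y" "g \<in> Hom C Y Z" "h \<in> Hom C Z (omap F X)"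
    "(amap F f, amap F g, Neg C (amap F h)) \<in> D"
  shows "(f, g, h) \<in> D"
proof -
  have F: "amap F f \<in> Hom C (omap F X) (omap F Y)" "amap F g \<in> Hom C (omap F Y) (omap F Z)"
    using F_hom assms by blast+
  then have n: "Neg C (amap F f) \<in> Hom C (omap F X) (omap F Y)" "Neg C (amap F g) \<in> Hom C (omap F Y) (omap F Z)"
    by (auto simp: Hom_iff)
  show ?thesis
    by (rule rotate_back[OF assms(1-3) rotate_back[OF assms(2,3) n(1)
      rotate_back[OF assms(3) n dist_signs(1)[OF assms(4)]]]])
qed

lemma lift_shift:
  assumes "(f, g, h) \<in> D" "f \<in> Hom C X Y" "g \<in> Hom C Y Z"
    "k \<in> Hom C W (omap F Y)" "amap F g \<cdot> k = Zero C W (omap F Z)"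
  obtains k' where "k' \<in> Hom C W (omap F X)" "amap F f \<cdot> k' = k"
  using lift[OF suspend[OF assms(1)] F_hom[OF assms(2)] F_hom[OF assms(3)] assms(4,5)] by blast

text \<open>The cone R of \<open>b\<close> is replaced by an isomorphic shift, so that the two
  remaining arrows descend along the full shift; two sign changes and two backward rotations then
  bring \<open>b\<close> into third position.\<close>

lemma cocone:
  assumes "b \<in> Hom C Z (omap F X)" "X \<in> Obj C"
  obtains f g Y where "f \<in> Hom C X Y" "g \<in> Hom C Y Z" "(f, g, b) \<in> D"
proof -
  have oZ: "Z \<in> Obj C" using assms hom_objs by blast
  have "b \<in> Arr C" using assms by (simp add: Hom_iff)
  then obtain r s where d: "(b, r, s) \<in> D" using dist_cone by blast
  obtain R where r: "r \<in> Hom C (omap F X) R" using dist_arr(2)[OF d] assms(1) by (auto simp: Hom_iff)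
  note H = dist_homs[OF d assms(1) r]
  obtain Y e where Y: "Y \<in> Obj C" "e \<in> Hom C (omap F Y) R" "is_isom C e" by (rule F_surj[OF H(5)])
  obtain i where i: "i \<in> Hom C R (omap F Y)" "i \<cdot> e = Ident C (omap F Y)" "e \<cdot> i = Ident C R" "is_isom C i"
    using is_isomE[OF Y(3,2)] by metis
  obtain f where f: "f \<in> Hom C X Y" "amap F f = i \<cdot> r" using F_full[OF comp_hom[OF r i(1)] assms(2) Y(1)] by blast
  obtain g where g: "g \<in> Hom C Y Z" "amap F g = s \<cdot> e" using F_full[OF comp_hom[OF Y(2) H(2)] Y(1) oZ] by blast
  have "(b, amap F f, amap F g) \<in> D"
    by (rule dist_isoI[OF d assms(1) r H(2), where x = "Ident C Z" and y = "Ident C (omap F X)" and z = i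
        and X' = Z and Y' = "omap F X" and Z' = "omap F Y"])
      (use assms f g i Y oZ H r in \<open>auto simp: Hom_iff\<close>)
  then have "(b, Neg C (amap F f), Neg C (amap F g)) \<in> D" using dist_signs(3) by blast
  then have "(f, g, b) \<in> D"
    using rotate_back[OF f(1) g(1) assms(1)] rotate_back[OF g(1) assms(1), of "Neg C (amap F f)"] f g H r i
    by (simp add: Hom_iff)
  then show thesis using that f g by blast
qed

text \<open>The point is that \<open>e\<close> has the same cone as \<open>t\<close>. This is the
  octahedron of the composite \<open>amap F t \<cdot> b\<close>: its three cones are the shifts of
  Y, S and Y', and the resulting triangle is shifted back.\<close>

lemma pushout:
  assumes d: "(x, y, b) \<in> D" "(t, s, r) \<in> D" "(x', y', amap F t \<cdot> b) \<in> D"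
    and x: "x \<in> Hom C X Y" "y \<in> Hom C Y M" and t: "t \<in> Hom C X X'" "s \<in> Hom C X' S"
    and x': "x' \<in> Hom C X' Y'" "y' \<in> Hom C Y' M"
  obtains e k where "e \<in> Hom C Y Y'" "k \<in> Hom C Y' S" "(e, k, amap F x \<cdot> r) \<in> D"
    "e \<cdot> x = x' \<cdot> t" "y' \<cdot> e = y" "k \<cdot> x' = s" "r \<cdot> k = Neg C (b \<cdot> y')"
proof -
  note H = dist_homs[OF d(1) x] dist_homs[OF d(2) t] dist_homs[OF d(3) x']
  have d1: "(b, Neg C (amap F x), Neg C (amap F y)) \<in> D" by (rule rotate[OF rotate[OF d(1)]])
  have d2: "(amap F t, amap F s, Neg C (amap F r)) \<in> D" by (rule suspend[OF d(2)])
  have d3: "(amap F t \<cdot> b, Neg C (amap F x'), Neg C (amap F y')) \<in> D" by (rule rotate[OF rotate[OF d(3)]])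
  obtain u v where u: "u \<in> Hom C (omap F Y) (omap F Y')" and v: "v \<in> Hom C (omap F Y') (omap F S)"
    and D: "(u, v, amap F (Neg C (amap F x)) \<cdot> Neg C (amap F r)) \<in> D"
    and eqs: "u \<cdot> Neg C (amap F x) = Neg C (amap F x') \<cdot> amap F t"
      "Neg C (amap F y') \<cdot> u = Neg C (amap F y)" "v \<cdot> Neg C (amap F x') = amap F s"
      "Neg C (amap F r) \<cdot> v = amap F b \<cdot> Neg C (amap F y')"
    using octa[OF H(2) F_hom[OF t(1)] d1 d2 d3] x t x' by (auto simp: Hom_iff)
  obtain e where e: "e \<in> Hom C Y Y'" "amap F e = u" using F_full[OF u] H by blast
  obtain l where l: "l \<in> Hom C Y' S" "amap F l = v" using F_full[OF v] H by blast
  \<comment> \<open>The sign is dictated by \<open>k \<cdot> x' = s\<close>; the octahedron delivers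
    the opposite one since its cones carry minus signs.\<close>
  define k where "k = Neg C l"
  have k: "k \<in> Hom C Y' S" "amap F k = Neg C v" using l by (auto simp: k_def Hom_iff)
  have Fe: "amap F (e \<cdot> x) = amap F (x' \<cdot> t)" "amap F (y' \<cdot> e) = amap F y" "amap F (k \<cdot> x') = amap F s"
    "amap F (r \<cdot> k) = amap F (Neg C (b \<cdot> y'))"
    using eqs e k u v x t x' H by (auto simp: Hom_iff)
  have e1: "e \<cdot> x = x' \<cdot> t" using F_faithful[OF _ _ Fe(1), of X Y'] e x t x' comp_hom by blast
  have e2: "y' \<cdot> e = y" using F_faithful[OF _ _ Fe(2), of Y M] e x x' comp_hom by blast
  have e3: "k \<cdot> x' = s" using F_faithful[OF _ _ Fe(3), of X' S] k t x' comp_hom by blast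
  have "r \<cdot> k \<in> Hom C Y' (omap F X)" "Neg C (b \<cdot> y') \<in> Hom C Y' (omap F X)"
    using k x' H by (auto simp: Hom_iff)
  then have e4: "r \<cdot> k = Neg C (b \<cdot> y')" using F_faithful[OF _ _ Fe(4)] by blast
  have "(amap F e, Neg C (amap F k), amap F (amap F x \<cdot> r)) \<in> D"
    using D e k v x H by (simp add: Hom_iff)
  then have "(amap F e, amap F k, Neg C (amap F (amap F x \<cdot> r))) \<in> D"
    using dist_signs(3)[of "amap F e" "Neg C (amap F k)"] k v by (simp add: Hom_iff)
  then have "(e, k, amap F x \<cdot> r) \<in> D"
    using desuspend[OF e(1) k(1)] H x by (simp add: Hom_iff)
  then show thesis using that e k e1 e2 e3 e4 by blast
qed

text \<open>Counterpart of \<open>pushout\<close>: \<open>e\<close> has the same cone as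
  \<open>m\<close>. Here the octahedron belongs to \<open>b \<cdot> m\<close>, whose three cones are
  K and the shifts of Y and Y'.\<close>

lemma pullback:
  assumes d: "(x, y, b) \<in> D" "(m, c, r) \<in> D" "(x', y', b \<cdot> m) \<in> D"
    and x: "x \<in> Hom C X Y" "y \<in> Hom C Y M" and m: "m \<in> Hom C M' M" "c \<in> Hom C M K"
    and x': "x' \<in> Hom C X Y'" "y' \<in> Hom C Y' M'"
  obtains e k where "e \<in> Hom C Y' Y" "k \<in> Hom C K (omap F Y')" "(e, c \<cdot> y, k) \<in> D"
    "e \<cdot> x' = x" "y \<cdot> e = m \<cdot> y'" "k \<cdot> c = amap F x' \<cdot> b" "amap F y' \<cdot> k = r"
proof -
  note H = dist_homs[OF d(1) x] dist_homs[OF d(2) m] dist_homs[OF d(3) x']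
  have d1: "(b, Neg C (amap F x), Neg C (amap F y)) \<in> D" by (rule rotate[OF rotate[OF d(1)]])
  have d3: "(b \<cdot> m, Neg C (amap F x'), Neg C (amap F y')) \<in> D" by (rule rotate[OF rotate[OF d(3)]])
  obtain u v where u: "u \<in> Hom C K (omap F Y')" and v: "v \<in> Hom C (omap F Y') (omap F Y)"
    and D: "(u, v, amap F c \<cdot> Neg C (amap F y)) \<in> D"
    and eqs: "u \<cdot> c = Neg C (amap F x') \<cdot> b" "Neg C (amap F y') \<cdot> u = r"
      "v \<cdot> Neg C (amap F x') = Neg C (amap F x)" "Neg C (amap F y) \<cdot> v = amap F m \<cdot> Neg C (amap F y')"
    using octa[OF m(1) H(2) d(2) d1 d3] x m x' by (auto simp: Hom_iff)
  obtain e where e: "e \<in> Hom C Y' Y" "amap F e = v" using F_full[OF v] H by blast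
  define k where "k = Neg C u"
  have k: "k \<in> Hom C K (omap F Y')" using u by (auto simp: k_def Hom_iff)
  have Fe: "amap F (e \<cdot> x') = amap F x" "amap F (y \<cdot> e) = amap F (m \<cdot> y')"
    using eqs e u v x m x' H by (auto simp: Hom_iff)
  have e1: "e \<cdot> x' = x" using F_faithful[OF _ _ Fe(1), of X Y] e x x' comp_hom by blast
  have e2: "y \<cdot> e = m \<cdot> y'" using F_faithful[OF _ _ Fe(2), of Y' M] e x m x' comp_hom by blast
  have e3: "k \<cdot> c = amap F x' \<cdot> b" "amap F y' \<cdot> k = r"
    using eqs u m x' H by (auto simp: k_def Hom_iff)
  have cy: "c \<cdot> y \<in> Hom C Y K" using m x comp_hom by blast
  have "(Neg C u, Neg C v, amap F c \<cdot> Neg C (amap F y)) \<in> D" by (rule dist_signs(1)[OF D])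
  then have "(k, Neg C (amap F e), Neg C (amap F (c \<cdot> y))) \<in> D"
    using e m x by (simp add: k_def Hom_iff)
  moreover have "Neg C (amap F e) \<in> Hom C (omap F Y') (omap F Y)" using e v by (simp add: Hom_iff)
  ultimately have "(e, c \<cdot> y, k) \<in> D"
    using rotate_back[OF e(1) cy k rotate_back[OF cy k]] by blast
  then show thesis using that e k e1 e2 e3 by blast
qed

text \<open>In a triangulated category a split monomorphism has a complement, namely its cone R: the
  third arrow \<open>h\<close> vanishes because \<open>amap F m\<close> is split, so
  \<open>g\<close> has a section.\<close>

lemma retract_closed:
  assumes cl: "closed_under_summands C \<X>" and J: "J \<in> \<X>"
    and m: "m \<in> Hom C A J" and r: "r \<in> Hom C J A" and rm: "r \<cdot> m = Ident C A"
  shows "A \<in> \<X>"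
proof -
  have "m \<in> Arr C" using m by (simp add: Hom_iff)
  then obtain g h where d: "(m, g, h) \<in> D" using dist_cone by blast
  obtain R where g: "g \<in> Hom C J R" using dist_arr(2)[OF d] m by (auto simp: Hom_iff)
  note H = dist_homs[OF d m g]
  have "amap F r \<cdot> amap F m = Ident C (omap F A)"
    using F_comp[of m r] m r rm H by (simp add: Hom_iff del: F_comp)
  then have "h = Zero C R (omap F A)"
    using retraction_zero[OF _ F_hom[OF m] F_hom[OF r] H(2) dist_zero2(2)[OF d m g]] by blast
  then obtain j0 where j0: "j0 \<in> Hom C R J" "g \<cdot> j0 = Ident C R"
    using lift2[OF d m g ident_hom[OF H(5)]] H by auto
  have gm: "g \<cdot> m = Zero C A R" by (rule dist_zero[OF d m g])
  \<comment> \<open>The section is corrected so that \<open>r \<cdot> j\<close> vanishes, as a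
    biproduct demands.\<close>
  define j where "j = j0 \<oplus> Neg C (m \<cdot> (r \<cdot> j0))"
  have j: "j \<in> Hom C R J" unfolding j_def using j0 m r by (simp add: Hom_iff)
  have gj: "g \<cdot> j = Ident C R"
    using j0 m r g H comp_rewrite1[OF gm m g, of "r \<cdot> j0"] unfolding j_def by (simp add: Hom_iff)
  have rj: "r \<cdot> j = Zero C R A"
    using j0 m r H comp_cancel_left[OF rm m r, of "r \<cdot> j0"] unfolding j_def by (simp add: Hom_iff)
  define q where "q = m \<cdot> r \<oplus> j \<cdot> g"
  \<comment> \<open>This difference vanishes on \<open>m\<close>, so it factors through
    \<open>g\<close>; it vanishes also on the section \<open>j\<close> of \<open>g\<close>, so the
    factor is zero.\<close>
  define d0 where "d0 = Ident C J \<oplus> Neg C q"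
  have qH: "q \<in> Hom C J J" unfolding q_def using j m r g by (simp add: Hom_iff)
  have dH: "d0 \<in> Hom C J J" unfolding d0_def using qH H by (simp add: Hom_iff)
  have "q \<cdot> m = m" using j m r g H rm gm by (simp add: q_def Hom_iff)
  then have "d0 \<cdot> m = Zero C A J" unfolding d0_def using qH m H by (simp add: Hom_iff)
  then obtain l where l: "l \<in> Hom C R J" "l \<cdot> g = d0" using extend[OF d m g dH] by blast
  have "q \<cdot> j = j" using j m r g H rj gj by (simp add: q_def Hom_iff)
  then have "d0 \<cdot> j = Zero C R J" unfolding d0_def using qH j H by (simp add: Hom_iff)
  moreover have "d0 \<cdot> j = l" unfolding l(2)[symmetric] using l(1) g j gj by (simp add: Hom_iff)
  ultimately have "d0 = Zero C J J" using l g H by (auto simp: Hom_iff)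
  then have "q = Ident C J" using sub_zero[OF ident_hom[OF H(4)] qH] unfolding d0_def by simp
  then have "is_biproduct C A R J"
    unfolding is_biproduct_def q_def using H m r g j rm gj rj gm by blast
  then show ?thesis using cl J unfolding closed_under_summands_def by blast
qed

section \<open>Cotorsion pairs: orthogonality, extensions and factorisation\<close>

context
  fixes U V assumes cp: "is_cotorsion_pair C F D U V"
begin

lemma cp_closed:
  "U \<subseteq> Obj C" "V \<subseteq> Obj C" "closed_under_isom C U" "closed_under_isom C V"
  "closed_under_summands C U" "closed_under_summands C V"
  "is_full_additive_sub C U" "is_full_additive_sub C V"
  using cp unfolding is_cotorsion_pair_def is_full_additive_sub_def by blast+

lemma cp_vanish:
  assumes "f \<in> Hom C A (omap F B)" "A \<in> U" "B \<in> V"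
  shows "f = Zero C A (omap F B)"
proof -
  have "Ext1_vanishes C F U V" using cp unfolding is_cotorsion_pair_def by blast
  then have "carrier (Ext1 C F A B) = {one (Ext1 C F A B)}"
    using assms unfolding Ext1_vanishes_def by blast
  then show ?thesis using assms by (simp add: Ext1_def)
qed

lemma cp_decompose:
  assumes "A \<in> Obj C"
  obtains u v w U0 V0 where "(u, v, w) \<in> D" "u \<in> Hom C U0 A" "v \<in> Hom C A (omap F V0)" "U0 \<in> U" "V0 \<in> V"
proof -
  have "Obj C = star C D U (shift_set F V)" using cp unfolding is_cotorsion_pair_def by blast
  then obtain u v w V0 where *: "(u, v, w) \<in> D" "Dom C u \<in> U" "Cod C u = A" "Cod C v = omap F V0" "V0 \<in> V"
    using assms unfolding star_def shift_set_def by blast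
  show thesis using that[OF *(1)] * dist_arr[OF *(1)] by auto
qed

text \<open>If A has no arrows into V[1], its decomposition triangle splits and A is a retract of
  its U-part. So U is the full left orthogonal of V[1], from which closure under extensions
  follows.\<close>

lemma cp_leftI:
  assumes "A \<in> Obj C" "\<And>B f. B \<in> V \<Longrightarrow> f \<in> Hom C A (omap F B) \<Longrightarrow> f = Zero C A (omap F B)"
  shows "A \<in> U"
proof -
  obtain u v w U0 V0 where d: "(u, v, w) \<in> D" "u \<in> Hom C U0 A" "v \<in> Hom C A (omap F V0)" "U0 \<in> U" "V0 \<in> V"
    by (rule cp_decompose[OF assms(1)])
  have "v \<cdot> Ident C A = Zero C A (omap F V0)" using assms d by (simp add: Hom_iff)
  then obtain s where "s \<in> Hom C A U0" "u \<cdot> s = Ident C A"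
    using lift[OF d(1-3) ident_hom[OF assms(1)]] by blast
  then show ?thesis using retract_closed[OF cp_closed(5) d(4)] d by blast
qed

text \<open>Mirror image, applied to the decomposition of the shift of B: the shift of B becomes a
  retract of the shift of V0, and the retraction descends.\<close>

lemma cp_rightI:
  assumes "B \<in> Obj C" "\<And>A f. A \<in> U \<Longrightarrow> f \<in> Hom C A (omap F B) \<Longrightarrow> f = Zero C A (omap F B)"
  shows "B \<in> V"
proof -
  have oB: "omap F B \<in> Obj C" using assms(1) by simp
  obtain u v w U0 V0 where d: "(u, v, w) \<in> D" "u \<in> Hom C U0 (omap F B)" "v \<in> Hom C (omap F B) (omap F V0)" "U0 \<in> U" "V0 \<in> V"
    by (rule cp_decompose[OF oB])
  have oV: "V0 \<in> Obj C" "U0 \<in> Obj C" using d cp_closed by blast+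
  have "Ident C (omap F B) \<cdot> u = Zero C U0 (omap F B)"
    using assms(2)[OF d(4,2)] d(2) by (simp add: Hom_iff)
  then obtain s where s: "s \<in> Hom C (omap F V0) (omap F B)" "s \<cdot> v = Ident C (omap F B)"
    using extend[OF d(1-3) ident_hom[OF oB]] by blast
  obtain s' where s': "s' \<in> Hom C V0 B" "amap F s' = s" using F_full[OF s(1) oV(1) assms(1)] by blast
  obtain v' where v': "v' \<in> Hom C B V0" "amap F v' = v" using F_full[OF d(3) assms(1) oV(1)] by blast
  have "amap F (s' \<cdot> v') = amap F (Ident C B)" using s s' v' assms by (simp add: Hom_iff)
  then have "s' \<cdot> v' = Ident C B"
    using F_faithful[OF comp_hom[OF v'(1) s'(1)] ident_hom[OF assms(1)]] by blast
  then show ?thesis using retract_closed[OF cp_closed(6) d(5) v'(1) s'(1)] by blast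
qed

lemma cp_left_ext:
  assumes "(f, g, h) \<in> D" "f \<in> Hom C X Y" "g \<in> Hom C Y Z" "X \<in> U" "Z \<in> U"
  shows "Y \<in> U"
proof (rule cp_leftI)
  show "Y \<in> Obj C" using dist_homs[OF assms(1-3)] by blast
  fix B k assume B: "B \<in> V" and k: "k \<in> Hom C Y (omap F B)"
  have "k \<cdot> f = Zero C X (omap F B)" using cp_vanish[OF comp_hom[OF assms(2) k] assms(4) B] .
  then obtain l where l: "l \<in> Hom C Z (omap F B)" "l \<cdot> g = k" using extend[OF assms(1-3) k] by blast
  show "k = Zero C Y (omap F B)"
    using l cp_vanish[OF l(1) assms(5) B] assms hom_objs[OF k] by (auto simp: Hom_iff)
qed

lemma cp_right_ext:
  assumes "(f, g, h) \<in> D" "f \<in> Hom C X Y" "g \<in> Hom C Y Z" "X \<in> V" "Z \<in> V"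
  shows "Y \<in> V"
proof (rule cp_rightI)
  show "Y \<in> Obj C" using dist_homs[OF assms(1-3)] by blast
  fix A k assume A: "A \<in> U" and k: "k \<in> Hom C A (omap F Y)"
  have "amap F g \<cdot> k = Zero C A (omap F Z)" using cp_vanish[OF comp_hom[OF k F_hom[OF assms(3)]] A assms(5)] .
  then obtain l where l: "l \<in> Hom C A (omap F X)" "amap F f \<cdot> l = k" using lift_shift[OF assms(1-3) k] by blast
  show "k = Zero C A (omap F Y)"
    using l cp_vanish[OF l(1) A assms(4)] assms F_hom[OF assms(2)] hom_objs[OF k] by (auto simp: Hom_iff)
qed

text \<open>The decomposition of A[1], read one rotation earlier: J is in U as an extension of U1 by
  A, and J[1] is isomorphic to the V[1]-part of A[1].\<close>

lemma cp_enough: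
  assumes "A \<in> U"
  obtains a c u J U1 where "(a, c, u) \<in> D" "a \<in> Hom C A J" "c \<in> Hom C J U1" "J \<in> U \<inter> V" "U1 \<in> U"
proof -
  have oA: "A \<in> Obj C" "omap F A \<in> Obj C" using assms cp_closed by auto
  obtain u v w U1 V1 where d: "(u, v, w) \<in> D" "u \<in> Hom C U1 (omap F A)" "v \<in> Hom C (omap F A) (omap F V1)" "U1 \<in> U" "V1 \<in> V"
    by (rule cp_decompose[OF oA(2)])
  obtain a c J where ac: "a \<in> Hom C A J" "c \<in> Hom C J U1" "(a, c, u) \<in> D" by (rule cocone[OF d(2) oA(1)])
  have oJ: "J \<in> Obj C" using ac hom_objs by blast
  have JU: "J \<in> U" using cp_left_ext[OF ac(3,1,2) assms d(4)] .
  have "J \<in> V"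
  proof (rule cp_rightI[OF oJ])
    fix B k assume B: "B \<in> U" and k: "k \<in> Hom C B (omap F J)"
    have Fa: "Neg C (amap F a) \<in> Hom C (omap F A) (omap F J)" using ac by (simp add: Hom_iff)
    obtain z where z: "z \<in> Hom C (Cod C (Neg C (amap F a))) (Cod C v)" "is_isom C z"
      by (rule cone_unique[OF rotate[OF rotate[OF ac(3)]] d(1)])
    have z': "z \<in> Hom C (omap F J) (omap F V1)" using z(1) d(3) Fa by (simp add: Hom_iff)
    have "z \<cdot> k = Zero C B (omap F V1)" using cp_vanish[OF comp_hom[OF k z'] B d(5)] .
    then show "k = Zero C B (omap F J)"
      using isom_mono[OF z(2) z' k hom_zero[OF hom_objs[OF k]]] z' hom_objs[OF k] by (simp add: Hom_iff)
  qed
  then show thesis using that[OF ac(3,1,2)] JU d(4) by blast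
qed

text \<open>\<open>f\<close> extends over the arrow from A to J of \<open>cp_enough\<close>, since
  the obstruction is an arrow from U1 to B[1]. All vanishing modulo I of arrows from S to T or from
  U to V comes from here.\<close>

lemma cp_factor:
  assumes "f \<in> Hom C A B" "A \<in> U" "B \<in> V"
  obtains J f1 f2 where "J \<in> U \<inter> V" "f1 \<in> Hom C A J" "f2 \<in> Hom C J B" "f = f2 \<cdot> f1"
proof -
  obtain a c u J U1 where d: "(a, c, u) \<in> D" "a \<in> Hom C A J" "c \<in> Hom C J U1" "J \<in> U \<inter> V" "U1 \<in> U"
    by (rule cp_enough[OF assms(2)])
  have "amap F f \<cdot> u = Zero C U1 (omap F B)"
    using cp_vanish[OF _ d(5) assms(3)] comp_hom[OF dist_homs(2)[OF d(1-3)] F_hom[OF assms(1)]] by blast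
  then show thesis using extend0[OF d(1-3) assms(1)] that[OF d(4,2)] by metis
qed

lemma cp_zero: "is_zero_object C A \<Longrightarrow> A \<in> U" "is_zero_object C A \<Longrightarrow> A \<in> V"
proof -
  assume A: "is_zero_object C A"
  then have o: "A \<in> Obj C" unfolding is_zero_object_def by blast
  show "A \<in> U" by (rule cp_leftI[OF o]) (use zero_obj_hom_eq(1)[OF A] in blast)
  have "is_zero_object C (omap F A)"
    using A o zero_object_iff[of A] zero_object_iff[of "omap F A"] F_ident[of A] by simp
  then show "A \<in> V" by (intro cp_rightI[OF o]) (use zero_obj_hom_eq(2) in blast)
qed

end

end

section \<open>Ideal quotients and full subcategories\<close>

locale quotcat = addc C for C :: "('o, 'a) addcat" (structure) +
  fixes J :: "'o set"
  assumes J_add: "is_full_additive_sub C J"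
begin

abbreviation "Q \<equiv> ideal_quotient C J"
abbreviation "cl \<equiv> quot_class C J"
abbreviation "fac \<equiv> factoring_arrows C J"

lemma J_obj: "A \<in> J \<Longrightarrow> A \<in> Obj C"
  using J_add unfolding is_full_additive_sub_def by blast

lemma facI: "A \<in> J \<Longrightarrow> f \<in> Hom C X A \<Longrightarrow> g \<in> Hom C A Y \<Longrightarrow> g \<cdot> f \<in> fac X Y"
  unfolding factoring_arrows_def by blast

lemma facE:
  assumes "h \<in> fac X Y"
  obtains A f g where "A \<in> J" "f \<in> Hom C X A" "g \<in> Hom C A Y" "h = g \<cdot> f"
  using assms unfolding factoring_arrows_def by blast

lemma fac_hom: "h \<in> fac X Y \<Longrightarrow> h \<in> Hom C X Y"
  by (erule facE) (auto simp: Hom_iff)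

lemma fac_zero: "X \<in> Obj C \<Longrightarrow> Y \<in> Obj C \<Longrightarrow> Zero C X Y \<in> fac X Y"
proof -
  assume o: "X \<in> Obj C" "Y \<in> Obj C"
  obtain A where A: "A \<in> J" using J_add unfolding is_full_additive_sub_def by blast
  show ?thesis using facI[OF A, of "Zero C X A" X "Zero C A Y" Y] o J_obj[OF A] by (simp add: Hom_iff)
qed

lemma fac_add:
  assumes "h \<in> fac X Y" "k \<in> fac X Y"
  shows "h \<oplus> k \<in> fac X Y"
proof -
  obtain A f g where A: "A \<in> J" "f \<in> Hom C X A" "g \<in> Hom C A Y" "h = g \<cdot> f" by (rule facE[OF assms(1)])
  obtain B f' g' where B: "B \<in> J" "f' \<in> Hom C X B" "g' \<in> Hom C B Y" "k = g' \<cdot> f'" by (rule facE[OF assms(2)])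
  obtain P where P: "P \<in> J" "is_biproduct C A B P"
    using J_add A(1) B(1) unfolding is_full_additive_sub_def by blast
  then obtain i j p q where b: "i \<in> Hom C A P" "j \<in> Hom C B P" "p \<in> Hom C P A" "q \<in> Hom C P B"
    "p \<cdot> i = Ident C A" "q \<cdot> j = Ident C B" "p \<cdot> j = Zero C B A" "q \<cdot> i = Zero C A B"
    unfolding is_biproduct_def by blast
  note o = J_obj[OF A(1)] J_obj[OF B(1)] J_obj[OF P(1)] hom_objs[OF A(2)] hom_objs[OF A(3)]
  have "(g \<cdot> p \<oplus> g' \<cdot> q) \<cdot> (i \<cdot> f \<oplus> j \<cdot> f') \<in> fac X Y"
    using A B b by (intro facI[OF P(1)]) (auto simp: Hom_iff)
  moreover have "(g \<cdot> p \<oplus> g' \<cdot> q) \<cdot> (i \<cdot> f \<oplus> j \<cdot> f') = h \<oplus> k"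
    using A B b(1-4) comp_cancel_left[OF b(5,1,3), of f] comp_cancel_left[OF b(6,2,4), of f']
      comp_rewrite1[OF b(7,2,3), of f'] comp_rewrite1[OF b(8,1,4), of f] o
    by (simp add: Hom_iff)
  ultimately show ?thesis by simp
qed

lemma fac_comp:
  "h \<in> fac X Y \<Longrightarrow> g \<in> Hom C Y Z \<Longrightarrow> g \<cdot> h \<in> fac X Z"
  "h \<in> fac X Y \<Longrightarrow> f \<in> Hom C W X \<Longrightarrow> h \<cdot> f \<in> fac W Y"
proof -
  assume "h \<in> fac X Y"
  then obtain A a b where A: "A \<in> J" "a \<in> Hom C X A" "b \<in> Hom C A Y" "h = b \<cdot> a" by (rule facE)
  show "g \<cdot> h \<in> fac X Z" if "g \<in> Hom C Y Z"
    using facI[OF A(1,2) comp_hom[OF A(3) that]] A that by (simp add: Hom_iff)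
  show "h \<cdot> f \<in> fac W Y" if "f \<in> Hom C W X"
    using facI[OF A(1) comp_hom[OF that A(2)] A(3)] A that by (simp add: Hom_iff)
qed

lemma fac_neg: "h \<in> fac X Y \<Longrightarrow> Neg C h \<in> fac X Y"
  using fac_comp(1)[of h X Y "Neg C (Ident C Y)" Y] fac_hom[of h X Y] hom_objs[of h X Y]
  by (simp add: Hom_iff)

lemma cl_Hom: "f \<in> Hom C X Y \<Longrightarrow> cl f = {f \<oplus> h | h. h \<in> fac X Y}"
  by (simp add: quot_class_def Hom_iff)

lemma cl_eqI:
  assumes "f \<in> Hom C X Y" "g \<in> Hom C X Y" "f \<oplus> Neg C g \<in> fac X Y"
  shows "cl f = cl g"
proof -
  have *: "cl f \<subseteq> cl g" if a: "f \<in> Hom C X Y" "g \<in> Hom C X Y" "f \<oplus> Neg C g \<in> fac X Y" for f g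
  proof
    fix x assume "x \<in> cl f"
    then obtain h where h: "h \<in> fac X Y" "x = f \<oplus> h" using cl_Hom[OF a(1)] by blast
    have "g \<oplus> ((f \<oplus> Neg C g) \<oplus> h) = (f \<oplus> h) \<oplus> (g \<oplus> Neg C g)"
      using a(1,2) fac_hom[OF h(1)] by (simp only: Hom_iff add_ac arr_add arr_neg)
    then have "x = g \<oplus> ((f \<oplus> Neg C g) \<oplus> h)"
      using h(2) a(1,2) fac_hom[OF h(1)] hom_objs[OF a(1)] by (simp add: Hom_iff)
    moreover have "(f \<oplus> Neg C g) \<oplus> h \<in> fac X Y" using fac_add a h by blast
    ultimately show "x \<in> cl g" using cl_Hom[OF a(2)] by blast
  qed
  have "Neg C (f \<oplus> Neg C g) = g \<oplus> Neg C f" using assms(1,2) add_commute[of "Neg C f" g] by (simp add: Hom_iff)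
  then have "g \<oplus> Neg C f \<in> fac X Y" using fac_neg[OF assms(3)] by simp
  then show ?thesis using *[OF assms] *[OF assms(2,1)] by blast
qed

lemma cl_self: "f \<in> Arr C \<Longrightarrow> f \<in> cl f"
  unfolding quot_class_def using fac_zero[of "Dom C f" "Cod C f"] by (auto intro!: exI[of _ "Zero C (Dom C f) (Cod C f)"])

lemma in_cl:
  assumes "g \<in> cl f" "f \<in> Hom C X Y"
  shows "g \<in> Hom C X Y" "g \<oplus> Neg C f \<in> fac X Y" "cl g = cl f"
proof -
  obtain h where h: "h \<in> fac X Y" "g = f \<oplus> h" using assms cl_Hom[OF assms(2)] by blast
  show g: "g \<in> Hom C X Y" using h fac_hom[OF h(1)] assms(2) by (simp add: Hom_iff)
  have "g \<oplus> Neg C f = h \<oplus> (f \<oplus> Neg C f)"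
    unfolding h(2) using fac_hom[OF h(1)] assms(2) by (simp only: Hom_iff add_ac arr_add arr_neg)
  then show "g \<oplus> Neg C f \<in> fac X Y" using h(1) fac_hom[OF h(1)] assms(2) hom_objs[OF assms(2)] by (simp add: Hom_iff)
  then show "cl g = cl f" using cl_eqI g assms(2) by blast
qed

lemma cl_eqD:
  assumes "cl f = cl g" "f \<in> Hom C X Y" "g \<in> Arr C"
  shows "g \<in> Hom C X Y" "f \<oplus> Neg C g \<in> fac X Y"
proof -
  have g: "g \<in> Hom C (Dom C g) (Cod C g)" "f \<in> cl g" using assms cl_self[of f] by (auto simp: Hom_iff)
  show "g \<in> Hom C X Y" using in_cl(1)[OF g(2,1)] assms(2) g(1) by (simp add: Hom_iff)
  then show "f \<oplus> Neg C g \<in> fac X Y" by (rule in_cl(2)[OF g(2)])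
qed

lemma cl_eq_iff:
  assumes "f \<in> Hom C X Y" "g \<in> Hom C X Y"
  shows "cl f = cl g \<longleftrightarrow> f \<oplus> Neg C g \<in> fac X Y"
proof -
  have "g \<in> Arr C" using assms by (simp add: Hom_iff)
  then show ?thesis using cl_eqI[OF assms] cl_eqD(2)[OF _ assms(1)] by blast
qed

lemma rep_cl:
  assumes "f \<in> Hom C X Y"
  shows "quot_rep (cl f) \<in> Hom C X Y" "cl (quot_rep (cl f)) = cl f"
proof -
  have "quot_rep (cl f) \<in> cl f" unfolding quot_rep_def
    by (rule someI[of _ f]) (use cl_self assms in \<open>auto simp: Hom_iff\<close>)
  then show "quot_rep (cl f) \<in> Hom C X Y" "cl (quot_rep (cl f)) = cl f" using in_cl assms by blast+
qed

lemma Q_simps [simp]: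
  "Obj Q = Obj C" "Ident Q X = cl (Ident C X)" "Zero Q X Y = cl (Zero C X Y)" "Arr Q = cl ` Arr C"
  by (simp_all add: ideal_quotient_def)

lemma Q_dom [simp]: "f \<in> Arr C \<Longrightarrow> Dom Q (cl f) = Dom C f" "f \<in> Arr C \<Longrightarrow> Cod Q (cl f) = Cod C f"
  using rep_cl(1)[of f "Dom C f" "Cod C f"] by (auto simp: ideal_quotient_def Hom_iff)

lemma cl_hom: "f \<in> Hom C X Y \<Longrightarrow> cl f \<in> Hom Q X Y"
  by (auto simp: Hom_iff)

lemma Q_homE:
  assumes "c \<in> Hom Q X Y"
  obtains f where "f \<in> Hom C X Y" "c = cl f"
proof -
  have "c \<in> cl ` Arr C" "Dom Q c = X" "Cod Q c = Y" using assms by (simp_all add: Hom_iff)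
  then obtain f where f: "f \<in> Arr C" "c = cl f" "Dom Q c = X" "Cod Q c = Y" by blast
  then have "f \<in> Hom C X Y" by (simp add: Hom_iff)
  then show thesis using f(2) that by blast
qed

lemma Q_hom_ex: "c \<in> Hom Q X Y \<Longrightarrow> \<exists>f. f \<in> Hom C X Y \<and> c = cl f"
  by (erule Q_homE) blast

lemma cl_cong_comp:
  assumes "f \<in> Hom C X Y" "f' \<in> Hom C X Y" "g \<in> Hom C Y Z" "g' \<in> Hom C Y Z" "cl f = cl f'" "cl g = cl g'"
  shows "cl (g \<cdot> f) = cl (g' \<cdot> f')"
proof -
  have f: "f \<oplus> Neg C f' \<in> fac X Y" and g: "g \<oplus> Neg C g' \<in> fac Y Z"
    using assms cl_eq_iff by blast+
  have "g \<cdot> (f \<oplus> Neg C f') \<oplus> (g \<oplus> Neg C g') \<cdot> f' \<in> fac X Z"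
    using fac_add fac_comp f g assms by blast
  moreover have "g \<cdot> (f \<oplus> Neg C f') \<oplus> (g \<oplus> Neg C g') \<cdot> f' = g \<cdot> f \<oplus> Neg C (g' \<cdot> f')"
    using assms(1-4) by (simp add: Hom_iff add_assoc)
  ultimately have "g \<cdot> f \<oplus> Neg C (g' \<cdot> f') \<in> fac X Z"
    by simp
  then show ?thesis by (rule cl_eqI[OF comp_hom[OF assms(1,3)] comp_hom[OF assms(2,4)]])
qed

lemma cl_cong_add:
  assumes "f \<in> Hom C X Y" "f' \<in> Hom C X Y" "g \<in> Hom C X Y" "g' \<in> Hom C X Y" "cl f = cl f'" "cl g = cl g'"
  shows "cl (f \<oplus> g) = cl (f' \<oplus> g')"
proof -
  have "(f \<oplus> Neg C f') \<oplus> (g \<oplus> Neg C g') \<in> fac X Y"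
    using fac_add cl_eq_iff[OF assms(1,2)] cl_eq_iff[OF assms(3,4)] assms(5,6) by blast
  moreover have "(f \<oplus> Neg C f') \<oplus> (g \<oplus> Neg C g') = (f \<oplus> g) \<oplus> Neg C (f' \<oplus> g')"
    using assms(1-4) add_left_commute[of "Neg C f'" g "Neg C g'"] by (simp add: Hom_iff add_assoc)
  moreover have "f \<oplus> g \<in> Hom C X Y" "f' \<oplus> g' \<in> Hom C X Y" using assms(1-4) by (simp_all add: Hom_iff)
  ultimately show ?thesis using cl_eqI by metis
qed

lemma Q_comp:
  assumes "f \<in> Hom C X Y" "g \<in> Hom C Y Z"
  shows "cl g \<cdot>\<^bsub>Q\<^esub> cl f = cl (g \<cdot> f)"
proof -
  have "cl g \<cdot>\<^bsub>Q\<^esub> cl f = cl (quot_rep (cl g) \<cdot> quot_rep (cl f))" by (simp add: ideal_quotient_def)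
  also have "\<dots> = cl (g \<cdot> f)"
    by (rule cl_cong_comp[OF rep_cl(1)[OF assms(1)] assms(1) rep_cl(1)[OF assms(2)] assms(2)
      rep_cl(2)[OF assms(1)] rep_cl(2)[OF assms(2)]])
  finally show ?thesis .
qed

lemma Q_add:
  assumes "f \<in> Hom C X Y" "g \<in> Hom C X Y"
  shows "Add Q (cl f) (cl g) = cl (f \<oplus> g)"
proof -
  have "Add Q (cl f) (cl g) = cl (quot_rep (cl f) \<oplus> quot_rep (cl g))" by (simp add: ideal_quotient_def)
  also have "\<dots> = cl (f \<oplus> g)"
    by (rule cl_cong_add[OF rep_cl(1)[OF assms(1)] assms(1) rep_cl(1)[OF assms(2)] assms(2)
      rep_cl(2)[OF assms(1)] rep_cl(2)[OF assms(2)]])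
  finally show ?thesis .
qed

lemma cl_comp:
  "f \<in> Arr C \<Longrightarrow> g \<in> Arr C \<Longrightarrow> Dom C g = Cod C f \<Longrightarrow> cl (g \<cdot> f) = cl g \<cdot>\<^bsub>Q\<^esub> cl f"
  using Q_comp[of f "Dom C f" "Cod C f" g "Cod C g"] by (simp add: Hom_iff)

lemma cl_add:
  "f \<in> Arr C \<Longrightarrow> g \<in> Arr C \<Longrightarrow> Dom C f = Dom C g \<Longrightarrow> Cod C f = Cod C g \<Longrightarrow> cl (f \<oplus> g) = Add Q (cl f) (cl g)"
  using Q_add[of f "Dom C g" "Cod C g" g] by (simp add: Hom_iff)

lemma biproduct_Q: assumes "is_biproduct C A B P" shows "is_biproduct Q A B P"
proof -
  obtain i j p q where b: "i \<in> Hom C A P" "j \<in> Hom C B P" "p \<in> Hom C P A" "q \<in> Hom C P B"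
    "p \<cdot> i = Ident C A" "q \<cdot> j = Ident C B" "p \<cdot> j = Zero C B A" "q \<cdot> i = Zero C A B"
    "i \<cdot> p \<oplus> j \<cdot> q = Ident C P"
    using assms unfolding is_biproduct_def by blast
  have o: "A \<in> Obj Q" "B \<in> Obj Q" "P \<in> Obj Q" using assms unfolding is_biproduct_def by auto
  have "Add Q (cl i \<cdot>\<^bsub>Q\<^esub> cl p) (cl j \<cdot>\<^bsub>Q\<^esub> cl q) = Ident Q P"
    using Q_add[of "i \<cdot> p" P P "j \<cdot> q"] Q_comp[OF b(3,1)] Q_comp[OF b(4,2)] b by (simp add: Hom_iff)
  moreover have "cl p \<cdot>\<^bsub>Q\<^esub> cl i = Ident Q A" "cl q \<cdot>\<^bsub>Q\<^esub> cl j = Ident Q B" "cl p \<cdot>\<^bsub>Q\<^esub> cl j = Zero Q B A" "cl q \<cdot>\<^bsub>Q\<^esub> cl i = Zero Q A B"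
    using Q_comp[OF b(1,3)] Q_comp[OF b(2,4)] Q_comp[OF b(2,3)] Q_comp[OF b(1,4)] b(5-8) by simp_all
  ultimately show ?thesis unfolding is_biproduct_def using o cl_hom b(1-4) by blast
qed

lemma Q_additive: "additive_category Q"
proof (intro additive_category.intro category.intro additive_category_axioms.intro)
  fix c assume "c \<in> Arr Q" then show "Dom Q c \<in> Obj Q" "Cod Q c \<in> Obj Q" by auto
next
  fix X assume "X \<in> Obj Q" then show "Ident Q X \<in> Hom Q X X" by (auto simp: Hom_iff)
next
  fix X Y Z c d assume "c \<in> Hom Q X Y" "d \<in> Hom Q Y Z"
  then obtain f g where fg: "f \<in> Hom C X Y" "c = cl f" "g \<in> Hom C Y Z" "d = cl g"
    by (blast dest!: Q_hom_ex)
  then show "d \<cdot>\<^bsub>Q\<^esub> c \<in> Hom Q X Z" using Q_comp cl_hom[OF comp_hom[OF fg(1,3)]] by simp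
next
  fix X Y c assume "c \<in> Hom Q X Y"
  then obtain f where f: "f \<in> Hom C X Y" "c = cl f" by (rule Q_homE)
  note o = hom_objs[OF f(1)]
  show "Ident Q Y \<cdot>\<^bsub>Q\<^esub> c = c" "c \<cdot>\<^bsub>Q\<^esub> Ident Q X = c"
    using Q_comp[OF f(1) ident_hom[OF o(2)]] Q_comp[OF ident_hom[OF o(1)] f(1)] f by (simp_all add: Hom_iff)
next
  fix W X Y Z c d e assume "c \<in> Hom Q W X" "d \<in> Hom Q X Y" "e \<in> Hom Q Y Z"
  then obtain f g h where fgh: "f \<in> Hom C W X" "c = cl f" "g \<in> Hom C X Y" "d = cl g" "h \<in> Hom C Y Z" "e = cl h"
    by (blast dest!: Q_hom_ex)
  have "h \<cdot> (g \<cdot> f) = (h \<cdot> g) \<cdot> f" using fgh by (simp add: Hom_iff)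
  then show "e \<cdot>\<^bsub>Q\<^esub> (d \<cdot>\<^bsub>Q\<^esub> c) = (e \<cdot>\<^bsub>Q\<^esub> d) \<cdot>\<^bsub>Q\<^esub> c"
    using Q_comp[OF comp_hom[OF fgh(1,3)] fgh(5)] Q_comp[OF fgh(1) comp_hom[OF fgh(3,5)]] Q_comp fgh by simp
next
  fix X Y assume o: "X \<in> Obj Q" "Y \<in> Obj Q"
  have oC: "X \<in> Obj C" "Y \<in> Obj C" using o by auto
  show "comm_group (Hom_group Q X Y)"
  proof (rule comm_groupI)
    fix c d assume "c \<in> carrier (Hom_group Q X Y)" "d \<in> carrier (Hom_group Q X Y)"
    then obtain f g where fg: "f \<in> Hom C X Y" "c = cl f" "g \<in> Hom C X Y" "d = cl g"
      unfolding Hom_group_def partial_object.simps by (blast dest!: Q_hom_ex)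
    show "c \<otimes>\<^bsub>Hom_group Q X Y\<^esub> d \<in> carrier (Hom_group Q X Y)"
      using fg Q_add cl_hom[of "f \<oplus> g" X Y] by (simp add: Hom_group_def Hom_iff)
    show "c \<otimes>\<^bsub>Hom_group Q X Y\<^esub> d = d \<otimes>\<^bsub>Hom_group Q X Y\<^esub> c"
      using fg Q_add[OF fg(1,3)] Q_add[OF fg(3,1)] add_commute[of f g] by (simp add: Hom_group_def Hom_iff)
    fix e assume "e \<in> carrier (Hom_group Q X Y)"
    then obtain h where h: "h \<in> Hom C X Y" "e = cl h"
      unfolding Hom_group_def partial_object.simps by (blast dest!: Q_hom_ex)
    have H: "f \<oplus> g \<in> Hom C X Y" "g \<oplus> h \<in> Hom C X Y" using fg h by (auto simp: Hom_iff)
    show "c \<otimes>\<^bsub>Hom_group Q X Y\<^esub> d \<otimes>\<^bsub>Hom_group Q X Y\<^esub> e = c \<otimes>\<^bsub>Hom_group Q X Y\<^esub> (d \<otimes>\<^bsub>Hom_group Q X Y\<^esub> e)"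
      using Q_add[OF fg(1,3)] Q_add[OF fg(3) h(1)] Q_add[OF fg(1) H(2)] Q_add[OF H(1) h(1)] fg h add_assoc[of f g h]
      by (simp add: Hom_group_def Hom_iff)
  next
    show "\<one>\<^bsub>Hom_group Q X Y\<^esub> \<in> carrier (Hom_group Q X Y)"
      using cl_hom[OF hom_zero[OF oC]] by (simp add: Hom_group_def)
  next
    fix c assume "c \<in> carrier (Hom_group Q X Y)"
    then obtain f where f: "f \<in> Hom C X Y" "c = cl f"
      unfolding Hom_group_def partial_object.simps by (blast dest!: Q_hom_ex)
    show "\<one>\<^bsub>Hom_group Q X Y\<^esub> \<otimes>\<^bsub>Hom_group Q X Y\<^esub> c = c"
      using Q_add[OF hom_zero[OF oC] f(1)] f by (simp add: Hom_group_def Hom_iff)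
    have n: "Neg C f \<in> Hom C X Y" using f by (simp add: Hom_iff)
    show "\<exists>d\<in>carrier (Hom_group Q X Y). d \<otimes>\<^bsub>Hom_group Q X Y\<^esub> c = \<one>\<^bsub>Hom_group Q X Y\<^esub>"
      using Q_add[OF n f(1)] f cl_hom[OF n] by (intro bexI[of _ "cl (Neg C f)"]) (auto simp: Hom_group_def Hom_iff)
  qed
next
  fix X Y Z c c' d assume "c \<in> Hom Q X Y" "c' \<in> Hom Q X Y" "d \<in> Hom Q Y Z"
  then obtain f f' g where fgh: "f \<in> Hom C X Y" "c = cl f" "f' \<in> Hom C X Y" "c' = cl f'" "g \<in> Hom C Y Z" "d = cl g"
    by (blast dest!: Q_hom_ex)
  have "cl (g \<cdot> (f \<oplus> f')) = cl (g \<cdot> f \<oplus> g \<cdot> f')" using fgh by (simp add: Hom_iff)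
  then show "d \<cdot>\<^bsub>Q\<^esub> Add Q c c' = Add Q (d \<cdot>\<^bsub>Q\<^esub> c) (d \<cdot>\<^bsub>Q\<^esub> c')" using fgh by (simp add: Hom_iff cl_comp cl_add del: comp_add)
next
  fix X Y Z c d d' assume "c \<in> Hom Q X Y" "d \<in> Hom Q Y Z" "d' \<in> Hom Q Y Z"
  then obtain f g g' where fgh: "f \<in> Hom C X Y" "c = cl f" "g \<in> Hom C Y Z" "d = cl g" "g' \<in> Hom C Y Z" "d' = cl g'"
    by (blast dest!: Q_hom_ex)
  have "cl ((g \<oplus> g') \<cdot> f) = cl (g \<cdot> f \<oplus> g' \<cdot> f)" using fgh by (simp add: Hom_iff)
  then show "Add Q d d' \<cdot>\<^bsub>Q\<^esub> c = Add Q (d \<cdot>\<^bsub>Q\<^esub> c) (d' \<cdot>\<^bsub>Q\<^esub> c)" using fgh by (simp add: Hom_iff cl_comp cl_add del: add_comp)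
next
  obtain Z where Z: "is_zero_object C Z" using zero_object by blast
  have oZ: "Z \<in> Obj C" using Z unfolding is_zero_object_def by blast
  have "\<exists>!f. f \<in> Hom Q Z X" "\<exists>!f. f \<in> Hom Q X Z" if "X \<in> Obj C" for X
    using zero_obj_hom_eq[OF Z] cl_hom[OF hom_zero[OF oZ that]] cl_hom[OF hom_zero[OF that oZ]] Q_homE by metis+
  then show "\<exists>Z. is_zero_object Q Z" unfolding is_zero_object_def using oZ by (intro exI[of _ Z]) simp
next
  fix A B assume "A \<in> Obj Q" "B \<in> Obj Q"
  then obtain P where "is_biproduct C A B P" using biproducts by auto
  then show "\<exists>P. is_biproduct Q A B P" by (auto intro: biproduct_Q)
qed


lemma Q_zero_iff: "f \<in> Hom C X Y \<Longrightarrow> cl f = Zero Q X Y \<longleftrightarrow> f \<in> fac X Y"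
  using cl_eq_iff[of f X Y "Zero C X Y"] hom_zero[of X Y] hom_objs[of f X Y] by (auto simp: Hom_iff)

lemma Q_neg: "f \<in> Hom C X Y \<Longrightarrow> Neg Q (cl f) = cl (Neg C f)"
proof -
  assume f: "f \<in> Hom C X Y"
  interpret Q: addc Q by (rule addcI[OF Q_additive])
  have "Neg C f \<in> Hom C X Y" using f by (simp add: Hom_iff)
  then show ?thesis
    using f Q_add[of f X Y "Neg C f"] hom_objs[OF f]
    by (intro Q.neg_unique[of _ X Y] cl_hom) (auto simp: Hom_iff)
qed

declare Q_simps(2-4) [simp del]

text \<open>The orientation is now reversed: classes of identities and zeros are folded into those
  of \<open>Q\<close>, so that the rules for additive categories apply to \<open>Q\<close>
  itself.\<close>

lemma cl_simps [simp]:
  "f \<in> Arr C \<Longrightarrow> cl f \<in> Arr Q" "cl (Ident C X) = Ident Q X" "cl (Zero C X Y) = Zero Q X Y"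
  by (simp_all add: Q_simps)

end

section \<open>Full subcategories of an additive category\<close>

lemma full_simps [simp]:
  "Obj (full_subcategory C A) = A"
  "Arr (full_subcategory C A) = {f \<in> Arr C. Dom C f \<in> A \<and> Cod C f \<in> A}"
  "Dom (full_subcategory C A) = Dom C" "Cod (full_subcategory C A) = Cod C"
  "Ident (full_subcategory C A) = Ident C" "Comp (full_subcategory C A) = Comp C"
  "Add (full_subcategory C A) = Add C" "Zero (full_subcategory C A) = Zero C"
  by (simp_all add: full_subcategory_def)

lemma full_hom: "f \<in> Hom (full_subcategory C A) X Y \<longleftrightarrow> f \<in> Hom C X Y \<and> X \<in> A \<and> Y \<in> A"
  by (auto simp: Hom_iff)

lemma full_hom_eq: "X \<in> A \<Longrightarrow> Y \<in> A \<Longrightarrow> Hom (full_subcategory C A) X Y = Hom C X Y"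
  by (auto simp: full_hom)

context addc
begin

lemma full_neg:
  assumes "f \<in> Hom (full_subcategory C A) X Y"
  shows "Neg (full_subcategory C A) f = Neg C f"
proof -
  have "Hom_group (full_subcategory C A) X Y = Hom_group C X Y"
    using assms by (simp add: Hom_group_def full_hom full_hom_eq)
  then show ?thesis using assms by (simp add: Neg_def Hom_iff)
qed

lemma full_isom:
  assumes "f \<in> Hom C X Y" "X \<in> A" "Y \<in> A"
  shows "is_isom (full_subcategory C A) f \<longleftrightarrow> is_isom C f"
  using assms unfolding is_isom_def by (auto simp: Hom_iff)

lemma full_additive:
  assumes A: "A \<subseteq> Obj C" and Z: "Z \<in> A" "is_zero_object C Z"
    and P: "\<And>X Y. X \<in> A \<Longrightarrow> Y \<in> A \<Longrightarrow> \<exists>P \<in> A. is_biproduct C X Y P"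
  shows "additive_category (full_subcategory C A)" (is "additive_category ?A")
proof (intro additive_category.intro category.intro additive_category_axioms.intro)
  fix X Y assume "X \<in> Obj ?A" "Y \<in> Obj ?A"
  then have XY: "X \<in> A" "Y \<in> A" by auto
  have "Hom_group ?A X Y = Hom_group C X Y" using XY by (simp add: Hom_group_def full_hom_eq)
  then show "comm_group (Hom_group ?A X Y)" using hom_group XY A by auto
  obtain P where "P \<in> A" "is_biproduct C X Y P" using P[OF XY] by blast
  then have "is_biproduct ?A X Y P"
    using XY unfolding is_biproduct_def by (simp add: full_hom_eq)
  then show "\<exists>P. is_biproduct ?A X Y P" by blast
next
  show "\<exists>Z. is_zero_object ?A Z"
    using Z A unfolding is_zero_object_def by (intro exI[of _ Z]) (simp add: full_hom_eq subset_iff)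
qed (use A in \<open>auto simp: Hom_iff\<close>)

end

section \<open>Approximations modulo the ideal\<close>

context rtri
begin

text \<open>The definition of a cotorsion pair supplies some biproduct in U and some biproduct in V,
  possibly different ones. Orthogonality puts every biproduct into the class, so that a single one
  lies in an intersection such as I or Z.\<close>

lemma cp_biproduct:
  assumes cp: "is_cotorsion_pair C F D U V" and P: "is_biproduct C A B P"
  shows "A \<in> U \<Longrightarrow> B \<in> U \<Longrightarrow> P \<in> U" "A \<in> V \<Longrightarrow> B \<in> V \<Longrightarrow> P \<in> V"
proof -
  obtain i j p q where b: "i \<in> Hom C A P" "j \<in> Hom C B P" "p \<in> Hom C P A" "q \<in> Hom C P B"
    "i \<cdot> p \<oplus> j \<cdot> q = Ident C P"
    using P unfolding is_biproduct_def by blast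
  note o = hom_objs[OF b(1)] hom_objs[OF b(2)]
  show "P \<in> U" if "A \<in> U" "B \<in> U"
  proof (rule cp_leftI[OF cp o(2)])
    fix X f assume X: "X \<in> V" and f: "f \<in> Hom C P (omap F X)"
    have "f = f \<cdot> (i \<cdot> p \<oplus> j \<cdot> q)" unfolding b(5) using f by (simp add: Hom_iff)
    also have "\<dots> = (f \<cdot> i) \<cdot> p \<oplus> (f \<cdot> j) \<cdot> q" using f b(1-4) by (simp add: Hom_iff)
    also have "\<dots> = Zero C P (omap F X)"
      using cp_vanish[OF cp comp_hom[OF b(1) f] that(1) X] cp_vanish[OF cp comp_hom[OF b(2) f] that(2) X]
        b o hom_objs[OF f] by (simp add: Hom_iff)
    finally show "f = Zero C P (omap F X)" .
  qed
  show "P \<in> V" if "A \<in> V" "B \<in> V"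
  proof (rule cp_rightI[OF cp o(2)])
    fix X f assume X: "X \<in> U" and f: "f \<in> Hom C X (omap F P)"
    have "f = amap F (i \<cdot> p \<oplus> j \<cdot> q) \<cdot> f" unfolding b(5) using f o by (simp add: Hom_iff)
    also have "\<dots> = amap F i \<cdot> (amap F p \<cdot> f) \<oplus> amap F j \<cdot> (amap F q \<cdot> f)" using f b(1-4) by (simp add: Hom_iff)
    also have "\<dots> = Zero C X (omap F P)"
      using cp_vanish[OF cp comp_hom[OF f F_hom[OF b(3)]] X that(1)] cp_vanish[OF cp comp_hom[OF f F_hom[OF b(4)]] X that(2)]
        b o hom_objs[OF f] by (simp add: Hom_iff)
    finally show "f = Zero C X (omap F P)" .
  qed
qed

end

locale ctcp = rtri C F D for C :: "('o, 'a) addcat" (structure) and F D +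
  fixes S T U V :: "'o set" and K :: "('o, 'a) tcp_choices"
  assumes ST: "is_cotorsion_pair C F D S T"
    and UV: "is_cotorsion_pair C F D U V"
    and SV: "Ext1_vanishes C F S V"
    and conc: "S \<inter> T = U \<inter> V"
    and K: "valid_choices \<lparr>amb = C, shift = F, dist = D, subS = S, subT = T, subU = U, subV = V\<rparr> K"
    and condI: "condition_I \<lparr>amb = C, shift = F, dist = D, subS = S, subT = T, subU = U, subV = V\<rparr> K"
    and condII: "condition_II \<lparr>amb = C, shift = F, dist = D, subS = S, subT = T, subU = U, subV = V\<rparr>"
begin

abbreviation "P \<equiv> \<lparr>amb = C, shift = F, dist = D, subS = S, subT = T, subU = U, subV = V\<rparr>"
abbreviation "I \<equiv> S \<inter> T"
abbreviation "Z \<equiv> T \<inter> U"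
abbreviation "Q \<equiv> ideal_quotient C I"
abbreviation "cl \<equiv> quot_class C I"
abbreviation qcomp (infixl "\<star>" 70) where "g \<star> f \<equiv> Comp Q g f"

lemma I_memb: "J \<in> I \<Longrightarrow> J \<in> S" "J \<in> I \<Longrightarrow> J \<in> T" "J \<in> I \<Longrightarrow> J \<in> U" "J \<in> I \<Longrightarrow> J \<in> V"
  using conc by auto

lemma I_additive: "is_full_additive_sub C I"
proof -
  have "\<exists>P\<in>S \<inter> T. is_biproduct C A B P" if AB: "A \<in> S \<inter> T" "B \<in> S \<inter> T" for A B
  proof -
    have "A \<in> Obj C" "B \<in> Obj C" using AB cp_closed(1)[OF ST] by blast+
    then obtain P where "is_biproduct C A B P" using biproducts by blast
    then show ?thesis using cp_biproduct[OF ST] AB by blast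
  qed
  then show ?thesis
    unfolding is_full_additive_sub_def using cp_closed(1)[OF ST] cp_zero[OF ST] zero_object by blast
qed

sublocale q: quotcat C "S \<inter> T"
  by unfold_locales (rule I_additive)

sublocale Qa: addc "ideal_quotient C (S \<inter> T)"
  by (rule addcI[OF q.Q_additive])

lemma S_U: "A \<in> S \<Longrightarrow> A \<in> U"
proof (rule cp_leftI[OF UV])
  fix B f assume a: "A \<in> S" "B \<in> V" "f \<in> Hom C A (omap F B)"
  then have "carrier (Ext1 C F A B) = {one (Ext1 C F A B)}"
    using SV unfolding Ext1_vanishes_def by blast
  then show "f = Zero C A (omap F B)" using a by (simp add: Ext1_def)
qed (use cp_closed(1)[OF ST] in blast)

lemma V_T: "B \<in> V \<Longrightarrow> B \<in> T"
proof (rule cp_rightI[OF ST])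
  fix A f assume a: "B \<in> V" "A \<in> S" "f \<in> Hom C A (omap F B)"
  then have "carrier (Ext1 C F A B) = {one (Ext1 C F A B)}"
    using SV unfolding Ext1_vanishes_def by blast
  then show "f = Zero C A (omap F B)" using a by (simp add: Ext1_def)
qed (use cp_closed(2)[OF UV] in blast)

lemmas vanish_ST = cp_vanish[OF ST]
lemmas vanish_UV = cp_vanish[OF UV]

lemma memb_obj:
  "A \<in> S \<Longrightarrow> A \<in> Obj C" "A \<in> T \<Longrightarrow> A \<in> Obj C" "A \<in> U \<Longrightarrow> A \<in> Obj C" "A \<in> V \<Longrightarrow> A \<in> Obj C"
  using cp_closed(1,2)[OF ST] cp_closed(1,2)[OF UV] by blast+

section \<open>Vanishing in the quotient and triangles that split there\<close>

lemma fac_cl: "f \<in> Hom C X J \<Longrightarrow> g \<in> Hom C J Y \<Longrightarrow> J \<in> I \<Longrightarrow> cl (g \<cdot> f) = Zero Q X Y"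
  using q.Q_zero_iff[of "g \<cdot> f" X Y] q.facI comp_hom by blast

lemma cl_zeroE:
  assumes "cl f = Zero Q X Y" "f \<in> Hom C X Y"
  obtains J a b where "J \<in> I" "a \<in> Hom C X J" "b \<in> Hom C J Y" "f = b \<cdot> a"
  using q.Q_zero_iff[OF assms(2)] assms(1) by (blast elim: q.facE)

lemma cl_eqE:
  assumes "cl f = cl g" "f \<in> Hom C X Y" "g \<in> Hom C X Y"
  obtains J a b where "J \<in> I" "a \<in> Hom C X J" "b \<in> Hom C J Y" "f \<oplus> Neg C g = b \<cdot> a"
  using q.cl_eq_iff[OF assms(2,3)] assms(1) by (blast elim: q.facE)

lemma cl_eq_facI:
  assumes "f \<in> Hom C X Y" "g \<in> Hom C X Y" "f \<oplus> Neg C g = b \<cdot> a" "J \<in> I" "a \<in> Hom C X J" "b \<in> Hom C J Y"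
  shows "cl f = cl g"
  using q.cl_eqI[OF assms(1,2)] q.facI[OF assms(4-6)] assms(3) by simp

lemma S_to_T_zero: "f \<in> Hom C A B \<Longrightarrow> A \<in> S \<Longrightarrow> B \<in> T \<Longrightarrow> cl f = Zero Q A B"
  using cp_factor[OF ST, of f A B] fac_cl by metis

lemma U_to_V_zero: "f \<in> Hom C A B \<Longrightarrow> A \<in> U \<Longrightarrow> B \<in> V \<Longrightarrow> cl f = Zero Q A B"
  using cp_factor[OF UV, of f A B] fac_cl conc by metis

text \<open>The identity of A factors through an object of I, so A is a retract of it, and both S
  and T are closed under retracts.\<close>

lemma zero_in_I:
  assumes "A \<in> Obj C" "Ident Q A = Zero Q A A"
  shows "A \<in> I"
proof -
  have "cl (Ident C A) = Zero Q A A" using assms(2) by simp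
  then obtain J a b where J: "J \<in> I" "a \<in> Hom C A J" "b \<in> Hom C J A" "Ident C A = b \<cdot> a"
    by (rule cl_zeroE[OF _ ident_hom[OF assms(1)]])
  show ?thesis
    using retract_closed[OF cp_closed(5)[OF ST] _ J(2,3)] retract_closed[OF cp_closed(6)[OF ST] _ J(2,3)] J by simp
qed

lemma I_zero: "J \<in> I \<Longrightarrow> Ident Q J = Zero Q J J"
  using fac_cl[of "Ident C J" J J "Ident C J" J] memb_obj(1)[of J] by (simp add: Hom_iff)

lemma I_hom_zero:
  assumes "J \<in> I"
  shows "f \<in> Hom Q J X \<Longrightarrow> f = Zero Q J X" "f \<in> Hom Q X J \<Longrightarrow> f = Zero Q X J"
proof -
  have "is_zero_object Q J"
    using Qa.zero_object_iff[of J] I_zero[OF assms] memb_obj(1) assms by simp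
  then show "f \<in> Hom Q J X \<Longrightarrow> f = Zero Q J X" "f \<in> Hom Q X J \<Longrightarrow> f = Zero Q X J"
    using Qa.zero_obj_hom_eq by blast+
qed

text \<open>The zero third arrow gives a section \<open>s\<close> of \<open>k\<close>. The error of
  \<open>s \<cdot> k\<close> factors through an arrow from Y to J, and such arrows die in the
  quotient. This last condition is kept as a hypothesis since J is sometimes an object of V and Y an
  object of U. \<open>split_right0\<close> is dual.\<close>

lemma split_left0:
  assumes d: "(e, k, Zero C W (omap F J)) \<in> D" and e: "e \<in> Hom C J Y" "k \<in> Hom C Y W"
    and J: "\<And>l. l \<in> Hom C Y J \<Longrightarrow> cl l = Zero Q Y J"
  shows "is_isom Q (cl k)"
proof -
  note H = dist_homs[OF d e]
  have "Zero C W (omap F J) \<cdot> Ident C W = Zero C W (omap F J)" using H by simp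
  then obtain s where s: "s \<in> Hom C W Y" "k \<cdot> s = Ident C W" using lift2[OF d e ident_hom[OF H(5)]] by blast
  have dH: "Ident C Y \<oplus> Neg C (s \<cdot> k) \<in> Hom C Y Y" using s e H by (simp add: Hom_iff)
  have "k \<cdot> (Ident C Y \<oplus> Neg C (s \<cdot> k)) = Zero C Y W"
    using s e H comp_cancel_left[OF s(2,1) e(2), of k] by (simp add: Hom_iff)
  then obtain l where l: "l \<in> Hom C Y J" "e \<cdot> l = Ident C Y \<oplus> Neg C (s \<cdot> k)" using lift[OF d e dH] by blast
  have "cl (e \<cdot> l) = Zero Q Y Y"
    using q.Q_comp[OF l(1) e(1)] J[OF l(1)] e(1) H by (simp add: Hom_iff)
  then have "cl (Ident C Y) = cl (s \<cdot> k)"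
    using q.cl_eqI[OF ident_hom[OF H(4)] comp_hom[OF e(2) s(1)]] q.Q_zero_iff[OF dH] l(2) by simp
  then have "cl s \<star> cl k = Ident Q Y" "cl k \<star> cl s = Ident Q W"
    using q.Q_comp[OF e(2) s(1)] q.Q_comp[OF s(1) e(2)] s(2) by simp_all
  then show ?thesis using Qa.is_isomI[OF q.cl_hom[OF e(2)] q.cl_hom[OF s(1)]] by blast
qed

lemma split_right0:
  assumes d: "(j, e, Zero C J (omap F X)) \<in> D" and e: "j \<in> Hom C X Y" "e \<in> Hom C Y J"
    and J: "\<And>l. l \<in> Hom C J Y \<Longrightarrow> cl l = Zero Q J Y"
  shows "is_isom Q (cl j)"
proof -
  note H = dist_homs[OF d e]
  have "amap F (Ident C X) \<cdot> Zero C J (omap F X) = Zero C J (omap F X)" using H by simp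
  then obtain r where r: "r \<in> Hom C Y X" "r \<cdot> j = Ident C X" using extend0[OF d e ident_hom[OF H(3)]] by blast
  have dH: "Ident C Y \<oplus> Neg C (j \<cdot> r) \<in> Hom C Y Y" using r e H by (simp add: Hom_iff)
  have "(Ident C Y \<oplus> Neg C (j \<cdot> r)) \<cdot> j = Zero C X Y" using r e H by (simp add: Hom_iff)
  then obtain l where l: "l \<in> Hom C J Y" "l \<cdot> e = Ident C Y \<oplus> Neg C (j \<cdot> r)" using extend[OF d e dH] by blast
  have "cl (l \<cdot> e) = Zero Q Y Y"
    using q.Q_comp[OF e(2) l(1)] J[OF l(1)] e(2) H by (simp add: Hom_iff)
  then have "cl (Ident C Y) = cl (j \<cdot> r)"
    using q.cl_eqI[OF ident_hom[OF H(4)] comp_hom[OF r(1) e(1)]] q.Q_zero_iff[OF dH] l(2) by simp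
  then have "cl j \<star> cl r = Ident Q Y" "cl r \<star> cl j = Ident Q X"
    using q.Q_comp[OF r(1) e(1)] q.Q_comp[OF e(1) r(1)] r(2) by simp_all
  then show ?thesis using Qa.is_isomI[OF q.cl_hom[OF e(1)] q.cl_hom[OF r(1)]] by blast
qed

lemma split_left:
  assumes "(e, k, Zero C W (omap F J)) \<in> D" "e \<in> Hom C J Y" "k \<in> Hom C Y W" "J \<in> I"
  shows "is_isom Q (cl k)"
  by (rule split_left0[OF assms(1-3)]) (use I_hom_zero(2)[OF assms(4)] q.cl_hom in blast)

lemma split_right:
  assumes "(j, e, Zero C J (omap F X)) \<in> D" "j \<in> Hom C X Y" "e \<in> Hom C Y J" "J \<in> I"
  shows "is_isom Q (cl j)"
  by (rule split_right0[OF assms(1-3)]) (use I_hom_zero(1)[OF assms(4)] q.cl_hom in blast)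

text \<open>The common shape of the triangles behind both shifts: for \<open>tri_plus X\<close> the
  end A is X, for \<open>tri_minus X\<close> the end B is X. One set of lemmas thus serves
  both.\<close>

definition itri :: "'o \<Rightarrow> 'a \<Rightarrow> 'o \<Rightarrow> 'a \<Rightarrow> 'o \<Rightarrow> 'a \<Rightarrow> bool" where
  "itri A j J p B w \<longleftrightarrow> (j, p, w) \<in> D \<and> j \<in> Hom C A J \<and> p \<in> Hom C J B \<and> A \<in> T \<and> J \<in> I \<and> B \<in> U"

context
  fixes A j J p B w assumes it: "itri A j J p B w"
begin

lemma itriD: "(j, p, w) \<in> D" "j \<in> Hom C A J" "p \<in> Hom C J B" "A \<in> T" "J \<in> I" "B \<in> U"
  "w \<in> Hom C B (omap F A)"
  using it dist_homs unfolding itri_def by blast+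

text \<open>The obstruction \<open>amap F j \<cdot> g\<close> runs from W in U to the shift of J,
  and J lies in V.\<close>

lemma itri_lift:
  assumes "W \<in> U" "g \<in> Hom C W (omap F A)"
  obtains h where "h \<in> Hom C W B" "w \<cdot> h = g"
  using lift3[OF itriD(1-3) assms(2)] vanish_UV[OF comp_hom[OF assms(2) F_hom[OF itriD(2)]] assms(1) I_memb(4)[OF itriD(5)]]
  by blast

text \<open>A difference killed by \<open>w\<close> factors through \<open>p\<close>, hence through
  J in I. Conversely \<open>w\<close> kills every arrow through I, because an arrow from an object
  of S to the shift of A in T is zero.\<close>

lemma itri_lift_eq:
  assumes h: "h \<in> Hom C W B" "h' \<in> Hom C W B"
  shows "w \<cdot> h = w \<cdot> h' \<longleftrightarrow> cl h = cl h'"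
proof
  note o = hom_objs[OF h(1)] hom_objs[OF itriD(7)]
  assume e: "w \<cdot> h = w \<cdot> h'"
  have dH: "h \<oplus> Neg C h' \<in> Hom C W B" using h by (simp add: Hom_iff)
  have "w \<cdot> (h \<oplus> Neg C h') = Zero C W (omap F A)" using h itriD(7) e by (simp add: Hom_iff)
  then obtain l where l: "l \<in> Hom C W J" "p \<cdot> l = h \<oplus> Neg C h'" using lift2[OF itriD(1-3) dH] by blast
  show "cl h = cl h'" by (rule cl_eq_facI[OF h l(2)[symmetric] itriD(5) l(1) itriD(3)])
next
  note o = hom_objs[OF h(1)] hom_objs[OF itriD(7)]
  assume "cl h = cl h'"
  then obtain J' a b where J': "J' \<in> I" "a \<in> Hom C W J'" "b \<in> Hom C J' B" "h \<oplus> Neg C h' = b \<cdot> a"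
    by (rule cl_eqE[OF _ h])
  have wb: "w \<cdot> b = Zero C J' (omap F A)" using vanish_ST[OF comp_hom[OF J'(3) itriD(7)] I_memb(1)[OF J'(1)] itriD(4)] .
  have "w \<cdot> h \<oplus> Neg C (w \<cdot> h') = w \<cdot> (h \<oplus> Neg C h')" using h itriD(7) by (simp add: Hom_iff)
  also have "\<dots> = Zero C W (omap F A)"
    unfolding J'(4) using comp_rewrite1[OF wb J'(3) itriD(7), of a] J'(2) o by (simp add: Hom_iff)
  finally show "w \<cdot> h = w \<cdot> h'" using sub_zero[OF comp_hom[OF h(1) itriD(7)] comp_hom[OF h(2) itriD(7)]] by simp
qed

lemma itri_ext:
  assumes "W \<in> T" "g \<in> Hom C B (omap F W)"
  obtains f where "f \<in> Hom C A W" "amap F f \<cdot> w = g"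
proof -
  have "g \<cdot> p = Zero C J (omap F W)"
    using vanish_ST[OF comp_hom[OF itriD(3) assms(2)] I_memb(1)[OF itriD(5)] assms(1)] .
  then obtain k where k: "k \<in> Hom C (omap F A) (omap F W)" "k \<cdot> w = g"
    using extend2[OF itriD(1-3) assms(2)] by blast
  obtain f where "f \<in> Hom C A W" "amap F f = k" using F_full[OF k(1)] memb_obj(2) itriD(4) assms(1) by blast
  then show thesis using that k by blast
qed

text \<open>The same argument on the other side: a difference killed after \<open>w\<close> extends
  over \<open>j\<close>, and arrows of the form \<open>amap F a \<cdot> w\<close> with target the
  shift of an object of I run from U to V[1].\<close>

lemma itri_ext_eq:
  assumes f: "f \<in> Hom C A W" "f' \<in> Hom C A W"
  shows "amap F f \<cdot> w = amap F f' \<cdot> w \<longleftrightarrow> cl f = cl f'"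
proof
  note o = hom_objs[OF f(1)] hom_objs[OF itriD(7)]
  assume e: "amap F f \<cdot> w = amap F f' \<cdot> w"
  have dH: "f \<oplus> Neg C f' \<in> Hom C A W" using f by (simp add: Hom_iff)
  have "amap F (f \<oplus> Neg C f') \<cdot> w = Zero C B (omap F W)" using f itriD(7) e o by (simp add: Hom_iff)
  then obtain l where l: "l \<in> Hom C J W" "l \<cdot> j = f \<oplus> Neg C f'" using extend0[OF itriD(1-3) dH] by blast
  show "cl f = cl f'" by (rule cl_eq_facI[OF f l(2)[symmetric] itriD(5,2) l(1)])
next
  note o = hom_objs[OF f(1)] hom_objs[OF itriD(7)]
  assume "cl f = cl f'"
  then obtain J' a b where J': "J' \<in> I" "a \<in> Hom C A J'" "b \<in> Hom C J' W" "f \<oplus> Neg C f' = b \<cdot> a"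
    by (rule cl_eqE[OF _ f])
  have aw: "amap F a \<cdot> w = Zero C B (omap F J')"
    using vanish_UV[OF comp_hom[OF itriD(7) F_hom[OF J'(2)]] itriD(6) I_memb(4)[OF J'(1)]] .
  have "amap F f \<cdot> w \<oplus> Neg C (amap F f' \<cdot> w) = amap F (f \<oplus> Neg C f') \<cdot> w" using f itriD(7) by (simp add: Hom_iff)
  also have "\<dots> = Zero C B (omap F W)"
    unfolding J'(4) using aw J'(2,3) itriD(7) o by (simp add: Hom_iff)
  finally show "amap F f \<cdot> w = amap F f' \<cdot> w"
    using sub_zero[OF comp_hom[OF itriD(7) F_hom[OF f(1)]] comp_hom[OF itriD(7) F_hom[OF f(2)]]] by simp
qed

end

text \<open>The universal property of a reflection into T/I, without asking Y' to lie in T. In this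
  generality reflections compose and cancel, and every map with cone in S is one; if the target does
  lie in T it is unique up to isomorphism. \<open>corefl\<close> is the dual notion for U.\<close>

definition refl :: "'o \<Rightarrow> 'o \<Rightarrow> 'a set \<Rightarrow> bool" where
  "refl Y Y' t \<longleftrightarrow> t \<in> Hom Q Y Y' \<and> (\<forall>W \<in> T. \<forall>k \<in> Hom Q Y W. \<exists>!k'. k' \<in> Hom Q Y' W \<and> k' \<star> t = k)"

definition corefl :: "'o \<Rightarrow> 'o \<Rightarrow> 'a set \<Rightarrow> bool" where
  "corefl X' X u \<longleftrightarrow> u \<in> Hom Q X' X \<and> (\<forall>W \<in> U. \<forall>k \<in> Hom Q W X. \<exists>!k'. k' \<in> Hom Q W X' \<and> u \<star> k' = k)"

lemma refl_hom: "refl Y Y' t \<Longrightarrow> t \<in> Hom Q Y Y'"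
  unfolding refl_def by blast

lemma refl_ex:
  assumes "refl Y Y' t" "k \<in> Hom Q Y W" "W \<in> T"
  obtains k' where "k' \<in> Hom Q Y' W" "k' \<star> t = k"
  using assms unfolding refl_def by blast

lemma refl_eq:
  "refl Y Y' t \<Longrightarrow> k \<in> Hom Q Y' W \<Longrightarrow> k' \<in> Hom Q Y' W \<Longrightarrow> W \<in> T \<Longrightarrow> k \<star> t = k' \<star> t \<Longrightarrow> k = k'"
  using Qa.comp_hom unfolding refl_def by metis

lemma corefl_hom: "corefl X' X u \<Longrightarrow> u \<in> Hom Q X' X"
  unfolding corefl_def by blast

lemma corefl_ex:
  assumes "corefl X' X u" "k \<in> Hom Q W X" "W \<in> U"
  obtains k' where "k' \<in> Hom Q W X'" "u \<star> k' = k"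
  using assms unfolding corefl_def by blast

lemma corefl_eq:
  "corefl X' X u \<Longrightarrow> k \<in> Hom Q W X' \<Longrightarrow> k' \<in> Hom Q W X' \<Longrightarrow> W \<in> U \<Longrightarrow> u \<star> k = u \<star> k' \<Longrightarrow> k = k'"
  using Qa.comp_hom unfolding corefl_def by metis

lemma refl_comp:
  assumes "refl X Y s" "refl Y Y' t"
  shows "refl X Y' (t \<star> s)"
  unfolding refl_def
proof (intro conjI ballI)
  note s = refl_hom[OF assms(1)] and t = refl_hom[OF assms(2)]
  show "t \<star> s \<in> Hom Q X Y'" using Qa.comp_hom s t by blast
  fix W k assume W: "W \<in> T" and k: "k \<in> Hom Q X W"
  obtain k1 where k1: "k1 \<in> Hom Q Y W" "k1 \<star> s = k" by (rule refl_ex[OF assms(1) k W])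
  obtain k2 where k2: "k2 \<in> Hom Q Y' W" "k2 \<star> t = k1" by (rule refl_ex[OF assms(2) k1(1) W])
  show "\<exists>!k'. k' \<in> Hom Q Y' W \<and> k' \<star> (t \<star> s) = k"
  proof (intro ex1I[of _ k2] conjI)
    show "k2 \<star> (t \<star> s) = k" using Qa.comp_assoc[OF s t k2(1)] k1 k2 by simp
    fix k' assume k': "k' \<in> Hom Q Y' W \<and> k' \<star> (t \<star> s) = k"
    then have h: "k' \<in> Hom Q Y' W" and e: "k' \<star> (t \<star> s) = k" by blast+
    have "(k' \<star> t) \<star> s = (k2 \<star> t) \<star> s"
      using Qa.comp_assoc[OF s t h] Qa.comp_assoc[OF s t k2(1)] k1 k2 e by simp
    then have "k' \<star> t = k2 \<star> t" by (rule refl_eq[OF assms(1) Qa.comp_hom[OF t h] Qa.comp_hom[OF t k2(1)] W])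
    then show "k' = k2" by (rule refl_eq[OF assms(2) h k2(1) W])
  qed (rule k2(1))
qed

lemma refl_cancel:
  assumes "refl X Y s" "refl X Y' (t \<star> s)" "t \<in> Hom Q Y Y'"
  shows "refl Y Y' t"
  unfolding refl_def
proof (intro conjI ballI)
  note s = refl_hom[OF assms(1)] and t = assms(3)
  show "t \<in> Hom Q Y Y'" by (rule t)
  fix W k assume W: "W \<in> T" and k: "k \<in> Hom Q Y W"
  obtain k1 where k1: "k1 \<in> Hom Q Y' W" "k1 \<star> (t \<star> s) = k \<star> s"
    by (rule refl_ex[OF assms(2) Qa.comp_hom[OF s k] W])
  have ass: "x \<star> (t \<star> s) = (x \<star> t) \<star> s" if "x \<in> Hom Q Y' W" for x using Qa.comp_assoc[OF s t that] .
  show "\<exists>!k'. k' \<in> Hom Q Y' W \<and> k' \<star> t = k"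
  proof (intro ex1I[of _ k1] conjI)
    show "k1 \<star> t = k" using refl_eq[OF assms(1) Qa.comp_hom[OF t k1(1)] k W] ass[OF k1(1)] k1 by simp
    fix k' assume k': "k' \<in> Hom Q Y' W \<and> k' \<star> t = k"
    then show "k' = k1" using refl_eq[OF assms(2) _ k1(1) W, of k'] ass[of k'] k1 by simp
  qed (rule k1(1))
qed

lemma refl_isom:
  assumes "is_isom Q t" "t \<in> Hom Q Y Y'"
  shows "refl Y Y' t"
  unfolding refl_def
proof (intro conjI ballI)
  show "t \<in> Hom Q Y Y'" by (rule assms)
  obtain t' where t': "t' \<in> Hom Q Y' Y" "t' \<star> t = Ident Q Y" "t \<star> t' = Ident Q Y'"
    using Qa.is_isomE[OF assms] by metis
  fix W k assume k: "k \<in> Hom Q Y W"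
  show "\<exists>!k'. k' \<in> Hom Q Y' W \<and> k' \<star> t = k"
  proof (intro ex1I[of _ "k \<star> t'"] conjI)
    show "k \<star> t' \<in> Hom Q Y' W" by (rule Qa.comp_hom[OF t'(1) k])
    show 1: "k \<star> t' \<star> t = k" using k t' assms(2) by (simp add: Hom_iff)
    fix k' assume k': "k' \<in> Hom Q Y' W \<and> k' \<star> t = k"
    then show "k' = k \<star> t'" using Qa.isom_epi[OF assms _ Qa.comp_hom[OF t'(1) k]] 1 by simp
  qed
qed

lemma refl_to_T:
  assumes "refl X A s" "refl X B t" "A \<in> T" "B \<in> T"
  obtains z where "z \<in> Hom Q A B" "is_isom Q z" "z \<star> s = t"
proof -
  note s = refl_hom[OF assms(1)] and t = refl_hom[OF assms(2)]
  obtain z where z: "z \<in> Hom Q A B" "z \<star> s = t" by (rule refl_ex[OF assms(1) t assms(4)])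
  obtain y where y: "y \<in> Hom Q B A" "y \<star> t = s" by (rule refl_ex[OF assms(2) s assms(3)])
  have "(y \<star> z) \<star> s = Ident Q A \<star> s" "(z \<star> y) \<star> t = Ident Q B \<star> t" using z y s t by (simp_all add: Hom_iff)
  then have "y \<star> z = Ident Q A" "z \<star> y = Ident Q B"
    using refl_eq[OF assms(1) Qa.comp_hom[OF z(1) y(1)] Qa.ident_hom assms(3)]
      refl_eq[OF assms(2) Qa.comp_hom[OF y(1) z(1)] Qa.ident_hom assms(4)] memb_obj(2) assms(3,4) by auto
  then show thesis using that z y Qa.is_isomI by blast
qed

lemma corefl_to_U:
  assumes "corefl A X s" "corefl B X t" "A \<in> U" "B \<in> U"
  obtains z where "z \<in> Hom Q A B" "is_isom Q z" "t \<star> z = s"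
proof -
  note s = corefl_hom[OF assms(1)] and t = corefl_hom[OF assms(2)]
  obtain z where z: "z \<in> Hom Q A B" "t \<star> z = s" by (rule corefl_ex[OF assms(2) s assms(3)])
  obtain y where y: "y \<in> Hom Q B A" "s \<star> y = t" by (rule corefl_ex[OF assms(1) t assms(4)])
  have "s \<star> (y \<star> z) = (s \<star> y) \<star> z" "t \<star> (z \<star> y) = (t \<star> z) \<star> y" using z(1) y(1) s t by (simp_all add: Hom_iff)
  then have "s \<star> (y \<star> z) = s \<star> Ident Q A" "t \<star> (z \<star> y) = t \<star> Ident Q B"
    unfolding z(2) y(2) using s t by (simp_all add: Hom_iff z(2) y(2))
  then have "y \<star> z = Ident Q A" "z \<star> y = Ident Q B"
    using corefl_eq[OF assms(1) Qa.comp_hom[OF z(1) y(1)] Qa.ident_hom assms(3)]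
      corefl_eq[OF assms(2) Qa.comp_hom[OF y(1) z(1)] Qa.ident_hom assms(4)] memb_obj(3) assms(3,4) by auto
  then show thesis using that z y Qa.is_isomI by blast
qed

lemma cone_S_extend:
  assumes d: "(t, w, r) \<in> D" and t: "t \<in> Hom C M M'" "w \<in> Hom C M' S0" "S0 \<in> S"
    and k: "k \<in> Hom C M W" "W \<in> T"
  obtains k' where "k' \<in> Hom C M' W" "k' \<cdot> t = k"
  using extend0[OF d t(1,2) k(1)] vanish_ST[OF comp_hom[OF dist_homs(2)[OF d t(1,2)] F_hom[OF k(1)]] t(3) k(2)] by blast

text \<open>Arrows into W in T extend over \<open>t\<close> because Ext^1(S, T) = 0. Two extensions
  that agree modulo I differ, up to an arrow through I, by an arrow through S0, and arrows from S to
  T vanish in the quotient.\<close>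

lemma cone_S_refl:
  assumes d: "(t, w, r) \<in> D" and t: "t \<in> Hom C M M'" "w \<in> Hom C M' S0" "S0 \<in> S"
  shows "refl M M' (cl t)"
  unfolding refl_def
proof (intro conjI ballI)
  show "cl t \<in> Hom Q M M'" by (rule q.cl_hom[OF t(1)])
  fix W c assume W: "W \<in> T" and "c \<in> Hom Q M W"
  then obtain k where k: "k \<in> Hom C M W" "c = cl k" by (blast dest!: q.Q_hom_ex)
  obtain k1 where k1: "k1 \<in> Hom C M' W" "k1 \<cdot> t = k" by (rule cone_S_extend[OF d t k(1) W])
  show "\<exists>!k'. k' \<in> Hom Q M' W \<and> k' \<star> cl t = c"
  proof (intro ex1I[of _ "cl k1"] conjI)
    show "cl k1 \<in> Hom Q M' W" by (rule q.cl_hom[OF k1(1)])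
    show "cl k1 \<star> cl t = c" using q.Q_comp[OF t(1) k1(1)] k1 k by simp
    fix c' assume c': "c' \<in> Hom Q M' W \<and> c' \<star> cl t = c"
    then obtain l where l: "l \<in> Hom C M' W" "c' = cl l" by (blast dest!: q.Q_hom_ex)
    have "cl (l \<cdot> t) = cl (k1 \<cdot> t)" using c' k k1 l q.Q_comp[OF t(1) l(1)] by simp
    then obtain J a b where J: "J \<in> I" "a \<in> Hom C M J" "b \<in> Hom C J W" "l \<cdot> t \<oplus> Neg C (k1 \<cdot> t) = b \<cdot> a"
      by (rule cl_eqE[OF _ comp_hom[OF t(1) l(1)] comp_hom[OF t(1) k1(1)]])
    obtain a' where a': "a' \<in> Hom C M' J" "a' \<cdot> t = a" by (rule cone_S_extend[OF d t J(2) I_memb(2)[OF J(1)]])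
    note H = dist_homs[OF d t(1,2)]
    have oW: "W \<in> Obj C" using W memb_obj by blast
    \<comment> \<open>The factor \<open>a\<close> through J extends over \<open>t\<close> as J is in
      T; subtracting the extended composite makes the difference vanish strictly, not just modulo I,
      after \<open>t\<close>.\<close>
    define d where "d = (l \<oplus> Neg C k1) \<oplus> Neg C (b \<cdot> a')"
    have dH: "d \<in> Hom C M' W" unfolding d_def using l k1 a' J by (simp add: Hom_iff)
    have "d \<cdot> t = (l \<cdot> t \<oplus> Neg C (k1 \<cdot> t)) \<oplus> Neg C (b \<cdot> (a' \<cdot> t))"
      unfolding d_def using l(1) k1(1) a'(1) J(3) t(1) by (simp add: Hom_iff)
    also have "\<dots> = Zero C M W" unfolding a'(2) J(4) using J(2,3) by (simp add: Hom_iff)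
    finally obtain m where m: "m \<in> Hom C S0 W" "m \<cdot> w = d" using extend[OF assms(1) t(1,2) dH] by blast
    have "cl d = cl m \<star> cl w" using m q.Q_comp[OF t(2) m(1)] by simp
    also have "\<dots> = Zero Q M' W" unfolding S_to_T_zero[OF m(1) t(3) W] using t m oW H by (simp add: Hom_iff)
    finally obtain J' a2 b2 where J': "J' \<in> I" "a2 \<in> Hom C M' J'" "b2 \<in> Hom C J' W" "d = b2 \<cdot> a2"
      by (rule cl_zeroE[OF _ dH])
    have "(l \<oplus> Neg C k1) = d \<oplus> b \<cdot> a'"
      unfolding d_def using l(1) k1(1) a'(1) J(3) by (simp add: Hom_iff add_assoc)
    also have "\<dots> \<in> q.fac M' W"
      using q.fac_add[OF q.facI[OF J'(1-3)] q.facI[OF J(1) a'(1) J(3)]] J'(4) by simp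
    finally show "c' = cl k1" using q.cl_eqI[OF l(1) k1(1)] l(2) by simp
  qed
qed

lemma cone_V_lift:
  assumes d: "(u, v, w) \<in> D" and u: "u \<in> Hom C X A" "v \<in> Hom C A (omap F V0)" "V0 \<in> V"
    and k: "k \<in> Hom C W A" "W \<in> U"
  obtains k' where "k' \<in> Hom C W X" "u \<cdot> k' = k"
  using lift[OF d u(1,2) k(1)] vanish_UV[OF comp_hom[OF k(1) u(2)] k(2) u(3)] by blast

text \<open>Dual to \<open>cone_S_refl\<close>: lifts exist because Ext^1(U, V) = 0, and the
  ambiguity of a lift passes through V0, where arrows from U vanish in the quotient.\<close>

lemma cone_V_corefl:
  assumes d: "(u, v, w) \<in> D" and u: "u \<in> Hom C X A" "v \<in> Hom C A (omap F V0)" "V0 \<in> V"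
  shows "corefl X A (cl u)"
  unfolding corefl_def
proof (intro conjI ballI)
  show "cl u \<in> Hom Q X A" by (rule q.cl_hom[OF u(1)])
  fix W c assume W: "W \<in> U" and "c \<in> Hom Q W A"
  then obtain k where k: "k \<in> Hom C W A" "c = cl k" by (blast dest!: q.Q_hom_ex)
  obtain k1 where k1: "k1 \<in> Hom C W X" "u \<cdot> k1 = k" by (rule cone_V_lift[OF d u k(1) W])
  show "\<exists>!k'. k' \<in> Hom Q W X \<and> cl u \<star> k' = c"
  proof (intro ex1I[of _ "cl k1"] conjI)
    show "cl k1 \<in> Hom Q W X" by (rule q.cl_hom[OF k1(1)])
    show "cl u \<star> cl k1 = c" using q.Q_comp[OF k1(1) u(1)] k1 k by simp
    fix c' assume c': "c' \<in> Hom Q W X \<and> cl u \<star> c' = c"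
    then obtain l where l: "l \<in> Hom C W X" "c' = cl l" by (blast dest!: q.Q_hom_ex)
    have "cl (u \<cdot> l) = cl (u \<cdot> k1)" using c' k k1 l q.Q_comp[OF l(1) u(1)] by simp
    then obtain J a b where J: "J \<in> I" "a \<in> Hom C W J" "b \<in> Hom C J A" "u \<cdot> l \<oplus> Neg C (u \<cdot> k1) = b \<cdot> a"
      by (rule cl_eqE[OF _ comp_hom[OF l(1) u(1)] comp_hom[OF k1(1) u(1)]])
    obtain b' where b': "b' \<in> Hom C J X" "u \<cdot> b' = b" by (rule cone_V_lift[OF d u J(3) I_memb(3)[OF J(1)]])
    note H = dist_homs[OF d u(1,2)]
    have oW: "W \<in> Obj C" "V0 \<in> Obj C" using W u(3) memb_obj by blast+
    define d where "d = (l \<oplus> Neg C k1) \<oplus> Neg C (b' \<cdot> a)"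
    have dH: "d \<in> Hom C W X" unfolding d_def using l k1 b' J by (simp add: Hom_iff)
    have ub: "u \<cdot> (b' \<cdot> a) = b \<cdot> a" using comp_rewrite1[OF b'(2,1) u(1), of a] J(2) by (simp add: Hom_iff)
    have "u \<cdot> d = (u \<cdot> l \<oplus> Neg C (u \<cdot> k1)) \<oplus> Neg C (u \<cdot> (b' \<cdot> a))"
      unfolding d_def using l(1) k1(1) b'(1) J(2) u(1) by (simp add: Hom_iff)
    also have "\<dots> = Zero C W A" unfolding ub J(4) using J(2,3) by (simp add: Hom_iff)
    finally have ud: "u \<cdot> d = Zero C W A" .
    have w: "w \<in> Hom C (omap F V0) (omap F X)" by (rule H(2))
    \<comment> \<open>The arrow \<open>w\<close> starts at the shift of V0, so the factorisation
      through it exists only after shifting \<open>d\<close>; both factors are then brought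
      back.\<close>
    have "amap F u \<cdot> amap F d = Zero C (omap F W) (omap F A)"
      using F_comp[of d u] dH u(1) ud oW H by (simp add: Hom_iff del: F_comp)
    then obtain m where m: "m \<in> Hom C (omap F W) (omap F V0)" "w \<cdot> m = amap F d"
      using lift3[OF assms(1) u(1,2) F_hom[OF dH]] by blast
    obtain m0 where m0: "m0 \<in> Hom C W V0" "amap F m0 = m" using F_full[OF m(1) oW] by blast
    obtain w0 where w0: "w0 \<in> Hom C V0 X" "amap F w0 = w" using F_full[OF w oW(2) H(3)] by blast
    have "d = w0 \<cdot> m0"
      using F_faithful[OF dH comp_hom[OF m0(1) w0(1)]] m0 w0 m by (simp add: Hom_iff)
    then have "cl d = cl w0 \<star> cl m0" using q.Q_comp[OF m0(1) w0(1)] by simp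
    also have "\<dots> = Zero Q W X" unfolding U_to_V_zero[OF m0(1) W u(3)] using w0 m0 oW H by (simp add: Hom_iff)
    finally obtain J' a2 b2 where J': "J' \<in> I" "a2 \<in> Hom C W J'" "b2 \<in> Hom C J' X" "d = b2 \<cdot> a2"
      by (rule cl_zeroE[OF _ dH])
    have "(l \<oplus> Neg C k1) = d \<oplus> b' \<cdot> a"
      unfolding d_def using l(1) k1(1) b'(1) J(2) by (simp add: Hom_iff add_assoc)
    also have "\<dots> \<in> q.fac W X"
      using q.fac_add[OF q.facI[OF J'(1-3)] q.facI[OF J(1,2) b'(1)]] J'(4) by simp
    finally show "c' = cl k1" using q.cl_eqI[OF l(1) k1(1)] l(2) by simp
  qed
qed

section \<open>The functors of a concentric twin cotorsion pair\<close>

lemma P_simps [simp]: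
  "C_mod_I P = Q" "subI P = I" "subZ P = Z" "Z_mod_I P = full_subcategory Q Z"
  by (simp_all add: C_mod_I_def Z_mod_I_def subI_def subZ_def)

abbreviation "sg \<equiv> omap (sigmaT P K)"
abbreviation "sa \<equiv> amap (sigmaT P K)"
abbreviation "et \<equiv> unitT P K"
abbreviation "om \<equiv> omap (omegaU P K)"
abbreviation "oa \<equiv> amap (omegaU P K)"
abbreviation "ep \<equiv> counitU P K"
abbreviation "up \<equiv> omap (shift_plus P K)"
abbreviation "ua \<equiv> amap (shift_plus P K)"
abbreviation "dn \<equiv> omap (shift_minus P K)"
abbreviation "da \<equiv> amap (shift_minus P K)"
abbreviation "Sg \<equiv> omap (Sigma_ftor P K)"
abbreviation "Sa \<equiv> amap (Sigma_ftor P K)"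
abbreviation "Om \<equiv> omap (Omega_ftor P K)"
abbreviation "Oa \<equiv> amap (Omega_ftor P K)"
abbreviation "qq X \<equiv> snd (snd (tri_plus K X))"
abbreviation "ww X \<equiv> snd (snd (tri_minus K X))"

lemma functor_unfold:
  "Sg X = sg (up X)" "Sa f = sa (ua f)" "Om X = om (dn X)" "Oa f = oa (da f)"
  by (simp_all add: Sigma_ftor_def Omega_ftor_def comp_ftor_def)

lemma Z_memb: "X \<in> Z \<Longrightarrow> X \<in> T" "X \<in> Z \<Longrightarrow> X \<in> U" "X \<in> Z \<Longrightarrow> X \<in> Obj C"
  using memb_obj by blast+

lemma triT_data:
  assumes "X \<in> Obj C"
  obtains s t w A where "triT K X = (s, t, w)" "(s, t, w) \<in> D" "s \<in> Hom C A X" "t \<in> Hom C X (sg X)"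
    "w \<in> Hom C (sg X) (omap F A)" "omap F A \<in> S" "sg X \<in> T" "et X = cl t" "A \<in> Obj C"
proof -
  obtain s t w where *: "triT K X = (s, t, w)" "(s, t, w) \<in> D" "Dom C s \<in> unshift_set C F S" "Cod C s = X" "Cod C t \<in> T"
    using K assms unfolding valid_choices_def by auto
  have "sg X = Cod C t" "et X = cl t" using * by (simp_all add: sigmaT_def unitT_def Let_def)
  then show thesis using that[OF *(1,2)] * dist_arr[OF *(2)] by (auto simp: unshift_set_def)
qed

lemma triU_data:
  assumes "X \<in> Obj C"
  obtains u v w V0 where "triU K X = (u, v, w)" "(u, v, w) \<in> D" "u \<in> Hom C (om X) X" "v \<in> Hom C X (omap F V0)"
    "w \<in> Hom C (omap F V0) (omap F (om X))" "V0 \<in> V" "om X \<in> U" "ep X = cl u"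
proof -
  obtain u v w where *: "triU K X = (u, v, w)" "(u, v, w) \<in> D" "Dom C u \<in> U" "Cod C u = X"
    "Cod C v \<in> shift_set F V"
    using K assms unfolding valid_choices_def by auto
  have "om X = Dom C u" "ep X = cl u" using * by (simp_all add: omegaU_def counitU_def Let_def)
  then show thesis using that[OF *(1,2)] * dist_arr[OF *(2)] by (auto simp: shift_set_def)
qed

lemma unit_cone:
  assumes "X \<in> Obj C"
  obtains t w r S0 where "(t, w, r) \<in> D" "t \<in> Hom C X (sg X)" "w \<in> Hom C (sg X) S0" "S0 \<in> S" "et X = cl t"
proof -
  obtain s t w A where *: "(s, t, w) \<in> D" "s \<in> Hom C A X" "t \<in> Hom C X (sg X)"
    "w \<in> Hom C (sg X) (omap F A)" "omap F A \<in> S" "et X = cl t"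
    by (rule triT_data[OF assms])
  show thesis using that[OF rotate[OF *(1)] *(3,4,5,6)] .
qed

lemma sg_T: "X \<in> Obj C \<Longrightarrow> sg X \<in> T"
  by (erule triT_data)

lemma om_U: "X \<in> Obj C \<Longrightarrow> om X \<in> U"
  by (erule triU_data)

lemma et_refl: "X \<in> Obj C \<Longrightarrow> refl X (sg X) (et X)"
  by (erule unit_cone) (use cone_S_refl in metis)

lemma ep_corefl: "X \<in> Obj C \<Longrightarrow> corefl (om X) X (ep X)"
  by (erule triU_data) (use cone_V_corefl in metis)

lemmas et_hom = refl_hom[OF et_refl]
lemmas ep_hom = corefl_hom[OF ep_corefl]

lemma sg_Z: "X \<in> U \<Longrightarrow> sg X \<in> Z"
proof -
  assume X: "X \<in> U"
  obtain t w r S0 where *: "(t, w, r) \<in> D" "t \<in> Hom C X (sg X)" "w \<in> Hom C (sg X) S0" "S0 \<in> S"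
    by (rule unit_cone[OF memb_obj(3)[OF X]])
  show ?thesis using cp_left_ext[OF UV *(1-3) X S_U[OF *(4)]] sg_T memb_obj(3)[OF X] by blast
qed

text \<open>Morally \<open>om X\<close> is an extension of X by V0, both in T. To avoid shifting the
  triangle back, orthogonality to S is tested directly: an arrow from S to the shift of
  \<open>om X\<close> dies in the shift of X, hence comes from the shift of V0.\<close>

lemma om_Z: "X \<in> T \<Longrightarrow> om X \<in> Z"
proof -
  assume X: "X \<in> T"
  obtain u v w V0 where *: "(u, v, w) \<in> D" "u \<in> Hom C (om X) X" "v \<in> Hom C X (omap F V0)" "V0 \<in> V"
    by (rule triU_data[OF memb_obj(2)[OF X]])
  have "om X \<in> T"
  proof (rule cp_rightI[OF ST])
    show "om X \<in> Obj C" using * hom_objs by blast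
    fix A f assume A: "A \<in> S" and f: "f \<in> Hom C A (omap F (om X))"
    have "amap F u \<cdot> f = Zero C A (omap F X)" using vanish_ST[OF comp_hom[OF f F_hom[OF *(2)]] A X] .
    then obtain k where k: "k \<in> Hom C A (omap F V0)" "w \<cdot> k = f" using lift3[OF *(1-3) f] by blast
    note o = hom_objs[OF k(1)] hom_objs[OF f]
    show "f = Zero C A (omap F (om X))"
      using k vanish_ST[OF k(1) A V_T[OF *(4)]] dist_homs(2)[OF *(1-3)] o by (auto simp: Hom_iff)
  qed
  then show ?thesis using om_U memb_obj(2)[OF X] by blast
qed

section \<open>The adjoints on arrows, and the comparison transformation\<close>

lemma sa_eq:
  assumes "f \<in> Hom Q X Y"
  shows "sa f \<in> Hom Q (sg X) (sg Y)" "sa f \<star> et X = et Y \<star> f"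
proof -
  have o: "X \<in> Obj C" "Y \<in> Obj C" using Qa.hom_objs[OF assms] by auto
  have fd: "Dom Q f = X" "Cod Q f = Y" using assms by (auto simp: Hom_iff)
  have "\<exists>!g. g \<in> Hom Q (sg X) (sg Y) \<and> g \<star> et X = et Y \<star> f"
    using et_refl[OF o(1)] sg_T[OF o(2)] Qa.comp_hom[OF assms et_hom[OF o(2)]] unfolding refl_def by blast
  moreover have "sa f = (THE g. g \<in> Hom Q (sg X) (sg Y) \<and> g \<star> et X = et Y \<star> f)"
    using fd by (simp add: sigmaT_def Let_def)
  ultimately show "sa f \<in> Hom Q (sg X) (sg Y)" "sa f \<star> et X = et Y \<star> f"
    using theI'[of "\<lambda>g. g \<in> Hom Q (sg X) (sg Y) \<and> g \<star> et X = et Y \<star> f"] by auto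
qed

lemma oa_eq:
  assumes "f \<in> Hom Q X Y"
  shows "oa f \<in> Hom Q (om X) (om Y)" "ep Y \<star> oa f = f \<star> ep X"
proof -
  have o: "X \<in> Obj C" "Y \<in> Obj C" using Qa.hom_objs[OF assms] by auto
  have fd: "Dom Q f = X" "Cod Q f = Y" using assms by (auto simp: Hom_iff)
  have "\<exists>!g. g \<in> Hom Q (om X) (om Y) \<and> ep Y \<star> g = f \<star> ep X"
    using ep_corefl[OF o(2)] om_U[OF o(1)] Qa.comp_hom[OF ep_hom[OF o(1)] assms] unfolding corefl_def by blast
  moreover have "oa f = (THE g. g \<in> Hom Q (om X) (om Y) \<and> ep Y \<star> g = f \<star> ep X)"
    using fd by (simp add: omegaU_def Let_def)
  ultimately show "oa f \<in> Hom Q (om X) (om Y)" "ep Y \<star> oa f = f \<star> ep X"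
    using theI'[of "\<lambda>g. g \<in> Hom Q (om X) (om Y) \<and> ep Y \<star> g = f \<star> ep X"] by auto
qed

text \<open>The unit may be cancelled against B in T, and the counit against \<open>sg A\<close>,
  which lies in U. This gives both naturality and uniqueness of \<open>mu\<close>.\<close>

lemma sandwich_eq:
  assumes "A \<in> U" "B \<in> T" "a \<in> Hom Q (sg A) (om B)" "b \<in> Hom Q (sg A) (om B)"
    "ep B \<star> a \<star> et A = ep B \<star> b \<star> et A"
  shows "a = b"
proof -
  have o: "A \<in> Obj C" "B \<in> Obj C" using assms memb_obj by blast+
  have "ep B \<star> a = ep B \<star> b"
    using refl_eq[OF et_refl[OF o(1)] Qa.comp_hom[OF assms(3) ep_hom[OF o(2)]] Qa.comp_hom[OF assms(4) ep_hom[OF o(2)]] assms(2,5)] .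
  then show ?thesis using corefl_eq[OF ep_corefl[OF o(2)] assms(3,4)] sg_Z[OF assms(1)] by blast
qed

text \<open>Condition (I) speaks of \<open>mu\<close>, which is a definite description. Even its
  source and target become known only after existence and uniqueness of the natural transformation
  are proved.\<close>

lemma mu_hom:
  assumes "X \<in> Obj C"
  shows "mu P K X \<in> Hom Q (sg (om X)) (om (sg X))"
proof -
  let ?eq = "\<lambda>X m. ep (sg X) \<star> m \<star> et (om X) = et X \<star> ep X"
  have ex: "\<exists>m. m \<in> Hom Q (sg (om X)) (om (sg X)) \<and> ?eq X m" if X: "X \<in> Obj C" for X
  proof -
    have o: "om X \<in> Obj C" "sg X \<in> Obj C" using om_U[OF X] sg_T[OF X] memb_obj by blast+
    obtain k where k: "k \<in> Hom Q (sg (om X)) (sg X)" "k \<star> et (om X) = et X \<star> ep X"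
      by (rule refl_ex[OF et_refl[OF o(1)] Qa.comp_hom[OF ep_hom[OF X] et_hom[OF X]] sg_T[OF X]])
    have "sg (om X) \<in> U" using sg_Z[OF om_U[OF X]] by blast
    then show ?thesis using corefl_ex[OF ep_corefl[OF o(2)] k(1)] k(2) by metis
  qed
  \<comment> \<open>The default \<open>undefined\<close> off the objects matches the
    \<open>extensional\<close> clause of \<open>mu\<close>, which makes the transformation unique as
    a function.\<close>
  define m0 where "m0 X = (if X \<in> Obj C then SOME m. m \<in> Hom Q (sg (om X)) (om (sg X)) \<and> ?eq X m else undefined)" for X
  have m0: "m0 X \<in> Hom Q (sg (om X)) (om (sg X))" "?eq X (m0 X)" if "X \<in> Obj C" for X
    using someI_ex[OF ex[OF that]] that unfolding m0_def by auto
  define R where "R m \<longleftrightarrow> m \<in> extensional (Obj Q) \<and>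
     is_nat_trans Q (Z_mod_I P)
       (comp_ftor (sigmaT P K) (omegaU P K)) (comp_ftor (omegaU P K) (sigmaT P K)) m \<and>
     (\<forall>X \<in> Obj Q. ?eq X (m X))" for m
  have nat: "m0 Y \<star> sa (oa f) = oa (sa f) \<star> m0 X" if f: "f \<in> Hom Q X Y" for X Y f
  proof -
    have X: "X \<in> Obj C" "Y \<in> Obj C" using Qa.hom_objs[OF f] by auto
    have o: "om X \<in> Obj C" "sg X \<in> Obj C" "om Y \<in> Obj C" "sg Y \<in> Obj C"
      using om_U sg_T X memb_obj by blast+
    note h = m0(1)[OF X(1)] m0(1)[OF X(2)] sa_eq[OF f] oa_eq[OF f]
    note h2 = sa_eq[OF h(5)] oa_eq[OF h(3)]
    note e = et_hom[OF X(1)] et_hom[OF X(2)] ep_hom[OF X(1)] ep_hom[OF X(2)]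
      et_hom[OF o(1)] et_hom[OF o(3)] ep_hom[OF o(2)] ep_hom[OF o(4)]
    have "ep (sg Y) \<star> (m0 Y \<star> sa (oa f)) \<star> et (om X) = ep (sg Y) \<star> (m0 Y \<star> (sa (oa f) \<star> et (om X)))"
      using h(1,2) h2(1) e by (simp add: Hom_iff)
    also have "\<dots> = (ep (sg Y) \<star> m0 Y \<star> et (om Y)) \<star> oa f"
      unfolding h2(2) using h(1,2,5) h2(1) e by (simp add: Hom_iff)
    also have "\<dots> = et Y \<star> (ep Y \<star> oa f)" unfolding m0(2)[OF X(2)] using h(5) e by (simp add: Hom_iff)
    also have "\<dots> = (et Y \<star> f) \<star> ep X" unfolding h(6) using f e by (simp add: Hom_iff)
    also have "\<dots> = sa f \<star> (et X \<star> ep X)" unfolding h(4)[symmetric] using h(3) e by (simp add: Hom_iff)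
    also have "\<dots> = (sa f \<star> ep (sg X)) \<star> (m0 X \<star> et (om X))"
      unfolding m0(2)[OF X(1), symmetric] using h(1,3) e by (simp add: Hom_iff)
    also have "\<dots> = ep (sg Y) \<star> (oa (sa f) \<star> m0 X) \<star> et (om X)"
      unfolding h2(4)[symmetric] using h(1) h2(3) e by (simp add: Hom_iff)
    finally show ?thesis
      by (rule sandwich_eq[OF om_U[OF X(1)] sg_T[OF X(2)] Qa.comp_hom[OF h2(1) h(2)] Qa.comp_hom[OF h(1) h2(3)]])
  qed
  have ZZ: "sg (om X) \<in> Z" "om (sg X) \<in> Z" if "X \<in> Obj C" for X
    using om_Z[OF sg_T] sg_Z[OF om_U] that by blast+
  have "R m0"
    unfolding R_def is_nat_trans_def comp_ftor_def using m0 nat ZZ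
    by (auto simp: full_hom m0_def extensional_def)
  moreover have "m = m0" if "R m" for m
  proof
    fix X show "m X = m0 X"
    proof (cases "X \<in> Obj C")
      case True
      have "m X \<in> Hom Q (sg (om X)) (om (sg X))" "?eq X (m X)"
        using \<open>R m\<close> True unfolding R_def is_nat_trans_def comp_ftor_def by (auto simp: full_hom)
      then show ?thesis using sandwich_eq[OF om_U[OF True] sg_T[OF True]] m0[OF True] by simp
    next
      case False
      then show ?thesis using \<open>R m\<close> unfolding R_def extensional_def m0_def by simp
    qed
  qed
  ultimately have "(THE m. R m) = m0" by blast
  then have "mu P K = m0" unfolding mu_def R_def by (simp add: Let_def)
  then show ?thesis using m0(1)[OF assms] by simp
qed

section \<open>The two shifts attached to triangles through I\<close>

lemma plus_itri:
  assumes "X \<in> Z"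
  obtains i J p where "tri_plus K X = (i, p, qq X)" "itri X i J p (up X) (qq X)"
proof -
  obtain i p q where *: "tri_plus K X = (i, p, q)" "(i, p, q) \<in> D" "Dom C i = X" "Cod C i \<in> I" "Cod C p \<in> U"
  proof -
    have "\<forall>X \<in> subZ P. \<exists>i p q. tri_plus K X = (i, p, q) \<and> (i, p, q) \<in> dist P \<and>
        Dom (amb P) i = X \<and> Cod (amb P) i \<in> subI P \<and> Cod (amb P) p \<in> subU P"
      using K unfolding valid_choices_def by (elim conjE)
    from bspec[OF this, of X] assms that show thesis by auto
  qed
  have "up X = Cod C p" using * by (simp add: shift_plus_def Let_def)
  then have "itri X i (Cod C i) p (up X) (qq X)"
    unfolding itri_def using * dist_arr[OF *(2)] assms by auto
  then show thesis using that * by simp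
qed

lemma minus_itri:
  assumes "X \<in> Z"
  obtains j J k where "tri_minus K X = (j, k, ww X)" "itri (dn X) j J k X (ww X)"
proof -
  obtain j k l where *: "tri_minus K X = (j, k, l)" "(j, k, l) \<in> D" "Dom C j \<in> T" "Cod C j \<in> I" "Cod C k = X"
  proof -
    have "\<forall>X \<in> subZ P. \<exists>j k l. tri_minus K X = (j, k, l) \<and> (j, k, l) \<in> dist P \<and>
        Dom (amb P) j \<in> subT P \<and> Cod (amb P) j \<in> subI P \<and> Cod (amb P) k = X"
      using K unfolding valid_choices_def by (elim conjE)
    from bspec[OF this, of X] assms that show thesis by auto
  qed
  have "dn X = Dom C j" using * by (simp add: shift_minus_def Let_def)
  then have "itri (dn X) j (Cod C j) k X (ww X)"
    unfolding itri_def using * dist_arr[OF *(2)] assms by auto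
  then show thesis using that * by simp
qed

lemma up_U:
  assumes "X \<in> Z"
  shows "up X \<in> U" "qq X \<in> Hom C (up X) (omap F X)"
proof -
  obtain i J p where "itri X i J p (up X) (qq X)" by (rule plus_itri[OF assms])
  from itriD[OF this] show "up X \<in> U" "qq X \<in> Hom C (up X) (omap F X)" by blast+
qed

lemma dn_T:
  assumes "X \<in> Z"
  shows "dn X \<in> T" "ww X \<in> Hom C X (omap F (dn X))"
proof -
  obtain i J p where "itri (dn X) i J p X (ww X)" by (rule minus_itri[OF assms])
  from itriD[OF this] show "dn X \<in> T" "ww X \<in> Hom C X (omap F (dn X))" by blast+
qed

lemma plus_lift:
  assumes "X \<in> Z" "W \<in> U" "g \<in> Hom C W (omap F X)"
  obtains h where "h \<in> Hom C W (up X)" "qq X \<cdot> h = g"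
proof -
  obtain i J p where "itri X i J p (up X) (qq X)" by (rule plus_itri[OF assms(1)])
  from itri_lift[OF this assms(2,3)] that show thesis by blast
qed

lemma plus_lift_eq:
  "X \<in> Z \<Longrightarrow> h \<in> Hom C W (up X) \<Longrightarrow> h' \<in> Hom C W (up X) \<Longrightarrow> qq X \<cdot> h = qq X \<cdot> h' \<longleftrightarrow> cl h = cl h'"
  by (erule plus_itri) (rule itri_lift_eq)

lemma plus_ext_eq:
  "X \<in> Z \<Longrightarrow> f \<in> Hom C X W \<Longrightarrow> f' \<in> Hom C X W \<Longrightarrow> amap F f \<cdot> qq X = amap F f' \<cdot> qq X \<longleftrightarrow> cl f = cl f'"
  by (erule plus_itri) (rule itri_ext_eq)

lemma plus_ext:
  assumes "X \<in> Z" "W \<in> T" "g \<in> Hom C (up X) (omap F W)"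
  obtains f where "f \<in> Hom C X W" "amap F f \<cdot> qq X = g"
proof -
  obtain i J p where "itri X i J p (up X) (qq X)" by (rule plus_itri[OF assms(1)])
  from itri_ext[OF this assms(2,3)] that show thesis by blast
qed

lemma minus_lift:
  assumes "X \<in> Z" "W \<in> U" "g \<in> Hom C W (omap F (dn X))"
  obtains h where "h \<in> Hom C W X" "ww X \<cdot> h = g"
proof -
  obtain i J p where "itri (dn X) i J p X (ww X)" by (rule minus_itri[OF assms(1)])
  from itri_lift[OF this assms(2,3)] that show thesis by blast
qed

lemma minus_lift_eq:
  "X \<in> Z \<Longrightarrow> h \<in> Hom C W X \<Longrightarrow> h' \<in> Hom C W X \<Longrightarrow> ww X \<cdot> h = ww X \<cdot> h' \<longleftrightarrow> cl h = cl h'"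
  by (erule minus_itri) (rule itri_lift_eq)

lemma minus_ext_eq:
  "X \<in> Z \<Longrightarrow> f \<in> Hom C (dn X) W \<Longrightarrow> f' \<in> Hom C (dn X) W \<Longrightarrow> amap F f \<cdot> ww X = amap F f' \<cdot> ww X \<longleftrightarrow> cl f = cl f'"
  by (erule minus_itri) (rule itri_ext_eq)

lemma minus_ext:
  assumes "X \<in> Z" "W \<in> T" "g \<in> Hom C X (omap F W)"
  obtains f where "f \<in> Hom C (dn X) W" "amap F f \<cdot> ww X = g"
proof -
  obtain i J p where "itri (dn X) i J p X (ww X)" by (rule minus_itri[OF assms(1)])
  from itri_ext[OF this assms(2,3)] that show thesis by blast
qed

text \<open>The square over the connecting arrows suffices: \<open>fill_backE\<close> completes it
  to a morphism of triangles, as the description in \<open>shift_plus\<close> requires. Another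
  representative of \<open>cl x\<close> gives the same composite with \<open>qq X\<close>, hence the
  same class of \<open>u\<close>. \<open>da_eq\<close> is the mirror image.\<close>

lemma ua_eq:
  assumes X: "X \<in> Z" "Y \<in> Z" and x: "x \<in> Hom C X Y" and u: "u \<in> Hom C (up X) (up Y)"
    and e: "qq Y \<cdot> u = amap F x \<cdot> qq X"
  shows "ua (cl x) = cl u"
proof -
  obtain i J p where t: "tri_plus K X = (i, p, qq X)" "itri X i J p (up X) (qq X)" by (rule plus_itri[OF X(1)])
  obtain i' J' p' where t': "tri_plus K Y = (i', p', qq Y)" "itri Y i' J' p' (up Y) (qq Y)" by (rule plus_itri[OF X(2)])
  note a = itriD[OF t(2)] and b = itriD[OF t'(2)]
  have xd: "Dom Q (cl x) = X" "Cod Q (cl x) = Y" using x by (auto simp: Hom_iff)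
  obtain k where k: "k \<in> Hom C J J'" "u \<cdot> p = p' \<cdot> k"
    "amap F k \<cdot> Neg C (amap F i) = Neg C (amap F i') \<cdot> amap F x"
    using fill_backE[OF rotate[OF a(1)] rotate[OF b(1)] a(3,7) b(3,7) u F_hom[OF x] e[symmetric]] by blast
  have "amap F (k \<cdot> i) = amap F (i' \<cdot> x)" using k(1,3) a(2) b(2) x by (simp add: Hom_iff)
  then have ki: "k \<cdot> i = i' \<cdot> x" using F_faithful[OF comp_hom[OF a(2) k(1)] comp_hom[OF x b(2)]] by blast
  have tt: "is_tri_morph C F (tri_plus K X) (tri_plus K Y) = is_tri_morph C F (i, p, qq X) (i', p', qq Y)"
    by (rule arg_cong2[OF t(1) t'(1)])
  have m: "is_tri_morph C F (tri_plus K X) (tri_plus K Y) x k u"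
    unfolding tt tri_morph_iff[OF a(2,3,7) b(2,3,7)] using x k(1,2) u e ki by simp
  have "(\<exists>z i u. z \<in> cl x \<and> g = cl u \<and> is_tri_morph C F (tri_plus K X) (tri_plus K Y) z i u) \<longleftrightarrow> g = cl u" for g
  proof
    assume "\<exists>z i u. z \<in> cl x \<and> g = cl u \<and> is_tri_morph C F (tri_plus K X) (tri_plus K Y) z i u"
    then obtain z k' u' where z: "z \<in> cl x" "g = cl u'" "is_tri_morph C F (tri_plus K X) (tri_plus K Y) z k' u'" by blast
    have h: "z \<in> Hom C X Y" "u' \<in> Hom C (up X) (up Y)" "amap F z \<cdot> qq X = qq Y \<cdot> u'"
      using z(3) unfolding tt tri_morph_iff[OF a(2,3,7) b(2,3,7)] by auto
    have "cl z = cl x" using q.in_cl(3)[OF z(1) x] .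
    then have "amap F z \<cdot> qq X = amap F x \<cdot> qq X" using plus_ext_eq[OF X(1) h(1) x] by blast
    then have "qq Y \<cdot> u' = qq Y \<cdot> u" using h e by simp
    then show "g = cl u" using plus_lift_eq[OF X(2) h(2) u] z(2) by blast
  next
    assume "g = cl u"
    then show "\<exists>z i u. z \<in> cl x \<and> g = cl u \<and> is_tri_morph C F (tri_plus K X) (tri_plus K Y) z i u"
      using m q.cl_self x by (auto simp: Hom_iff)
  qed
  then show ?thesis unfolding shift_plus_def using xd by (simp add: Let_def)
qed

lemma da_eq:
  assumes X: "X \<in> Z" "Y \<in> Z" and x: "x \<in> Hom C X Y" and u: "u \<in> Hom C (dn X) (dn Y)"
    and e: "amap F u \<cdot> ww X = ww Y \<cdot> x"
  shows "da (cl x) = cl u"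
proof -
  obtain i J p where t: "tri_minus K X = (i, p, ww X)" "itri (dn X) i J p X (ww X)" by (rule minus_itri[OF X(1)])
  obtain i' J' p' where t': "tri_minus K Y = (i', p', ww Y)" "itri (dn Y) i' J' p' Y (ww Y)" by (rule minus_itri[OF X(2)])
  note a = itriD[OF t(2)] and b = itriD[OF t'(2)]
  have xd: "Dom Q (cl x) = X" "Cod Q (cl x) = Y" using x by (auto simp: Hom_iff)
  obtain k where k: "k \<in> Hom C J J'" "x \<cdot> p = p' \<cdot> k"
    "amap F k \<cdot> Neg C (amap F i) = Neg C (amap F i') \<cdot> amap F u"
    using fill_backE[OF rotate[OF a(1)] rotate[OF b(1)] a(3,7) b(3,7) x F_hom[OF u] e] by blast
  have "amap F (k \<cdot> i) = amap F (i' \<cdot> u)" using k(1,3) a(2) b(2) u by (simp add: Hom_iff)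
  then have ki: "k \<cdot> i = i' \<cdot> u" using F_faithful[OF comp_hom[OF a(2) k(1)] comp_hom[OF u b(2)]] by blast
  have tt: "is_tri_morph C F (tri_minus K X) (tri_minus K Y) = is_tri_morph C F (i, p, ww X) (i', p', ww Y)"
    by (rule arg_cong2[OF t(1) t'(1)])
  have m: "is_tri_morph C F (tri_minus K X) (tri_minus K Y) u k x"
    unfolding tt tri_morph_iff[OF a(2,3,7) b(2,3,7)] using x k(1,2) u e ki by simp
  have "(\<exists>t i z. z \<in> cl x \<and> g = cl t \<and> is_tri_morph C F (tri_minus K X) (tri_minus K Y) t i z) \<longleftrightarrow> g = cl u" for g
  proof
    assume "\<exists>t i z. z \<in> cl x \<and> g = cl t \<and> is_tri_morph C F (tri_minus K X) (tri_minus K Y) t i z"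
    then obtain z k' u' where z: "z \<in> cl x" "g = cl u'" "is_tri_morph C F (tri_minus K X) (tri_minus K Y) u' k' z" by blast
    have h: "z \<in> Hom C X Y" "u' \<in> Hom C (dn X) (dn Y)" "amap F u' \<cdot> ww X = ww Y \<cdot> z"
      using z(3) unfolding tt tri_morph_iff[OF a(2,3,7) b(2,3,7)] by auto
    have "cl z = cl x" using q.in_cl(3)[OF z(1) x] .
    then have "ww Y \<cdot> z = ww Y \<cdot> x" using minus_lift_eq[OF X(2) h(1) x] by blast
    then have "amap F u' \<cdot> ww X = amap F u \<cdot> ww X" using h e by simp
    then show "g = cl u" using minus_ext_eq[OF X(1) h(2) u] z(2) by blast
  next
    assume "g = cl u"
    then show "\<exists>t i z. z \<in> cl x \<and> g = cl t \<and> is_tri_morph C F (tri_minus K X) (tri_minus K Y) t i z"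
      using m q.cl_self x by (auto simp: Hom_iff)
  qed
  then show ?thesis unfolding shift_minus_def using xd by (simp add: Let_def)
qed

lemma ua_obtain:
  assumes X: "X \<in> Z" "Y \<in> Z" and x: "x \<in> Hom C X Y"
  obtains u where "u \<in> Hom C (up X) (up Y)" "qq Y \<cdot> u = amap F x \<cdot> qq X" "ua (cl x) = cl u"
  using plus_lift[OF X(2) up_U(1)[OF X(1)] comp_hom[OF up_U(2)[OF X(1)] F_hom[OF x]]] ua_eq[OF assms] that by metis

lemma da_obtain:
  assumes X: "X \<in> Z" "Y \<in> Z" and x: "x \<in> Hom C X Y"
  obtains u where "u \<in> Hom C (dn X) (dn Y)" "amap F u \<cdot> ww X = ww Y \<cdot> x" "da (cl x) = cl u"
  using minus_ext[OF X(1) dn_T(1)[OF X(2)] comp_hom[OF x dn_T(2)[OF X(2)]]] da_eq[OF assms] that by metis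

lemma Sg_Z: "X \<in> Z \<Longrightarrow> Sg X \<in> Z"
  unfolding functor_unfold by (rule sg_Z[OF up_U(1)])

lemma Om_Z: "X \<in> Z \<Longrightarrow> Om X \<in> Z"
  unfolding functor_unfold by (rule om_Z[OF dn_T(1)])

section \<open>Connecting classes and the functor Sigma\<close>

definition delta :: "'o \<Rightarrow> 'a \<Rightarrow> 'a set" where
  "delta X b = et (up X) \<star> cl (SOME c. c \<in> Hom C (Dom C b) (up X) \<and> qq X \<cdot> c = b)"

text \<open>Two lifts of one arrow along \<open>qq X\<close> agree modulo I, so the choice in
  \<open>delta\<close> has no effect.\<close>

lemma delta_eq:
  assumes "X \<in> Z" "c \<in> Hom C M (up X)"
  shows "delta X (qq X \<cdot> c) = et (up X) \<star> cl c"
proof -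
  have d: "Dom C (qq X \<cdot> c) = M" using assms(2) up_U[OF assms(1)] by (simp add: Hom_iff)
  let ?c = "SOME c'. c' \<in> Hom C M (up X) \<and> qq X \<cdot> c' = qq X \<cdot> c"
  have "?c \<in> Hom C M (up X) \<and> qq X \<cdot> ?c = qq X \<cdot> c" by (rule someI[of _ c]) (use assms in simp)
  then have "cl ?c = cl c" using plus_lift_eq[OF assms(1)] assms(2) by blast
  then show ?thesis unfolding delta_def d by simp
qed

lemma et_up: "X \<in> Z \<Longrightarrow> et (up X) \<in> Hom Q (up X) (Sg X)"
  unfolding functor_unfold by (rule et_hom[OF memb_obj(3)[OF up_U(1)]])

lemma et_up_refl: "X \<in> Z \<Longrightarrow> refl (up X) (Sg X) (et (up X))"
  unfolding functor_unfold by (rule et_refl[OF memb_obj(3)[OF up_U(1)]])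

lemma delta_hom:
  assumes "X \<in> Z" "M \<in> U" "b \<in> Hom C M (omap F X)"
  shows "delta X b \<in> Hom Q M (Sg X)"
proof -
  obtain c where c: "c \<in> Hom C M (up X)" "qq X \<cdot> c = b" by (rule plus_lift[OF assms])
  show ?thesis using delta_eq[OF assms(1) c(1)] c(2) Qa.comp_hom[OF q.cl_hom[OF c(1)] et_up[OF assms(1)]] by simp
qed

lemma delta_comp:
  assumes "X \<in> Z" "M \<in> U" "b \<in> Hom C M (omap F X)" "u \<in> Hom C M' M"
  shows "delta X (b \<cdot> u) = delta X b \<star> cl u"
proof -
  obtain c where c: "c \<in> Hom C M (up X)" "qq X \<cdot> c = b" by (rule plus_lift[OF assms(1-3)])
  have "b \<cdot> u = qq X \<cdot> (c \<cdot> u)" using c up_U(2)[OF assms(1)] assms(4) by (auto simp: Hom_iff)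
  then have "delta X (b \<cdot> u) = et (up X) \<star> cl (c \<cdot> u)" using delta_eq[OF assms(1) comp_hom[OF assms(4) c(1)]] by simp
  also have "\<dots> = et (up X) \<star> cl c \<star> cl u"
    using q.Q_comp[OF assms(4) c(1)] Qa.comp_assoc[OF q.cl_hom[OF assms(4)] q.cl_hom[OF c(1)] et_up[OF assms(1)]] by simp
  finally show ?thesis using delta_eq[OF assms(1) c(1)] c(2) by simp
qed

lemma delta_add:
  assumes "X \<in> Z" "M \<in> U" "b \<in> Hom C M (omap F X)" "b' \<in> Hom C M (omap F X)"
  shows "delta X (b \<oplus> b') = Add Q (delta X b) (delta X b')"
proof -
  obtain c where c: "c \<in> Hom C M (up X)" "qq X \<cdot> c = b" by (rule plus_lift[OF assms(1-3)])
  obtain c' where c': "c' \<in> Hom C M (up X)" "qq X \<cdot> c' = b'" by (rule plus_lift[OF assms(1,2,4)])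
  have "b \<oplus> b' = qq X \<cdot> (c \<oplus> c')" using c c' up_U(2)[OF assms(1)] by (auto simp: Hom_iff)
  moreover have "c \<oplus> c' \<in> Hom C M (up X)" using c c' by (simp add: Hom_iff)
  ultimately have "delta X (b \<oplus> b') = et (up X) \<star> cl (c \<oplus> c')" using delta_eq[OF assms(1)] by simp
  also have "\<dots> = et (up X) \<star> Add Q (cl c) (cl c')" using q.Q_add[OF c(1) c'(1)] by simp
  also have "\<dots> = Add Q (delta X b) (delta X b')"
    using delta_eq[OF assms(1) c(1)] delta_eq[OF assms(1) c'(1)] c c' et_up[OF assms(1)] by (simp add: Hom_iff)
  finally show ?thesis .
qed

lemma delta_q: "X \<in> Z \<Longrightarrow> delta X (qq X) = et (up X)"
proof -
  assume X: "X \<in> Z"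
  have "up X \<in> Obj C" using up_U(1)[OF X] memb_obj by blast
  then show ?thesis using delta_eq[OF X, of "Ident C (up X)" "up X"] up_U(2)[OF X] et_up[OF X] by (simp add: Hom_iff)
qed

lemma Sa_hom:
  assumes "X \<in> Z" "Y \<in> Z" "f \<in> Hom Q X Y"
  shows "Sa f \<in> Hom Q (Sg X) (Sg Y)"
proof -
  obtain x where x: "x \<in> Hom C X Y" "f = cl x" using assms(3) by (rule q.Q_homE)
  obtain u where u: "u \<in> Hom C (up X) (up Y)" "ua (cl x) = cl u" by (rule ua_obtain[OF assms(1,2) x(1)])
  show ?thesis unfolding functor_unfold x(2) u(2) by (rule sa_eq(1)[OF q.cl_hom[OF u(1)]])
qed

lemma delta_natural:
  assumes "X \<in> Z" "Y \<in> Z" "x \<in> Hom C X Y" "M \<in> U" "b \<in> Hom C M (omap F X)"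
  shows "delta Y (amap F x \<cdot> b) = Sa (cl x) \<star> delta X b"
proof -
  obtain u where u: "u \<in> Hom C (up X) (up Y)" "qq Y \<cdot> u = amap F x \<cdot> qq X" "ua (cl x) = cl u"
    by (rule ua_obtain[OF assms(1-3)])
  obtain c where c: "c \<in> Hom C M (up X)" "qq X \<cdot> c = b" by (rule plus_lift[OF assms(1,4,5)])
  have "qq Y \<cdot> (u \<cdot> c) = amap F x \<cdot> b"
    using comp_rewrite[OF u(2,1) up_U(2)[OF assms(2)] up_U(2)[OF assms(1)] F_hom[OF assms(3)], of c] c by (simp add: Hom_iff)
  then have "delta Y (amap F x \<cdot> b) = et (up Y) \<star> cl (u \<cdot> c)"
    using delta_eq[OF assms(2) comp_hom[OF c(1) u(1)]] by simp
  also have "\<dots> = (et (up Y) \<star> cl u) \<star> cl c"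
    using q.Q_comp[OF c(1) u(1)] Qa.comp_assoc[OF q.cl_hom[OF c(1)] q.cl_hom[OF u(1)] et_up[OF assms(2)]] by simp
  also have "\<dots> = (Sa (cl x) \<star> et (up X)) \<star> cl c"
    using sa_eq(2)[OF q.cl_hom[OF u(1)]] u(3) unfolding functor_unfold by simp
  also have "\<dots> = Sa (cl x) \<star> delta X b"
    using Qa.comp_assoc[OF q.cl_hom[OF c(1)] et_up[OF assms(1)] Sa_hom[OF assms(1,2) q.cl_hom[OF assms(3)]]]
      delta_eq[OF assms(1) c(1)] c(2) by simp
  finally show ?thesis .
qed

text \<open>\<open>et (up X)\<close> is \<open>delta\<close> of the universal arrow
  \<open>qq X\<close>, and arrows from \<open>Sg X\<close> into T are determined after it. The
  functor laws and additivity of Sigma are read off from this characterisation.\<close>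

lemma Sa_unique:
  assumes "X \<in> Z" "Y \<in> Z" "g \<in> Hom Q (Sg X) (Sg Y)" "x \<in> Hom C X Y" "g \<star> et (up X) = delta Y (amap F x \<cdot> qq X)"
  shows "Sa (cl x) = g"
proof (rule refl_eq[OF et_up_refl[OF assms(1)] Sa_hom[OF assms(1,2) q.cl_hom[OF assms(4)]] assms(3)])
  show "Sg Y \<in> T" using Sg_Z[OF assms(2)] by blast
  show "Sa (cl x) \<star> et (up X) = g \<star> et (up X)"
    unfolding assms(5) delta_natural[OF assms(1,2,4) up_U[OF assms(1)]] delta_q[OF assms(1)] ..
qed

lemma Sa_ident: "X \<in> Z \<Longrightarrow> Sa (Ident Q X) = Ident Q (Sg X)"
proof -
  assume X: "X \<in> Z"
  have "Sg X \<in> Obj C" using Sg_Z X memb_obj by blast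
  then show ?thesis
    using Sa_unique[OF X X, of "Ident Q (Sg X)" "Ident C X"] delta_q[OF X] et_up[OF X] up_U[OF X] Z_memb(3)[OF X]
    by (simp add: Hom_iff)
qed

lemma Sa_comp:
  assumes "X \<in> Z" "Y \<in> Z" "W \<in> Z" "f \<in> Hom Q X Y" "g \<in> Hom Q Y W"
  shows "Sa (g \<star> f) = Sa g \<star> Sa f"
proof -
  obtain x where x: "x \<in> Hom C X Y" "f = cl x" using assms(4) by (rule q.Q_homE)
  obtain y where y: "y \<in> Hom C Y W" "g = cl y" using assms(5) by (rule q.Q_homE)
  note S = Sa_hom[OF assms(1,2,4)] Sa_hom[OF assms(2,3,5)]
  have "(Sa g \<star> Sa f) \<star> et (up X) = Sa g \<star> (Sa f \<star> et (up X))"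
    using Qa.comp_assoc[OF et_up[OF assms(1)] S] by simp
  also have "\<dots> = delta W (amap F y \<cdot> (amap F x \<cdot> qq X))"
    using delta_natural[OF assms(1,2) x(1) up_U[OF assms(1)]] delta_q[OF assms(1)]
      delta_natural[OF assms(2,3) y(1) up_U(1)[OF assms(1)] comp_hom[OF up_U(2)[OF assms(1)] F_hom[OF x(1)]]] x y by simp
  also have "\<dots> = delta W (amap F (y \<cdot> x) \<cdot> qq X)" using x y up_U[OF assms(1)] by (simp add: Hom_iff)
  finally have "Sa (cl (y \<cdot> x)) = Sa g \<star> Sa f"
    by (rule Sa_unique[OF assms(1,3) Qa.comp_hom[OF S] comp_hom[OF x(1) y(1)]])
  then show ?thesis unfolding x(2) y(2) q.Q_comp[OF x(1) y(1)] .
qed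

lemma Sa_add:
  assumes "X \<in> Z" "Y \<in> Z" "f \<in> Hom Q X Y" "g \<in> Hom Q X Y"
  shows "Sa (Add Q f g) = Add Q (Sa f) (Sa g)"
proof -
  obtain x where x: "x \<in> Hom C X Y" "f = cl x" using assms(3) by (rule q.Q_homE)
  obtain y where y: "y \<in> Hom C X Y" "g = cl y" using assms(4) by (rule q.Q_homE)
  note S = Sa_hom[OF assms(1,2,3)] Sa_hom[OF assms(1,2,4)]
  have "Add Q (Sa f) (Sa g) \<star> et (up X) = Add Q (Sa f \<star> et (up X)) (Sa g \<star> et (up X))"
    using S et_up[OF assms(1)] by (simp add: Hom_iff)
  also have "\<dots> = delta Y (amap F x \<cdot> qq X \<oplus> amap F y \<cdot> qq X)"
    using delta_natural[OF assms(1,2) x(1) up_U[OF assms(1)]] delta_natural[OF assms(1,2) y(1) up_U[OF assms(1)]] delta_q[OF assms(1)]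
      delta_add[OF assms(2) up_U(1)[OF assms(1)] comp_hom[OF up_U(2)[OF assms(1)] F_hom[OF x(1)]] comp_hom[OF up_U(2)[OF assms(1)] F_hom[OF y(1)]]] x y by simp
  also have "\<dots> = delta Y (amap F (x \<oplus> y) \<cdot> qq X)" using x y up_U[OF assms(1)] by (simp add: Hom_iff)
  finally have "Add Q (Sa f) (Sa g) \<star> et (up X) = delta Y (amap F (x \<oplus> y) \<cdot> qq X)" .
  moreover have "Add Q (Sa f) (Sa g) \<in> Hom Q (Sg X) (Sg Y)" "x \<oplus> y \<in> Hom C X Y" using S x y by (simp_all add: Hom_iff)
  ultimately have "Sa (cl (x \<oplus> y)) = Add Q (Sa f) (Sa g)" by (intro Sa_unique[OF assms(1,2)])
  then show ?thesis unfolding x(2) y(2) q.Q_add[OF x(1) y(1)] .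
qed

section \<open>Standard right triangles\<close>

abbreviation "ZQ \<equiv> full_subcategory Q Z"
abbreviation "\<Sigma> \<equiv> Sigma_ftor P K"
abbreviation "STD \<equiv> standard_right_triangles P K"
abbreviation "DT \<equiv> dist_right_triangles P K"

lemma ZQ_additive: "additive_category ZQ"
proof -
  obtain O1 where O: "is_zero_object C O1" using zero_object by blast
  then have oO: "O1 \<in> Obj C" unfolding is_zero_object_def by blast
  have OZ: "O1 \<in> Z" using cp_zero[OF ST O] cp_zero[OF UV O] by blast
  have "cl (Ident C O1) = cl (Zero C O1 O1)" using O oO zero_object_iff by simp
  then have "is_zero_object Q O1" using Qa.zero_object_iff[of O1] oO by simp
  moreover have "\<exists>P\<in>Z. is_biproduct Q A B P" if AB: "A \<in> Z" "B \<in> Z" for A B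
  proof -
    have "A \<in> Obj C" "B \<in> Obj C" using AB memb_obj by blast+
    then obtain P where "is_biproduct C A B P" using biproducts by blast
    then show ?thesis using cp_biproduct[OF ST] cp_biproduct[OF UV] AB q.biproduct_Q by blast
  qed
  moreover have "Z \<subseteq> Obj Q" using memb_obj by auto
  ultimately show ?thesis using Qa.full_additive OZ by blast
qed

lemma ZQ_hom: "f \<in> Hom ZQ X Y \<longleftrightarrow> f \<in> Hom Q X Y \<and> X \<in> Z \<and> Y \<in> Z"
  by (rule full_hom)

lemma ZQ_isom: "f \<in> Hom Q X Y \<Longrightarrow> X \<in> Z \<Longrightarrow> Y \<in> Z \<Longrightarrow> is_isom ZQ f \<longleftrightarrow> is_isom Q f"
  by (rule Qa.full_isom)

lemma ZQ_addftor: "addftor ZQ \<Sigma>"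
proof (intro addftor.intro addcI[OF ZQ_additive] addftor_axioms.intro)
  show "is_additive_functor ZQ ZQ \<Sigma>"
    unfolding is_additive_functor_def is_functor_def full_simps
  proof (intro conjI allI ballI)
    fix X assume "X \<in> Z" then show "Sg X \<in> Z" by (rule Sg_Z)
  next
    fix X assume "X \<in> Z" then show "Sa (Ident Q X) = Ident Q (Sg X)" by (rule Sa_ident)
  next
    fix X Y f assume "f \<in> Hom ZQ X Y"
    then have "f \<in> Hom Q X Y" "X \<in> Z" "Y \<in> Z" unfolding ZQ_hom by blast+
    then show "Sa f \<in> Hom ZQ (Sg X) (Sg Y)" unfolding ZQ_hom using Sa_hom Sg_Z by blast
  next
    fix X Y W f g assume "f \<in> Hom ZQ X Y" "g \<in> Hom ZQ Y W"
    then have "f \<in> Hom Q X Y" "g \<in> Hom Q Y W" "X \<in> Z" "Y \<in> Z" "W \<in> Z" unfolding ZQ_hom by blast+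
    then show "Sa (g \<star> f) = Sa g \<star> Sa f" by (intro Sa_comp)
  next
    fix X Y f g assume "f \<in> Hom ZQ X Y" "g \<in> Hom ZQ X Y"
    then have "f \<in> Hom Q X Y" "g \<in> Hom Q X Y" "X \<in> Z" "Y \<in> Z" unfolding ZQ_hom by blast+
    then show "Sa (Add Q f g) = Add Q (Sa f) (Sa g)" by (intro Sa_add)
  qed
qed

text \<open>The auxiliary data of a standard triangle are traded for one equation on its third
  arrow: \<open>c\<close> is a lift of \<open>b\<close>, \<open>y\<close> exists by
  \<open>fill_backE\<close>, and \<open>h\<close> equals \<open>sa (cl c)\<close> since both agree
  after the unit. \<open>std_elim\<close> goes the other way.\<close>

lemma std_intro:
  assumes d: "(f, a, b) \<in> D" and f: "f \<in> Hom C X Y" "a \<in> Hom C Y M" and X: "X \<in> Z" "Y \<in> Z" "M \<in> U"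
    and h: "h \<in> Hom Q (sg M) (Sg X)" "h \<star> et M = delta X b"
  shows "(cl f, et M \<star> cl a, h) \<in> STD"
proof -
  note H = dist_homs[OF d f]
  obtain i J p where t: "tri_plus K X = (i, p, qq X)" "itri X i J p (up X) (qq X)" by (rule plus_itri[OF X(1)])
  note it = itriD[OF t(2)]
  obtain c where c: "c \<in> Hom C M (up X)" "qq X \<cdot> c = b" by (rule plus_lift[OF X(1,3) H(2)])
  have e: "Ident C (omap F X) \<cdot> b = qq X \<cdot> c" using c H by (simp add: Hom_iff)
  have i1: "Ident C (omap F X) \<in> Hom C (omap F X) (omap F X)" using H by (simp add: Hom_iff)
  obtain y where y: "y \<in> Hom C Y J" "c \<cdot> a = p \<cdot> y"
    "amap F y \<cdot> Neg C (amap F f) = Neg C (amap F i) \<cdot> Ident C (omap F X)"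
    using fill_backE[OF rotate[OF d] rotate[OF it(1)] f(2) H(2) it(3,7) c(1) i1 e] by blast
  have "amap F (y \<cdot> f) = amap F i" using y(1,3) f(1) it(2) by (simp add: Hom_iff)
  then have yf: "y \<cdot> f = i" using F_faithful[OF comp_hom[OF f(1) y(1)] it(2)] by blast
  have "is_tri_morph C F (f, a, b) (i, p, qq X) (Ident C X) y c"
    unfolding tri_morph_iff[OF f H(2) it(2,3,7)] using y(1,2) yf c(1) e it(2) H by (simp add: Hom_iff)
  then have m: "is_tri_morph C F (f, a, b) (tri_plus K (Dom C f)) (Ident C (Dom C f)) y c"
    using f(1) t(1) by (simp add: Hom_iff)
  have "sa (cl c) \<in> Hom Q (sg M) (Sg X)" "sa (cl c) \<star> et M = delta X b"
    using sa_eq[OF q.cl_hom[OF c(1)]] delta_eq[OF X(1) c(1)] c(2) unfolding functor_unfold by simp_all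
  then have hc: "h = sa (cl c)"
    using refl_eq[OF et_refl[OF H(5)] h(1)] h(2) Sg_Z[OF X(1)] by simp
  show ?thesis
    unfolding standard_right_triangles_def mem_Collect_eq
    by (rule exI[of _ f], rule exI[of _ a], rule exI[of _ b], rule exI[of _ y], rule exI[of _ c])
      (use d m f X hc in \<open>simp add: Hom_iff\<close>)
qed

lemma std_elim:
  assumes "s \<in> STD"
  obtains f a b X Y M h where "s = (cl f, et M \<star> cl a, h)" "(f, a, b) \<in> D" "f \<in> Hom C X Y" "a \<in> Hom C Y M"
    "X \<in> Z" "Y \<in> Z" "M \<in> U" "b \<in> Hom C M (omap F X)" "h \<in> Hom Q (sg M) (Sg X)" "h \<star> et M = delta X b"
proof -
  obtain f a b y c where s: "s = (cl f, et (Cod C a) \<star> cl a, sa (cl c))" "(f, a, b) \<in> D"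
    "Dom C f \<in> Z" "Cod C f \<in> Z" "Cod C a \<in> U"
    "is_tri_morph C F (f, a, b) (tri_plus K (Dom C f)) (Ident C (Dom C f)) y c"
    using assms unfolding standard_right_triangles_def by auto
  define X Y M where "X = Dom C f" "Y = Cod C f" "M = Cod C a"
  note XYM = this
  have H: "f \<in> Hom C X Y" "a \<in> Hom C Y M" "b \<in> Hom C M (omap F X)" using dist_arr[OF s(2)] XYM by auto
  have X: "X \<in> Z" "Y \<in> Z" "M \<in> U" using s XYM by auto
  obtain i J p where t: "tri_plus K X = (i, p, qq X)" "itri X i J p (up X) (qq X)" by (rule plus_itri[OF X(1)])
  note it = itriD[OF t(2)]
  have tt: "is_tri_morph C F (f, a, b) (tri_plus K X) = is_tri_morph C F (f, a, b) (i, p, qq X)"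
    by (rule arg_cong[OF t(1)])
  have "c \<in> Hom C M (up X)" "amap F (Ident C X) \<cdot> b = qq X \<cdot> c"
    using s(6) unfolding XYM(1)[symmetric] tt tri_morph_iff[OF H it(2,3,7)] by auto
  then have c: "c \<in> Hom C M (up X)" "qq X \<cdot> c = b" using H Z_memb(3)[OF X(1)] by (auto simp: Hom_iff)
  have "sa (cl c) \<in> Hom Q (sg M) (Sg X)" "sa (cl c) \<star> et M = delta X b"
    using sa_eq[OF q.cl_hom[OF c(1)]] delta_eq[OF X(1) c(1)] c(2) unfolding functor_unfold by simp_all
  then show thesis using that s(1,2) H X XYM by blast
qed

lemma ZQ_triangle:
  "f \<in> Hom Q X Y \<Longrightarrow> g \<in> Hom Q Y M \<Longrightarrow> h \<in> Hom Q M (Sg X) \<Longrightarrow> X \<in> Z \<Longrightarrow> Y \<in> Z \<Longrightarrow> M \<in> Z \<Longrightarrow>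
    is_triangle ZQ \<Sigma> (f, g, h)"
  unfolding is_triangle_def split_def fst_conv snd_conv ZQ_hom using Sg_Z by blast

lemma std_triangle: "s \<in> STD \<Longrightarrow> is_triangle ZQ \<Sigma> s"
proof (erule std_elim)
  fix f a b X Y M h assume *: "s = (cl f, et M \<star> cl a, h)" "f \<in> Hom C X Y" "a \<in> Hom C Y M"
    "X \<in> Z" "Y \<in> Z" "M \<in> U" "h \<in> Hom Q (sg M) (Sg X)"
  show "is_triangle ZQ \<Sigma> s"
    unfolding *(1)
    by (rule ZQ_triangle[OF q.cl_hom[OF *(2)] Qa.comp_hom[OF q.cl_hom[OF *(3)] et_hom[OF memb_obj(3)[OF *(6)]]] *(7,4,5) sg_Z[OF *(6)]])
qed

section \<open>Distinguished right triangles: closure under isomorphism and completion of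
  squares\<close>

lemma DT_triangle: "t \<in> DT \<Longrightarrow> is_triangle ZQ \<Sigma> t"
  unfolding dist_right_triangles_def by simp

lemma DT_elim:
  assumes "t \<in> DT"
  obtains s where "s \<in> STD" "tri_isomorphic ZQ \<Sigma> t s"
  using assms unfolding dist_right_triangles_def by auto

lemma DT_iso:
  assumes "t \<in> DT" "is_triangle ZQ \<Sigma> t'" "tri_isomorphic ZQ \<Sigma> t t'"
  shows "t' \<in> DT"
proof -
  obtain s where s: "s \<in> STD" "tri_isomorphic ZQ \<Sigma> t s" by (rule DT_elim[OF assms(1)])
  have "tri_isomorphic ZQ \<Sigma> t' s"
    using addftor.tri_iso_trans[OF ZQ_addftor assms(2) DT_triangle[OF assms(1)] std_triangle[OF s(1)]]
      addftor.tri_iso_sym[OF ZQ_addftor DT_triangle[OF assms(1)] assms(2,3)] s(2) by blast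
  then show ?thesis unfolding dist_right_triangles_def using assms(2) s(1) by simp blast
qed

lemma std_DT: "s \<in> STD \<Longrightarrow> s \<in> DT"
proof -
  assume s: "s \<in> STD"
  obtain f a b X Y M h where *: "s = (cl f, et M \<star> cl a, h)" "f \<in> Hom C X Y" "a \<in> Hom C Y M"
    "X \<in> Z" "Y \<in> Z" "M \<in> U" "h \<in> Hom Q (sg M) (Sg X)" by (rule std_elim[OF s])
  interpret R: addftor ZQ \<Sigma> by (rule ZQ_addftor)
  have "tri_isomorphic ZQ \<Sigma> s s"
  proof -
    obtain f g h A B E where t: "s = (f, g, h)" "f \<in> Hom ZQ A B" "g \<in> Hom ZQ B E" "h \<in> Hom ZQ E (Sg A)"
      using std_triangle[OF s] unfolding is_triangle_def by (cases s) auto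
    have o: "A \<in> Obj ZQ" "B \<in> Obj ZQ" "E \<in> Obj ZQ" using R.hom_objs[OF t(2)] R.hom_objs[OF t(3)] by blast+
    have "is_tri_morph ZQ \<Sigma> s s (Ident ZQ A) (Ident ZQ B) (Ident ZQ E)"
      unfolding t(1) R.tri_morph_iff[OF t(2-4) t(2-4)]
      using R.ident_left[OF t(2)] R.ident_right[OF t(2)] R.ident_left[OF t(3)] R.ident_right[OF t(3)]
        R.ident_left[OF t(4)] R.ident_right[OF t(4)] R.F_ident[OF o(1)] R.ident_hom[OF o(1)] R.ident_hom[OF o(2)]
        R.ident_hom[OF o(3)] by metis
    then show ?thesis unfolding tri_isomorphic_def using R.isom_ident o by blast
  qed
  then show ?thesis unfolding dist_right_triangles_def using std_triangle[OF s] s by simp blast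
qed

lemma DT_isoI:
  assumes d: "(f, g, h) \<in> DT"
    and H: "f \<in> Hom Q X Y" "g \<in> Hom Q Y M" "h \<in> Hom Q M (Sg X)" "X \<in> Z" "Y \<in> Z" "M \<in> Z"
    and H': "f' \<in> Hom Q X' Y'" "g' \<in> Hom Q Y' M'" "h' \<in> Hom Q M' (Sg X')" "X' \<in> Z" "Y' \<in> Z" "M' \<in> Z"
    and x: "x \<in> Hom Q X X'" "y \<in> Hom Q Y Y'" "z \<in> Hom Q M M'" "is_isom Q x" "is_isom Q y" "is_isom Q z"
    and e: "y \<star> f = f' \<star> x" "z \<star> g = g' \<star> y" "Sa x \<star> h = h' \<star> z"
  shows "(f', g', h') \<in> DT"
proof (rule DT_iso[OF d ZQ_triangle[OF H']])
  have Z: "f \<in> Hom ZQ X Y" "g \<in> Hom ZQ Y M" "h \<in> Hom ZQ M (Sg X)"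
    "f' \<in> Hom ZQ X' Y'" "g' \<in> Hom ZQ Y' M'" "h' \<in> Hom ZQ M' (Sg X')"
    unfolding ZQ_hom using H H' Sg_Z by blast+
  have "is_tri_morph ZQ \<Sigma> (f, g, h) (f', g', h') x y z"
    unfolding addftor.tri_morph_iff[OF ZQ_addftor Z] ZQ_hom using x e H H' by simp
  moreover have "is_isom ZQ x" "is_isom ZQ y" "is_isom ZQ z"
    using x ZQ_isom[OF x(1) H(4) H'(4)] ZQ_isom[OF x(2) H(5) H'(5)] ZQ_isom[OF x(3) H(6) H'(6)] by blast+
  ultimately show "tri_isomorphic ZQ \<Sigma> (f, g, h) (f', g', h')" unfolding tri_isomorphic_def by blast
qed

text \<open>Standard triangles want their second term in Z and use the chosen units. This criterion
  allows a second term in U and arbitrary reflections, which is the form in which cones, rotations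
  and octahedra present themselves.\<close>

lemma DT_intro:
  assumes d: "(f0, a, b) \<in> D" and f0: "f0 \<in> Hom C X Y" "a \<in> Hom C Y M" and X: "X \<in> Z" "Y \<in> U" "M \<in> U"
    and t: "refl Y Y' t" "refl M M' t'" "Y' \<in> Z" "M' \<in> Z"
    and g: "f \<in> Hom Q X Y'" "g \<in> Hom Q Y' M'" "h \<in> Hom Q M' (Sg X)"
    and e: "f = t \<star> cl f0" "g \<star> t = t' \<star> cl a" "h \<star> t' = delta X b"
  shows "(f, g, h) \<in> DT"
proof -
  note H = dist_homs[OF d f0]
  obtain t0 w r S0 where t0: "(t0, w, r) \<in> D" "t0 \<in> Hom C Y (sg Y)" "w \<in> Hom C (sg Y) S0" "S0 \<in> S" "et Y = cl t0"
    by (rule unit_cone[OF H(4)])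
  have tf: "t0 \<cdot> f0 \<in> Hom C X (sg Y)" using f0 t0 comp_hom by blast
  then have "t0 \<cdot> f0 \<in> Arr C" by (simp add: Hom_iff)
  then obtain k k'' where k: "(t0 \<cdot> f0, k, k'') \<in> D" using dist_cone by blast
  define M2 where "M2 = Cod C k"
  have kH: "k \<in> Hom C (sg Y) M2" "k'' \<in> Hom C M2 (omap F X)" using dist_arr[OF k] tf M2_def by (auto simp: Hom_iff)
  \<comment> \<open>The octahedron of \<open>t0 \<cdot> f0\<close>: M maps to the new cone M2 with
    the cone S0 of \<open>t0\<close>. So M2 stays in U and is a reflection of M, and the standard
    triangle of \<open>t0 \<cdot> f0\<close> is isomorphic to the desired one.\<close>
  obtain u v where u: "u \<in> Hom C M M2" "v \<in> Hom C M2 S0" "(u, v, amap F a \<cdot> r) \<in> D"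
    "u \<cdot> a = k \<cdot> t0" "k'' \<cdot> u = b"
    using octa[OF f0(1) t0(2) d t0(1) k] f0(2) t0(3) M2_def by (auto simp: Hom_iff)
  have M2: "M2 \<in> U" using cp_left_ext[OF UV u(3,1,2) X(3) S_U[OF t0(4)]] .
  have oM2: "M2 \<in> Obj C" using M2 memb_obj by blast
  have ru: "refl M M2 (cl u)" by (rule cone_S_refl[OF u(3,1,2) t0(4)])
  note uQ = q.cl_hom[OF u(1)] and kQ = q.cl_hom[OF kH(1)] and fQ = q.cl_hom[OF f0(1)] and aQ = q.cl_hom[OF f0(2)]
  note eY = et_hom[OF H(4)] and eM = et_hom[OF oM2] and tH = refl_hom[OF t(1)] and t'H = refl_hom[OF t(2)]
  obtain h0 where h0: "h0 \<in> Hom Q (sg M2) (Sg X)" "h0 \<star> et M2 = delta X k''"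
    using refl_ex[OF et_refl[OF oM2] delta_hom[OF X(1) M2 kH(2)]] Sg_Z[OF X(1)] by blast
  have s: "(cl (t0 \<cdot> f0), et M2 \<star> cl k, h0) \<in> STD"
    by (rule std_intro[OF k tf kH(1) X(1) sg_Z[OF X(2)] M2 h0])
  have YT: "sg Y \<in> T" "Y' \<in> T" "sg M2 \<in> T" "M' \<in> T" using sg_Z X M2 t by blast+
  obtain y where y: "y \<in> Hom Q (sg Y) Y'" "is_isom Q y" "y \<star> et Y = t"
    by (rule refl_to_T[OF et_refl[OF H(4)] t(1) YT(1,2)])
  have rM: "refl M (sg M2) (et M2 \<star> cl u)" by (rule refl_comp[OF ru et_refl[OF oM2]])
  obtain z where z: "z \<in> Hom Q (sg M2) M'" "is_isom Q z" "z \<star> (et M2 \<star> cl u) = t'"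
    by (rule refl_to_T[OF rM t(2) YT(3,4)])
  have XQ: "Ident Q X \<in> Hom Q X X" "is_isom Q (Ident Q X)" "Sa (Ident Q X) = Ident Q (Sg X)"
    using Z_memb(3)[OF X(1)] Sa_ident[OF X(1)] by (auto simp: Hom_iff)
  have tfQ: "cl (t0 \<cdot> f0) = et Y \<star> cl f0" using q.Q_comp[OF f0(1) t0(2)] t0(5) by simp
  show ?thesis
  proof (rule DT_isoI[OF std_DT[OF s] q.cl_hom[OF tf] Qa.comp_hom[OF kQ eM] h0(1) X(1) sg_Z[OF X(2)] sg_Z[OF M2]
        g X(1) t(3,4) XQ(1) y(1) z(1) XQ(2) y(2) z(2)])
    show "y \<star> cl (t0 \<cdot> f0) = f \<star> Ident Q X"
      unfolding tfQ e(1) using Qa.comp_assoc[OF fQ eY y(1)] y(3) Qa.ident_right[OF g(1)] e(1) by simp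
    show "z \<star> (et M2 \<star> cl k) = g \<star> y"
    proof (rule refl_eq[OF et_refl[OF H(4)] _ _ YT(4)])
      show "z \<star> (et M2 \<star> cl k) \<in> Hom Q (sg Y) M'" "g \<star> y \<in> Hom Q (sg Y) M'"
        using z(1) eM kQ g(2) y(1) Qa.comp_hom by blast+
      have "(z \<star> (et M2 \<star> cl k)) \<star> et Y = z \<star> (et M2 \<star> (cl k \<star> et Y))"
        using z(1) eM kQ eY by (simp add: Hom_iff)
      also have "cl k \<star> et Y = cl u \<star> cl a" using q.Q_comp[OF t0(2) kH(1)] q.Q_comp[OF f0(2) u(1)] u(4) t0(5) by simp
      also have "z \<star> (et M2 \<star> (cl u \<star> cl a)) = (z \<star> (et M2 \<star> cl u)) \<star> cl a"
        using z(1) eM uQ aQ by (simp add: Hom_iff)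
      also have "\<dots> = g \<star> (y \<star> et Y)" unfolding z(3) y(3) e(2) ..
      also have "\<dots> = g \<star> y \<star> et Y" using g(2) y(1) eY by (simp add: Hom_iff)
      finally show "(z \<star> (et M2 \<star> cl k)) \<star> et Y = (g \<star> y) \<star> et Y" .
    qed
    show "Sa (Ident Q X) \<star> h0 = h \<star> z"
    proof (rule refl_eq[OF rM])
      show "Sg X \<in> T" using Sg_Z X by blast
      show "Sa (Ident Q X) \<star> h0 \<in> Hom Q (sg M2) (Sg X)" "h \<star> z \<in> Hom Q (sg M2) (Sg X)"
        using XQ(3) h0(1) z(1) g(3) Qa.comp_hom Qa.ident_left by auto
      have "Sa (Ident Q X) \<star> h0 \<star> (et M2 \<star> cl u) = (h0 \<star> et M2) \<star> cl u"
        unfolding XQ(3) using h0(1) eM uQ by (simp add: Hom_iff)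
      also have "\<dots> = delta X b" unfolding h0(2) using delta_comp[OF X(1) M2 kH(2) u(1)] u(5) by simp
      also have "\<dots> = h \<star> (z \<star> (et M2 \<star> cl u))" unfolding z(3) e(3) ..
      also have "\<dots> = h \<star> z \<star> (et M2 \<star> cl u)" using g(3) z(1) eM uQ by (simp add: Hom_iff)
      finally show "Sa (Ident Q X) \<star> h0 \<star> (et M2 \<star> cl u) = h \<star> z \<star> (et M2 \<star> cl u)" .
    qed
  qed
qed

text \<open>The given square commutes only in the quotient. After a correction of \<open>y0\<close>
  within its class it commutes in C, where TR3 applies; the third arrow is then the image of the
  filler under \<open>sa\<close>.\<close>

lemma std_fill:
  assumes d: "(f, a, b) \<in> D" "f \<in> Hom C X Y" "a \<in> Hom C Y M" "X \<in> Z" "Y \<in> Z" "M \<in> U"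
      "h \<in> Hom Q (sg M) (Sg X)" "h \<star> et M = delta X b"
    and d': "(f', a', b') \<in> D" "f' \<in> Hom C X' Y'" "a' \<in> Hom C Y' M'" "X' \<in> Z" "Y' \<in> Z" "M' \<in> U"
      "h' \<in> Hom Q (sg M') (Sg X')" "h' \<star> et M' = delta X' b'"
    and x: "x \<in> Hom Q X X'" "y \<in> Hom Q Y Y'" "y \<star> cl f = cl f' \<star> x"
  obtains z where "z \<in> Hom Q (sg M) (sg M')" "z \<star> (et M \<star> cl a) = (et M' \<star> cl a') \<star> y" "Sa x \<star> h = h' \<star> z"
proof -
  note H = dist_homs[OF d(1-3)] dist_homs[OF d'(1-3)]
  obtain x0 where x0: "x0 \<in> Hom C X X'" "x = cl x0" using x(1) by (rule q.Q_homE)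
  obtain y0 where y0: "y0 \<in> Hom C Y Y'" "y = cl y0" using x(2) by (rule q.Q_homE)
  have "cl (y0 \<cdot> f) = cl (f' \<cdot> x0)" using q.Q_comp[OF d(2) y0(1)] q.Q_comp[OF x0(1) d'(2)] x(3) x0 y0 by simp
  then obtain J \<alpha> \<beta> where J: "J \<in> I" "\<alpha> \<in> Hom C X J" "\<beta> \<in> Hom C J Y'" "y0 \<cdot> f \<oplus> Neg C (f' \<cdot> x0) = \<beta> \<cdot> \<alpha>"
    by (rule cl_eqE[OF _ comp_hom[OF d(2) y0(1)] comp_hom[OF x0(1) d'(2)]])
  \<comment> \<open>The error factors through J in I, and its first factor extends over
    \<open>f\<close> because the obstruction runs from M in U to the shift of J, which lies in
    V.\<close>
  obtain \<alpha>' where \<alpha>': "\<alpha>' \<in> Hom C Y J" "\<alpha>' \<cdot> f = \<alpha>"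
    using extend0[OF d(1-3) J(2)] vanish_UV[OF comp_hom[OF H(2) F_hom[OF J(2)]] d(6) I_memb(4)[OF J(1)]] by blast
  define y1 where "y1 = y0 \<oplus> Neg C (\<beta> \<cdot> \<alpha>')"
  have y1: "y1 \<in> Hom C Y Y'" unfolding y1_def using y0 \<alpha>' J by (simp add: Hom_iff)
  have "y1 \<cdot> f = y0 \<cdot> f \<oplus> Neg C (y0 \<cdot> f \<oplus> Neg C (f' \<cdot> x0))"
    unfolding J(4) y1_def using y0(1) \<alpha>' J(2,3) d(2) by (simp add: Hom_iff)
  also have "\<dots> = f' \<cdot> x0" using y0(1) d(2) d'(2) x0(1) by (simp add: Hom_iff add_assoc[symmetric])
  finally have yf: "y1 \<cdot> f = f' \<cdot> x0" .
  have "cl y0 = cl y1"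
  proof (rule cl_eq_facI[OF y0(1) y1 _ J(1) \<alpha>'(1) J(3)])
    show "y0 \<oplus> Neg C y1 = \<beta> \<cdot> \<alpha>'" unfolding y1_def using y0(1) \<alpha>'(1) J(3) by (simp add: Hom_iff add_assoc[symmetric])
  qed
  then have yy: "y = cl y1" using y0 by simp
  obtain z0 where z0: "z0 \<in> Hom C M M'" "z0 \<cdot> a = a' \<cdot> y1" "amap F x0 \<cdot> b = b' \<cdot> z0"
    by (rule fillE[OF d(1) d'(1) d(2,3) d'(2,3) x0(1) y1 yf])
  note z0Q = q.cl_hom[OF z0(1)]
  note z = sa_eq[OF z0Q]
  note eM = et_hom[OF H(5)] and eM' = et_hom[OF H(10)]
  note aQ = q.cl_hom[OF d(3)] and a'Q = q.cl_hom[OF d'(3)]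
  have 1: "sa (cl z0) \<star> (et M \<star> cl a) = (et M' \<star> cl a') \<star> y"
  proof -
    have "sa (cl z0) \<star> (et M \<star> cl a) = (sa (cl z0) \<star> et M) \<star> cl a" using z(1) eM aQ by (simp add: Hom_iff)
    also have "\<dots> = et M' \<star> cl (z0 \<cdot> a)"
      unfolding z(2) using q.Q_comp[OF d(3) z0(1)] Qa.comp_assoc[OF aQ z0Q eM'] by simp
    also have "\<dots> = (et M' \<star> cl a') \<star> y"
      unfolding z0(2) yy using q.Q_comp[OF y1 d'(3)] Qa.comp_assoc[OF q.cl_hom[OF y1] a'Q eM'] by simp
    finally show ?thesis .
  qed
  have 2: "Sa x \<star> h = h' \<star> sa (cl z0)"
  proof (rule refl_eq[OF et_refl[OF H(5)]])
    note Sx = Sa_hom[OF d(4) d'(4) x(1)]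
    show "Sg X' \<in> T" using Sg_Z d' by blast
    show "Sa x \<star> h \<in> Hom Q (sg M) (Sg X')" by (rule Qa.comp_hom[OF d(7) Sx])
    show "h' \<star> sa (cl z0) \<in> Hom Q (sg M) (Sg X')" by (rule Qa.comp_hom[OF z(1) d'(7)])
    have "Sa x \<star> h \<star> et M = Sa x \<star> delta X b" using Qa.comp_assoc[OF eM d(7) Sx] d(8) by simp
    also have "\<dots> = delta X' (b' \<cdot> z0)"
      using delta_natural[OF d(4) d'(4) x0(1) d(6) H(2)] x0(2) z0(3) by simp
    also have "\<dots> = (h' \<star> et M') \<star> cl z0" using delta_comp[OF d'(4,6) H(7) z0(1)] d'(8) by simp
    also have "\<dots> = h' \<star> (sa (cl z0) \<star> et M)" unfolding z(2) using Qa.comp_assoc[OF z0Q eM' d'(7)] by simp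
    also have "\<dots> = h' \<star> sa (cl z0) \<star> et M" using Qa.comp_assoc[OF eM z(1) d'(7)] by simp
    finally show "Sa x \<star> h \<star> et M = h' \<star> sa (cl z0) \<star> et M" .
  qed
  show thesis using that z(1) 1 2 by blast
qed

lemma DT_fill:
  assumes t: "(f, g, h) \<in> DT" "(f', g', h') \<in> DT"
    and x: "x \<in> Hom ZQ (Dom ZQ f) (Dom ZQ f')" "y \<in> Hom ZQ (Cod ZQ f) (Cod ZQ f')"
    and e: "Comp ZQ y f = Comp ZQ f' x"
  shows "\<exists>z. is_tri_morph ZQ \<Sigma> (f, g, h) (f', g', h') x y z"
proof -
  interpret R: addftor ZQ \<Sigma> by (rule ZQ_addftor)
  obtain s where s: "s \<in> STD" "tri_isomorphic ZQ \<Sigma> (f, g, h) s" by (rule DT_elim[OF t(1)])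
  obtain s' where s': "s' \<in> STD" "tri_isomorphic ZQ \<Sigma> (f', g', h') s'" by (rule DT_elim[OF t(2)])
  obtain x1 y1 z1 where m1: "is_tri_morph ZQ \<Sigma> (f, g, h) s x1 y1 z1" "is_isom ZQ x1" "is_isom ZQ y1" "is_isom ZQ z1"
    using s(2) unfolding tri_isomorphic_def by blast
  obtain x2 y2 z2 where m2: "is_tri_morph ZQ \<Sigma> (f', g', h') s' x2 y2 z2" "is_isom ZQ x2" "is_isom ZQ y2" "is_isom ZQ z2"
    using s'(2) unfolding tri_isomorphic_def by blast
  note T = DT_triangle[OF t(1)] DT_triangle[OF t(2)] std_triangle[OF s(1)] std_triangle[OF s'(1)]
  obtain x1' y1' z1' where n1: "is_tri_morph ZQ \<Sigma> s (f, g, h) x1' y1' z1'"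
    "Comp ZQ x1' x1 = Ident ZQ (Dom ZQ x1)" "Comp ZQ y1' y1 = Ident ZQ (Dom ZQ y1)"
    by (rule R.tri_morph_inverse[OF T(1,3) m1])
  obtain x2' y2' z2' where n2: "is_tri_morph ZQ \<Sigma> s' (f', g', h') x2' y2' z2'"
    "Comp ZQ x2' x2 = Ident ZQ (Dom ZQ x2)" "Comp ZQ y2' y2 = Ident ZQ (Dom ZQ y2)"
    by (rule R.tri_morph_inverse[OF T(2,4) m2])
  obtain f0 a b X Y M k where S1: "s = (cl f0, et M \<star> cl a, k)" "(f0, a, b) \<in> D" "f0 \<in> Hom C X Y" "a \<in> Hom C Y M"
    "X \<in> Z" "Y \<in> Z" "M \<in> U" "b \<in> Hom C M (omap F X)" "k \<in> Hom Q (sg M) (Sg X)" "k \<star> et M = delta X b"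
    by (rule std_elim[OF s(1)])
  obtain f0' a' b' X' Y' M' k' where S2: "s' = (cl f0', et M' \<star> cl a', k')" "(f0', a', b') \<in> D" "f0' \<in> Hom C X' Y'" "a' \<in> Hom C Y' M'"
    "X' \<in> Z" "Y' \<in> Z" "M' \<in> U" "b' \<in> Hom C M' (omap F X')" "k' \<in> Hom Q (sg M') (Sg X')" "k' \<star> et M' = delta X' b'"
    by (rule std_elim[OF s'(1)])
  obtain A B E where t1: "f \<in> Hom ZQ A B" "g \<in> Hom ZQ B E" "h \<in> Hom ZQ E (Sg A)"
    using T(1) unfolding is_triangle_def by auto
  obtain A' B' E' where t2: "f' \<in> Hom ZQ A' B'" "g' \<in> Hom ZQ B' E'" "h' \<in> Hom ZQ E' (Sg A')"
    using T(2) unfolding is_triangle_def by auto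
  have oM: "M \<in> Obj C" "M' \<in> Obj C" using S1 S2 memb_obj by blast+
  have s1: "cl f0 \<in> Hom ZQ X Y" "et M \<star> cl a \<in> Hom ZQ Y (sg M)" "k \<in> Hom ZQ (sg M) (Sg X)"
    unfolding ZQ_hom using q.cl_hom[OF S1(3)] Qa.comp_hom[OF q.cl_hom[OF S1(4)] et_hom[OF oM(1)]] S1 sg_Z Sg_Z by blast+
  have s2: "cl f0' \<in> Hom ZQ X' Y'" "et M' \<star> cl a' \<in> Hom ZQ Y' (sg M')" "k' \<in> Hom ZQ (sg M') (Sg X')"
    unfolding ZQ_hom using q.cl_hom[OF S2(3)] Qa.comp_hom[OF q.cl_hom[OF S2(4)] et_hom[OF oM(2)]] S2 sg_Z Sg_Z by blast+
  have xy: "x \<in> Hom ZQ A A'" "y \<in> Hom ZQ B B'" using x t1 t2 by (auto simp: Hom_iff)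
  have h1: "x1 \<in> Hom ZQ A X" "y1 \<in> Hom ZQ B Y" "x1' \<in> Hom ZQ X A" "y1' \<in> Hom ZQ Y B" "Comp ZQ y1' (cl f0) = Comp ZQ f x1'"
    using m1(1) n1(1) unfolding S1(1) R.tri_morph_iff[OF t1 s1] R.tri_morph_iff[OF s1 t1] by auto
  have h2: "x2 \<in> Hom ZQ A' X'" "y2 \<in> Hom ZQ B' Y'" "x2' \<in> Hom ZQ X' A'" "y2' \<in> Hom ZQ Y' B'" "Comp ZQ y2 f' = Comp ZQ (cl f0') x2"
    using m2(1) n2(1) unfolding S2(1) R.tri_morph_iff[OF t2 s2] R.tri_morph_iff[OF s2 t2] by auto
  let ?x = "Comp ZQ x2 (Comp ZQ x x1')" and ?y = "Comp ZQ y2 (Comp ZQ y y1')"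
  have xyH: "?x \<in> Hom ZQ X X'" "?y \<in> Hom ZQ Y Y'" using xy h1 h2 R.comp_hom by blast+
  have "Comp ZQ ?y (cl f0) = Comp ZQ y2 (Comp ZQ y (Comp ZQ y1' (cl f0)))"
    using R.comp_assoc[OF s1(1) R.comp_hom[OF h1(4) xy(2)] h2(2)] R.comp_assoc[OF s1(1) h1(4) xy(2)] by simp
  also have "\<dots> = Comp ZQ y2 (Comp ZQ (Comp ZQ y f) x1')"
    unfolding h1(5) using R.comp_assoc[OF h1(3) t1(1) xy(2)] by simp
  also have "\<dots> = Comp ZQ (Comp ZQ y2 f') (Comp ZQ x x1')"
    unfolding e using R.comp_assoc[OF h1(3) xy(1) t2(1)] R.comp_assoc[OF R.comp_hom[OF h1(3) xy(1)] t2(1) h2(2)] by simp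
  also have "\<dots> = Comp ZQ (cl f0') ?x"
    unfolding h2(5) using R.comp_assoc[OF R.comp_hom[OF h1(3) xy(1)] h2(1) s2(1)] by simp
  finally have e': "?y \<star> cl f0 = cl f0' \<star> ?x" by simp
  have xyQ: "?x \<in> Hom Q X X'" "?y \<in> Hom Q Y Y'" using xyH unfolding ZQ_hom by blast+
  obtain z where z: "z \<in> Hom Q (sg M) (sg M')" "z \<star> (et M \<star> cl a) = (et M' \<star> cl a') \<star> ?y" "Sa ?x \<star> k = k' \<star> z"
    by (rule std_fill[OF S1(2-7,9,10) S2(2-7,9,10) xyQ e'])
  have zZ: "z \<in> Hom ZQ (sg M) (sg M')" unfolding ZQ_hom using z sg_Z S1 S2 by blast
  have "is_tri_morph ZQ \<Sigma> s s' ?x ?y z"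
    unfolding S1(1) S2(1) R.tri_morph_iff[OF s1 s2] using xyH zZ e' z(2,3) by simp
  then have m: "is_tri_morph ZQ \<Sigma> (f, g, h) (f', g', h') (Comp ZQ x2' (Comp ZQ ?x x1)) (Comp ZQ y2' (Comp ZQ ?y y1)) (Comp ZQ z2' (Comp ZQ z z1))"
    using R.tri_morph_comp[OF T(1,4,2) R.tri_morph_comp[OF T(1,3,4) m1(1)] n2(1)] by blast
  \<comment> \<open>Conjugating back by the isomorphisms to the standard triangles returns exactly
    the given \<open>x\<close> and \<open>y\<close>.\<close>
  have canc: "Comp ZQ p2' (Comp ZQ (Comp ZQ p2 (Comp ZQ p p1')) p1) = p"
    if "Comp ZQ p2' p2 = Ident ZQ (Dom ZQ p2)" "Comp ZQ p1' p1 = Ident ZQ (Dom ZQ p1)"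
      "p1 \<in> Hom ZQ G H" "p1' \<in> Hom ZQ H G" "p2 \<in> Hom ZQ G' H'" "p2' \<in> Hom ZQ H' G'" "p \<in> Hom ZQ G G'"
    for p p1 p2 p1' p2' G H G' H'
  proof -
    have d: "Dom ZQ p2 = G'" "Dom ZQ p1 = G" using that by (auto simp: Hom_iff)
    have "Comp ZQ (Comp ZQ p2 (Comp ZQ p p1')) p1 = Comp ZQ p2 (Comp ZQ p (Comp ZQ p1' p1))"
      using R.comp_assoc[OF that(3) R.comp_hom[OF that(4,7)] that(5)] R.comp_assoc[OF that(3,4,7)] by simp
    also have "\<dots> = Comp ZQ p2 p" unfolding that(2) d using R.ident_right[OF that(7)] by simp
    finally have "Comp ZQ p2' (Comp ZQ (Comp ZQ p2 (Comp ZQ p p1')) p1) = Comp ZQ p2' (Comp ZQ p2 p)" by simp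
    also have "\<dots> = Comp ZQ (Comp ZQ p2' p2) p" by (rule R.comp_assoc[OF that(7,5,6)])
    also have "\<dots> = p" unfolding that(1) d by (rule R.ident_left[OF that(7)])
    finally show ?thesis .
  qed
  show ?thesis
    using m unfolding canc[OF n2(2) n1(2) h1(1,3) h2(1,3) xy(1)] canc[OF n2(3) n1(3) h1(2,4) h2(2,4) xy(2)] by blast
qed

section \<open>Rotation, cones and octahedra\<close>

lemma refl_ident: "X \<in> Obj C \<Longrightarrow> refl X X (Ident Q X)"
  by (rule refl_isom) (auto simp: Hom_iff)

lemma DT_zero:
  assumes X: "X \<in> Z"
  shows "\<exists>O1. is_zero_object ZQ O1 \<and> (Ident ZQ X, Zero ZQ X O1, Zero ZQ O1 (Sg X)) \<in> DT"
proof -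
  obtain O1 where O: "is_zero_object C O1" using zero_object by blast
  then have oO: "O1 \<in> Obj C" unfolding is_zero_object_def by blast
  have OU: "O1 \<in> U" and OI: "O1 \<in> I" using cp_zero[OF UV O] cp_zero[OF ST O] by blast+
  have oX: "X \<in> Obj C" "Sg X \<in> Obj C" using X Sg_Z memb_obj by blast+
  have OZ: "O1 \<in> Z" using OU I_memb(2)[OF OI] by blast
  interpret R: addc ZQ by (rule addcI[OF ZQ_additive])
  have "is_zero_object ZQ O1" using R.zero_object_iff[of O1] OZ I_zero[OF OI] by simp
  moreover have "(Ident Q X, Zero Q X O1, Zero Q O1 (Sg X)) \<in> DT"
  proof (rule DT_intro[OF dist_ident[OF oX(1) O] ident_hom[OF oX(1)] hom_zero[OF oX(1) oO] X _ OU
        refl_ident[OF oX(1)] refl_ident[OF oO] X OZ])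
    show "X \<in> U" using X by blast
    show H: "Ident Q X \<in> Hom Q X X" "Zero Q X O1 \<in> Hom Q X O1" "Zero Q O1 (Sg X) \<in> Hom Q O1 (Sg X)"
      using oX oO by (auto simp: Hom_iff)
    show "Ident Q X = Ident Q X \<star> cl (Ident C X)" using oX by simp
    show "Zero Q X O1 \<star> Ident Q X = Ident Q O1 \<star> cl (Zero C X O1)" using oX oO by simp
    have "delta X (Zero C O1 (omap F X)) \<in> Hom Q O1 (Sg X)"
      by (rule delta_hom[OF X OU]) (use oX oO in \<open>auto simp: Hom_iff\<close>)
    from I_hom_zero(1)[OF OI this]
    show "Zero Q O1 (Sg X) \<star> Ident Q O1 = delta X (Zero C O1 (omap F X))"
      using oX oO by simp
  qed
  ultimately show ?thesis by auto
qed

text \<open>Up to isomorphism Y0 is a sum of Y and J, and \<open>x\<close> has the components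
  \<open>i\<close> and, modulo I, \<open>f\<close>. Constructing it through N instead of as a sum
  shows at once that its cone is an extension of B by Y, with the explicit connecting arrow
  \<open>q \<cdot> c\<close>.\<close>

lemma inflation:
  assumes X: "X \<in> T" "B \<in> U" "itri X i J p B q" and Y: "Y \<in> Obj C" and f: "f \<in> Hom C X Y"
    and n: "(n, c, amap F f \<cdot> q) \<in> D" "n \<in> Hom C Y N" "c \<in> Hom C N B"
  obtains x a Y0 j e where "(x, a, q \<cdot> c) \<in> D" "x \<in> Hom C X Y0" "a \<in> Hom C Y0 N"
    "j \<in> Hom C Y Y0" "e \<in> Hom C Y0 J" "(j, e, Zero C J (omap F Y)) \<in> D" "is_isom Q (cl j)" "cl (j \<cdot> f) = cl x"
proof -
  note it = itriD[OF X(3)]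
  note H = dist_homs[OF n] and Hi = dist_homs[OF it(1-3)]
  have g: "amap F f \<cdot> q \<in> Hom C B (omap F Y)" using comp_hom[OF it(7) F_hom[OF f]] .
  obtain x a Y0 where x: "x \<in> Hom C X Y0" "a \<in> Hom C Y0 N" "(x, a, q \<cdot> c) \<in> D"
    using cocone[OF comp_hom[OF n(3) it(7)] Hi(3)] by blast
  obtain e k where e: "e \<in> Hom C Y0 J" "k \<in> Hom C (omap F Y) (omap F Y0)" "(e, (amap F f \<cdot> q) \<cdot> p, k) \<in> D"
    "k \<cdot> (amap F f \<cdot> q) = amap F x \<cdot> q"
    by (rule pullback[OF it(1) rotate[OF n(1)] x(3) it(2,3) n(3) g x(1,2)])
  \<comment> \<open>Hence the connecting arrow from J to the shift of Y is zero, so Y0 splits and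
    its inclusion \<open>j\<close> of Y is invertible modulo I.\<close>
  have "q \<cdot> p = Zero C J (omap F X)" using dist_zero2(1)[OF it(1-3)] .
  then have z: "(amap F f \<cdot> q) \<cdot> p = Zero C J (omap F Y)"
    using it(3,7) f Hi H by (simp add: Hom_iff)
  have o: "Y0 \<in> Obj C" using x hom_objs by blast
  obtain j where j: "j \<in> Hom C Y Y0" "amap F j = k" by (rule F_full[OF e(2) H(3) o])
  have jn: "Neg C j \<in> Hom C Y Y0" using j by (simp add: Hom_iff)
  have z0: "Zero C J (omap F Y) \<in> Hom C J (omap F Y)" using Hi H by (simp add: Hom_iff)
  have "(Neg C j, e, Zero C J (omap F Y)) \<in> D"
    by (rule rotate_back[OF jn e(1) z0]) (use e(2,3) z j in \<open>simp add: Hom_iff\<close>)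
  from dist_signs(2)[OF this] have dj: "(j, e, Zero C J (omap F Y)) \<in> D"
    using j(1) Hi H by (simp add: Hom_iff)
  have "is_isom Q (cl j)" by (rule split_right[OF dj j(1) e(1) it(5)])
  moreover have "cl (j \<cdot> f) = cl x"
  proof -
    have "amap F (j \<cdot> f) \<cdot> q = amap F x \<cdot> q"
      using e(2,4) j f it(7) by (simp add: Hom_iff)
    then show ?thesis using itri_ext_eq[OF X(3) comp_hom[OF f j(1)] x(1)] by blast
  qed
  ultimately show thesis using that x j(1) e(1) dj by blast
qed

text \<open>N is an extension of \<open>up X\<close> by Y, and Y0 one of J by Y, so they remain in U
  and in Z.\<close>

lemma inflation_Z:
  assumes X: "X \<in> Z" and Y: "Y \<in> Z" and f: "f \<in> Hom C X Y"
  obtains x a b Y0 N j where "(x, a, b) \<in> D" "x \<in> Hom C X Y0" "a \<in> Hom C Y0 N" "Y0 \<in> Z" "N \<in> U"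
    "j \<in> Hom C Y Y0" "is_isom Q (cl j)" "cl (j \<cdot> f) = cl x"
proof -
  obtain i J p where t: "itri X i J p (up X) (qq X)" by (rule plus_itri[OF X])
  note it = itriD[OF t]
  have oY: "Y \<in> Obj C" and XT: "X \<in> T" using X Y memb_obj by blast+
  obtain n c N where n: "n \<in> Hom C Y N" "c \<in> Hom C N (up X)" "(n, c, amap F f \<cdot> qq X) \<in> D"
    by (rule cocone[OF comp_hom[OF it(7) F_hom[OF f]] oY])
  obtain x a Y0 j e where x: "(x, a, qq X \<cdot> c) \<in> D" "x \<in> Hom C X Y0" "a \<in> Hom C Y0 N"
    "j \<in> Hom C Y Y0" "e \<in> Hom C Y0 J" "(j, e, Zero C J (omap F Y)) \<in> D" "is_isom Q (cl j)" "cl (j \<cdot> f) = cl x"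
    by (rule inflation[OF XT it(6) t oY f n(3,1,2)])
  have "N \<in> U" using cp_left_ext[OF UV n(3,1,2) _ it(6)] Y by blast
  moreover have "Y0 \<in> Z"
    using cp_left_ext[OF UV x(6,4,5)] cp_right_ext[OF ST x(6,4,5)] I_memb[OF it(5)] Y by blast
  ultimately show thesis using that x by blast
qed

lemma DT_cone:
  assumes f: "f \<in> Hom Q X Y" and X: "X \<in> Z" "Y \<in> Z"
  shows "\<exists>g h. (f, g, h) \<in> DT"
proof -
  obtain f0 where f0: "f0 \<in> Hom C X Y" "f = cl f0" using f by (rule q.Q_homE)
  obtain x a b Y0 N j where i: "(x, a, b) \<in> D" "x \<in> Hom C X Y0" "a \<in> Hom C Y0 N" "Y0 \<in> Z" "N \<in> U"
    "j \<in> Hom C Y Y0" "is_isom Q (cl j)" "cl (j \<cdot> f0) = cl x"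
    by (rule inflation_Z[OF X f0(1)])
  note H = dist_homs[OF i(1-3)]
  obtain s where s: "s \<in> Hom Q Y0 Y" "s \<star> cl j = Ident Q Y" "cl j \<star> s = Ident Q Y0" "is_isom Q s"
    using Qa.is_isomE[OF i(7) q.cl_hom[OF i(6)]] by metis
  have oN: "N \<in> Obj C" by (rule H(5))
  have rs: "refl Y0 Y s" by (rule refl_isom[OF s(4,1)])
  have NT: "sg N \<in> T" by (rule sg_T[OF oN])
  obtain g where g: "g \<in> Hom Q Y (sg N)" "g \<star> s = et N \<star> cl a"
    by (rule refl_ex[OF rs Qa.comp_hom[OF q.cl_hom[OF i(3)] et_hom[OF oN]] NT])
  have ST: "Sg X \<in> T" using Sg_Z X by blast
  obtain h where h: "h \<in> Hom Q (sg N) (Sg X)" "h \<star> et N = delta X b"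
    by (rule refl_ex[OF et_refl[OF oN] delta_hom[OF X(1) i(5) H(2)] ST])
  have "f = s \<star> cl x"
    using q.Q_comp[OF f0(1) i(6)] Qa.comp_cancel_left[OF s(2) q.cl_hom[OF i(6)] s(1), of "cl f0"] i(8) f0
    by (simp add: Hom_iff)
  then have "(f, g, h) \<in> DT"
    using DT_intro[OF i(1-3) X(1) _ i(5) rs et_refl[OF oN] X(2) sg_Z[OF i(5)] f g(1) h(1) _ g(2) h(2)] i(4) by blast
  then show ?thesis by blast
qed

text \<open>
  The rotated triangle is obtained from \<open>Y \<rightarrow> N \<rightarrow> X\<langle>1\<rangle> \<rightarrow> Y[1]\<close>, whose second term agrees with
  the cone \<open>M\<close> of \<open>f\<close> modulo \<open>I\<close>.
\<close>

lemma std_rotate: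
  assumes d: "(f, a, b) \<in> D" "f \<in> Hom C X Y" "a \<in> Hom C Y M" and X: "X \<in> Z" "Y \<in> Z" "M \<in> U"
    and h: "h \<in> Hom Q (sg M) (Sg X)" "h \<star> et M = delta X b"
  shows "(et M \<star> cl a, h, Sa (cl (Neg C f))) \<in> DT"
proof -
  note H = dist_homs[OF d]
  obtain i J p where t: "itri X i J p (up X) (qq X)" by (rule plus_itri[OF X(1)])
  note it = itriD[OF t]
  \<comment> \<open>The sign is the one that rotation puts on the shifted arrow; building N from
    minus \<open>f\<close> produces it directly as the third arrow.\<close>
  have nf: "Neg C f \<in> Hom C X Y" using d by (simp add: Hom_iff)
  obtain n c N where n: "n \<in> Hom C Y N" "c \<in> Hom C N (up X)" "(n, c, amap F (Neg C f) \<cdot> qq X) \<in> D"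
    by (rule cocone[OF comp_hom[OF it(7) F_hom[OF nf]] H(4)])
  have NU: "N \<in> U" using cp_left_ext[OF UV n(3,1,2) _ it(6)] X by blast
  obtain e k where k: "e \<in> Hom C J N" "k \<in> Hom C N M" "(e, k, amap F i \<cdot> Neg C b) \<in> D"
    "k \<cdot> n = a" "Neg C b \<cdot> k = Neg C (qq X \<cdot> c)"
    by (rule pushout[OF it(1) dist_signs(2)[OF d(1)] n(3) it(2,3) nf d(3) n(1,2)])
  \<comment> \<open>N is an extension of M by J. Its connecting arrow runs from U to V[1] and so
    vanishes, which makes \<open>k\<close> invertible modulo I.\<close>
  have "Neg C b \<in> Hom C M (omap F X)" using H by (simp add: Hom_iff)
  then have "amap F i \<cdot> Neg C b = Zero C M (omap F J)"
    using vanish_UV[OF comp_hom[OF _ F_hom[OF it(2)]] X(3) I_memb(4)[OF it(5)]] by blast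
  then have "is_isom Q (cl k)" using split_left[OF _ k(1,2) it(5)] k(3) by simp
  then have rk: "refl N M (cl k)" using refl_isom q.cl_hom[OF k(2)] by blast
  have bk: "b \<cdot> k = qq X \<cdot> c" using k(2,5) n(2) it(7) H by (simp add: Hom_iff)
  note eM = et_hom[OF H(5)]
  have XU: "up X \<in> Obj C" using it hom_objs by blast
  show ?thesis
  proof (rule DT_intro[OF n(3,1,2) X(2) NU it(6) refl_comp[OF rk et_refl[OF H(5)]] et_up_refl[OF X(1)]
        sg_Z[OF X(3)] Sg_Z[OF X(1)] Qa.comp_hom[OF q.cl_hom[OF d(3)] eM] h(1) Sa_hom[OF X(1,2) q.cl_hom[OF nf]]])
    show "et M \<star> cl a = et M \<star> cl k \<star> cl n"
      using q.Q_comp[OF n(1) k(2)] k(4) Qa.comp_assoc[OF q.cl_hom[OF n(1)] q.cl_hom[OF k(2)] eM] by simp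
    have "h \<star> (et M \<star> cl k) = delta X b \<star> cl k"
      using Qa.comp_assoc[OF q.cl_hom[OF k(2)] eM h(1)] h(2) by simp
    also have "\<dots> = et (up X) \<star> cl c"
      using delta_comp[OF X(1,3) H(2) k(2)] bk delta_eq[OF X(1) n(2)] by simp
    finally show "h \<star> (et M \<star> cl k) = et (up X) \<star> cl c" .
    show "Sa (cl (Neg C f)) \<star> et (up X) = delta Y (amap F (Neg C f) \<cdot> qq X)"
      using delta_natural[OF X(1,2) nf it(6,7)] delta_q[OF X(1)] by simp
  qed
qed

lemma DT_rotate:
  assumes "(f, g, h) \<in> DT"
  shows "(g, h, Neg ZQ (Sa f)) \<in> DT"
proof -
  interpret R: addftor ZQ \<Sigma> by (rule ZQ_addftor)
  obtain s where s: "s \<in> STD" "tri_isomorphic ZQ \<Sigma> (f, g, h) s" by (rule DT_elim[OF assms])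
  obtain f0 a b X Y M k where S1: "s = (cl f0, et M \<star> cl a, k)" "(f0, a, b) \<in> D" "f0 \<in> Hom C X Y" "a \<in> Hom C Y M"
    "X \<in> Z" "Y \<in> Z" "M \<in> U" "b \<in> Hom C M (omap F X)" "k \<in> Hom Q (sg M) (Sg X)" "k \<star> et M = delta X b"
    by (rule std_elim[OF s(1)])
  have fZ: "cl f0 \<in> Hom ZQ X Y" unfolding ZQ_hom using q.cl_hom[OF S1(3)] S1 by blast
  have n: "Neg ZQ (cl f0) = cl (Neg C f0)"
    using Qa.full_neg[OF fZ] q.Q_neg[OF S1(3)] by simp
  have "Neg ZQ (Sa (cl f0)) = Sa (cl (Neg C f0))"
    using R.F_neg[of "cl f0"] fZ n S1(5,6) by (simp add: Hom_iff)
  then have st: "(et M \<star> cl a, k, Neg ZQ (Sa (cl f0))) \<in> DT"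
    using std_rotate[OF S1(2-7,9,10)] by simp
  note T = DT_triangle[OF assms] std_triangle[OF s(1)]
  have rt: "is_triangle ZQ \<Sigma> (g, h, Neg ZQ (Sa f))"
  proof -
    obtain A B E where t1: "f \<in> Hom ZQ A B" "g \<in> Hom ZQ B E" "h \<in> Hom ZQ E (Sg A)"
      using T(1) unfolding is_triangle_def by auto
    have "Neg ZQ (Sa f) \<in> Hom ZQ (Sg A) (Sg B)"
      using R.neg0(1)[OF R.hom_objs[OF R.F_hom[OF t1(1)]] R.F_hom[OF t1(1)]] .
    then show ?thesis unfolding is_triangle_def using t1 by blast
  qed
  have "tri_isomorphic ZQ \<Sigma> (g, h, Neg ZQ (Sa f)) (et M \<star> cl a, k, Neg ZQ (Sa (cl f0)))"
    using R.tri_iso_rotate T s(2) unfolding S1(1) by blast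
  then have "tri_isomorphic ZQ \<Sigma> (et M \<star> cl a, k, Neg ZQ (Sa (cl f0))) (g, h, Neg ZQ (Sa f))"
    using R.tri_iso_sym[OF rt DT_triangle[OF st]] by blast
  then show ?thesis using DT_iso[OF st rt] by blast
qed

text \<open>X need not be in Z, so the triangle is first pushed out along the unit of X. The arrow
  from Y to the pushout Y1 again has cone S0, hence \<open>sg Y\<close> is a reflection of Y1 as
  well and \<open>DT_intro\<close> applies.\<close>

lemma DT_push:
  assumes d: "(u, v, b) \<in> D" "u \<in> Hom C X Y" "v \<in> Hom C Y M" and U: "X \<in> U" "Y \<in> U" "M \<in> U"
    and t: "et X = cl t" "(t, w, r) \<in> D" "t \<in> Hom C X (sg X)" "w \<in> Hom C (sg X) S0" "S0 \<in> S"
    and h: "h \<in> Hom Q (sg M) (Sg (sg X))" "h \<star> et M = delta (sg X) (amap F t \<cdot> b)"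
  shows "(sa (cl u), sa (cl v), h) \<in> DT"
proof -
  note H = dist_homs[OF d]
  have oX: "sg X \<in> Obj C" using t hom_objs by blast
  have XZ: "sg X \<in> Z" by (rule sg_Z[OF U(1)])
  obtain x a Y1 where x: "x \<in> Hom C (sg X) Y1" "a \<in> Hom C Y1 M" "(x, a, amap F t \<cdot> b) \<in> D"
    by (rule cocone[OF comp_hom[OF H(2) F_hom[OF t(3)]] oX])
  obtain e k where e: "e \<in> Hom C Y Y1" "k \<in> Hom C Y1 S0" "(e, k, amap F u \<cdot> r) \<in> D" "e \<cdot> u = x \<cdot> t" "a \<cdot> e = v"
    by (rule pushout[OF d(1) t(2) x(3) d(2,3) t(3,4) x(1,2)])
  have re: "refl Y Y1 (cl e)" by (rule cone_S_refl[OF e(3,1,2) t(5)])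
  have Y1: "Y1 \<in> U" using cp_left_ext[OF UV x(3,1,2) _ U(3)] XZ by blast
  have YT: "sg Y \<in> T" by (rule sg_T[OF H(4)])
  note eX = et_hom[OF H(3)] and eY = et_hom[OF H(4)] and eM = et_hom[OF H(5)]
  obtain t2 where t2: "t2 \<in> Hom Q Y1 (sg Y)" "t2 \<star> cl e = et Y" by (rule refl_ex[OF re eY YT])
  have r2: "refl Y1 (sg Y) t2" using refl_cancel[OF re _ t2(1)] t2(2) et_refl[OF H(4)] by simp
  note uQ = q.cl_hom[OF d(2)] and vQ = q.cl_hom[OF d(3)] and xQ = q.cl_hom[OF x(1)] and aQ = q.cl_hom[OF x(2)]
    and eQ = q.cl_hom[OF e(1)]
  note su = sa_eq[OF uQ] and sv = sa_eq[OF vQ]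
  show ?thesis
  proof (rule DT_intro[OF x(3,1,2) XZ Y1 U(3) r2 et_refl[OF H(5)] sg_Z[OF U(2)] sg_Z[OF U(3)] su(1) sv(1) h(1)
        _ _ h(2)])
    show "sa (cl u) = t2 \<star> cl x"
    proof (rule refl_eq[OF et_refl[OF H(3)] su(1) Qa.comp_hom[OF xQ t2(1)] YT])
      have "sa (cl u) \<star> et X = t2 \<star> (cl e \<star> cl u)"
        using su(2) t2(2) Qa.comp_assoc[OF uQ eQ t2(1)] by simp
      also have "cl e \<star> cl u = cl x \<star> et X" using q.Q_comp[OF d(2) e(1)] q.Q_comp[OF t(3) x(1)] e(4) t(1) by simp
      finally show "sa (cl u) \<star> et X = t2 \<star> cl x \<star> et X" using Qa.comp_assoc[OF eX xQ t2(1)] by simp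
    qed
    show "sa (cl v) \<star> t2 = et M \<star> cl a"
    proof (rule refl_eq[OF re Qa.comp_hom[OF t2(1) sv(1)] Qa.comp_hom[OF aQ eM] sg_T[OF H(5)]])
      have "sa (cl v) \<star> t2 \<star> cl e = et M \<star> cl v" using Qa.comp_assoc[OF eQ t2(1) sv(1)] t2(2) sv(2) by simp
      also have "\<dots> = et M \<star> cl a \<star> cl e"
        using q.Q_comp[OF e(1) x(2)] e(5) Qa.comp_assoc[OF eQ aQ eM] by simp
      finally show "sa (cl v) \<star> t2 \<star> cl e = et M \<star> cl a \<star> cl e" .
    qed
  qed
qed

text \<open>Modulo I the two arrows are replaced by composable arrows \<open>x\<close> and
  \<open>x2\<close> with cones N and N2 in U; the cone N3 of the composite is an extension of these.
  The octahedron of C on \<open>x\<close> and \<open>x2\<close> is then carried to the quotient. Its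
  last triangle starts at N, which need not be in Z, and therefore goes through
  \<open>DT_push\<close>.\<close>

lemma DT_octa:
  assumes f: "f \<in> Hom Q X Y" "g \<in> Hom Q Y W" and Z: "X \<in> Z" "Y \<in> Z" "W \<in> Z"
  shows "\<exists>f' f'' g' g'' k' k''. (f, f', f'') \<in> DT \<and> (g, g', g'') \<in> DT \<and> (g \<star> f, k', k'') \<in> DT \<and>
      (\<exists>u \<in> Hom Q (Cod Q f') (Cod Q k'). \<exists>v \<in> Hom Q (Cod Q k') (Cod Q g').
        (u, v, Sa f' \<star> g'') \<in> DT \<and>
        u \<star> f' = k' \<star> g \<and> k'' \<star> u = f'' \<and>
        v \<star> k' = g' \<and> g'' \<star> v = Sa f \<star> k'')"
proof -
  obtain f0 where f0: "f0 \<in> Hom C X Y" "f = cl f0" using f(1) by (rule q.Q_homE)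
  obtain x a b Y0 N j where i: "(x, a, b) \<in> D" "x \<in> Hom C X Y0" "a \<in> Hom C Y0 N" "Y0 \<in> Z" "N \<in> U"
    "j \<in> Hom C Y Y0" "is_isom Q (cl j)" "cl (j \<cdot> f0) = cl x"
    by (rule inflation_Z[OF Z(1,2) f0(1)])
  obtain s where s: "s \<in> Hom Q Y0 Y" "s \<star> cl j = Ident Q Y" "cl j \<star> s = Ident Q Y0" "is_isom Q s"
    using Qa.is_isomE[OF i(7) q.cl_hom[OF i(6)]] by metis
  \<comment> \<open>The first replacement has moved the middle object from Y to Y0, so it is
    \<open>g\<close> after the isomorphism \<open>s\<close> that has to be replaced next.\<close>
  obtain gs where gs: "gs \<in> Hom C Y0 W" "g \<star> s = cl gs" using Qa.comp_hom[OF s(1) f(2)] by (rule q.Q_homE)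
  obtain x2 a2 b2 W0 N2 j2 where i2: "(x2, a2, b2) \<in> D" "x2 \<in> Hom C Y0 W0" "a2 \<in> Hom C W0 N2" "W0 \<in> Z" "N2 \<in> U"
    "j2 \<in> Hom C W W0" "is_isom Q (cl j2)" "cl (j2 \<cdot> gs) = cl x2"
    by (rule inflation_Z[OF i(4) Z(3) gs(1)])
  obtain s2 where s2: "s2 \<in> Hom Q W0 W" "s2 \<star> cl j2 = Ident Q W" "cl j2 \<star> s2 = Ident Q W0" "is_isom Q s2"
    using Qa.is_isomE[OF i2(7) q.cl_hom[OF i2(6)]] by metis
  have xx: "x2 \<cdot> x \<in> Hom C X W0" using i i2 comp_hom by blast
  then have "x2 \<cdot> x \<in> Arr C" by (simp add: Hom_iff)
  then obtain k k'' where k: "(x2 \<cdot> x, k, k'') \<in> D" using dist_cone by blast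
  define N3 where "N3 = Cod C k"
  have kH: "k \<in> Hom C W0 N3" "k'' \<in> Hom C N3 (omap F X)" using dist_arr[OF k] xx N3_def by (auto simp: Hom_iff)
  obtain u v where u: "u \<in> Hom C N N3" "v \<in> Hom C N3 N2" "(u, v, amap F a \<cdot> b2) \<in> D"
    "u \<cdot> a = k \<cdot> x2" "k'' \<cdot> u = b" "v \<cdot> k = a2" "b2 \<cdot> v = amap F x \<cdot> k''"
    using octa[OF i(2) i2(2) i(1) i2(1) k] i(3) i2(3) N3_def by (auto simp: Hom_iff)
  note H = dist_homs[OF i(1-3)] and H2 = dist_homs[OF i2(1-3)]
  have N3: "N3 \<in> U" by (rule cp_left_ext[OF UV u(3,1,2) i(5) i2(5)])
  have o: "N \<in> Obj C" "N2 \<in> Obj C" "N3 \<in> Obj C" using N3 i(5) i2(5) memb_obj by blast+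
  note eN = et_hom[OF o(1)] and eN2 = et_hom[OF o(2)] and eN3 = et_hom[OF o(3)]
  have SgT: "Sg X \<in> T" "Sg Y0 \<in> T" "Sg Y \<in> T" "Sg W \<in> T" using Sg_Z Z i(4) by blast+
  note jQ = q.cl_hom[OF i(6)] and j2Q = q.cl_hom[OF i2(6)] and xQ = q.cl_hom[OF i(2)] and x2Q = q.cl_hom[OF i2(2)]
    and aQ = q.cl_hom[OF i(3)] and a2Q = q.cl_hom[OF i2(3)] and kQ = q.cl_hom[OF kH(1)]
    and uQ = q.cl_hom[OF u(1)] and vQ = q.cl_hom[OF u(2)]
  have fx: "f = s \<star> cl x"
    using q.Q_comp[OF f0(1) i(6)] Qa.comp_cancel_left[OF s(2) jQ s(1), of "cl f0"] i(8) f0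
    by (simp add: Hom_iff)
  have x2s: "s2 \<star> cl x2 = g \<star> s"
    using q.Q_comp[OF gs(1) i2(6)] Qa.comp_cancel_left[OF s2(2) j2Q s2(1), of "cl gs"] i2(8) gs
    by (simp add: Hom_iff)
  have x2j: "cl x2 \<star> cl j = cl j2 \<star> g"
  proof -
    have "cl x2 = cl j2 \<star> (g \<star> s)" using q.Q_comp[OF gs(1) i2(6)] i2(8) gs(2) by simp
    then have "cl x2 \<star> cl j = cl j2 \<star> (g \<star> (s \<star> cl j))" using jQ j2Q f(2) s(1) by (simp add: Hom_iff)
    then show ?thesis unfolding s(2) using f(2) by (simp add: Hom_iff)
  qed
  define f' where "f' = et N \<star> cl a \<star> cl j"
  define k' where "k' = et N3 \<star> cl k \<star> cl j2"
  define g' where "g' = et N2 \<star> cl a2 \<star> cl j2"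
  have f'H: "f' \<in> Hom Q Y (sg N)" "k' \<in> Hom Q W (sg N3)" "g' \<in> Hom Q W (sg N2)"
    unfolding f'_def k'_def g'_def using jQ j2Q eN eN2 eN3 aQ a2Q kQ Qa.comp_hom by blast+
  have f's: "f' \<star> s = et N \<star> cl a" "k' \<star> s2 = et N3 \<star> cl k" "g' \<star> s2 = et N2 \<star> cl a2"
    unfolding f'_def k'_def g'_def using jQ j2Q eN eN2 eN3 aQ a2Q kQ s(1) s2(1) s(3) s2(3) by (simp_all add: Hom_iff)
  obtain f'' where f'': "f'' \<in> Hom Q (sg N) (Sg X)" "f'' \<star> et N = delta X b"
    by (rule refl_ex[OF et_refl[OF o(1)] delta_hom[OF Z(1) i(5) H(2)] SgT(1)])
  obtain g0 where g0: "g0 \<in> Hom Q (sg N2) (Sg Y0)" "g0 \<star> et N2 = delta Y0 b2"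
    by (rule refl_ex[OF et_refl[OF o(2)] delta_hom[OF i(4) i2(5) H2(2)] SgT(2)])
  obtain k0 where k0: "k0 \<in> Hom Q (sg N3) (Sg X)" "k0 \<star> et N3 = delta X k''"
    by (rule refl_ex[OF et_refl[OF o(3)] delta_hom[OF Z(1) N3 kH(2)] SgT(1)])
  have rs: "refl Y0 Y s" "refl W0 W s2" using refl_isom s(1,4) s2(1,4) by blast+
  have YU: "Y0 \<in> U" "W0 \<in> U" using i(4) i2(4) by blast+
  have gf: "g \<star> f \<in> Hom Q X W" by (rule Qa.comp_hom[OF f])
  have gfx: "g \<star> f = s2 \<star> cl (x2 \<cdot> x)"
  proof -
    have "s2 \<star> cl (x2 \<cdot> x) = (s2 \<star> cl x2) \<star> cl x"
      using q.Q_comp[OF i(2) i2(2)] Qa.comp_assoc[OF xQ x2Q s2(1)] by simp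
    also have "\<dots> = g \<star> f" unfolding x2s fx using Qa.comp_assoc[OF xQ s(1) f(2)] by simp
    finally show ?thesis by simp
  qed
  have t1: "(f, f', f'') \<in> DT"
    by (rule DT_intro[OF i(1-3) Z(1) YU(1) i(5) rs(1) et_refl[OF o(1)] Z(2) sg_Z[OF i(5)] f(1) f'H(1) f''(1) fx f's(1) f''(2)])
  have t3: "(g \<star> f, k', k0) \<in> DT"
    by (rule DT_intro[OF k xx kH(1) Z(1) YU(2) N3 rs(2) et_refl[OF o(3)] Z(3) sg_Z[OF N3] gf f'H(2) k0(1) gfx f's(2) k0(2)])
  define g'' where "g'' = Sa s \<star> g0"
  note Ss = Sa_hom[OF i(4) Z(2) s(1)]
  have g''H: "g'' \<in> Hom Q (sg N2) (Sg Y)" unfolding g''_def by (rule Qa.comp_hom[OF g0(1) Ss])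
  have I2: "Ident Q (sg N2) \<in> Hom Q (sg N2) (sg N2)" "is_isom Q (Ident Q (sg N2))"
    using Qa.hom_objs[OF eN2] by (auto simp: Hom_iff)
  have t2: "(g, g', g'') \<in> DT"
  proof (rule DT_isoI[OF std_DT[OF std_intro[OF i2(1-3) i(4) i2(4,5) g0]] x2Q Qa.comp_hom[OF a2Q eN2] g0(1) i(4) i2(4) sg_Z[OF i2(5)]
        f(2) f'H(3) g''H Z(2,3) sg_Z[OF i2(5)] s(1) s2(1) I2(1) s(4) s2(4) I2(2)])
    show "s2 \<star> cl x2 = g \<star> s" by (rule x2s)
    show "Ident Q (sg N2) \<star> (et N2 \<star> cl a2) = g' \<star> s2"
      using f's(3) Qa.ident_left[OF Qa.comp_hom[OF a2Q eN2]] by simp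
    show "Sa s \<star> g0 = g'' \<star> Ident Q (sg N2)" using Qa.ident_right[OF g''H] g''_def by simp
  qed
  note su = sa_eq[OF uQ] and sv = sa_eq[OF vQ]
  note Sf' = Sa_hom[OF Z(2) sg_Z[OF i(5)] f'H(1)]
  obtain t0 w r S0 where t0: "(t0, w, r) \<in> D" "t0 \<in> Hom C N (sg N)" "w \<in> Hom C (sg N) S0" "S0 \<in> S" "et N = cl t0"
    by (rule unit_cone[OF o(1)])
  have t4: "(sa (cl u), sa (cl v), Sa f' \<star> g'') \<in> DT"
  proof (rule DT_push[OF u(3,1,2) i(5) N3 i2(5) t0(5,1-4)])
    show "Sa f' \<star> g'' \<in> Hom Q (sg N2) (Sg (sg N))" by (rule Qa.comp_hom[OF g''H Sf'])
    have ta: "t0 \<cdot> a \<in> Hom C Y0 (sg N)" by (rule comp_hom[OF i(3) t0(2)])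
    have "Sa f' \<star> g'' = Sa (f' \<star> s) \<star> g0"
      unfolding g''_def Sa_comp[OF i(4) Z(2) sg_Z[OF i(5)] s(1) f'H(1)] using Qa.comp_assoc[OF g0(1) Ss Sf'] .
    also have "f' \<star> s = cl (t0 \<cdot> a)" unfolding f's(1) using q.Q_comp[OF i(3) t0(2)] t0(5) by simp
    finally have "Sa f' \<star> g'' \<star> et N2 = Sa (cl (t0 \<cdot> a)) \<star> delta Y0 b2"
      using Qa.comp_assoc[OF eN2 g0(1) Sa_hom[OF i(4) sg_Z[OF i(5)] q.cl_hom[OF ta]]] g0(2) by simp
    also have "\<dots> = delta (sg N) (amap F (t0 \<cdot> a) \<cdot> b2)"
      using delta_natural[OF i(4) sg_Z[OF i(5)] ta i2(5) H2(2)] by simp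
    finally show "Sa f' \<star> g'' \<star> et N2 = delta (sg N) (amap F t0 \<cdot> (amap F a \<cdot> b2))"
      using i(3) t0(2) H2(2) by (simp add: Hom_iff)
  qed
  have c1: "sa (cl u) \<star> f' = k' \<star> g"
  proof -
    have "sa (cl u) \<star> f' = (sa (cl u) \<star> et N) \<star> (cl a \<star> cl j)" unfolding f'_def using su(1) eN aQ jQ by (simp add: Hom_iff)
    also have "\<dots> = et N3 \<star> ((cl u \<star> cl a) \<star> cl j)" unfolding su(2) using uQ eN3 aQ jQ by (simp add: Hom_iff)
    also have "cl u \<star> cl a = cl k \<star> cl x2" using q.Q_comp[OF i(3) u(1)] q.Q_comp[OF i2(2) kH(1)] u(4) by simp
    also have "et N3 \<star> ((cl k \<star> cl x2) \<star> cl j) = et N3 \<star> (cl k \<star> (cl x2 \<star> cl j))" using kQ x2Q jQ by (simp add: Hom_iff)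
    also have "\<dots> = k' \<star> g" unfolding x2j k'_def using kQ j2Q f(2) eN3 by (simp add: Hom_iff)
    finally show ?thesis .
  qed
  have c2: "k0 \<star> sa (cl u) = f''"
  proof (rule refl_eq[OF et_refl[OF o(1)] Qa.comp_hom[OF su(1) k0(1)] f''(1) SgT(1)])
    have "k0 \<star> sa (cl u) \<star> et N = k0 \<star> (et N3 \<star> cl u)" using su(2) Qa.comp_assoc[OF eN su(1) k0(1)] by simp
    also have "\<dots> = delta X k'' \<star> cl u" using k0(2) Qa.comp_assoc[OF uQ eN3 k0(1)] by simp
    also have "\<dots> = delta X b" using delta_comp[OF Z(1) N3 kH(2) u(1)] u(5) by simp
    finally show "k0 \<star> sa (cl u) \<star> et N = f'' \<star> et N" unfolding f''(2) .
  qed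
  have c3: "sa (cl v) \<star> k' = g'"
  proof -
    have "sa (cl v) \<star> k' = (sa (cl v) \<star> et N3) \<star> (cl k \<star> cl j2)" unfolding k'_def using sv(1) eN3 kQ j2Q by (simp add: Hom_iff)
    also have "\<dots> = et N2 \<star> ((cl v \<star> cl k) \<star> cl j2)" unfolding sv(2) using vQ eN2 kQ j2Q by (simp add: Hom_iff)
    also have "cl v \<star> cl k = cl a2" using q.Q_comp[OF kH(1) u(2)] u(6) by simp
    also have "et N2 \<star> (cl a2 \<star> cl j2) = g'" unfolding g'_def using a2Q j2Q eN2 by (simp add: Hom_iff)
    finally show ?thesis .
  qed
  have c4: "g'' \<star> sa (cl v) = Sa f \<star> k0"
  proof (rule refl_eq[OF et_refl[OF o(3)] Qa.comp_hom[OF sv(1) g''H] Qa.comp_hom[OF k0(1) Sa_hom[OF Z(1,2) f(1)]] SgT(3)])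
    note Sx = Sa_hom[OF Z(1) i(4) xQ]
    have "g'' \<star> sa (cl v) \<star> et N3 = Sa s \<star> (g0 \<star> (et N2 \<star> cl v))"
      unfolding g''_def sv(2)[symmetric] using Ss g0(1) sv(1) eN3 by (simp add: Hom_iff)
    also have "g0 \<star> (et N2 \<star> cl v) = delta Y0 (b2 \<cdot> v)"
      using Qa.comp_assoc[OF vQ eN2 g0(1)] g0(2) delta_comp[OF i(4) i2(5) H2(2) u(2)] by simp
    also have "delta Y0 (b2 \<cdot> v) = Sa (cl x) \<star> (k0 \<star> et N3)"
      using u(7) delta_natural[OF Z(1) i(4) i(2) N3 kH(2)] k0(2) by simp
    also have "Sa s \<star> (Sa (cl x) \<star> (k0 \<star> et N3)) = (Sa s \<star> Sa (cl x)) \<star> k0 \<star> et N3"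
      using Ss Sx k0(1) eN3 by (simp add: Hom_iff)
    also have "Sa s \<star> Sa (cl x) = Sa f" using Sa_comp[OF Z(1) i(4) Z(2) xQ s(1)] fx by simp
    finally show "g'' \<star> sa (cl v) \<star> et N3 = Sa f \<star> k0 \<star> et N3" .
  qed
  have cod: "Cod Q f' = sg N" "Cod Q k' = sg N3" "Cod Q g' = sg N2" using f'H by (auto simp: Hom_iff)
  show ?thesis
    by (rule exI[of _ f'], rule exI[of _ f''], rule exI[of _ g'], rule exI[of _ g''], rule exI[of _ k'], rule exI[of _ k0],
      intro conjI t1 t2 t3 bexI[of _ "sa (cl u)"] bexI[of _ "sa (cl v)"] t4 c1 c2 c3 c4)
      (use su(1) sv(1) cod in simp_all)
qed

section \<open>Invertibility of the shift\<close>

lemma corefl_comp: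
  assumes "corefl A B s" "corefl B X t"
  shows "corefl A X (t \<star> s)"
  unfolding corefl_def
proof (intro conjI ballI)
  note s = corefl_hom[OF assms(1)] and t = corefl_hom[OF assms(2)]
  show "t \<star> s \<in> Hom Q A X" using Qa.comp_hom s t by blast
  fix W k assume W: "W \<in> U" and k: "k \<in> Hom Q W X"
  obtain k1 where k1: "k1 \<in> Hom Q W B" "t \<star> k1 = k" by (rule corefl_ex[OF assms(2) k W])
  obtain k2 where k2: "k2 \<in> Hom Q W A" "s \<star> k2 = k1" by (rule corefl_ex[OF assms(1) k1(1) W])
  show "\<exists>!k'. k' \<in> Hom Q W A \<and> t \<star> s \<star> k' = k"
  proof (intro ex1I[of _ k2] conjI)
    show "t \<star> s \<star> k2 = k" using Qa.comp_assoc[OF k2(1) s t] k1 k2 by simp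
    fix k' assume k': "k' \<in> Hom Q W A \<and> t \<star> s \<star> k' = k"
    then have h: "k' \<in> Hom Q W A" and e: "t \<star> s \<star> k' = k" by blast+
    have "t \<star> (s \<star> k') = t \<star> (s \<star> k2)"
      using Qa.comp_assoc[OF h s t] Qa.comp_assoc[OF k2(1) s t] k1 k2 e by simp
    then have "s \<star> k' = s \<star> k2" by (rule corefl_eq[OF assms(2) Qa.comp_hom[OF h s] Qa.comp_hom[OF k2(1) s] W])
    then show "k' = k2" by (rule corefl_eq[OF assms(1) h k2(1) W])
  qed (rule k2(1))
qed

lemma corefl_isom:
  assumes "is_isom Q u" "u \<in> Hom Q A X"
  shows "corefl A X u"
  unfolding corefl_def
proof (intro conjI ballI)
  show "u \<in> Hom Q A X" by (rule assms)
  obtain u' where u': "u' \<in> Hom Q X A" "u' \<star> u = Ident Q A" "u \<star> u' = Ident Q X"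
    using Qa.is_isomE[OF assms] by metis
  fix W k assume k: "k \<in> Hom Q W X"
  show "\<exists>!k'. k' \<in> Hom Q W A \<and> u \<star> k' = k"
  proof (intro ex1I[of _ "u' \<star> k"] conjI)
    show "u' \<star> k \<in> Hom Q W A" by (rule Qa.comp_hom[OF k u'(1)])
    show 1: "u \<star> (u' \<star> k) = k" using Qa.comp_cancel_left[OF u'(3,1) assms(2)] k by (simp add: Hom_iff)
    fix k' assume k': "k' \<in> Hom Q W A \<and> u \<star> k' = k"
    then show "k' = u' \<star> k" using Qa.isom_mono[OF assms _ Qa.comp_hom[OF k u'(1)]] 1 by simp
  qed
qed

section \<open>Objects that vanish modulo the ideal\<close>

definition nul :: "'o \<Rightarrow> bool" where "nul A \<longleftrightarrow> A \<in> Obj C \<and> Ident Q A = Zero Q A A"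

lemma nul_hom:
  assumes "nul A"
  shows "f \<in> Hom Q A X \<Longrightarrow> f = Zero Q A X" "f \<in> Hom Q X A \<Longrightarrow> f = Zero Q X A"
proof -
  have "is_zero_object Q A" using assms Qa.zero_object_iff[of A] unfolding nul_def by simp
  then show "f \<in> Hom Q A X \<Longrightarrow> f = Zero Q A X" "f \<in> Hom Q X A \<Longrightarrow> f = Zero Q X A"
    using Qa.zero_obj_hom_eq by blast+
qed

lemma nul_I: "J \<in> I \<Longrightarrow> nul J"
  unfolding nul_def using I_zero memb_obj by blast

lemma nul_in_I: "nul A \<Longrightarrow> A \<in> I"
  unfolding nul_def using zero_in_I by blast

lemma nul_isom:
  assumes "is_isom Q z" "z \<in> Hom Q A B"
  shows "nul A \<longleftrightarrow> nul B"
proof -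
  have o: "A \<in> Obj C" "B \<in> Obj C" using Qa.hom_objs[OF assms(2)] by auto
  obtain y where y: "y \<in> Hom Q B A" "y \<star> z = Ident Q A" "z \<star> y = Ident Q B"
    using Qa.is_isomE[OF assms] by metis
  show ?thesis
  proof
    assume "nul A"
    then have "z = Zero Q A B" using nul_hom(1) assms(2) by blast
    then show "nul B" unfolding nul_def using y(1,3) o by (simp add: Hom_iff)
  next
    assume "nul B"
    then have "z = Zero Q A B" using nul_hom(2) assms(2) by blast
    then show "nul A" unfolding nul_def using y(1,2) o by (simp add: Hom_iff)
  qed
qed

lemma nul_refl:
  assumes "refl X A t" "A \<in> T" "nul X"
  shows "nul A"
proof -
  note t = refl_hom[OF assms(1)]
  have o: "X \<in> Obj C" "A \<in> Obj C" using Qa.hom_objs[OF t] by auto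
  have t0: "t = Zero Q X A" by (rule nul_hom(1)[OF assms(3) t])
  have "Ident Q A = Zero Q A A"
    by (rule refl_eq[OF assms(1) _ _ assms(2)]) (use o t0 in \<open>auto simp: Hom_iff\<close>)
  then show ?thesis unfolding nul_def using o by blast
qed

lemma nul_corefl:
  assumes "corefl A X u" "A \<in> U" "nul X"
  shows "nul A"
proof -
  note u = corefl_hom[OF assms(1)]
  have o: "X \<in> Obj C" "A \<in> Obj C" using Qa.hom_objs[OF u] by auto
  have u0: "u = Zero Q A X" by (rule nul_hom(2)[OF assms(3) u])
  have "Ident Q A = Zero Q A A"
    by (rule corefl_eq[OF assms(1) _ _ assms(2)]) (use o u0 in \<open>auto simp: Hom_iff\<close>)
  then show ?thesis unfolding nul_def using o by blast
qed

lemma starI: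
  assumes "(x, y, b) \<in> D" "x \<in> Hom C A G" "y \<in> Hom C G B" "A \<in> \<X>" "B \<in> \<Y>"
  shows "G \<in> star C D \<X> \<Y>"
proof -
  have "Dom C x = A" "Cod C x = G" "Cod C y = B" using assms(2,3) by (auto simp: Hom_iff)
  then show ?thesis unfolding star_def using assms dist_homs(4)[OF assms(1-3)] by blast
qed

text \<open>An isomorphism carries vanishing across in both directions; in this form condition (I)
  enters the two splitting arguments below.\<close>

lemma condition_I_nul:
  assumes d: "(x, y, b) \<in> D" "x \<in> Hom C A G" "y \<in> Hom C G B" "A \<in> T" "B \<in> U"
  shows "nul (sg (om G)) \<longleftrightarrow> nul (om (sg G))"
proof -
  have G: "G \<in> Obj C" using dist_homs[OF d(1-3)] by blast
  have "G \<in> star C D T U" by (rule starI[OF d])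
  then have "is_isom ZQ (mu P K G)" using condI unfolding condition_I_def by simp
  then have "is_isom Q (mu P K G)"
    using ZQ_isom[OF mu_hom[OF G] sg_Z[OF om_U[OF G]] om_Z[OF sg_T[OF G]]] by blast
  then show ?thesis using nul_isom mu_hom[OF G] by blast
qed

text \<open>
  Invertibility of the unit and of the counit of the adjunction between \<open>\<Sigma>\<close> and \<open>\<Omega>\<close>. In
  both proofs, \<open>G'\<close> is an extension of an object of \<open>U\<close> by an object of \<open>T\<close>, one of whose two
  approximations \<open>\<sigma> \<omega>\<^sub>U G'\<close> and \<open>\<omega> \<sigma>\<^sub>T G'\<close> vanishes modulo \<open>I\<close>. By condition (I) both
  vanish, and condition (II) then puts the cone \<open>G\<close> into \<open>S\<close> (resp. \<open>V\<close>), so that the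
  triangle splits.
\<close>

lemma unit_corefl:
  assumes X: "X \<in> Z" and h: "h \<in> Hom C (up X) (Sg X)" "cl h = et (up X)"
    and f: "f \<in> Hom C X (dn (Sg X))" "amap F f \<cdot> qq X = ww (Sg X) \<cdot> h"
  shows "corefl X (dn (Sg X)) (cl f)"
proof -
  let ?Y = "Sg X"
  have Y: "?Y \<in> Z" by (rule Sg_Z[OF X])
  obtain i J p where ti: "itri X i J p (up X) (qq X)" by (rule plus_itri[OF X])
  note it = itriD[OF ti]
  obtain j J' k where tj: "itri (dn ?Y) j J' k ?Y (ww ?Y)" by (rule minus_itri[OF Y])
  note jt = itriD[OF tj]
  have oU: "up X \<in> Obj C" "dn ?Y \<in> Obj C" using it jt memb_obj by blast+
  obtain h0 w r S0 where h0: "(h0, w, r) \<in> D" "h0 \<in> Hom C (up X) ?Y" "w \<in> Hom C ?Y S0" "S0 \<in> S" "et (up X) = cl h0"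
    unfolding functor_unfold by (rule unit_cone[OF oU(1)])
  \<comment> \<open>\<open>h\<close> is traded for the chosen representative \<open>h0\<close> of
    the unit, whose cone is known to lie in S; composites with \<open>ww\<close> do not see the
    difference.\<close>
  have "cl h = cl h0" using h h0 by simp
  then have fw: "amap F f \<cdot> qq X = ww ?Y \<cdot> h0"
    using minus_lift_eq[OF Y h(1) h0(2)] f(2) by simp
  obtain \<kappa> v w2 V0 where \<kappa>: "(\<kappa>, v, w2) \<in> D" "\<kappa> \<in> Hom C (om (dn ?Y)) (dn ?Y)" "v \<in> Hom C (dn ?Y) (omap F V0)"
    "V0 \<in> V" "ep (dn ?Y) = cl \<kappa>"
    by (rule triU_data[OF oU(2)])
  let ?O = "om (dn ?Y)"
  have OZ: "?O \<in> Z" by (rule om_Z[OF jt(4)])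
  have XU: "X \<in> U" "X \<in> T" "?O \<in> U" "?O \<in> T" and oO: "?O \<in> Obj C" using X OZ memb_obj by blast+
  \<comment> \<open>This is the unit from X to \<open>Om (Sg X)\<close>. Once it is invertible
    modulo I, composing it with the counit of \<open>om\<close> gives the claim.\<close>
  obtain f1 where f1: "f1 \<in> Hom C X ?O" "\<kappa> \<cdot> f1 = f" by (rule cone_V_lift[OF \<kappa>(1-4) f(1) XU(1)])
  obtain x' y' G' where G': "x' \<in> Hom C (dn ?Y) G'" "y' \<in> Hom C G' (up X)" "(x', y', amap F f \<cdot> qq X) \<in> D"
    by (rule cocone[OF comp_hom[OF it(7) F_hom[OF f(1)]] oU(2)])
  have oG': "G' \<in> Obj C" using G' hom_objs by blast
  have dG': "(x', y', ww ?Y \<cdot> h0) \<in> D" using G'(3) fw by simp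
  \<comment> \<open>By \<open>fw\<close>, G' is also the pullback of the triangle from
    \<open>dn ?Y\<close> over J' to \<open>?Y\<close> along \<open>h0\<close>. So it maps to J' with
    cone S0, and its reflection in T is J', which vanishes.\<close>
  obtain e \<rho> where e: "e \<in> Hom C G' J'" "(e, w \<cdot> k, \<rho>) \<in> D"
    by (rule pullback[OF jt(1) h0(1) dG' jt(2,3) h0(2,3) G'(1,2)])
  have "refl G' J' (cl e)" by (rule cone_S_refl[OF e(2,1) comp_hom[OF jt(3) h0(3)] h0(4)])
  then obtain z where "z \<in> Hom Q J' (sg G')" "is_isom Q z"
    using refl_to_T[OF _ et_refl[OF oG'] I_memb(2)[OF jt(5)] sg_T[OF oG']] by blast
  then have "nul (sg G')" using nul_isom nul_I[OF jt(5)] by blast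
  then have "nul (om (sg G'))"
    using nul_corefl[OF ep_corefl om_U] sg_T[OF oG'] memb_obj by blast
  then have n1: "nul (sg (om G'))" using condition_I_nul[OF G'(3,1,2) jt(4) it(6)] by blast
  obtain n c G where G: "n \<in> Hom C ?O G" "c \<in> Hom C G (up X)" "(n, c, amap F f1 \<cdot> qq X) \<in> D"
    by (rule cocone[OF comp_hom[OF it(7) F_hom[OF f1(1)]] oO])
  have "amap F \<kappa> \<cdot> (amap F f1 \<cdot> qq X) = amap F f \<cdot> qq X"
    unfolding f1(2)[symmetric] using f1(1) \<kappa>(2) it(7) by (simp add: Hom_iff)
  then have dG2: "(x', y', amap F \<kappa> \<cdot> (amap F f1 \<cdot> qq X)) \<in> D" using G'(3) by simp
  \<comment> \<open>G' is the pushout of G along \<open>\<kappa>\<close>, so the cone of the arrow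
    from G to G' is the shift of V0. Hence G is the coreflection of G' in U, and \<open>sg G\<close>
    agrees with \<open>sg (om G')\<close>.\<close>
  obtain e2 k2 where e2: "e2 \<in> Hom C G G'" "k2 \<in> Hom C G' (omap F V0)" "(e2, k2, amap F n \<cdot> w2) \<in> D"
    by (rule pushout[OF G(3) \<kappa>(1) dG2 G(1,2) \<kappa>(2,3) G'(1,2)])
  have GU: "G \<in> U" by (rule cp_left_ext[OF UV G(3,1,2) XU(3) it(6)])
  have oG: "G \<in> Obj C" using GU memb_obj by blast
  have "corefl G G' (cl e2)" by (rule cone_V_corefl[OF e2(3,1,2) \<kappa>(4)])
  then obtain z2 where z2: "z2 \<in> Hom Q G (om G')" "is_isom Q z2"
    using corefl_to_U[OF _ ep_corefl[OF oG'] GU om_U[OF oG']] by blast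
  have oo: "om G' \<in> Obj C" using om_U[OF oG'] memb_obj by blast
  have "refl G (sg (om G')) (et (om G') \<star> z2)" by (rule refl_comp[OF refl_isom[OF z2(2,1)] et_refl[OF oo]])
  then obtain z3 where "z3 \<in> Hom Q (sg G) (sg (om G'))" "is_isom Q z3"
    using refl_to_T[OF et_refl[OF oG] _ sg_T[OF oG] sg_T[OF oo]] by blast
  then have "nul (sg G)" using nul_isom n1 by blast
  then have "sg G \<in> V" using nul_in_I I_memb by blast
  \<comment> \<open>As \<open>sg G\<close> is in V, the triangle defining it exhibits G as an object
    of S[-1] * V.\<close>
  moreover obtain s t wG A where t: "(s, t, wG) \<in> D" "s \<in> Hom C A G" "t \<in> Hom C G (sg G)"
    "omap F A \<in> S" "A \<in> Obj C" by (rule triT_data[OF oG])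
  ultimately have "G \<in> subNf P"
    unfolding subNf_def by (auto simp: unshift_set_def intro: starI[OF t(1-3)])
  then have GS: "G \<in> S" using condII GU unfolding condition_II_def by simp blast
  obtain x a Y0 j0 e0 where x: "(x, a, qq X \<cdot> c) \<in> D" "x \<in> Hom C X Y0" "a \<in> Hom C Y0 G"
    "j0 \<in> Hom C ?O Y0" "e0 \<in> Hom C Y0 J" "(j0, e0, Zero C J (omap F ?O)) \<in> D" "is_isom Q (cl j0)" "cl (j0 \<cdot> f1) = cl x"
    by (rule inflation[OF XU(2) it(6) ti oO f1(1) G(3,1,2)])
  \<comment> \<open>G in S gives both hypotheses of \<open>split_right0\<close> for the inflation of
    \<open>f1\<close> with cone G: the connecting arrow is zero, and arrows from G to Y0 in T vanish
    modulo I.\<close>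
  have q0: "qq X \<cdot> c = Zero C G (omap F X)" by (rule vanish_ST[OF comp_hom[OF G(2) it(7)] GS XU(2)])
  have Y0: "Y0 \<in> T" by (rule cp_right_ext[OF ST x(6,4,5) XU(4) I_memb(2)[OF it(5)]])
  have "is_isom Q (cl x)"
    by (rule split_right0[OF x(1)[unfolded q0] x(2,3)]) (rule S_to_T_zero[OF _ GS Y0])
  then have "is_isom Q (cl j0 \<star> cl f1)" using x(8) q.Q_comp[OF f1(1) x(4)] by simp
  then have "is_isom Q (cl f1)" by (rule Qa.isom_cancel_left[OF _ x(7) q.cl_hom[OF f1(1)] q.cl_hom[OF x(4)]])
  then have "corefl X (dn ?Y) (ep (dn ?Y) \<star> cl f1)"
    using corefl_comp[OF corefl_isom[OF _ q.cl_hom[OF f1(1)]] ep_corefl[OF oU(2)]] by blast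
  then show ?thesis using q.Q_comp[OF f1(1) \<kappa>(2)] f1(2) \<kappa>(5) by simp
qed

lemma counit_isom:
  assumes X: "X \<in> Z" and \<kappa>0: "\<kappa>' \<in> Hom C (Om X) (dn X)" "cl \<kappa>' = ep (dn X)"
    and h: "h \<in> Hom C (up (Om X)) X" "ww X \<cdot> h = amap F \<kappa>' \<cdot> qq (Om X)"
    and ee: "\<epsilon> \<in> Hom Q (Sg (Om X)) X" "\<epsilon> \<star> et (up (Om X)) = cl h"
  shows "is_isom Q \<epsilon>"
proof -
  let ?O = "Om X" let ?W = "Sg (Om X)"
  have OZ: "?O \<in> Z" by (rule Om_Z[OF X])
  have WZ: "?W \<in> Z" by (rule Sg_Z[OF OZ])
  obtain i J p where ti: "itri ?O i J p (up ?O) (qq ?O)" by (rule plus_itri[OF OZ])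
  note it = itriD[OF ti]
  obtain j J' k where tj: "itri (dn X) j J' k X (ww X)" by (rule minus_itri[OF X])
  note jt = itriD[OF tj]
  have oU: "up ?O \<in> Obj C" "dn X \<in> Obj C" using it jt memb_obj by blast+
  obtain \<kappa> v w2 V0 where \<kappa>: "(\<kappa>, v, w2) \<in> D" "\<kappa> \<in> Hom C ?O (dn X)" "v \<in> Hom C (dn X) (omap F V0)"
    "V0 \<in> V" "ep (dn X) = cl \<kappa>"
    unfolding functor_unfold by (rule triU_data[OF oU(2)])
  have "cl \<kappa>' = cl \<kappa>" using \<kappa>0 \<kappa> by simp
  then have hk: "ww X \<cdot> h = amap F \<kappa> \<cdot> qq ?O" using plus_ext_eq[OF OZ \<kappa>0(1) \<kappa>(2)] h(2) by simp
  obtain h0 w r S0 where h0: "(h0, w, r) \<in> D" "h0 \<in> Hom C (up ?O) ?W" "w \<in> Hom C ?W S0" "S0 \<in> S" "et (up ?O) = cl h0"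
    unfolding functor_unfold(1) by (rule unit_cone[OF oU(1)])
  obtain h1 where h1: "h1 \<in> Hom C ?W X" "\<epsilon> = cl h1" using ee(1) by (rule q.Q_homE)
  have "cl (h1 \<cdot> h0) = cl h" using q.Q_comp[OF h0(2) h1(1)] ee(2) h0(5) h1(2) by simp
  then have "ww X \<cdot> (h1 \<cdot> h0) = ww X \<cdot> h" using minus_lift_eq[OF X comp_hom[OF h0(2) h1(1)] h(1)] by blast
  then have wh: "(ww X \<cdot> h1) \<cdot> h0 = amap F \<kappa> \<cdot> qq ?O" using hk h0(2) h1(1) jt(7) by (simp add: Hom_iff)
  obtain x' y' G' where G': "x' \<in> Hom C (dn X) G'" "y' \<in> Hom C G' (up ?O)" "(x', y', amap F \<kappa> \<cdot> qq ?O) \<in> D"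
    by (rule cocone[OF comp_hom[OF it(7) F_hom[OF \<kappa>(2)]] oU(2)])
  have oG': "G' \<in> Obj C" using G' hom_objs by blast
  \<comment> \<open>G' is the pushout of the triangle \<open>tri_plus ?O\<close> along
    \<open>\<kappa>\<close>. So J maps to it with cone the shift of V0, and the coreflection of G'
    in U is J, which vanishes.\<close>
  obtain e k1 where e: "e \<in> Hom C J G'" "k1 \<in> Hom C G' (omap F V0)" "(e, k1, amap F i \<cdot> w2) \<in> D"
    by (rule pushout[OF it(1) \<kappa>(1) G'(3) it(2,3) \<kappa>(2,3) G'(1,2)])
  have "corefl J G' (cl e)" by (rule cone_V_corefl[OF e(3,1,2) \<kappa>(4)])
  then obtain z where "z \<in> Hom Q J (om G')" "is_isom Q z"
    using corefl_to_U[OF _ ep_corefl[OF oG'] I_memb(3)[OF it(5)] om_U[OF oG']] by blast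
  then have "nul (om G')" using nul_isom nul_I[OF it(5)] by blast
  then have "nul (sg (om G'))"
    using nul_refl[OF et_refl sg_T] om_U[OF oG'] memb_obj by blast
  then have n1: "nul (om (sg G'))" using condition_I_nul[OF G'(3,1,2) jt(4) it(6)] by blast
  obtain n c G where G: "n \<in> Hom C (dn X) G" "c \<in> Hom C G ?W" "(n, c, ww X \<cdot> h1) \<in> D"
    by (rule cocone[OF comp_hom[OF h1(1) jt(7)] oU(2)])
  have dG2: "(x', y', (ww X \<cdot> h1) \<cdot> h0) \<in> D" using G'(3) wh by simp
  \<comment> \<open>G' is the pullback of G along \<open>h0\<close>, so the cone of the arrow from
    G' to G is S0. As G lies in T, it is the reflection of G'.\<close>
  obtain e2 \<rho> where e2: "e2 \<in> Hom C G' G" "(e2, w \<cdot> c, \<rho>) \<in> D"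
    by (rule pullback[OF G(3) h0(1) dG2 G(1,2) h0(2,3) G'(1,2)])
  have WT: "?W \<in> T" "?W \<in> U" using WZ by blast+
  have GT: "G \<in> T" by (rule cp_right_ext[OF ST G(3,1,2) jt(4) WT(1)])
  have oG: "G \<in> Obj C" using GT memb_obj by blast
  have "refl G' G (cl e2)" by (rule cone_S_refl[OF e2(2,1) comp_hom[OF G(2) h0(3)] h0(4)])
  then obtain z2 where z2: "z2 \<in> Hom Q (sg G') G" "is_isom Q z2"
    using refl_to_T[OF et_refl[OF oG'] _ sg_T[OF oG'] GT] by blast
  have oo: "sg G' \<in> Obj C" using sg_T[OF oG'] memb_obj by blast
  have "corefl (om (sg G')) G (z2 \<star> ep (sg G'))" by (rule corefl_comp[OF ep_corefl[OF oo] corefl_isom[OF z2(2,1)]])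
  then obtain z3 where "z3 \<in> Hom Q (om G) (om (sg G'))" "is_isom Q z3"
    using corefl_to_U[OF ep_corefl[OF oG] _ om_U[OF oG] om_U[OF oo]] by blast
  then have "nul (om G)" using nul_isom n1 by blast
  then have "om G \<in> S" using nul_in_I by blast
  moreover obtain u v' wG V1 where t: "(u, v', wG) \<in> D" "u \<in> Hom C (om G) G" "v' \<in> Hom C G (omap F V1)" "V1 \<in> V"
    by (rule triU_data[OF oG])
  ultimately have "G \<in> subNi P"
    unfolding subNi_def by (auto simp: shift_set_def intro: starI[OF t(1-3)])
  then have GV: "G \<in> V" using condII GT unfolding condition_II_def by simp blast
  \<comment> \<open>Y0 links the source \<open>?W\<close> of the counit with X: it is an extension
    of X by G and, as a pushout along \<open>n\<close>, an extension of \<open>?W\<close> by J'.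
    Both connecting arrows vanish, so Y0 projects isomorphically modulo I to X and to
    \<open>?W\<close>.\<close>
  obtain x y Y0 where x: "x \<in> Hom C G Y0" "y \<in> Hom C Y0 X" "(x, y, amap F n \<cdot> ww X) \<in> D"
    by (rule cocone[OF comp_hom[OF jt(7) F_hom[OF G(1)]] oG])
  obtain e3 k3 where e3: "e3 \<in> Hom C J' Y0" "k3 \<in> Hom C Y0 ?W" "(e3, k3, amap F j \<cdot> (ww X \<cdot> h1)) \<in> D"
    "(ww X \<cdot> h1) \<cdot> k3 = Neg C (ww X \<cdot> y)"
    by (rule pushout[OF jt(1) G(3) x(3) jt(2,3) G(1,2) x(1,2)])
  have "amap F j \<cdot> (ww X \<cdot> h1) = Zero C ?W (omap F J')"
    using comp_rewrite1[OF dist_zero2(2)[OF jt(1-3)] jt(7) F_hom[OF jt(2)], of h1] h1(1) jt(2) hom_objs[OF e3(1)]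
      Z_memb(3)[OF X] by (simp add: Hom_iff)
  then have ik: "is_isom Q (cl k3)" using split_left[OF _ e3(1,2) jt(5)] e3(3) by simp
  have Y0: "Y0 \<in> U" by (rule cp_left_ext[OF UV e3(3,1,2) I_memb(3)[OF jt(5)] WT(2)])
  have ny: "Neg C y \<in> Hom C Y0 X" using x by (simp add: Hom_iff)
  have "amap F n \<cdot> ww X = Zero C X (omap F G)"
    using vanish_UV[OF comp_hom[OF jt(7) F_hom[OF G(1)]] jt(6) GV] .
  then have "(x, Neg C y, Zero C X (omap F G)) \<in> D"
    using dist_signs(3)[OF x(3)] oG Z_memb(3)[OF X] by simp
  from split_left0[OF this x(1) ny] have iy: "is_isom Q (cl (Neg C y))"
    using U_to_V_zero[OF _ Y0 GV] by blast
  \<comment> \<open>This identifies the counit, up to a sign, with the comparison of the two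
    projections from Y0.\<close>
  have "ww X \<cdot> (h1 \<cdot> k3) = ww X \<cdot> Neg C y" using e3(2,4) h1(1) jt(7) x(2) by (simp add: Hom_iff)
  then have "cl (h1 \<cdot> k3) = cl (Neg C y)" using minus_lift_eq[OF X comp_hom[OF e3(2) h1(1)] ny] by blast
  then have "is_isom Q (cl h1 \<star> cl k3)" using iy q.Q_comp[OF e3(2) h1(1)] by simp
  then show ?thesis unfolding h1(2) by (rule Qa.isom_cancel_right[OF _ ik q.cl_hom[OF e3(2)] q.cl_hom[OF h1(1)]])
qed

section \<open>Sigma is fully faithful, and the counit\<close>

lemma unit_obtain:
  assumes "X \<in> Z"
  obtains h f where "h \<in> Hom C (up X) (Sg X)" "cl h = et (up X)" "f \<in> Hom C X (dn (Sg X))"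
    "amap F f \<cdot> qq X = ww (Sg X) \<cdot> h" "corefl X (dn (Sg X)) (cl f)"
proof -
  obtain h where h: "h \<in> Hom C (up X) (Sg X)" "et (up X) = cl h" using et_up[OF assms] by (rule q.Q_homE)
  note w = dn_T[OF Sg_Z[OF assms]]
  obtain f where f: "f \<in> Hom C X (dn (Sg X))" "amap F f \<cdot> qq X = ww (Sg X) \<cdot> h"
    by (rule plus_ext[OF assms w(1) comp_hom[OF h(1) w(2)]])
  show thesis using that[OF h(1) h(2)[symmetric] f unit_corefl[OF assms h(1) h(2)[symmetric] f]] .
qed

text \<open>The triangles \<open>tri_minus\<close> and \<open>tri_plus\<close> identify arrows of
  the quotient from \<open>up X\<close> to \<open>Sg X'\<close> with those from X to
  \<open>dn (Sg X')\<close>. Under this identification Sigma becomes composition with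
  \<open>f\<close>, so full faithfulness of Sigma is the universal property of \<open>f\<close> as a
  coreflection.\<close>

lemma Sa_as_lift:
  assumes X: "X \<in> Z" "X' \<in> Z" and x: "x \<in> Hom C X X'"
    and h: "h \<in> Hom C (up X') (Sg X')" "cl h = et (up X')"
    and f: "f \<in> Hom C X' (dn (Sg X'))" "amap F f \<cdot> qq X' = ww (Sg X') \<cdot> h"
  obtains k where "k \<in> Hom C (up X) (Sg X')" "Sa (cl x) \<star> et (up X) = cl k"
    "ww (Sg X') \<cdot> k = amap F (f \<cdot> x) \<cdot> qq X"
proof -
  note q1 = up_U(2)[OF X(1)] and q2 = up_U(2)[OF X(2)] and w = dn_T(2)[OF Sg_Z[OF X(2)]]
  obtain u where u: "u \<in> Hom C (up X) (up X')" "qq X' \<cdot> u = amap F x \<cdot> qq X" "ua (cl x) = cl u"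
    by (rule ua_obtain[OF X x])
  have 1: "Sa (cl x) \<star> et (up X) = cl (h \<cdot> u)"
    using sa_eq(2)[OF q.cl_hom[OF u(1)]] q.Q_comp[OF u(1) h(1)] u(3) h(2) unfolding functor_unfold by simp
  have "ww (Sg X') \<cdot> (h \<cdot> u) = (amap F f \<cdot> qq X') \<cdot> u" unfolding f(2) using w h(1) u(1) by (simp add: Hom_iff)
  also have "\<dots> = amap F f \<cdot> (qq X' \<cdot> u)" using F_hom[OF f(1)] q2 u(1) by (simp add: Hom_iff)
  also have "\<dots> = amap F (f \<cdot> x) \<cdot> qq X" unfolding u(2) using f(1) x q1 by (simp add: Hom_iff)
  finally show thesis using that[OF comp_hom[OF u(1) h(1)] 1] by blast
qed

lemma Sa_faithful:
  assumes X: "X \<in> Z" "X' \<in> Z" and x: "x \<in> Hom Q X X'" "y \<in> Hom Q X X'" and e: "Sa x = Sa y"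
  shows "x = y"
proof -
  obtain h f where h: "h \<in> Hom C (up X') (Sg X')" "cl h = et (up X')" "f \<in> Hom C X' (dn (Sg X'))"
    "amap F f \<cdot> qq X' = ww (Sg X') \<cdot> h" "corefl X' (dn (Sg X')) (cl f)"
    by (rule unit_obtain[OF X(2)])
  obtain x0 where x0: "x0 \<in> Hom C X X'" "x = cl x0" using x(1) by (rule q.Q_homE)
  obtain y0 where y0: "y0 \<in> Hom C X X'" "y = cl y0" using x(2) by (rule q.Q_homE)
  obtain k where k: "k \<in> Hom C (up X) (Sg X')" "Sa (cl x0) \<star> et (up X) = cl k"
    "ww (Sg X') \<cdot> k = amap F (f \<cdot> x0) \<cdot> qq X" by (rule Sa_as_lift[OF X x0(1) h(1-4)])
  obtain l where l: "l \<in> Hom C (up X) (Sg X')" "Sa (cl y0) \<star> et (up X) = cl l"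
    "ww (Sg X') \<cdot> l = amap F (f \<cdot> y0) \<cdot> qq X" by (rule Sa_as_lift[OF X y0(1) h(1-4)])
  have "cl k = cl l" using k(2) l(2) e x0(2) y0(2) by simp
  then have "amap F (f \<cdot> x0) \<cdot> qq X = amap F (f \<cdot> y0) \<cdot> qq X"
    using minus_lift_eq[OF Sg_Z[OF X(2)] k(1) l(1)] k(3) l(3) by simp
  then have "cl (f \<cdot> x0) = cl (f \<cdot> y0)"
    using plus_ext_eq[OF X(1) comp_hom[OF x0(1) h(3)] comp_hom[OF y0(1) h(3)]] by blast
  then have "cl f \<star> x = cl f \<star> y" using q.Q_comp[OF x0(1) h(3)] q.Q_comp[OF y0(1) h(3)] x0(2) y0(2) by simp
  then show ?thesis using corefl_eq[OF h(5) x(1,2)] X by blast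
qed

lemma Sa_full:
  assumes X: "X \<in> Z" "X' \<in> Z" and g: "g \<in> Hom Q (Sg X) (Sg X')"
  obtains x where "x \<in> Hom Q X X'" "Sa x = g"
proof -
  obtain h f where h: "h \<in> Hom C (up X') (Sg X')" "cl h = et (up X')" "f \<in> Hom C X' (dn (Sg X'))"
    "amap F f \<cdot> qq X' = ww (Sg X') \<cdot> h" "corefl X' (dn (Sg X')) (cl f)"
    by (rule unit_obtain[OF X(2)])
  note w = dn_T[OF Sg_Z[OF X(2)]]
  have XU: "X \<in> U" using X by blast
  obtain k0 where k0: "k0 \<in> Hom C (up X) (Sg X')" "g \<star> et (up X) = cl k0"
    using Qa.comp_hom[OF et_up[OF X(1)] g] by (rule q.Q_homE)
  obtain f0 where f0: "f0 \<in> Hom C X (dn (Sg X'))" "amap F f0 \<cdot> qq X = ww (Sg X') \<cdot> k0"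
    by (rule plus_ext[OF X(1) w(1) comp_hom[OF k0(1) w(2)]])
  \<comment> \<open>\<open>f0\<close> corresponds to \<open>g\<close> under the identifications;
    since X lies in U it factors through the coreflection \<open>f\<close>.\<close>
  obtain x where x: "x \<in> Hom Q X X'" "cl f \<star> x = cl f0" by (rule corefl_ex[OF h(5) q.cl_hom[OF f0(1)] XU])
  obtain x0 where x0: "x0 \<in> Hom C X X'" "x = cl x0" using x(1) by (rule q.Q_homE)
  obtain k where k: "k \<in> Hom C (up X) (Sg X')" "Sa (cl x0) \<star> et (up X) = cl k"
    "ww (Sg X') \<cdot> k = amap F (f \<cdot> x0) \<cdot> qq X" by (rule Sa_as_lift[OF X x0(1) h(1-4)])
  have "cl (f \<cdot> x0) = cl f0" using q.Q_comp[OF x0(1) h(3)] x(2) x0(2) by simp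
  then have "ww (Sg X') \<cdot> k = ww (Sg X') \<cdot> k0"
    using plus_ext_eq[OF X(1) comp_hom[OF x0(1) h(3)] f0(1)] f0(2) k(3) by simp
  then have "cl k = cl k0" using minus_lift_eq[OF Sg_Z[OF X(2)] k(1) k0(1)] by blast
  then have "Sa x \<star> et (up X) = g \<star> et (up X)" using k(2) k0(2) x0(2) by simp
  then have "Sa x = g"
    using refl_eq[OF et_up_refl[OF X(1)] Sa_hom[OF X x(1)] g] Sg_Z[OF X(2)] by blast
  then show thesis using that x by blast
qed

text \<open>The counit \<open>\<Sigma>\<Omega> \<Rightarrow> Id\<close>; the relation does not depend on the choice of \<open>\<kappa>\<close>.\<close>

definition is_eps :: "'o \<Rightarrow> 'a set \<Rightarrow> bool" where
  "is_eps X \<epsilon> \<longleftrightarrow> \<epsilon> \<in> Hom Q (Sg (Om X)) X \<and> (\<exists>\<kappa> h. \<kappa> \<in> Hom C (Om X) (dn X) \<and> cl \<kappa> = ep (dn X) \<and>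
     h \<in> Hom C (up (Om X)) X \<and> ww X \<cdot> h = amap F \<kappa> \<cdot> qq (Om X) \<and> \<epsilon> \<star> et (up (Om X)) = cl h)"

lemma eps_ex: assumes X: "X \<in> Z" shows "\<exists>\<epsilon>. is_eps X \<epsilon>"
proof -
  note OZ = Om_Z[OF X] and w = dn_T[OF X]
  note q = up_U[OF OZ]
  have oT: "dn X \<in> Obj C" using w memb_obj by blast
  have "ep (dn X) \<in> Hom Q (Om X) (dn X)" unfolding functor_unfold by (rule ep_hom[OF oT])
  then obtain \<kappa> where \<kappa>: "\<kappa> \<in> Hom C (Om X) (dn X)" "ep (dn X) = cl \<kappa>" by (rule q.Q_homE)
  obtain h where h: "h \<in> Hom C (up (Om X)) X" "ww X \<cdot> h = amap F \<kappa> \<cdot> qq (Om X)"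
    by (rule minus_lift[OF X q(1) comp_hom[OF q(2) F_hom[OF \<kappa>(1)]]])
  have XT: "X \<in> T" using X by blast
  obtain \<epsilon> where "\<epsilon> \<in> Hom Q (Sg (Om X)) X" "\<epsilon> \<star> et (up (Om X)) = cl h"
    by (rule refl_ex[OF et_up_refl[OF OZ] q.cl_hom[OF h(1)] XT])
  then show ?thesis unfolding is_eps_def using \<kappa> h by metis
qed

definition eps :: "'o \<Rightarrow> 'a set" where "eps X = (SOME \<epsilon>. is_eps X \<epsilon>)"

lemma is_eps_eps: "X \<in> Z \<Longrightarrow> is_eps X (eps X)"
  unfolding eps_def by (rule someI_ex[OF eps_ex])

lemma eps_hom: "X \<in> Z \<Longrightarrow> eps X \<in> Hom Q (Sg (Om X)) X"
  using is_eps_eps unfolding is_eps_def by blast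

lemma eps_isom:
  assumes "X \<in> Z"
  shows "is_isom Q (eps X)"
proof -
  obtain \<kappa> h where "\<kappa> \<in> Hom C (Om X) (dn X)" "cl \<kappa> = ep (dn X)"
    "h \<in> Hom C (up (Om X)) X" "ww X \<cdot> h = amap F \<kappa> \<cdot> qq (Om X)" "eps X \<star> et (up (Om X)) = cl h"
    using is_eps_eps[OF assms] unfolding is_eps_def by blast
  then show ?thesis using counit_isom[OF assms] eps_hom[OF assms] by blast
qed

lemma Oa_hom:
  assumes "X \<in> Z" "Y \<in> Z" "f \<in> Hom Q X Y"
  shows "Oa f \<in> Hom Q (Om X) (Om Y)"
proof -
  obtain x where x: "x \<in> Hom C X Y" "f = cl x" using assms(3) by (rule q.Q_homE)
  obtain u where u: "u \<in> Hom C (dn X) (dn Y)" "da (cl x) = cl u" by (rule da_obtain[OF assms(1,2) x(1)])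
  show ?thesis unfolding functor_unfold x(2) u(2) by (rule oa_eq(1)[OF q.cl_hom[OF u(1)]])
qed

text \<open>The square is tested first after the unit at \<open>up (Om X')\<close> and then after
  \<open>ww X\<close>. There it reduces to naturality of the counit of \<open>om\<close>, recorded
  in \<open>oe\<close>, and to the squares defining the two shifts.\<close>

lemma eps_natural:
  assumes X: "X' \<in> Z" "X \<in> Z" and x: "x \<in> Hom Q X' X"
  shows "eps X \<star> Sa (Oa x) = x \<star> eps X'"
proof -
  note O = Om_Z[OF X(1)] Om_Z[OF X(2)]
  obtain \<kappa> h where k: "\<kappa> \<in> Hom C (Om X) (dn X)" "cl \<kappa> = ep (dn X)"
    "h \<in> Hom C (up (Om X)) X" "ww X \<cdot> h = amap F \<kappa> \<cdot> qq (Om X)" "eps X \<star> et (up (Om X)) = cl h"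
    using is_eps_eps[OF X(2)] unfolding is_eps_def by blast
  obtain \<kappa>' h' where k': "\<kappa>' \<in> Hom C (Om X') (dn X')" "cl \<kappa>' = ep (dn X')"
    "h' \<in> Hom C (up (Om X')) X'" "ww X' \<cdot> h' = amap F \<kappa>' \<cdot> qq (Om X')" "eps X' \<star> et (up (Om X')) = cl h'"
    using is_eps_eps[OF X(1)] unfolding is_eps_def by blast
  obtain x0 where x0: "x0 \<in> Hom C X' X" "x = cl x0" using x by (rule q.Q_homE)
  obtain t where t: "t \<in> Hom C (dn X') (dn X)" "amap F t \<cdot> ww X' = ww X \<cdot> x0" "da (cl x0) = cl t"
    by (rule da_obtain[OF X x0(1)])
  note Ox = Oa_hom[OF X x]
  obtain o0 where o0: "o0 \<in> Hom C (Om X') (Om X)" "Oa x = cl o0" using Ox by (rule q.Q_homE)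
  have oe: "cl (\<kappa> \<cdot> o0) = cl (t \<cdot> \<kappa>')"
    using oa_eq(2)[OF q.cl_hom[OF t(1)]] q.Q_comp[OF o0(1) k(1)] q.Q_comp[OF k'(1) t(1)] k(2) k'(2) o0(2) t(3) x0(2)
    unfolding functor_unfold by simp
  obtain u where u: "u \<in> Hom C (up (Om X')) (up (Om X))" "qq (Om X) \<cdot> u = amap F o0 \<cdot> qq (Om X')" "ua (cl o0) = cl u"
    by (rule ua_obtain[OF O o0(1)])
  note q1 = up_U(2)[OF O(1)] and q2 = up_U(2)[OF O(2)] and w1 = dn_T(2)[OF X(1)] and w2 = dn_T(2)[OF X(2)]
  have "ww X \<cdot> (h \<cdot> u) = (amap F \<kappa> \<cdot> qq (Om X)) \<cdot> u" unfolding k(4)[symmetric] using w2 k(3) u(1) by (simp add: Hom_iff)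
  also have "\<dots> = amap F \<kappa> \<cdot> (qq (Om X) \<cdot> u)" using F_hom[OF k(1)] q2 u(1) by (simp add: Hom_iff)
  also have "\<dots> = amap F (\<kappa> \<cdot> o0) \<cdot> qq (Om X')" unfolding u(2) using k(1) o0(1) q1 by (simp add: Hom_iff)
  also have "\<dots> = amap F (t \<cdot> \<kappa>') \<cdot> qq (Om X')"
    using plus_ext_eq[OF O(1) comp_hom[OF o0(1) k(1)] comp_hom[OF k'(1) t(1)]] oe by blast
  also have "\<dots> = amap F t \<cdot> (amap F \<kappa>' \<cdot> qq (Om X'))" using k'(1) t(1) q1 by (simp add: Hom_iff)
  also have "\<dots> = (amap F t \<cdot> ww X') \<cdot> h'" unfolding k'(4)[symmetric] using F_hom[OF t(1)] w1 k'(3) by (simp add: Hom_iff)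
  also have "\<dots> = ww X \<cdot> (x0 \<cdot> h')" unfolding t(2) using w2 x0(1) k'(3) by (simp add: Hom_iff)
  finally have "cl (h \<cdot> u) = cl (x0 \<cdot> h')"
    using minus_lift_eq[OF X(2) comp_hom[OF u(1) k(3)] comp_hom[OF k'(3) x0(1)]] by blast
  then have hu: "cl h \<star> cl u = x \<star> cl h'" using q.Q_comp[OF u(1) k(3)] q.Q_comp[OF k'(3) x0(1)] x0(2) by simp
  have su: "Sa (Oa x) \<star> et (up (Om X')) = et (up (Om X)) \<star> cl u"
    using sa_eq(2)[OF q.cl_hom[OF u(1)]] u(3) o0(2) unfolding functor_unfold by simp
  note S = Sa_hom[OF O Ox] and e = eps_hom[OF X(1)] eps_hom[OF X(2)] and et' = et_up[OF O(1)] et_up[OF O(2)]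
  show ?thesis
  proof (rule refl_eq[OF et_up_refl[OF O(1)] Qa.comp_hom[OF S e(2)] Qa.comp_hom[OF e(1) x]])
    show "X \<in> T" using X by blast
    have "eps X \<star> Sa (Oa x) \<star> et (up (Om X')) = eps X \<star> (et (up (Om X)) \<star> cl u)"
      using Qa.comp_assoc[OF et'(1) S e(2)] su by simp
    also have "\<dots> = x \<star> cl h'" using Qa.comp_assoc[OF q.cl_hom[OF u(1)] et'(2) e(2)] k(5) hu by simp
    also have "\<dots> = x \<star> eps X' \<star> et (up (Om X'))" using Qa.comp_assoc[OF et'(1) e(1) x] k'(5) by simp
    finally show "eps X \<star> Sa (Oa x) \<star> et (up (Om X')) = x \<star> eps X' \<star> et (up (Om X'))" .
  qed
qed

lemma ZQ_rtri: "rtri ZQ \<Sigma> DT"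
proof (intro rtri.intro ZQ_addftor rtri_axioms.intro)
  interpret R: addftor ZQ \<Sigma> by (rule ZQ_addftor)
  show "is_equivalence ZQ ZQ \<Sigma>"
  proof (rule R.full_faithful_equivalence)
    show "is_functor ZQ ZQ \<Sigma>" using R.sh_add unfolding is_additive_functor_def by blast
    show "f = f'" if "f \<in> Hom ZQ X Y" "f' \<in> Hom ZQ X Y" "Sa f = Sa f'" for f f' X Y
      using that Sa_faithful unfolding ZQ_hom by blast
    show "\<exists>f\<in>Hom ZQ X Y. Sa f = k" if a: "X \<in> Obj ZQ" "Y \<in> Obj ZQ" "k \<in> Hom ZQ (Sg X) (Sg Y)" for X Y k
    proof -
      have Z: "X \<in> Z" "Y \<in> Z" using a by auto
      have "k \<in> Hom Q (Sg X) (Sg Y)" using a(3) unfolding ZQ_hom by blast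
      then obtain x where "x \<in> Hom Q X Y" "Sa x = k" by (rule Sa_full[OF Z])
      then show ?thesis using Z ZQ_hom by blast
    qed
    show "\<exists>X\<in>Obj ZQ. \<exists>e\<in>Hom ZQ (Sg X) Y. is_isom ZQ e" if "Y \<in> Obj ZQ" for Y
    proof -
      have Y: "Y \<in> Z" using that by simp
      note O = Om_Z[OF Y]
      have "eps Y \<in> Hom ZQ (Sg (Om Y)) Y" unfolding ZQ_hom using eps_hom[OF Y] Sg_Z[OF O] Y by blast
      moreover have "is_isom ZQ (eps Y)" using ZQ_isom[OF eps_hom[OF Y] Sg_Z[OF O] Y] eps_isom[OF Y] by blast
      moreover have "Om Y \<in> Obj ZQ" using O by simp
      ultimately show ?thesis by blast
    qed
  qed
  show "is_triangle ZQ \<Sigma> t" if "t \<in> DT" for t by (rule DT_triangle[OF that])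
  show "t' \<in> DT" if "t \<in> DT" "is_triangle ZQ \<Sigma> t'" "tri_isomorphic ZQ \<Sigma> t t'" for t t' by (rule DT_iso[OF that])
  show "\<exists>O1. is_zero_object ZQ O1 \<and> (Ident ZQ X, Zero ZQ X O1, Zero ZQ O1 (Sg X)) \<in> DT" if "X \<in> Obj ZQ" for X
    using DT_zero that by simp
  show "(g, h, Neg ZQ (Sa f)) \<in> DT" if "(f, g, h) \<in> DT" for f g h by (rule DT_rotate[OF that])
  show "\<exists>g h. (f, g, h) \<in> DT" if "f \<in> Arr ZQ" for f
  proof -
    have "f \<in> Hom Q (Dom Q f) (Cod Q f)" "Dom Q f \<in> Z" "Cod Q f \<in> Z" using that by (auto simp: Hom_iff)
    then show ?thesis by (rule DT_cone)
  qed
  show "\<exists>z. is_tri_morph ZQ \<Sigma> (f, g, h) (f', g', h') x y z"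
    if "(f, g, h) \<in> DT" "(f', g', h') \<in> DT" "x \<in> Hom ZQ (Dom ZQ f) (Dom ZQ f')" "y \<in> Hom ZQ (Cod ZQ f) (Cod ZQ f')"
      "Comp ZQ y f = Comp ZQ f' x" for f g h f' g' h' x y
    by (rule DT_fill[OF that])
  show "\<exists>f' f'' g' g'' k' k''. (f, f', f'') \<in> DT \<and> (g, g', g'') \<in> DT \<and> (Comp ZQ g f, k', k'') \<in> DT \<and>
      (\<exists>u \<in> Hom ZQ (Cod ZQ f') (Cod ZQ k'). \<exists>v \<in> Hom ZQ (Cod ZQ k') (Cod ZQ g').
        (u, v, Comp ZQ (Sa f') g'') \<in> DT \<and>
        Comp ZQ u f' = Comp ZQ k' g \<and> Comp ZQ k'' u = f'' \<and>
        Comp ZQ v k' = g' \<and> Comp ZQ g'' v = Comp ZQ (Sa f) k'')"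
    if "f \<in> Hom ZQ X Y" "g \<in> Hom ZQ Y W" for f g X Y W
  proof -
    have a: "f \<in> Hom Q X Y" "g \<in> Hom Q Y W" "X \<in> Z" "Y \<in> Z" "W \<in> Z" using that unfolding ZQ_hom by blast+
    obtain f' f'' g' g'' k' k'' u v where o: "(f, f', f'') \<in> DT" "(g, g', g'') \<in> DT" "(g \<star> f, k', k'') \<in> DT"
      "u \<in> Hom Q (Cod Q f') (Cod Q k')" "v \<in> Hom Q (Cod Q k') (Cod Q g')"
      "(u, v, Sa f' \<star> g'') \<in> DT" "u \<star> f' = k' \<star> g" "k'' \<star> u = f''" "v \<star> k' = g'" "g'' \<star> v = Sa f \<star> k''"
      using DT_octa[OF a] by blast
    have m: "B \<in> Z" if "(p, q, r) \<in> DT" "Cod Q q = B" for p q r B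
      using DT_triangle[OF that(1)] that(2) unfolding is_triangle_def by (auto simp: ZQ_hom) (auto simp: Hom_iff)
    have "u \<in> Hom ZQ (Cod Q f') (Cod Q k')" "v \<in> Hom ZQ (Cod Q k') (Cod Q g')"
      unfolding ZQ_hom using o(4,5) m[OF o(1) HOL.refl] m[OF o(2) HOL.refl] m[OF o(3) HOL.refl] by blast+
    then show ?thesis unfolding full_simps using o by blast
  qed
qed

text \<open>Transposition along the counit: h after \<open>eps X\<close> is an arrow from
  \<open>Sg (Om X)\<close> to \<open>Sg Y\<close>, hence the image under Sigma of a unique arrow.
  Bijectivity thus rests on full faithfulness of Sigma and invertibility of
  \<open>eps\<close>.\<close>

definition phi :: "'o \<Rightarrow> 'o \<Rightarrow> 'a set \<Rightarrow> 'a set" where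
  "phi X Y h = (THE k. k \<in> Hom Q (Om X) Y \<and> Sa k = h \<star> eps X)"

lemma phi_unique:
  assumes "X \<in> Z" "Y \<in> Z" "k \<in> Hom Q (Om X) Y" "Sa k = h \<star> eps X"
  shows "phi X Y h = k"
  unfolding phi_def using assms Sa_faithful[OF Om_Z[OF assms(1)] assms(2)] by (intro the_equality) auto

lemma phi_eq:
  assumes "X \<in> Z" "Y \<in> Z" "h \<in> Hom Q X (Sg Y)"
  shows "phi X Y h \<in> Hom Q (Om X) Y" "Sa (phi X Y h) = h \<star> eps X"
proof -
  obtain k where k: "k \<in> Hom Q (Om X) Y" "Sa k = h \<star> eps X"
    by (rule Sa_full[OF Om_Z[OF assms(1)] assms(2) Qa.comp_hom[OF eps_hom[OF assms(1)] assms(3)]])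
  then show "phi X Y h \<in> Hom Q (Om X) Y" "Sa (phi X Y h) = h \<star> eps X" using phi_unique[OF assms(1,2) k] by simp_all
qed

lemma phi_iso:
  assumes X: "X \<in> Z" "Y \<in> Z"
  shows "phi X Y \<in> iso (Ext1 ZQ \<Sigma> X Y) (Hom_group ZQ (Om X) Y)"
proof -
  note O = Om_Z[OF X(1)] and S = Sg_Z[OF X(2)] and e = eps_hom[OF X(1)]
  have c: "carrier (Ext1 ZQ \<Sigma> X Y) = Hom Q X (Sg Y)" "carrier (Hom_group ZQ (Om X) Y) = Hom Q (Om X) Y"
    "mult (Ext1 ZQ \<Sigma> X Y) = Add Q" "mult (Hom_group ZQ (Om X) Y) = Add Q"
    using full_hom_eq[OF X(1) S, of Q] full_hom_eq[OF O X(2), of Q] by (simp_all add: Ext1_def Hom_group_def)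
  have add: "phi X Y (Add Q h h') = Add Q (phi X Y h) (phi X Y h')"
    if h: "h \<in> Hom Q X (Sg Y)" "h' \<in> Hom Q X (Sg Y)" for h h'
  proof (rule phi_unique[OF X])
    note p = phi_eq[OF X h(1)] phi_eq[OF X h(2)]
    show "Add Q (phi X Y h) (phi X Y h') \<in> Hom Q (Om X) Y" using p by (simp add: Hom_iff)
    show "Sa (Add Q (phi X Y h) (phi X Y h')) = Add Q h h' \<star> eps X"
      using Sa_add[OF O X(2) p(1,3)] p(2,4) h e by (simp add: Hom_iff)
  qed
  obtain i where i: "i \<in> Hom Q X (Sg (Om X))" "i \<star> eps X = Ident Q (Sg (Om X))" "eps X \<star> i = Ident Q X"
    using Qa.is_isomE[OF eps_isom[OF X(1)] e] by metis
  have "bij_betw (phi X Y) (Hom Q X (Sg Y)) (Hom Q (Om X) Y)"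
    unfolding bij_betw_def
  proof
    show "inj_on (phi X Y) (Hom Q X (Sg Y))"
    proof (rule inj_onI)
      fix h h' assume h: "h \<in> Hom Q X (Sg Y)" "h' \<in> Hom Q X (Sg Y)" "phi X Y h = phi X Y h'"
      then have "h \<star> eps X = h' \<star> eps X" using phi_eq(2)[OF X h(1)] phi_eq(2)[OF X h(2)] by simp
      then show "h = h'" by (rule Qa.isom_epi[OF eps_isom[OF X(1)] e h(1,2)])
    qed
    show "phi X Y ` Hom Q X (Sg Y) = Hom Q (Om X) Y"
    proof
      show "phi X Y ` Hom Q X (Sg Y) \<subseteq> Hom Q (Om X) Y" using phi_eq(1)[OF X] by blast
      show "Hom Q (Om X) Y \<subseteq> phi X Y ` Hom Q X (Sg Y)"
      proof
        fix k assume k: "k \<in> Hom Q (Om X) Y"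
        note Sk = Sa_hom[OF O X(2) k]
        have h: "Sa k \<star> i \<in> Hom Q X (Sg Y)" by (rule Qa.comp_hom[OF i(1) Sk])
        have "Sa k = (Sa k \<star> i) \<star> eps X"
          using Qa.comp_assoc[OF e i(1) Sk] i(2) Qa.ident_right[OF Sk] by simp
        then have "phi X Y (Sa k \<star> i) = k" by (rule phi_unique[OF X k])
        then show "k \<in> phi X Y ` Hom Q X (Sg Y)" using h by blast
      qed
    qed
  qed
  moreover have "phi X Y \<in> hom (Ext1 ZQ \<Sigma> X Y) (Hom_group ZQ (Om X) Y)"
    unfolding hom_def c using add phi_eq(1)[OF X] by auto
  ultimately show ?thesis unfolding iso_def c by simp
qed

text \<open>After applying Sigma, which is faithful, this is naturality of
  \<open>eps\<close>.\<close>

lemma phi_natural: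
  assumes "x \<in> Hom Q X' X" "y \<in> Hom Q Y Y'" "h \<in> Hom Q X (Sg Y)" and Z: "X \<in> Z" "X' \<in> Z" "Y \<in> Z" "Y' \<in> Z"
  shows "phi X' Y' (Sa y \<star> h \<star> x) = y \<star> phi X Y h \<star> Oa x"
proof (rule phi_unique[OF Z(2,4)])
  note p = phi_eq[OF Z(1,3) assms(3)] and Ox = Oa_hom[OF Z(2,1) assms(1)] and O = Om_Z[OF Z(1)] Om_Z[OF Z(2)]
  note yp = Qa.comp_hom[OF p(1) assms(2)]
  show "y \<star> phi X Y h \<star> Oa x \<in> Hom Q (Om X') Y'" by (rule Qa.comp_hom[OF Ox yp])
  note Sy = Sa_hom[OF Z(3,4) assms(2)] and SO = Sa_hom[OF O(2,1) Ox] and e = eps_hom[OF Z(1)] eps_hom[OF Z(2)]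
  have "Sa (y \<star> phi X Y h \<star> Oa x) = (Sa y \<star> (h \<star> eps X)) \<star> Sa (Oa x)"
    using Sa_comp[OF O(2,1) Z(4) Ox yp] Sa_comp[OF O(1) Z(3,4) p(1) assms(2)] p(2) by simp
  also have "\<dots> = Sa y \<star> (h \<star> (eps X \<star> Sa (Oa x)))" using Sy assms(3) e SO by (simp add: Hom_iff)
  also have "\<dots> = (Sa y \<star> h \<star> x) \<star> eps X'"
    unfolding eps_natural[OF Z(2,1) assms(1)] using Sy assms e by (simp add: Hom_iff)
  finally show "Sa (y \<star> phi X Y h \<star> Oa x) = Sa y \<star> h \<star> x \<star> eps X'" .
qed

lemma Z_mod_I_triangulated:
  "triangulated_category (Z_mod_I P) (Sigma_ftor P K) (dist_right_triangles P K) \<and>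
    (\<exists>\<phi>. (\<forall>X \<in> Obj (Z_mod_I P). \<forall>Y \<in> Obj (Z_mod_I P).
             \<phi> X Y \<in> iso (Ext1 (Z_mod_I P) (Sigma_ftor P K) X Y)
                         (Hom_group (Z_mod_I P) (omap (Omega_ftor P K) X) Y)) \<and>
          (\<forall>X X' Y Y'. \<forall>x \<in> Hom (Z_mod_I P) X' X. \<forall>y \<in> Hom (Z_mod_I P) Y Y'.
             \<forall>h \<in> Hom (Z_mod_I P) X (omap (Sigma_ftor P K) Y).
             \<phi> X' Y' (amap (Sigma_ftor P K) y \<cdot>\<^bsub>Z_mod_I P\<^esub> h \<cdot>\<^bsub>Z_mod_I P\<^esub> x) =
             y \<cdot>\<^bsub>Z_mod_I P\<^esub> \<phi> X Y h \<cdot>\<^bsub>Z_mod_I P\<^esub> amap (Omega_ftor P K) x))"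
  unfolding P_simps
proof (intro conjI exI[of _ phi] ballI allI)
  show "triangulated_category ZQ \<Sigma> DT" by (rule rtri.triangulated[OF ZQ_rtri])
  show "phi X Y \<in> iso (Ext1 ZQ \<Sigma> X Y) (Hom_group ZQ (Om X) Y)" if "X \<in> Obj ZQ" "Y \<in> Obj ZQ" for X Y
    using phi_iso that by simp
  fix X X' Y Y' x y h assume "x \<in> Hom ZQ X' X" "y \<in> Hom ZQ Y Y'" "h \<in> Hom ZQ X (Sg Y)"
  then show "phi X' Y' (Comp ZQ (Comp ZQ (Sa y) h) x) = Comp ZQ (Comp ZQ y (phi X Y h)) (Oa x)"
    unfolding full_simps ZQ_hom using phi_natural by blast
qed

end

theorem corollary5p11:
  fixes P :: "('o, 'a) tcp" and K :: "('o, 'a) tcp_choices"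
  assumes "triangulated_category (amb P) (shift P) (dist P)"
    and "is_twin_cotorsion_pair P"
    and "is_concentric P"
    and "valid_choices P K"
    and "condition_I P K"
    and "condition_II P"
  shows "triangulated_category (Z_mod_I P) (Sigma_ftor P K) (dist_right_triangles P K) \<and>
    (\<exists>\<phi>. (\<forall>X \<in> Obj (Z_mod_I P). \<forall>Y \<in> Obj (Z_mod_I P).
             \<phi> X Y \<in> iso (Ext1 (Z_mod_I P) (Sigma_ftor P K) X Y)
                         (Hom_group (Z_mod_I P) (omap (Omega_ftor P K) X) Y)) \<and>
          (\<forall>X X' Y Y'. \<forall>x \<in> Hom (Z_mod_I P) X' X. \<forall>y \<in> Hom (Z_mod_I P) Y Y'.
             \<forall>h \<in> Hom (Z_mod_I P) X (omap (Sigma_ftor P K) Y).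
             \<phi> X' Y' (amap (Sigma_ftor P K) y \<cdot>\<^bsub>Z_mod_I P\<^esub> h \<cdot>\<^bsub>Z_mod_I P\<^esub> x) =
             y \<cdot>\<^bsub>Z_mod_I P\<^esub> \<phi> X Y h \<cdot>\<^bsub>Z_mod_I P\<^esub> amap (Omega_ftor P K) x))"
proof -
  obtain C F D S T U V where P:
    "P = \<lparr>amb = C, shift = F, dist = D, subS = S, subT = T, subU = U, subV = V\<rparr>"
    by (cases P)
  have "ctcp C F D S T U V K"
    unfolding ctcp_def ctcp_axioms_def
    using triangulated_rtri assms unfolding P is_twin_cotorsion_pair_def is_concentric_def by simp
  from ctcp.Z_mod_I_triangulated[OF this] show ?thesis unfolding P .
qed

end
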